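(* Let $\mathfrak g$ be a Kac-Moody Lie algebra, let $A$ be a finitely generated commutative associative unital $\mathbb C$-algebra, and let $\widetilde{\mathfrak g}=\mathfrak g'\otimes A\oplus\mathfrak h''$ and $\widetilde{\mathfrak h}=\mathfrak h'\otimes A\oplus\mathfrak h''$. Let $I$ and $J$ be coprime cofinite ideals of $A$ (i.e. $I+J=A$). Let $\psi_1,\psi_2:\widetilde{\mathfrak h}\to\mathbb C$ be linear maps such that $\psi_1|_{\mathfrak h'\otimes I}=0$, $\psi_2|_{\mathfrak h'\otimes J}=0$, $\psi_1|_{\mathfrak h}=\lambda$ and $\psi_2|_{\mathfrak h}=\mu$, where $\lambda,\mu\in\mathfrak h^*$ are dominant integral. For $\alpha\in\Delta^+$ put $K_\alpha=I^{N_{\lambda,\alpha}}\cap J^{N_{\mu,\alpha}}$. Then, as $\widetilde{\mathfrak g}$-modules, $$M(\psi_1+\psi_2,\{K_\alpha,\ \alpha\in\Delta^+\})\;\cong\; M(\psi_1,I)\otimes M(\psi_2,J).$$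
   Context: Setting. $\mathfrak g$ is a Kac-Moody Lie algebra over $\mathbb C$ with Cartan subalgebra $\mathfrak h$, triangular decomposition $\mathfrak g=N^-\oplus\mathfrak h\oplus N^+$, simple roots $\alpha_1,\dots,\alpha_l$, simple coroots $\alpha_1^\vee,\dots,\alpha_l^\vee$, and set of positive roots $\Delta^+$. Put $\mathfrak g'=[\mathfrak g,\mathfrak g]$, $\mathfrak h'=\mathfrak g'\cap\mathfrak h$, and fix a subspace $\mathfrak h''$ with $\mathfrak h=\mathfrak h'\oplus\mathfrak h''$. $A$ is a finitely generated commutative associative unital $\mathbb C$-algebra. An ideal $I$ of $A$ is cofinite if $\dim_{\mathbb C}A/I<\infty$. A weight $\lambda\in\mathfrak h^*$ is dominant integral if $\lambda(\alpha_i^\vee)\in\mathbb Z_{\ge0}$ for all $i$. For $\alpha=\sum_i m_i\alpha_i\in\Delta^+$ and $\lambda$ dominant integral put $N_{\lambda,\alpha}=\sum_i m_i\lambda(\alpha_i^\vee)$. By convention $I^0=A$. The Lie algebra $\widetilde{\mathfrak g}=\mathfrak g'\otimes A\oplus\mathfrak h''$ has bracket $[X\otimes a,Y\otimes b]=[X,Y]\otimes ab$, $[h,X\otimes a]=[h,X]\otimes a$, $[h,h_1]=0$ for $X,Y\in\mathfrak g'$, $a,b\in A$, $h,h_1\in\mathfrak h''$. Put $\widetilde{\mathfrak h}=\mathfrak h'\otimes A\oplus\mathfrak h''$ and $\widetilde N^{\pm}=N^{\pm}\otimes A$, so $\widetilde{\mathfrak g}=\widetilde N^+\oplus\widetilde{\mathfrak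 h}\oplus\widetilde N^-$. We identify $\mathfrak h=\mathfrak h'\otimes 1\oplus\mathfrak h''\subset\widetilde{\mathfrak h}$. Tensor products of $\widetilde{\mathfrak g}$-modules carry the usual action $x(u\otimes w)=xu\otimes w+u\otimes xw$. Verma module. For a linear map $\psi:\widetilde{\mathfrak h}\to\mathbb C$, $M(\psi)=U(\widetilde{\mathfrak g})\otimes_{U(\widetilde N^+\oplus\widetilde{\mathfrak h})}\mathbb C$, where $\widetilde N^+$ acts on $\mathbb C$ by $0$ and $\widetilde{\mathfrak h}$ acts by $\psi$; $v$ denotes its highest weight vector $1\otimes1$. The modules $M(\psi,\{I_\alpha\})$ and $M(\psi,I)$. For a family $\{I_\alpha,\ \alpha\in\Delta^+\}$ of cofinite ideals of $A$, $M(\psi,\{I_\alpha,\ \alpha\in\Delta^+\})$ is the (universal) highest weight module of highest weight $\psi$ with highest weight vector $v$ satisfying $(X_{-\beta}\otimes I_\beta)v=0$ for all $\beta\in\Delta^+$ and all root vectors $X_{-\beta}$ of root $-\beta$; that is, the quotient of $M(\psi)$ by the submodule generated by all $(X_{-\beta}\otimes a)v$ with $\beta\in\Delta^+$, $a\in I_\beta$. If $I$ is a cofinite ideal with $\psi|_{\mathfrak h'\otimes I}=0$ and $\psi|_{\mathfrak h}=\lambda$ is dominant integral, then $M(\psi,I):=M(\psi,\{I^{N_{\lambda,\alpha}},\ \alpha\in\Delta^+\})$. *)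

theory Defs
  imports
    "HOL-Algebra.QuotRing"
    "HOL-Algebra.Ideal_Product"
    "HOL-Algebra.Subrings"
    "Jordan_Normal_Form.DL_Rank"
begin

section \<open>Complex vector spaces\<close>

abbreviation CC :: "complex ring"
  where "CC \<equiv> class_ring"

definition CC_mod :: "(complex, complex) module" where
  "CC_mod = \<lparr>carrier = UNIV, mult = (*), one = 1, zero = 0, add = (+), smult = (*)\<rparr>"

definition functionals :: "(complex, 'v, 'r) module_scheme \<Rightarrow> ('v \<Rightarrow> complex) set" where
  "functionals V = LinearCombinations.module_hom CC V CC_mod"

abbreviation cspan :: "(complex, 'v, 'r) module_scheme \<Rightarrow> 'v set \<Rightarrow> 'v set"
  where "cspan \<equiv> LinearCombinations.module.span CC"

text \<open>Quotient by a subspace \<open>K\<close>, on the same cosets as \<open>V Quot K\<close>.  The multiplication and unit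
  are meaningful only if \<open>V\<close> is an algebra and \<open>K\<close> a two-sided ideal.\<close>

definition quot_mod :: "(complex, 'v, 'r) module_scheme \<Rightarrow> 'v set \<Rightarrow> (complex, 'v set) module" where
  "quot_mod V K = ring.extend (V Quot K)
     (module.fields (\<lambda>c X. \<Union>x\<in>X. K +>\<^bsub>V\<^esub> (c \<odot>\<^bsub>V\<^esub> x)))"

text \<open>The vector space with basis \<open>S\<close>: finitely supported functions, \<open>delta s\<close> being the basis
  vector of \<open>s\<close>.  Here \<open>mult\<close> and \<open>one\<close> are irrelevant.\<close>

definition free_mod :: "'s set \<Rightarrow> (complex, 's \<Rightarrow> complex) module" where
  "free_mod S =
    \<lparr>carrier = {p. finite {s. p s \<noteq> 0} \<and> {s. p s \<noteq> 0} \<subseteq> S},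
     mult = (\<lambda>p q s. 0), one = (\<lambda>s. 0), zero = (\<lambda>s. 0),
     add = (\<lambda>p q s. p s + q s), smult = (\<lambda>c p s. c * p s)\<rparr>"

definition delta :: "'s \<Rightarrow> 's \<Rightarrow> complex" where
  "delta s = (\<lambda>t. if t = s then 1 else 0)"


section \<open>Tensor products\<close>

text \<open>\<open>V \<otimes>\<^sub>S W\<close>: the quotient of the free vector space on \<open>V \<times> W\<close> by the bilinearity relations and
  the balancing relations \<open>v s \<otimes> w = v \<otimes> s w\<close> for \<open>s \<in> S\<close>, where \<open>S\<close> acts on \<open>V\<close> from the right
  by \<open>rho\<close> and on \<open>W\<close> from the left by \<open>sig\<close>.\<close>

definition tensor_rels :: "(complex, 'v, 'r1) module_scheme \<Rightarrow> (complex, 'w, 'r2) module_scheme \<Rightarrow>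
    's set \<Rightarrow> ('v \<Rightarrow> 's \<Rightarrow> 'v) \<Rightarrow> ('s \<Rightarrow> 'w \<Rightarrow> 'w) \<Rightarrow> ('v \<times> 'w \<Rightarrow> complex) set" where
  "tensor_rels V W S rho sig =
     {\<lambda>z. delta (v \<oplus>\<^bsub>V\<^esub> v', w) z - delta (v, w) z - delta (v', w) z | v v' w.
        v \<in> carrier V \<and> v' \<in> carrier V \<and> w \<in> carrier W} \<union>
     {\<lambda>z. delta (v, w \<oplus>\<^bsub>W\<^esub> w') z - delta (v, w) z - delta (v, w') z | v w w'.
        v \<in> carrier V \<and> w \<in> carrier W \<and> w' \<in> carrier W} \<union>
     {\<lambda>z. delta (c \<odot>\<^bsub>V\<^esub> v, w) z - c * delta (v, w) z | c v w. v \<in> carrier V \<and> w \<in> carrier W} \<union>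
     {\<lambda>z. delta (v, c \<odot>\<^bsub>W\<^esub> w) z - c * delta (v, w) z | c v w. v \<in> carrier V \<and> w \<in> carrier W} \<union>
     {\<lambda>z. delta (rho v s, w) z - delta (v, sig s w) z | v s w.
        v \<in> carrier V \<and> s \<in> S \<and> w \<in> carrier W}"

definition tensor_ker where
  "tensor_ker V W S rho sig =
     cspan (free_mod (carrier V \<times> carrier W)) (tensor_rels V W S rho sig)"

definition tensor_over :: "(complex, 'v, 'r1) module_scheme \<Rightarrow> (complex, 'w, 'r2) module_scheme \<Rightarrow>
    's set \<Rightarrow> ('v \<Rightarrow> 's \<Rightarrow> 'v) \<Rightarrow> ('s \<Rightarrow> 'w \<Rightarrow> 'w) \<Rightarrow> (complex, ('v \<times> 'w \<Rightarrow> complex) set) module" where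
  "tensor_over V W S rho sig =
     quot_mod (free_mod (carrier V \<times> carrier W)) (tensor_ker V W S rho sig)"

definition ptensor_over :: "(complex, 'v, 'r1) module_scheme \<Rightarrow> (complex, 'w, 'r2) module_scheme \<Rightarrow>
    's set \<Rightarrow> ('v \<Rightarrow> 's \<Rightarrow> 'v) \<Rightarrow> ('s \<Rightarrow> 'w \<Rightarrow> 'w) \<Rightarrow> 'v \<Rightarrow> 'w \<Rightarrow> ('v \<times> 'w \<Rightarrow> complex) set" where
  "ptensor_over V W S rho sig v w =
     tensor_ker V W S rho sig +>\<^bsub>free_mod (carrier V \<times> carrier W)\<^esub> delta (v, w)"

abbreviation tensor :: "(complex, 'v, 'r1) module_scheme \<Rightarrow> (complex, 'w, 'r2) module_scheme \<Rightarrow>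
    (complex, ('v \<times> 'w \<Rightarrow> complex) set) module" where
  "tensor V W \<equiv> tensor_over V W ({} :: unit set) (\<lambda>v _. v) (\<lambda>_ w. w)"

abbreviation ptensor :: "(complex, 'v, 'r1) module_scheme \<Rightarrow> (complex, 'w, 'r2) module_scheme \<Rightarrow>
    'v \<Rightarrow> 'w \<Rightarrow> ('v \<times> 'w \<Rightarrow> complex) set" where
  "ptensor V W v w \<equiv> ptensor_over V W ({} :: unit set) (\<lambda>v _. v) (\<lambda>_ w. w) v w"

text \<open>The linear map \<open>v \<otimes> w \<mapsto> \<phi> (v, w)\<close> into \<open>U\<close> induced by a balanced bilinear \<open>\<phi>\<close>: the common
  value on the representatives of a coset \<open>P\<close>.\<close>

definition tensor_lift :: "(complex, 'u, 'r) module_scheme \<Rightarrow> ('v \<times> 'w \<Rightarrow> 'u) \<Rightarrow>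
    ('v \<times> 'w \<Rightarrow> complex) set \<Rightarrow> 'u" where
  "tensor_lift U \<phi> P =
     the_elem ((\<lambda>p. \<Oplus>\<^bsub>U\<^esub>z\<in>{z. p z \<noteq> 0}. p z \<odot>\<^bsub>U\<^esub> \<phi> z) ` P)"


section \<open>Lie algebras and their modules\<close>

record 'g lie_alg = "(complex, 'g) module" +
  bracket :: "'g \<Rightarrow> 'g \<Rightarrow> 'g"

locale lie_algebra = vectorspace CC L for L :: "'g lie_alg" (structure) +
  assumes bracket_closed: "x \<in> carrier L \<Longrightarrow> y \<in> carrier L \<Longrightarrow> bracket L x y \<in> carrier L"
    and bracket_add_l: "x \<in> carrier L \<Longrightarrow> x' \<in> carrier L \<Longrightarrow> y \<in> carrier L \<Longrightarrow>
          bracket L (x \<oplus> x') y = bracket L x y \<oplus> bracket L x' y"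
    and bracket_add_r: "x \<in> carrier L \<Longrightarrow> y \<in> carrier L \<Longrightarrow> y' \<in> carrier L \<Longrightarrow>
          bracket L x (y \<oplus> y') = bracket L x y \<oplus> bracket L x y'"
    and bracket_smult_l: "x \<in> carrier L \<Longrightarrow> y \<in> carrier L \<Longrightarrow>
          bracket L (c \<odot>\<^bsub>L\<^esub> x) y = c \<odot>\<^bsub>L\<^esub> bracket L x y"
    and bracket_smult_r: "x \<in> carrier L \<Longrightarrow> y \<in> carrier L \<Longrightarrow>
          bracket L x (c \<odot>\<^bsub>L\<^esub> y) = c \<odot>\<^bsub>L\<^esub> bracket L x y"
    and bracket_self: "x \<in> carrier L \<Longrightarrow> bracket L x x = \<zero>"
    and jacobi: "x \<in> carrier L \<Longrightarrow> y \<in> carrier L \<Longrightarrow> z \<in> carrier L \<Longrightarrow>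
          bracket L x (bracket L y z) \<oplus> bracket L y (bracket L z x) \<oplus> bracket L z (bracket L x y) = \<zero>"

definition lie_subalgebra :: "'g lie_alg \<Rightarrow> 'g set \<Rightarrow> bool" where
  "lie_subalgebra L S \<longleftrightarrow> VectorSpace.subspace CC S L \<and> (\<forall>x\<in>S. \<forall>y\<in>S. bracket L x y \<in> S)"

definition lie_ideal :: "'g lie_alg \<Rightarrow> 'g set \<Rightarrow> bool" where
  "lie_ideal L S \<longleftrightarrow> VectorSpace.subspace CC S L \<and> (\<forall>x\<in>carrier L. \<forall>y\<in>S. bracket L x y \<in> S)"

text \<open>A module over a Lie algebra with elements of type \<open>'x\<close>.\<close>

record ('x, 'v) lie_mod = "(complex, 'v) module" +
  act :: "'x \<Rightarrow> 'v \<Rightarrow> 'v"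

definition lie_submodule :: "'x lie_alg \<Rightarrow> ('x, 'v) lie_mod \<Rightarrow> 'v set \<Rightarrow> bool" where
  "lie_submodule L V N \<longleftrightarrow>
     VectorSpace.subspace CC N V \<and> (\<forall>x\<in>carrier L. \<forall>v\<in>N. act V x v \<in> N)"

definition lie_submodule_gen :: "'x lie_alg \<Rightarrow> ('x, 'v) lie_mod \<Rightarrow> 'v set \<Rightarrow> 'v set" where
  "lie_submodule_gen L V S = \<Inter>{N. lie_submodule L V N \<and> S \<subseteq> N}"

definition lie_quot :: "('x, 'v) lie_mod \<Rightarrow> 'v set \<Rightarrow> ('x, 'v set) lie_mod" where
  "lie_quot V N = module.extend (quot_mod V N)
     (lie_mod.fields (\<lambda>x X. \<Union>v\<in>X. N +>\<^bsub>V\<^esub> act V x v))"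

definition lie_tensor :: "('x, 'v) lie_mod \<Rightarrow> ('x, 'w) lie_mod \<Rightarrow>
    ('x, ('v \<times> 'w \<Rightarrow> complex) set) lie_mod" where
  "lie_tensor V W = module.extend (tensor V W)
     (lie_mod.fields (\<lambda>x. tensor_lift (tensor V W)
        (\<lambda>(v, w). ptensor V W (act V x v) w \<oplus>\<^bsub>tensor V W\<^esub> ptensor V W v (act W x w))))"

definition lie_mod_iso :: "'x lie_alg \<Rightarrow> ('x, 'v) lie_mod \<Rightarrow> ('x, 'w) lie_mod \<Rightarrow> bool" where
  "lie_mod_iso L V W \<longleftrightarrow>
     (\<exists>f \<in> LinearCombinations.module_hom CC V W. bij_betw f (carrier V) (carrier W) \<and>
        (\<forall>x\<in>carrier L. \<forall>v\<in>carrier V. f (act V x v) = act W x (f v)))"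


section \<open>The universal enveloping algebra\<close>

text \<open>The free associative algebra on the set \<open>X\<close>: words in \<open>X\<close>, with concatenation extended
  bilinearly.\<close>

definition free_alg :: "'x set \<Rightarrow> (complex, 'x list \<Rightarrow> complex) module" where
  "free_alg X = (free_mod (lists X))
     \<lparr>mult := (\<lambda>p q w. \<Sum>i\<le>length w. p (take i w) * q (drop i w)), one := delta []\<rparr>"

text \<open>The first two sets of relations turn the free algebra on the set \<open>L\<close> into the tensor algebra
  of the vector space \<open>L\<close>.\<close>

definition uea_ideal :: "'x lie_alg \<Rightarrow> ('x list \<Rightarrow> complex) set" where
  "uea_ideal L = genideal (free_alg (carrier L))
     ({\<lambda>w. delta [x \<oplus>\<^bsub>L\<^esub> y] w - delta [x] w - delta [y] w | x y. x \<in> carrier L \<and> y \<in> carrier L} \<union>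
      {\<lambda>w. delta [c \<odot>\<^bsub>L\<^esub> x] w - c * delta [x] w | c x. x \<in> carrier L} \<union>
      {\<lambda>w. delta [x, y] w - delta [y, x] w - delta [bracket L x y] w | x y.
         x \<in> carrier L \<and> y \<in> carrier L})"

definition uea :: "'x lie_alg \<Rightarrow> (complex, ('x list \<Rightarrow> complex) set) module" where
  "uea L = quot_mod (free_alg (carrier L)) (uea_ideal L)"

definition uea_inj :: "'x lie_alg \<Rightarrow> 'x \<Rightarrow> ('x list \<Rightarrow> complex) set" where
  "uea_inj L x = uea_ideal L +>\<^bsub>free_alg (carrier L)\<^esub> delta [x]"


section \<open>Kac-Moody Lie algebras\<close>

text \<open>Simple roots and coroots are indexed by \<open>{..<km_rank D}\<close>.\<close>

record 'g km_datum =
  km_alg :: "'g lie_alg"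
  km_csa :: "'g set"
  km_rank :: nat
  km_root :: "nat \<Rightarrow> 'g \<Rightarrow> complex"
  km_coroot :: "nat \<Rightarrow> 'g"
  km_e :: "nat \<Rightarrow> 'g"
  km_f :: "nat \<Rightarrow> 'g"

definition cartan_matrix :: "'g km_datum \<Rightarrow> complex mat" where
  "cartan_matrix D = mat (km_rank D) (km_rank D) (\<lambda>(i, j). km_root D j (km_coroot D i))"

definition generalized_cartan_matrix :: "nat \<Rightarrow> complex mat \<Rightarrow> bool" where
  "generalized_cartan_matrix l C \<longleftrightarrow> C \<in> carrier_mat l l \<and>
     (\<forall>i<l. C $$ (i, i) = 2) \<and>
     (\<forall>i<l. \<forall>j<l. i \<noteq> j \<longrightarrow> (\<exists>n::nat. C $$ (i, j) = - of_nat n)) \<and>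
     (\<forall>i<l. \<forall>j<l. C $$ (i, j) = 0 \<longrightarrow> C $$ (j, i) = 0)"

text \<open>The Kac-Moody algebra of a generalized Cartan matrix (Kac, Infinite-dimensional Lie algebras,
  Chapter 1).  The assumptions from \<open>csa_subspace\<close> to \<open>cartan\<close> say that \<open>(\<hh>, \<Pi>, \<Pi>\<^sup>\<or>)\<close> is a realization of the matrix.
  By \<open>generated\<close> and the relations, the algebra is a quotient of Kac's auxiliary algebra on the
  generators \<open>\<hh>\<close>, \<open>e\<^sub>i\<close>, \<open>f\<^sub>i\<close>; by \<open>no_ideal\<close> it is the quotient by the largest ideal that meets \<open>\<hh>\<close>
  trivially.\<close>

locale kac_moody =
  fixes D :: "'g km_datum"
  assumes lie: "lie_algebra (km_alg D)"
    and csa_subspace: "VectorSpace.subspace CC (km_csa D) (km_alg D)"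
    and csa_fin_dim: "vectorspace.fin_dim CC ((km_alg D)\<lparr>carrier := km_csa D\<rparr>)"
    and csa_dim: "vectorspace.dim CC ((km_alg D)\<lparr>carrier := km_csa D\<rparr>)
          + vec_space.rank (km_rank D) (cartan_matrix D) = 2 * km_rank D"
    and root_linear: "i < km_rank D \<Longrightarrow>
          km_root D i \<in> functionals ((km_alg D)\<lparr>carrier := km_csa D\<rparr>)"
    and root_indep: "(\<And>h. h \<in> km_csa D \<Longrightarrow> (\<Sum>i<km_rank D. c i * km_root D i h) = 0) \<Longrightarrow>
          i < km_rank D \<Longrightarrow> c i = 0"
    and coroot_csa: "i < km_rank D \<Longrightarrow> km_coroot D i \<in> km_csa D"
    and coroot_inj: "inj_on (km_coroot D) {..<km_rank D}"
    and coroot_indep: "LinearCombinations.module.lin_indpt CC (km_alg D)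
          (km_coroot D ` {..<km_rank D})"
    and cartan: "generalized_cartan_matrix (km_rank D) (cartan_matrix D)"
    and e_carrier: "i < km_rank D \<Longrightarrow> km_e D i \<in> carrier (km_alg D)"
    and f_carrier: "i < km_rank D \<Longrightarrow> km_f D i \<in> carrier (km_alg D)"
    and rel_hh: "h \<in> km_csa D \<Longrightarrow> h' \<in> km_csa D \<Longrightarrow> bracket (km_alg D) h h' = \<zero>\<^bsub>km_alg D\<^esub>"
    and rel_ef: "i < km_rank D \<Longrightarrow> j < km_rank D \<Longrightarrow>
          bracket (km_alg D) (km_e D i) (km_f D j) = (if i = j then km_coroot D i else \<zero>\<^bsub>km_alg D\<^esub>)"
    and rel_he: "h \<in> km_csa D \<Longrightarrow> i < km_rank D \<Longrightarrow>
          bracket (km_alg D) h (km_e D i) = km_root D i h \<odot>\<^bsub>km_alg D\<^esub> km_e D i"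
    and rel_hf: "h \<in> km_csa D \<Longrightarrow> i < km_rank D \<Longrightarrow>
          bracket (km_alg D) h (km_f D i) = (- km_root D i h) \<odot>\<^bsub>km_alg D\<^esub> km_f D i"
    and generated: "lie_subalgebra (km_alg D) S \<Longrightarrow>
          km_csa D \<union> km_e D ` {..<km_rank D} \<union> km_f D ` {..<km_rank D} \<subseteq> S \<Longrightarrow>
          S = carrier (km_alg D)"
    and no_ideal: "lie_ideal (km_alg D) S \<Longrightarrow> S \<inter> km_csa D = {\<zero>\<^bsub>km_alg D\<^esub>} \<Longrightarrow>
          S = {\<zero>\<^bsub>km_alg D\<^esub>}"

definition root_space :: "'g km_datum \<Rightarrow> ('g \<Rightarrow> complex) \<Rightarrow> 'g set" where
  "root_space D \<beta> = {x \<in> carrier (km_alg D).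
     \<forall>h\<in>km_csa D. bracket (km_alg D) h x = \<beta> h \<odot>\<^bsub>km_alg D\<^esub> x}"

text \<open>As the simple roots are linearly independent, a positive root \<open>\<Sum>\<^sub>i m\<^sub>i \<alpha>\<^sub>i\<close> is represented by
  its coefficients \<open>m\<close>, set to \<open>0\<close> outside the index range.\<close>

definition root_of :: "'g km_datum \<Rightarrow> (nat \<Rightarrow> nat) \<Rightarrow> 'g \<Rightarrow> complex" where
  "root_of D m h = (\<Sum>i<km_rank D. of_nat (m i) * km_root D i h)"

definition pos_roots :: "'g km_datum \<Rightarrow> (nat \<Rightarrow> nat) set" where
  "pos_roots D = {m. (\<forall>i\<ge>km_rank D. m i = 0) \<and> (\<exists>i<km_rank D. m i \<noteq> 0) \<and>
     root_space D (root_of D m) \<noteq> {\<zero>\<^bsub>km_alg D\<^esub>}}"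

definition N_plus :: "'g km_datum \<Rightarrow> 'g set" where
  "N_plus D = cspan (km_alg D) (\<Union>m\<in>pos_roots D. root_space D (root_of D m))"

definition derived :: "'g km_datum \<Rightarrow> 'g set" where
  "derived D = cspan (km_alg D)
     {bracket (km_alg D) x y | x y. x \<in> carrier (km_alg D) \<and> y \<in> carrier (km_alg D)}"

definition csa_derived :: "'g km_datum \<Rightarrow> 'g set" where
  "csa_derived D = derived D \<inter> km_csa D"

definition csa_complement :: "'g km_datum \<Rightarrow> 'g set \<Rightarrow> bool" where
  "csa_complement D H2 \<longleftrightarrow> VectorSpace.subspace CC H2 (km_alg D) \<and>
     csa_derived D \<inter> H2 = {\<zero>\<^bsub>km_alg D\<^esub>} \<and> csa_derived D <+>\<^bsub>km_alg D\<^esub> H2 = km_csa D"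

definition dominant_integral :: "'g km_datum \<Rightarrow> ('g \<Rightarrow> complex) \<Rightarrow> bool" where
  "dominant_integral D \<Lambda> \<longleftrightarrow> \<Lambda> \<in> functionals ((km_alg D)\<lparr>carrier := km_csa D\<rparr>) \<and>
     (\<forall>i<km_rank D. \<Lambda> (km_coroot D i) \<in> \<nat>)"

definition weight_height :: "'g km_datum \<Rightarrow> ('g \<Rightarrow> complex) \<Rightarrow> (nat \<Rightarrow> nat) \<Rightarrow> nat" where
  "weight_height D \<Lambda> m =
     (THE n. of_nat n = (\<Sum>i<km_rank D. of_nat (m i) * \<Lambda> (km_coroot D i)))"


section \<open>The coefficient algebra\<close>

definition fin_gen_algebra :: "(complex, 'a) module \<Rightarrow> bool" where
  "fin_gen_algebra A \<longleftrightarrow> Module.algebra CC A \<and>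
     (\<exists>S. finite S \<and> S \<subseteq> carrier A \<and>
        (\<forall>B. subring B A \<and> VectorSpace.subspace CC B A \<and> S \<subseteq> B \<longrightarrow> B = carrier A))"

definition cofinite_ideal :: "(complex, 'a) module \<Rightarrow> 'a set \<Rightarrow> bool" where
  "cofinite_ideal A I \<longleftrightarrow> ideal I A \<and> vectorspace.fin_dim CC (quot_mod A I)"


section \<open>The Lie algebra $\mathfrak g' \otimes A \oplus \mathfrak h''$\<close>

text \<open>Its elements are pairs in \<open>(\<gg>' \<otimes> A) \<times> \<hh>''\<close>; \<open>H2\<close> stands for \<open>\<hh>''\<close>.\<close>

type_synonym ('g, 'a) cur = "('g \<times> 'a \<Rightarrow> complex) set \<times> 'g"

definition loop_space :: "'g km_datum \<Rightarrow> (complex, 'a) module \<Rightarrow>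
    (complex, ('g \<times> 'a \<Rightarrow> complex) set) module" where
  "loop_space D A = tensor ((km_alg D)\<lparr>carrier := derived D\<rparr>) A"

definition loop_elem :: "'g km_datum \<Rightarrow> (complex, 'a) module \<Rightarrow> 'g \<Rightarrow> 'a \<Rightarrow>
    ('g \<times> 'a \<Rightarrow> complex) set" where
  "loop_elem D A x a = ptensor ((km_alg D)\<lparr>carrier := derived D\<rparr>) A x a"

definition loop_bracket :: "'g km_datum \<Rightarrow> (complex, 'a) module \<Rightarrow>
    ('g \<times> 'a \<Rightarrow> complex) set \<Rightarrow> ('g \<times> 'a \<Rightarrow> complex) set \<Rightarrow> ('g \<times> 'a \<Rightarrow> complex) set" where
  "loop_bracket D A P Q = tensor_lift (loop_space D A) (\<lambda>(x, a).
     tensor_lift (loop_space D A) (\<lambda>(y, b).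
       loop_elem D A (bracket (km_alg D) x y) (a \<otimes>\<^bsub>A\<^esub> b)) Q) P"

definition loop_deriv :: "'g km_datum \<Rightarrow> (complex, 'a) module \<Rightarrow> 'g \<Rightarrow>
    ('g \<times> 'a \<Rightarrow> complex) set \<Rightarrow> ('g \<times> 'a \<Rightarrow> complex) set" where
  "loop_deriv D A h Q = tensor_lift (loop_space D A)
     (\<lambda>(y, b). loop_elem D A (bracket (km_alg D) h y) b) Q"

definition current :: "'g km_datum \<Rightarrow> (complex, 'a) module \<Rightarrow> 'g set \<Rightarrow> ('g, 'a) cur lie_alg" where
  "current D A H2 = module.extend
     (direct_sum (loop_space D A) ((km_alg D)\<lparr>carrier := H2\<rparr>))
     (lie_alg.fields (\<lambda>(P, h) (Q, k).
        ((loop_bracket D A P Q \<oplus>\<^bsub>loop_space D A\<^esub> loop_deriv D A h Q)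
           \<ominus>\<^bsub>loop_space D A\<^esub> loop_deriv D A k P,
         \<zero>\<^bsub>km_alg D\<^esub>)))"

definition cur_elem :: "'g km_datum \<Rightarrow> (complex, 'a) module \<Rightarrow> 'g \<Rightarrow> 'a \<Rightarrow> ('g, 'a) cur" where
  "cur_elem D A x a = (loop_elem D A x a, \<zero>\<^bsub>km_alg D\<^esub>)"

definition cur_N_plus :: "'g km_datum \<Rightarrow> (complex, 'a) module \<Rightarrow> 'g set \<Rightarrow> ('g, 'a) cur set" where
  "cur_N_plus D A H2 = cspan (current D A H2)
     {cur_elem D A x a | x a. x \<in> N_plus D \<and> a \<in> carrier A}"

definition cur_h :: "'g km_datum \<Rightarrow> (complex, 'a) module \<Rightarrow> 'g set \<Rightarrow> ('g, 'a) cur set" where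
  "cur_h D A H2 =
     cspan (loop_space D A) {loop_elem D A x a | x a. x \<in> csa_derived D \<and> a \<in> carrier A} \<times> H2"

text \<open>The identification of \<open>\<hh> = \<hh>' \<oplus> \<hh>''\<close> with \<open>\<hh>' \<otimes> 1 \<oplus> \<hh>''\<close>.\<close>

definition csa_embed :: "'g km_datum \<Rightarrow> (complex, 'a) module \<Rightarrow> 'g set \<Rightarrow> 'g \<Rightarrow> ('g, 'a) cur" where
  "csa_embed D A H2 h = the_elem {(loop_elem D A h1 \<one>\<^bsub>A\<^esub>, h2) | h1 h2.
     h1 \<in> csa_derived D \<and> h2 \<in> H2 \<and> h = h1 \<oplus>\<^bsub>km_alg D\<^esub> h2}"


section \<open>Highest weight modules\<close>

text \<open>\<open>M(\<psi>) = U(\<gg>) \<otimes>\<^bsub>U(\<bb>)\<^esub> \<complex>\<close>, for the Lie algebra \<open>\<gg> = current D A H2\<close> and its subalgebra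
  \<open>\<bb> = cur_N_plus D A H2 \<oplus> cur_h D A H2\<close>.  Since \<open>\<bb>\<close> generates \<open>U(\<bb>)\<close>, balancing over \<open>\<bb>\<close> is balancing
  over \<open>U(\<bb>)\<close>; an element \<open>n + t\<close> of \<open>\<bb>\<close> is presented by the pair \<open>(n, t)\<close> and acts on \<open>\<complex>\<close> as
  \<open>\<psi> t\<close>.\<close>

type_synonym ('g, 'a) verma_elem =
  "((('g, 'a) cur list \<Rightarrow> complex) set \<times> complex \<Rightarrow> complex) set"

definition verma_right :: "'g km_datum \<Rightarrow> (complex, 'a) module \<Rightarrow> 'g set \<Rightarrow>
    (('g, 'a) cur list \<Rightarrow> complex) set \<Rightarrow> ('g, 'a) cur \<times> ('g, 'a) cur \<Rightarrow>
    (('g, 'a) cur list \<Rightarrow> complex) set" where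
  "verma_right D A H2 u = (\<lambda>(n, t).
     u \<otimes>\<^bsub>uea (current D A H2)\<^esub> uea_inj (current D A H2) (n \<oplus>\<^bsub>current D A H2\<^esub> t))"

definition verma_left :: "(('g, 'a) cur \<Rightarrow> complex) \<Rightarrow> ('g, 'a) cur \<times> ('g, 'a) cur \<Rightarrow>
    complex \<Rightarrow> complex" where
  "verma_left \<psi> = (\<lambda>(n, t) c. \<psi> t * c)"

definition verma_space :: "'g km_datum \<Rightarrow> (complex, 'a) module \<Rightarrow> 'g set \<Rightarrow>
    (('g, 'a) cur \<Rightarrow> complex) \<Rightarrow> (complex, ('g, 'a) verma_elem) module" where
  "verma_space D A H2 \<psi> = tensor_over (uea (current D A H2)) CC_mod
     (cur_N_plus D A H2 \<times> cur_h D A H2) (verma_right D A H2) (verma_left \<psi>)"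

definition verma_elem :: "'g km_datum \<Rightarrow> (complex, 'a) module \<Rightarrow> 'g set \<Rightarrow>
    (('g, 'a) cur \<Rightarrow> complex) \<Rightarrow> (('g, 'a) cur list \<Rightarrow> complex) set \<Rightarrow> complex \<Rightarrow>
    ('g, 'a) verma_elem" where
  "verma_elem D A H2 \<psi> = ptensor_over (uea (current D A H2)) CC_mod
     (cur_N_plus D A H2 \<times> cur_h D A H2) (verma_right D A H2) (verma_left \<psi>)"

definition verma :: "'g km_datum \<Rightarrow> (complex, 'a) module \<Rightarrow> 'g set \<Rightarrow>
    (('g, 'a) cur \<Rightarrow> complex) \<Rightarrow> (('g, 'a) cur, ('g, 'a) verma_elem) lie_mod" where
  "verma D A H2 \<psi> = module.extend (verma_space D A H2 \<psi>)
     (lie_mod.fields (\<lambda>x. tensor_lift (verma_space D A H2 \<psi>) (\<lambda>(u, c).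
        verma_elem D A H2 \<psi> (uea_inj (current D A H2) x \<otimes>\<^bsub>uea (current D A H2)\<^esub> u) c)))"

definition verma_vec :: "'g km_datum \<Rightarrow> (complex, 'a) module \<Rightarrow> 'g set \<Rightarrow>
    (('g, 'a) cur \<Rightarrow> complex) \<Rightarrow> ('g, 'a) verma_elem" where
  "verma_vec D A H2 \<psi> = verma_elem D A H2 \<psi> \<one>\<^bsub>uea (current D A H2)\<^esub> 1"

definition M_family :: "'g km_datum \<Rightarrow> (complex, 'a) module \<Rightarrow> 'g set \<Rightarrow>
    (('g, 'a) cur \<Rightarrow> complex) \<Rightarrow> ((nat \<Rightarrow> nat) \<Rightarrow> 'a set) \<Rightarrow>
    (('g, 'a) cur, ('g, 'a) verma_elem set) lie_mod" where
  "M_family D A H2 \<psi> F = lie_quot (verma D A H2 \<psi>)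
     (lie_submodule_gen (current D A H2) (verma D A H2 \<psi>)
        {act (verma D A H2 \<psi>) (cur_elem D A x a) (verma_vec D A H2 \<psi>) | m x a.
           m \<in> pos_roots D \<and> x \<in> root_space D (\<lambda>h. - root_of D m h) \<and> a \<in> F m})"

text \<open>\<open>ideals_set A\<close> is the monoid of ideals of \<open>A\<close> with unit \<open>carrier A\<close>, so that \<open>I\<^sup>0 = A\<close>.\<close>

definition M_ideal :: "'g km_datum \<Rightarrow> (complex, 'a) module \<Rightarrow> 'g set \<Rightarrow>
    (('g, 'a) cur \<Rightarrow> complex) \<Rightarrow> 'a set \<Rightarrow>
    (('g, 'a) cur, ('g, 'a) verma_elem set) lie_mod" where
  "M_ideal D A H2 \<psi> I = M_family D A H2 \<psi>
     (\<lambda>m. I [^]\<^bsub>ideals_set A\<^esub> weight_height D (\<lambda>h. \<psi> (csa_embed D A H2 h)) m)"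

end

theory Submission
  imports Defs
begin

text \<open>Write \<open>Z\<close> for the module on the left and \<open>V\<close>, \<open>W\<close> for the two tensor factors, with highest weight
  vectors \<open>z\<close>, \<open>v\<close>, \<open>w\<close>.  Choose \<open>e\<^sub>n \<in> J\<^sup>n\<close> and \<open>f\<^sub>n = 1 - e\<^sub>n \<in> I\<^sup>n\<close>.  Every vector of \<open>Z\<close> is killed by
  \<open>x \<otimes> a\<close> once \<open>a\<close> lies in a high power of \<open>I J\<close>, so \<open>x \<otimes> e\<^sub>n a\<close> and \<open>x \<otimes> f\<^sub>n a\<close> have limits on \<open>Z\<close>; these are
  two commuting actions of \<open>\<gg>' \<otimes> A\<close> whose sum is the given one.  By the universal property of \<open>V\<close> there is
  \<open>\<theta> : V \<rightarrow> Z\<close> intertwining the first action, and by that of \<open>W\<close>, applied to the second action on linear maps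
  \<open>V \<rightarrow> Z\<close>, there is \<open>W \<rightarrow> Hom(V, Z)\<close> sending \<open>w\<close> to \<open>\<theta>\<close>.  This amounts to a homomorphism
  \<open>V \<otimes> W \<rightarrow> Z\<close>, inverse to the one \<open>Z \<rightarrow> V \<otimes> W\<close> with \<open>z \<mapsto> v \<otimes> w\<close>.\<close>

section \<open>Linear algebra\<close>

text \<open>No basis of a Verma module is used, so bijectivity is not a matter of comparing sizes:
  an inverse has to be built, and universal properties are the only source of maps out of
  \<open>V\<close> and \<open>W\<close>. Each turns one highest weight vector into one map, which is
  why the factors enter one after the other, the second through linear maps from the first. The
  killing by high powers of I J is a closure argument. The vectors with this property form a
  submodule, and z is one of them: a positive root vector kills z with every coefficient, \<hh>'
  needs one power, \<open>f_i\<close> needs a power contained in the ideal of its simple root, and a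
  bracket is covered by the product of the powers of its entries. The exponent thus depends on the
  element of \<gg>' and on the vector, so limits take the place of a single idempotent. Modulo I^n
  the element \<open>e_n\<close> is 1 and modulo J^n it is 0; hence \<open>e_n\<close> selects the
  action on \<open>V\<close> and \<open>f_n\<close> that on \<open>W\<close>. The summand \<hh>''
  carries no coefficients that could be split. It acts on the target of \<theta> with its
  \<open>\<psi>2\<close>-weight subtracted, and on linear maps by a commutator, so that the weights
  of v and w come out right.\<close>

abbreviation lin :: "(complex, 'v, 'r) module_scheme \<Rightarrow> (complex, 'w, 's) module_scheme \<Rightarrow> ('v \<Rightarrow> 'w) \<Rightarrow> bool"
  where "lin V W f \<equiv> f \<in> LinearCombinations.module_hom CC V W"

abbreviation subsp :: "(complex, 'v, 'r) module_scheme \<Rightarrow> 'v set \<Rightarrow> bool"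
  where "subsp V N \<equiv> VectorSpace.subspace CC N V"

text \<open>The scalars \<open>CC\<close> form the record \<open>class_ring\<close>; the module
  axioms are restated here with the operations of the type \<open>complex\<close>, which keeps that
  record out of all later calculations.\<close>

locale cvs =
  fixes V :: "(complex, 'v, 'r) module_scheme" (structure)
  assumes vs: "vectorspace CC V"
begin

lemma module: "Module.module CC V"
  using vs by (simp add: vectorspace_def)

lemma abelian: "abelian_group V"
  using module by (simp add: Module.module_def)

lemma a_closed [simp]: "x \<in> carrier V \<Longrightarrow> y \<in> carrier V \<Longrightarrow> x \<oplus> y \<in> carrier V"
  and zero_closed [simp]: "\<zero> \<in> carrier V"
  and l_zero [simp]: "x \<in> carrier V \<Longrightarrow> \<zero> \<oplus> x = x"
  and r_zero [simp]: "x \<in> carrier V \<Longrightarrow> x \<oplus> \<zero> = x"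
  and minus_closed [simp]: "x \<in> carrier V \<Longrightarrow> y \<in> carrier V \<Longrightarrow> x \<ominus> y \<in> carrier V"
  and a_inv_closed [simp]: "x \<in> carrier V \<Longrightarrow> \<ominus> x \<in> carrier V"
  and a_assoc: "x \<in> carrier V \<Longrightarrow> y \<in> carrier V \<Longrightarrow> z \<in> carrier V \<Longrightarrow> (x \<oplus> y) \<oplus> z = x \<oplus> (y \<oplus> z)"
  and a_comm: "x \<in> carrier V \<Longrightarrow> y \<in> carrier V \<Longrightarrow> x \<oplus> y = y \<oplus> x"
  and a_lcomm: "x \<in> carrier V \<Longrightarrow> y \<in> carrier V \<Longrightarrow> z \<in> carrier V \<Longrightarrow> x \<oplus> (y \<oplus> z) = y \<oplus> (x \<oplus> z)"
  and l_neg: "x \<in> carrier V \<Longrightarrow> \<ominus> x \<oplus> x = \<zero>"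
  and r_neg: "x \<in> carrier V \<Longrightarrow> x \<oplus> \<ominus> x = \<zero>"
proof -
  interpret abelian_group V by (rule abelian)
  show "x \<in> carrier V \<Longrightarrow> y \<in> carrier V \<Longrightarrow> x \<oplus> y \<in> carrier V" "\<zero> \<in> carrier V"
    "x \<in> carrier V \<Longrightarrow> \<zero> \<oplus> x = x" "x \<in> carrier V \<Longrightarrow> x \<oplus> \<zero> = x"
    "x \<in> carrier V \<Longrightarrow> y \<in> carrier V \<Longrightarrow> x \<ominus> y \<in> carrier V"
    "x \<in> carrier V \<Longrightarrow> \<ominus> x \<in> carrier V"
    "x \<in> carrier V \<Longrightarrow> y \<in> carrier V \<Longrightarrow> z \<in> carrier V \<Longrightarrow> (x \<oplus> y) \<oplus> z = x \<oplus> (y \<oplus> z)"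
    "x \<in> carrier V \<Longrightarrow> y \<in> carrier V \<Longrightarrow> x \<oplus> y = y \<oplus> x"
    "x \<in> carrier V \<Longrightarrow> y \<in> carrier V \<Longrightarrow> z \<in> carrier V \<Longrightarrow> x \<oplus> (y \<oplus> z) = y \<oplus> (x \<oplus> z)"
    "x \<in> carrier V \<Longrightarrow> \<ominus> x \<oplus> x = \<zero>" "x \<in> carrier V \<Longrightarrow> x \<oplus> \<ominus> x = \<zero>"
    by (simp_all add: a_ac l_neg r_neg)
qed

lemmas a_ac = a_assoc a_comm a_lcomm

lemma s_closed [simp]: "x \<in> carrier V \<Longrightarrow> c \<odot> x \<in> carrier V"
  using module.smult_closed[OF module, of c x] by (simp add: class_ring_simps)

lemma s_ladd: "x \<in> carrier V \<Longrightarrow> (c + d) \<odot> x = c \<odot> x \<oplus> d \<odot> x"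
  using module.smult_l_distr[OF module, of c d x] by (simp add: class_ring_simps)

lemma s_radd: "x \<in> carrier V \<Longrightarrow> y \<in> carrier V \<Longrightarrow> c \<odot> (x \<oplus> y) = c \<odot> x \<oplus> c \<odot> y"
  using module.smult_r_distr[OF module, of c x y] by (simp add: class_ring_simps)

lemma s_mult: "x \<in> carrier V \<Longrightarrow> (c * d) \<odot> x = c \<odot> (d \<odot> x)"
  using module.smult_assoc1[OF module, of c d x] by (simp add: class_ring_simps)

lemma s_one [simp]: "x \<in> carrier V \<Longrightarrow> 1 \<odot> x = x"
  using module.smult_one[OF module, of x] by (simp add: class_ring_simps)

lemma s_zero [simp]: "x \<in> carrier V \<Longrightarrow> 0 \<odot> x = \<zero>"
  using module.smult_l_null[OF module, of x] by (simp add: class_ring_simps)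

lemma s_rzero [simp]: "c \<odot> \<zero> = \<zero>"
  using module.smult_r_null[OF module, of c] by (simp add: class_ring_simps)

lemma s_uminus: "x \<in> carrier V \<Longrightarrow> (- 1) \<odot> x = \<ominus> x"
proof -
  assume x: "x \<in> carrier V"
  then have "(- 1) \<odot> x \<oplus> x = \<zero>" using s_ladd[of x "- 1" 1] by simp
  then have "(- 1) \<odot> x \<oplus> (x \<oplus> \<ominus> x) = \<ominus> x" using x by (simp flip: a_assoc)
  then show ?thesis using x by (simp add: r_neg)
qed

lemma s_minus: "x \<in> carrier V \<Longrightarrow> y \<in> carrier V \<Longrightarrow> c \<odot> (x \<ominus> y) = c \<odot> x \<ominus> c \<odot> y"
  using module.smult_r_minus[OF module, of c y] by (simp add: a_minus_def s_radd class_ring_simps)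

lemma minus_cancel [simp]: "x \<in> carrier V \<Longrightarrow> y \<in> carrier V \<Longrightarrow> (x \<oplus> y) \<ominus> y = x"
  by (simp add: a_minus_def a_assoc r_neg)

lemma minus_add_cancel [simp]: "x \<in> carrier V \<Longrightarrow> y \<in> carrier V \<Longrightarrow> (x \<ominus> y) \<oplus> y = x"
  by (simp add: a_minus_def a_assoc l_neg)

lemma minus_self [simp]: "x \<in> carrier V \<Longrightarrow> x \<ominus> x = \<zero>"
  by (simp add: a_minus_def r_neg)

lemma minus_eq_iff: "x \<in> carrier V \<Longrightarrow> y \<in> carrier V \<Longrightarrow> z \<in> carrier V \<Longrightarrow> x \<ominus> y = z \<longleftrightarrow> x = z \<oplus> y"
  using minus_add_cancel minus_cancel by auto

lemma minus_eq_zero_iff: "x \<in> carrier V \<Longrightarrow> y \<in> carrier V \<Longrightarrow> x \<ominus> y = \<zero> \<longleftrightarrow> x = y"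
  by (simp add: minus_eq_iff)

lemma subsp_I:
  assumes "N \<subseteq> carrier V" "\<zero> \<in> N" "\<And>x y. x \<in> N \<Longrightarrow> y \<in> N \<Longrightarrow> x \<oplus> y \<in> N"
    "\<And>c x. x \<in> N \<Longrightarrow> c \<odot> x \<in> N"
  shows "subsp V N"
  unfolding VectorSpace.subspace_def
  by (intro conjI submodule.intro vs module) (use assms in auto)

lemma span_subsp: "S \<subseteq> carrier V \<Longrightarrow> subsp V (cspan V S)"
  using module.span_is_submodule[OF module, of S] vs by (simp add: VectorSpace.subspace_def)

lemma span_base: "S \<subseteq> carrier V \<Longrightarrow> x \<in> S \<Longrightarrow> x \<in> cspan V S"
  using module.in_own_span[OF module, of S] by auto

lemma span_least: "S \<subseteq> N \<Longrightarrow> subsp V N \<Longrightarrow> cspan V S \<subseteq> N"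
  using module.span_is_subset[OF module, of S N] by (simp add: VectorSpace.subspace_def)

lemma subsp_carrier: "subsp V (carrier V)"
  by (rule subsp_I) auto

lemma subsp_zero: "subsp V {\<zero>}"
  by (rule subsp_I) auto

end

text \<open>Negatives need not be supplied: by distributivity and
  \<open>0 \<odot> x = \<zero>\<close>, the vector \<open>(- 1) \<odot> x\<close> is an inverse of
  \<open>x\<close>.\<close>

lemma cvsI:
  fixes V (structure)
  assumes "\<And>x y. x \<in> carrier V \<Longrightarrow> y \<in> carrier V \<Longrightarrow> x \<oplus> y \<in> carrier V" "\<zero> \<in> carrier V"
    "\<And>x y z. x \<in> carrier V \<Longrightarrow> y \<in> carrier V \<Longrightarrow> z \<in> carrier V \<Longrightarrow> (x \<oplus> y) \<oplus> z = x \<oplus> (y \<oplus> z)"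
    "\<And>x y. x \<in> carrier V \<Longrightarrow> y \<in> carrier V \<Longrightarrow> x \<oplus> y = y \<oplus> x"
    "\<And>x. x \<in> carrier V \<Longrightarrow> \<zero> \<oplus> x = x"
    "\<And>c x. x \<in> carrier V \<Longrightarrow> c \<odot> x \<in> carrier V"
    "\<And>c d x. x \<in> carrier V \<Longrightarrow> (c + d) \<odot> x = c \<odot> x \<oplus> d \<odot> x"
    "\<And>c x y. x \<in> carrier V \<Longrightarrow> y \<in> carrier V \<Longrightarrow> c \<odot> (x \<oplus> y) = c \<odot> x \<oplus> c \<odot> y"
    "\<And>c d x. x \<in> carrier V \<Longrightarrow> (c * d) \<odot> x = c \<odot> (d \<odot> x)"
    "\<And>x. x \<in> carrier V \<Longrightarrow> 1 \<odot> x = x"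
    "\<And>x. x \<in> carrier V \<Longrightarrow> 0 \<odot> x = \<zero>"
  shows "cvs V"
proof -
  have inv: "\<exists>y\<in>carrier V. y \<oplus> x = \<zero>" if "x \<in> carrier V" for x
  proof
    show "(- 1) \<odot> x \<oplus> x = \<zero>"
      using assms(7)[of x "-1" 1] assms(10,11)[of x] that by simp
  qed (use assms that in auto)
  have "abelian_group V"
    by (rule abelian_groupI) (use assms inv in auto)
  then have "module CC V"
    by (intro moduleI domain.axioms(1)[OF field.axioms(1)[OF class_field]]) (use assms in \<open>auto simp: class_ring_simps\<close>)
  then show ?thesis
    unfolding cvs_def vectorspace_def using class_field by blast
qed

lemma subspD:
  fixes V (structure)
  assumes "subsp V N"
  shows "N \<subseteq> carrier V" "\<zero> \<in> N" "x \<in> N \<Longrightarrow> y \<in> N \<Longrightarrow> x \<oplus> y \<in> N" "x \<in> N \<Longrightarrow> c \<odot> x \<in> N"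
proof -
  interpret submodule CC N V using assms by (simp add: VectorSpace.subspace_def)
  show "N \<subseteq> carrier V" "\<zero> \<in> N" "x \<in> N \<Longrightarrow> y \<in> N \<Longrightarrow> x \<oplus> y \<in> N" "x \<in> N \<Longrightarrow> c \<odot> x \<in> N"
    using subset m_closed zero_closed smult_closed by (auto simp: class_ring_simps)
qed

lemma (in cvs) subspD_minus: "subsp V N \<Longrightarrow> x \<in> N \<Longrightarrow> y \<in> N \<Longrightarrow> x \<ominus> y \<in> N"
  using s_uminus[of y] subspD(1)[of N V] subspD(3)[of N V x "\<ominus> y"] subspD(4)[of N V y "- 1"]
  by (auto simp: a_minus_def)

lemma (in cvs) subsp_cvs: "subsp V N \<Longrightarrow> cvs (V\<lparr>carrier := N\<rparr>)"
proof -
  assume N: "subsp V N"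
  then have [simp]: "\<And>x. x \<in> N \<Longrightarrow> x \<in> carrier V" using subspD(1) by blast
  show ?thesis
    by (rule cvsI) (auto simp: s_ladd s_radd s_mult a_ac subspD(2-4)[OF N])
qed

lemma linI:
  assumes "\<And>x. x \<in> carrier V \<Longrightarrow> f x \<in> carrier W"
    "\<And>x y. x \<in> carrier V \<Longrightarrow> y \<in> carrier V \<Longrightarrow> f (x \<oplus>\<^bsub>V\<^esub> y) = f x \<oplus>\<^bsub>W\<^esub> f y"
    "\<And>c x. x \<in> carrier V \<Longrightarrow> f (c \<odot>\<^bsub>V\<^esub> x) = c \<odot>\<^bsub>W\<^esub> f x"
  shows "lin V W f"
  using assms by (auto simp: LinearCombinations.module_hom_def)

lemma linD:
  assumes "lin V W f"
  shows "x \<in> carrier V \<Longrightarrow> f x \<in> carrier W"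
    "x \<in> carrier V \<Longrightarrow> y \<in> carrier V \<Longrightarrow> f (x \<oplus>\<^bsub>V\<^esub> y) = f x \<oplus>\<^bsub>W\<^esub> f y"
    "x \<in> carrier V \<Longrightarrow> f (c \<odot>\<^bsub>V\<^esub> x) = c \<odot>\<^bsub>W\<^esub> f x"
  using assms by (auto simp: LinearCombinations.module_hom_def class_ring_simps)

lemma lin_zero:
  assumes "lin V W f" "cvs V" "cvs W" shows "f \<zero>\<^bsub>V\<^esub> = \<zero>\<^bsub>W\<^esub>"
proof -
  interpret V: cvs V by fact
  interpret W: cvs W by fact
  show ?thesis
    using linD(3)[OF assms(1), of "\<zero>\<^bsub>V\<^esub>" 0] linD(1)[OF assms(1), of "\<zero>\<^bsub>V\<^esub>"] by simp
qed

lemma lin_minus: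
  assumes f: "lin V W f" and "cvs V" "cvs W" and xy: "x \<in> carrier V" "y \<in> carrier V"
  shows "f (x \<ominus>\<^bsub>V\<^esub> y) = f x \<ominus>\<^bsub>W\<^esub> f y"
proof -
  interpret V: cvs V by fact
  interpret W: cvs W by fact
  have "f (x \<oplus>\<^bsub>V\<^esub> (- 1) \<odot>\<^bsub>V\<^esub> y) = f x \<oplus>\<^bsub>W\<^esub> (- 1) \<odot>\<^bsub>W\<^esub> f y"
    using linD[OF f] xy by simp
  then show ?thesis
    using xy linD[OF f] by (simp add: V.s_uminus W.s_uminus a_minus_def)
qed

lemma lin_comp: "lin U V f \<Longrightarrow> lin V W g \<Longrightarrow> lin U W (\<lambda>x. g (f x))"
  by (rule linI) (auto simp: linD)

lemma lin_vimage_subsp: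
  assumes "lin V W f" "cvs V" "cvs W" "subsp W N"
  shows "subsp V {x \<in> carrier V. f x \<in> N}"
proof -
  interpret V: cvs V by fact
  show ?thesis
    by (rule V.subsp_I) (use assms subspD[OF assms(4)] in \<open>auto simp: linD lin_zero\<close>)
qed

text \<open>Equalities of linear maps are proved throughout by showing that this equalizer contains
  a spanning set; equalities of homomorphisms are treated in the same way with generators.\<close>

lemma lin_eq_subsp:
  assumes "lin V W f" "lin V W g" "cvs V" "cvs W"
  shows "subsp V {x \<in> carrier V. f x = g x}"
proof -
  interpret V: cvs V by fact
  show ?thesis
    by (rule V.subsp_I) (use assms in \<open>auto simp: linD lin_zero\<close>)
qed

subsection \<open>Quotients\<close>

locale quot_space = cvs V for V :: "(complex, 'v, 'r) module_scheme" (structure) +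
  fixes K assumes K: "subsp V K"
begin

lemma ab: "abelian_subgroup K V"
proof (rule abelian_subgroupI3)
  show "additive_subgroup K V"
  proof
    show "K \<subseteq> carrier (add_monoid V)" "\<And>x y. x \<in> K \<Longrightarrow> y \<in> K \<Longrightarrow> x \<otimes>\<^bsub>add_monoid V\<^esub> y \<in> K"
      "\<one>\<^bsub>add_monoid V\<^esub> \<in> K"
      using subspD[OF K] by auto
    show "inv\<^bsub>add_monoid V\<^esub> x \<in> K" if "x \<in> K" for x
      using s_uminus[of x] subspD(4)[OF K that, of "-1"] subspD(1)[OF K] that
      by (auto simp: a_inv_def)
  qed
qed (rule abelian)

lemma quot_carrier: "carrier (quot_mod V K) = (+>) K ` carrier V"
  by (auto simp: quot_mod_def ring.defs module.defs FactRing_simps)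

lemma quot_I: "x \<in> carrier V \<Longrightarrow> K +> x \<in> carrier (quot_mod V K)"
  by (simp add: quot_carrier)

lemma rep_self: "x \<in> carrier V \<Longrightarrow> x \<in> K +> x"
  by (rule abelian_subgroup.a_rcos_self[OF ab])

lemma rep_carrier: "x \<in> carrier V \<Longrightarrow> y \<in> K +> x \<Longrightarrow> y \<in> carrier V"
  using abelian_subgroup.a_elemrcos_carrier[OF ab] by blast

lemma rep_eq: "x \<in> carrier V \<Longrightarrow> y \<in> K +> x \<Longrightarrow> K +> y = K +> x"
  using abelian_subgroup.a_repr_independence'[OF ab] by metis

lemma quot_eq_iff: "x \<in> carrier V \<Longrightarrow> y \<in> carrier V \<Longrightarrow> K +> x = K +> y \<longleftrightarrow> x \<ominus> y \<in> K"
  using abelian_subgroup.a_rcos_module[OF ab, of y x] rep_self[of x] rep_eq[of y x]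
  by (auto simp: a_minus_def)

lemma rep_minus: "x \<in> carrier V \<Longrightarrow> y \<in> K +> x \<Longrightarrow> y \<ominus> x \<in> K"
  using quot_eq_iff rep_carrier rep_eq by blast

lemma quot_zero: "\<zero>\<^bsub>quot_mod V K\<^esub> = K +> \<zero>"
  using subspD(1)[OF K] abelian_group.a_coset_add_zero[OF abelian, of K]
  by (simp add: quot_mod_def ring.defs module.defs FactRing_def)

lemma quot_add: "x \<in> carrier V \<Longrightarrow> y \<in> carrier V \<Longrightarrow>
    (K +> x) \<oplus>\<^bsub>quot_mod V K\<^esub> (K +> y) = K +> (x \<oplus> y)"
  by (simp add: quot_mod_def ring.defs module.defs FactRing_def abelian_subgroup.a_rcos_sum[OF ab])

text \<open>The scalar multiplication of \<open>quot_mod\<close> and the action of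
  \<open>lie_quot\<close> are unions over the representatives of a coset. When the united sets
  coincide, the union is any one of them.\<close>

lemma UN_rep:
  assumes x: "x \<in> carrier V" and f: "\<And>y. y \<in> carrier V \<Longrightarrow> y \<ominus> x \<in> K \<Longrightarrow> f y = f x"
  shows "(\<Union>y\<in>K +> x. f y) = f x"
proof -
  have "f y = f x" if "y \<in> K +> x" for y
    using that x f rep_carrier rep_minus by blast
  then show ?thesis by (rule UN_constant_eq[OF rep_self[OF x] ballI])
qed

lemma quot_smult: "x \<in> carrier V \<Longrightarrow> c \<odot>\<^bsub>quot_mod V K\<^esub> (K +> x) = K +> (c \<odot> x)"
proof -
  assume x: "x \<in> carrier V"
  have "(\<Union>y\<in>K +> x. K +> (c \<odot> y)) = K +> (c \<odot> x)"
  proof (rule UN_rep[OF x])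
    fix y assume "y \<in> carrier V" "y \<ominus> x \<in> K"
    then show "K +> (c \<odot> y) = K +> (c \<odot> x)"
      using x by (simp add: quot_eq_iff s_minus[symmetric] subspD(4)[OF K])
  qed
  then show ?thesis
    by (simp add: quot_mod_def ring.defs module.defs)
qed

lemma quot_cvs: "cvs (quot_mod V K)"
  by (rule cvsI)
    (auto simp: quot_carrier quot_add quot_smult quot_zero s_ladd s_radd s_mult a_ac)

lemma quot_lin: "lin V (quot_mod V K) ((+>) K)"
  by (rule linI) (auto simp: quot_add quot_smult quot_I)

lemma quot_lin_out:
  assumes "lin V W f" "cvs W" "\<And>x. x \<in> K \<Longrightarrow> f x = \<zero>\<^bsub>W\<^esub>"
  shows "\<exists>g. lin (quot_mod V K) W g \<and> (\<forall>x\<in>carrier V. g (K +> x) = f x)"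
proof -
  interpret W: cvs W by fact
  have eq: "f y = f x" if "x \<in> carrier V" "y \<in> carrier V" "y \<ominus> x \<in> K" for x y
    using lin_minus[OF assms(1) cvs_axioms assms(2) that(2,1)] assms(3)[OF that(3)]
      linD(1)[OF assms(1)] that W.minus_eq_zero_iff by metis
  \<comment> \<open>The choice of representative is harmless, because \<open>eq\<close> makes
    \<open>f\<close> constant on each coset.\<close>
  define g where "g X = f (SOME x. x \<in> X)" for X
  have g: "g (K +> x) = f x" if x: "x \<in> carrier V" for x
  proof -
    have "(SOME y. y \<in> K +> x) \<in> K +> x" by (rule someI) (rule rep_self[OF x])
    then show ?thesis
      unfolding g_def using x rep_carrier rep_minus by (intro eq) auto
  qed
  have "lin (quot_mod V K) W g"
    by (rule linI) (use assms in \<open>auto simp: quot_carrier quot_add quot_smult g linD\<close>)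
  with g show ?thesis by blast
qed

end

subsection \<open>Free vector spaces\<close>

lemma free_mod_carrier: "p \<in> carrier (free_mod S) \<longleftrightarrow> finite {s. p s \<noteq> 0} \<and> {s. p s \<noteq> 0} \<subseteq> S"
  by (simp add: free_mod_def)

lemma free_mod_simps:
  "\<zero>\<^bsub>free_mod S\<^esub> = (\<lambda>s. 0)" "p \<oplus>\<^bsub>free_mod S\<^esub> q = (\<lambda>s. p s + q s)"
  "c \<odot>\<^bsub>free_mod S\<^esub> p = (\<lambda>s. c * p s)"
  by (simp_all add: free_mod_def)

lemma free_mod_cvs: "cvs (free_mod S)"
proof (rule cvsI, goal_cases)
  case (1 x y)
  have "finite ({s. x s \<noteq> 0} \<union> {s. y s \<noteq> 0})" "{s. x s + y s \<noteq> 0} \<subseteq> {s. x s \<noteq> 0} \<union> {s. y s \<noteq> 0}"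
    using 1 by (auto simp: free_mod_carrier)
  then show ?case using 1 by (auto simp: free_mod_carrier free_mod_simps intro: finite_subset)
next
  case (6 c x)
  have "{s. c * x s \<noteq> 0} \<subseteq> {s. x s \<noteq> 0}" by auto
  then show ?case using 6 by (auto simp: free_mod_carrier free_mod_simps intro: finite_subset)
qed (auto simp: free_mod_simps free_mod_carrier algebra_simps fun_eq_iff)

interpretation F: cvs "free_mod S" for S by (rule free_mod_cvs)

lemma free_mod_uminus: "p \<in> carrier (free_mod S) \<Longrightarrow> \<ominus>\<^bsub>free_mod S\<^esub> p = (\<lambda>s. - p s)"
  by (simp add: F.s_uminus[symmetric] free_mod_simps)

lemma free_mod_minus: "p \<in> carrier (free_mod S) \<Longrightarrow> q \<in> carrier (free_mod S) \<Longrightarrow>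
    p \<ominus>\<^bsub>free_mod S\<^esub> q = (\<lambda>s. p s - q s)"
  by (simp add: a_minus_def free_mod_uminus free_mod_simps)

lemma delta_carrier [simp]: "s \<in> S \<Longrightarrow> delta s \<in> carrier (free_mod S)"
  by (auto simp: free_mod_carrier delta_def)

text \<open>Tensor and enveloping relations are given as pointwise differences of functions. In
  terms of the vector space operations, linear maps can be applied to them.\<close>

lemma delta_relations:
  assumes "a \<in> S" "b \<in> S"
  shows "c \<in> S \<Longrightarrow> (\<lambda>z. delta a z - delta b z - delta c z) =
      delta a \<ominus>\<^bsub>free_mod S\<^esub> (delta b \<oplus>\<^bsub>free_mod S\<^esub> delta c)"
    "(\<lambda>z. delta a z - k * delta b z) = delta a \<ominus>\<^bsub>free_mod S\<^esub> k \<odot>\<^bsub>free_mod S\<^esub> delta b"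
    "(\<lambda>z. delta a z - delta b z) = delta a \<ominus>\<^bsub>free_mod S\<^esub> delta b"
proof -
  have ab: "delta a \<in> carrier (free_mod S)" "delta b \<in> carrier (free_mod S)"
    using assms by auto
  show "(\<lambda>z. delta a z - delta b z - delta c z) =
      delta a \<ominus>\<^bsub>free_mod S\<^esub> (delta b \<oplus>\<^bsub>free_mod S\<^esub> delta c)" if "c \<in> S"
    using that unfolding free_mod_minus[OF ab(1) F.a_closed[OF ab(2) delta_carrier[OF that]]]
    by (simp add: free_mod_simps algebra_simps)
  show "(\<lambda>z. delta a z - k * delta b z) = delta a \<ominus>\<^bsub>free_mod S\<^esub> k \<odot>\<^bsub>free_mod S\<^esub> delta b"
    unfolding free_mod_minus[OF ab(1) F.s_closed[OF ab(2)]] by (simp add: free_mod_simps)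
  show "(\<lambda>z. delta a z - delta b z) = delta a \<ominus>\<^bsub>free_mod S\<^esub> delta b"
    unfolding free_mod_minus[OF ab] by simp
qed

text \<open>The vectors \<open>delta s\<close> span: induction on the support, splitting off one
  basis vector at a time.\<close>

lemma free_mod_induct:
  assumes N: "subsp (free_mod S) N" and d: "\<And>s. s \<in> S \<Longrightarrow> delta s \<in> N"
    and p: "p \<in> carrier (free_mod S)"
  shows "p \<in> N"
proof -
  have "\<forall>p. {s. p s \<noteq> 0} = T \<longrightarrow> p \<in> N" if "finite T" "T \<subseteq> S" for T
    using that
  proof (induction T rule: finite_induct)
    case empty
    then show ?case using subspD(2)[OF N] by (auto simp: free_mod_simps fun_eq_iff dest!: ext)
  next
    case (insert t T)
    show ?case
    proof (intro allI impI)
      fix p :: "'a \<Rightarrow> complex" assume p: "{s. p s \<noteq> 0} = insert t T"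
      define q where "q = p(t := 0)"
      have "{s. q s \<noteq> 0} = T" using p insert.hyps by (auto simp: q_def)
      then have "q \<in> N" using insert by auto
      moreover have "p = (\<lambda>s. q s + p t * delta t s)"
        by (auto simp: q_def delta_def)
      ultimately show "p \<in> N"
        using subspD(3)[OF N, of q "p t \<odot>\<^bsub>free_mod S\<^esub> delta t"] subspD(4)[OF N d[of t], of "p t"] insert.prems
        by (simp add: free_mod_simps)
    qed
  qed
  then show ?thesis using p by (auto simp: free_mod_carrier)
qed

text \<open>The linear extension of \<open>\<phi>\<close> from the basis, and at the same time the
  expression that \<open>tensor_lift\<close> evaluates on the representatives of a coset.\<close>

definition free_ext :: "(complex, 'u, 'r) module_scheme \<Rightarrow> ('s \<Rightarrow> 'u) \<Rightarrow> ('s \<Rightarrow> complex) \<Rightarrow> 'u" where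
  "free_ext U \<phi> p = (\<Oplus>\<^bsub>U\<^esub>z\<in>{z. p z \<noteq> 0}. p z \<odot>\<^bsub>U\<^esub> \<phi> z)"

context cvs begin

text \<open>Padding the sum with zero terms lets two vectors be summed over a common index set,
  which is how additivity is proved.\<close>

lemma free_ext_super:
  assumes "\<phi> \<in> S \<rightarrow> carrier V" "finite T" "{z. p z \<noteq> 0} \<subseteq> T" "T \<subseteq> S"
  shows "free_ext V \<phi> p = (\<Oplus>z\<in>T. p z \<odot> \<phi> z)"
  unfolding free_ext_def
proof -
  interpret abelian_group V by (rule abelian)
  show "(\<Oplus>z\<in>{z. p z \<noteq> 0}. p z \<odot> \<phi> z) = (\<Oplus>z\<in>T. p z \<odot> \<phi> z)"
    by (rule add.finprod_mono_neutral_cong_left) (use assms in \<open>auto simp: Pi_def\<close>)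
qed

lemma free_ext_delta: "\<phi> s \<in> carrier V \<Longrightarrow> free_ext V \<phi> (delta s) = \<phi> s"
proof -
  interpret abelian_group V by (rule abelian)
  show "free_ext V \<phi> (delta s) = \<phi> s" if "\<phi> s \<in> carrier V"
    using that by (subst free_ext_super[of _ "{s}" "{s}"]) (auto simp: delta_def)
qed

lemma free_ext_lin:
  assumes \<phi>: "\<phi> \<in> S \<rightarrow> carrier V"
  shows "lin (free_mod S) V (free_ext V \<phi>)"
proof (rule linI)
  interpret M: abelian_group V by (rule abelian)
  fix p assume p: "p \<in> carrier (free_mod S)"
  then show "free_ext V \<phi> p \<in> carrier V"
    using \<phi> unfolding free_ext_def by (intro M.finsum_closed) (auto simp: free_mod_carrier Pi_def intro!: s_closed)
  fix c
  show "free_ext V \<phi> (c \<odot>\<^bsub>free_mod S\<^esub> p) = c \<odot> free_ext V \<phi> p"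
  proof -
    let ?T = "{z. p z \<noteq> 0}"
    have "free_ext V \<phi> (c \<odot>\<^bsub>free_mod S\<^esub> p) = (\<Oplus>z\<in>?T. (c * p z) \<odot> \<phi> z)"
      using p \<phi> by (subst free_ext_super[of _ S ?T]) (auto simp: free_mod_carrier free_mod_simps)
    also have "\<dots> = (\<Oplus>z\<in>?T. c \<odot> (p z \<odot> \<phi> z))"
      using p \<phi> by (intro M.finsum_cong') (auto simp: s_mult free_mod_carrier Pi_def)
    also have "\<dots> = c \<odot> (\<Oplus>z\<in>?T. p z \<odot> \<phi> z)"
      using p \<phi> by (subst module.finsum_smult_ldistr[OF module]) (auto simp: free_mod_carrier Pi_def class_ring_simps)
    finally show ?thesis by (simp add: free_ext_def)
  qed
next
  interpret M: abelian_group V by (rule abelian)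
  fix p q assume p: "p \<in> carrier (free_mod S)" and q: "q \<in> carrier (free_mod S)"
  let ?T = "{z. p z \<noteq> 0} \<union> {z. q z \<noteq> 0}"
  have T: "finite ?T" "?T \<subseteq> S" using p q by (auto simp: free_mod_carrier)
  then have mem: "\<And>z. z \<in> ?T \<Longrightarrow> \<phi> z \<in> carrier V" using \<phi> by auto
  have "free_ext V \<phi> (p \<oplus>\<^bsub>free_mod S\<^esub> q) = (\<Oplus>z\<in>?T. (p z + q z) \<odot> \<phi> z)"
    using T \<phi> by (subst free_ext_super[of _ S ?T]) (auto simp: free_mod_simps)
  also have "\<dots> = (\<Oplus>z\<in>?T. p z \<odot> \<phi> z \<oplus> q z \<odot> \<phi> z)"
    using mem by (intro M.finsum_cong') (auto simp: s_ladd)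
  also have "\<dots> = (\<Oplus>z\<in>?T. p z \<odot> \<phi> z) \<oplus> (\<Oplus>z\<in>?T. q z \<odot> \<phi> z)"
    using mem by (intro M.finsum_addf) auto
  also have "(\<Oplus>z\<in>?T. p z \<odot> \<phi> z) = free_ext V \<phi> p"
    using T \<phi> by (subst free_ext_super[of _ S ?T]) auto
  also have "(\<Oplus>z\<in>?T. q z \<odot> \<phi> z) = free_ext V \<phi> q"
    using T \<phi> by (subst free_ext_super[of _ S ?T]) auto
  finally show "free_ext V \<phi> (p \<oplus>\<^bsub>free_mod S\<^esub> q) = free_ext V \<phi> p \<oplus> free_ext V \<phi> q" .
qed

end

subsection \<open>Tensor products\<close>

locale tensor_space = V: cvs V + W: cvs W
  for V :: "(complex, 'v, 'r1) module_scheme" and W :: "(complex, 'w, 'r2) module_scheme" +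
  fixes S :: "'s set" and rho :: "'v \<Rightarrow> 's \<Rightarrow> 'v" and sig :: "'s \<Rightarrow> 'w \<Rightarrow> 'w"
  assumes rho_closed: "v \<in> carrier V \<Longrightarrow> s \<in> S \<Longrightarrow> rho v s \<in> carrier V"
    and sig_closed: "w \<in> carrier W \<Longrightarrow> s \<in> S \<Longrightarrow> sig s w \<in> carrier W"
begin

abbreviation "FVW \<equiv> free_mod (carrier V \<times> carrier W)"
abbreviation "T \<equiv> tensor_over V W S rho sig"
abbreviation "pt \<equiv> ptensor_over V W S rho sig"
abbreviation "TK \<equiv> tensor_ker V W S rho sig"

text \<open>One test for all five kinds of relations, applied once to the free space itself and once
  to the kernel of a linear map.\<close>

lemma rels_subset:
  assumes N: "N \<subseteq> carrier FVW"
    and "\<And>v v' w. v \<in> carrier V \<Longrightarrow> v' \<in> carrier V \<Longrightarrow> w \<in> carrier W \<Longrightarrow>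
      delta (v \<oplus>\<^bsub>V\<^esub> v', w) \<ominus>\<^bsub>FVW\<^esub> (delta (v, w) \<oplus>\<^bsub>FVW\<^esub> delta (v', w)) \<in> N"
    and "\<And>v w w'. v \<in> carrier V \<Longrightarrow> w \<in> carrier W \<Longrightarrow> w' \<in> carrier W \<Longrightarrow>
      delta (v, w \<oplus>\<^bsub>W\<^esub> w') \<ominus>\<^bsub>FVW\<^esub> (delta (v, w) \<oplus>\<^bsub>FVW\<^esub> delta (v, w')) \<in> N"
    and "\<And>c v w. v \<in> carrier V \<Longrightarrow> w \<in> carrier W \<Longrightarrow>
      delta (c \<odot>\<^bsub>V\<^esub> v, w) \<ominus>\<^bsub>FVW\<^esub> c \<odot>\<^bsub>FVW\<^esub> delta (v, w) \<in> N"
    and "\<And>c v w. v \<in> carrier V \<Longrightarrow> w \<in> carrier W \<Longrightarrow>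
      delta (v, c \<odot>\<^bsub>W\<^esub> w) \<ominus>\<^bsub>FVW\<^esub> c \<odot>\<^bsub>FVW\<^esub> delta (v, w) \<in> N"
    and "\<And>v s w. v \<in> carrier V \<Longrightarrow> w \<in> carrier W \<Longrightarrow> s \<in> S \<Longrightarrow>
      delta (rho v s, w) \<ominus>\<^bsub>FVW\<^esub> delta (v, sig s w) \<in> N"
  shows "tensor_rels V W S rho sig \<subseteq> N"
proof -
  note d = delta_relations[where S = "carrier V \<times> carrier W"]
  have "(\<lambda>z. delta (v \<oplus>\<^bsub>V\<^esub> v', w) z - delta (v, w) z - delta (v', w) z) \<in> N"
    if "v \<in> carrier V" "v' \<in> carrier V" "w \<in> carrier W" for v v' w
    using that assms(2)[OF that] by (subst d(1)) auto
  moreover have "(\<lambda>z. delta (v, w \<oplus>\<^bsub>W\<^esub> w') z - delta (v, w) z - delta (v, w') z) \<in> N"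
    if "v \<in> carrier V" "w \<in> carrier W" "w' \<in> carrier W" for v w w'
    using that assms(3)[OF that] by (subst d(1)) auto
  moreover have "(\<lambda>z. delta (c \<odot>\<^bsub>V\<^esub> v, w) z - c * delta (v, w) z) \<in> N"
    if "v \<in> carrier V" "w \<in> carrier W" for c v w
    using that assms(4)[OF that] by (subst d(2)) auto
  moreover have "(\<lambda>z. delta (v, c \<odot>\<^bsub>W\<^esub> w) z - c * delta (v, w) z) \<in> N"
    if "v \<in> carrier V" "w \<in> carrier W" for c v w
    using that assms(5)[OF that] by (subst d(2)) auto
  moreover have "(\<lambda>z. delta (rho v s, w) z - delta (v, sig s w) z) \<in> N"
    if "v \<in> carrier V" "w \<in> carrier W" "s \<in> S" for v s w
    using that assms(6)[OF that] by (subst d(3)) (auto simp: rho_closed sig_closed)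
  ultimately show ?thesis
    unfolding tensor_rels_def by (intro Un_least subsetI; elim CollectE exE conjE; simp only:)
qed

lemma rels_carrier: "tensor_rels V W S rho sig \<subseteq> carrier FVW"
  by (rule rels_subset) (simp_all add: rho_closed sig_closed)

lemma TK_subsp: "subsp FVW TK"
  unfolding tensor_ker_def by (rule F.span_subsp) (rule rels_carrier)

lemma Q: "quot_space FVW TK"
  unfolding quot_space_def quot_space_axioms_def using TK_subsp free_mod_cvs by blast

sublocale Q: quot_space FVW TK by (rule Q)

lemma T_cvs: "cvs T"
  unfolding tensor_over_def by (rule Q.quot_cvs)

sublocale T: cvs T by (rule T_cvs)

lemma pt_closed [simp]: "v \<in> carrier V \<Longrightarrow> w \<in> carrier W \<Longrightarrow> pt v w \<in> carrier T"
  unfolding tensor_over_def ptensor_over_def by (rule Q.quot_I) simp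

lemma pt_rel:
  assumes "p \<in> carrier FVW" "q \<in> carrier FVW" "p \<ominus>\<^bsub>FVW\<^esub> q \<in> tensor_rels V W S rho sig"
  shows "TK +>\<^bsub>FVW\<^esub> p = TK +>\<^bsub>FVW\<^esub> q"
proof -
  have "p \<ominus>\<^bsub>FVW\<^esub> q \<in> TK"
    unfolding tensor_ker_def by (rule F.span_base[OF rels_carrier assms(3)])
  then show ?thesis
    using assms(1,2) Q.quot_eq_iff by blast
qed

lemma pt_relation:
  assumes "(v, w) \<in> carrier V \<times> carrier W" "(v', w') \<in> carrier V \<times> carrier W"
  shows "(v'', w'') \<in> carrier V \<times> carrier W \<Longrightarrow>
      (\<lambda>z. delta (v, w) z - delta (v', w') z - delta (v'', w'') z) \<in> tensor_rels V W S rho sig \<Longrightarrow>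
      pt v w = pt v' w' \<oplus>\<^bsub>T\<^esub> pt v'' w''"
    and "(\<lambda>z. delta (v, w) z - c * delta (v', w') z) \<in> tensor_rels V W S rho sig \<Longrightarrow>
      pt v w = c \<odot>\<^bsub>T\<^esub> pt v' w'"
    and "(\<lambda>z. delta (v, w) z - delta (v', w') z) \<in> tensor_rels V W S rho sig \<Longrightarrow> pt v w = pt v' w'"
proof -
  note [simp] = assms[THEN delta_carrier]
  { assume *: "(v'', w'') \<in> carrier V \<times> carrier W"
      "(\<lambda>z. delta (v, w) z - delta (v', w') z - delta (v'', w'') z) \<in> tensor_rels V W S rho sig"
    note [simp] = *(1)[THEN delta_carrier]
    show "pt v w = pt v' w' \<oplus>\<^bsub>T\<^esub> pt v'' w''"
      unfolding tensor_over_def ptensor_over_def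
      by (subst Q.quot_add, simp, simp, rule pt_rel)
        (use *(2) in \<open>simp_all only: delta_relations(1)[OF assms *(1)], simp_all\<close>) }
  { assume *: "(\<lambda>z. delta (v, w) z - c * delta (v', w') z) \<in> tensor_rels V W S rho sig"
    show "pt v w = c \<odot>\<^bsub>T\<^esub> pt v' w'"
      unfolding tensor_over_def ptensor_over_def
      by (subst Q.quot_smult, simp, rule pt_rel)
        (use * in \<open>simp_all only: delta_relations(2)[OF assms], simp_all\<close>) }
  { assume *: "(\<lambda>z. delta (v, w) z - delta (v', w') z) \<in> tensor_rels V W S rho sig"
    show "pt v w = pt v' w'"
      unfolding ptensor_over_def
      by (rule pt_rel) (use * in \<open>simp_all only: delta_relations(3)[OF assms], simp_all\<close>) }
qed

lemma pt_add_l: "v \<in> carrier V \<Longrightarrow> v' \<in> carrier V \<Longrightarrow> w \<in> carrier W \<Longrightarrow>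
    pt (v \<oplus>\<^bsub>V\<^esub> v') w = pt v w \<oplus>\<^bsub>T\<^esub> pt v' w"
  by (rule pt_relation(1); ((simp; fail) | (unfold tensor_rels_def Un_iff mem_Collect_eq; metis)))

lemma pt_add_r: "v \<in> carrier V \<Longrightarrow> w \<in> carrier W \<Longrightarrow> w' \<in> carrier W \<Longrightarrow>
    pt v (w \<oplus>\<^bsub>W\<^esub> w') = pt v w \<oplus>\<^bsub>T\<^esub> pt v w'"
  by (rule pt_relation(1); ((simp; fail) | (unfold tensor_rels_def Un_iff mem_Collect_eq; metis)))

lemma pt_smult_l: "v \<in> carrier V \<Longrightarrow> w \<in> carrier W \<Longrightarrow> pt (c \<odot>\<^bsub>V\<^esub> v) w = c \<odot>\<^bsub>T\<^esub> pt v w"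
  by (rule pt_relation(2); ((simp; fail) | (unfold tensor_rels_def Un_iff mem_Collect_eq; metis)))

lemma pt_smult_r: "v \<in> carrier V \<Longrightarrow> w \<in> carrier W \<Longrightarrow> pt v (c \<odot>\<^bsub>W\<^esub> w) = c \<odot>\<^bsub>T\<^esub> pt v w"
  by (rule pt_relation(2); ((simp; fail) | (unfold tensor_rels_def Un_iff mem_Collect_eq; metis)))

lemma pt_bal: "v \<in> carrier V \<Longrightarrow> w \<in> carrier W \<Longrightarrow> s \<in> S \<Longrightarrow> pt (rho v s) w = pt v (sig s w)"
  by (rule pt_relation(3); ((simp add: rho_closed sig_closed; fail) | (unfold tensor_rels_def Un_iff mem_Collect_eq; metis)))

lemma pt_lin_l: "w \<in> carrier W \<Longrightarrow> lin V T (\<lambda>v. pt v w)"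
  by (rule linI) (auto simp: pt_add_l pt_smult_l)

lemma pt_lin_r: "v \<in> carrier V \<Longrightarrow> lin W T (\<lambda>w. pt v w)"
  by (rule linI) (auto simp: pt_add_r pt_smult_r)

lemma T_induct:
  assumes N: "subsp T N" and pt: "\<And>v w. v \<in> carrier V \<Longrightarrow> w \<in> carrier W \<Longrightarrow> pt v w \<in> N"
    and P: "P \<in> carrier T"
  shows "P \<in> N"
proof -
  obtain p where p: "p \<in> carrier FVW" "P = TK +>\<^bsub>FVW\<^esub> p"
    using P by (auto simp: tensor_over_def Q.quot_carrier)
  have "subsp FVW {x \<in> carrier FVW. TK +>\<^bsub>FVW\<^esub> x \<in> N}"
    by (rule lin_vimage_subsp[OF _ _ T_cvs N]) (auto simp: tensor_over_def Q.quot_lin free_mod_cvs)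
  from free_mod_induct[OF this _ p(1)] pt show ?thesis
    by (auto simp: p(2) ptensor_over_def)
qed

lemma tensor_eqI:
  assumes "lin T U f" "lin T U g" "cvs U"
    and "\<And>v w. v \<in> carrier V \<Longrightarrow> w \<in> carrier W \<Longrightarrow> f (pt v w) = g (pt v w)"
    and "P \<in> carrier T"
  shows "f P = g P"
  using T_induct[OF lin_eq_subsp[OF assms(1,2) T_cvs assms(3)] _ assms(5)] assms(4) by auto

text \<open>Bilinearity and balancing of \<open>\<phi>\<close> say that
  \<open>free_ext U \<phi>\<close> kills every relation, hence \<open>tensor_ker\<close>. Its image
  of a coset is then a singleton, so that the \<open>the_elem\<close> in the definition has the
  expected value.\<close>

lemma tensor_lift:
  assumes "cvs U"
    and "\<And>v w. v \<in> carrier V \<Longrightarrow> w \<in> carrier W \<Longrightarrow> \<phi> (v, w) \<in> carrier U"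
    and "\<And>v v' w. v \<in> carrier V \<Longrightarrow> v' \<in> carrier V \<Longrightarrow> w \<in> carrier W \<Longrightarrow>
      \<phi> (v \<oplus>\<^bsub>V\<^esub> v', w) = \<phi> (v, w) \<oplus>\<^bsub>U\<^esub> \<phi> (v', w)"
    and "\<And>v w w'. v \<in> carrier V \<Longrightarrow> w \<in> carrier W \<Longrightarrow> w' \<in> carrier W \<Longrightarrow>
      \<phi> (v, w \<oplus>\<^bsub>W\<^esub> w') = \<phi> (v, w) \<oplus>\<^bsub>U\<^esub> \<phi> (v, w')"
    and "\<And>c v w. v \<in> carrier V \<Longrightarrow> w \<in> carrier W \<Longrightarrow> \<phi> (c \<odot>\<^bsub>V\<^esub> v, w) = c \<odot>\<^bsub>U\<^esub> \<phi> (v, w)"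
    and "\<And>c v w. v \<in> carrier V \<Longrightarrow> w \<in> carrier W \<Longrightarrow> \<phi> (v, c \<odot>\<^bsub>W\<^esub> w) = c \<odot>\<^bsub>U\<^esub> \<phi> (v, w)"
    and "\<And>v s w. v \<in> carrier V \<Longrightarrow> w \<in> carrier W \<Longrightarrow> s \<in> S \<Longrightarrow> \<phi> (rho v s, w) = \<phi> (v, sig s w)"
  shows "lin T U (tensor_lift U \<phi>)"
    and "v \<in> carrier V \<Longrightarrow> w \<in> carrier W \<Longrightarrow> tensor_lift U \<phi> (pt v w) = \<phi> (v, w)"
proof -
  interpret U: cvs U by fact
  let ?e = "free_ext U \<phi>"
  have lin: "lin FVW U ?e" by (rule U.free_ext_lin) (use assms in auto)
  note e = linD[OF lin] lin_minus[OF lin free_mod_cvs U.cvs_axioms]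
  have e_delta: "?e (delta (v, w)) = \<phi> (v, w)" if "v \<in> carrier V" "w \<in> carrier W" for v w
    by (rule U.free_ext_delta) (use that assms in auto)
  have "subsp FVW {p \<in> carrier FVW. ?e p \<in> {\<zero>\<^bsub>U\<^esub>}}"
    by (rule lin_vimage_subsp[OF lin free_mod_cvs U.cvs_axioms U.subsp_zero])
  moreover have "tensor_rels V W S rho sig \<subseteq> {p \<in> carrier FVW. ?e p \<in> {\<zero>\<^bsub>U\<^esub>}}"
    by (rule rels_subset) (simp_all add: e e_delta assms rho_closed sig_closed)
  ultimately have "TK \<subseteq> {p \<in> carrier FVW. ?e p \<in> {\<zero>\<^bsub>U\<^esub>}}"
    unfolding tensor_ker_def by (intro F.span_least)
  then have ker: "?e p = \<zero>\<^bsub>U\<^esub>" if "p \<in> TK" for p using that by auto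
  have lift: "tensor_lift U \<phi> (TK +>\<^bsub>FVW\<^esub> p) = ?e p" if p: "p \<in> carrier FVW" for p
  proof -
    have eq: "?e q = ?e p" if "q \<in> TK +>\<^bsub>FVW\<^esub> p" for q
    proof -
      have q: "q \<in> carrier FVW" "q \<ominus>\<^bsub>FVW\<^esub> p \<in> TK"
        using that p Q.rep_carrier Q.rep_minus by auto
      then show ?thesis using ker[OF q(2)] p U.minus_eq_zero_iff[of "?e q" "?e p"] by (simp add: e)
    qed
    have "?e ` (TK +>\<^bsub>FVW\<^esub> p) = {?e p}"
    proof (rule equalityI[OF image_subsetI])
      show "?e q \<in> {?e p}" if "q \<in> TK +>\<^bsub>FVW\<^esub> p" for q
        unfolding eq[OF that] by (rule singletonI)
      show "{?e p} \<subseteq> ?e ` (TK +>\<^bsub>FVW\<^esub> p)"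
        using Q.rep_self[OF p] by blast
    qed
    then show ?thesis by (simp add: tensor_lift_def free_ext_def)
  qed
  show "lin T U (tensor_lift U \<phi>)"
    by (rule linI)
      (auto simp: tensor_over_def Q.quot_carrier Q.quot_add Q.quot_smult lift e)
  show "tensor_lift U \<phi> (pt v w) = \<phi> (v, w)" if "v \<in> carrier V" "w \<in> carrier W"
    using that by (simp add: ptensor_over_def lift e_delta)
qed

end

subsection \<open>Free algebras and enveloping algebras\<close>

lemma lin_eq_free:
  assumes "lin (free_mod S) W f" "lin (free_mod S) W g" "cvs W"
    and "\<And>s. s \<in> S \<Longrightarrow> f (delta s) = g (delta s)" and "p \<in> carrier (free_mod S)"
  shows "f p = g p"
  using free_mod_induct[OF lin_eq_subsp[OF assms(1,2) free_mod_cvs assms(3)] _ assms(5)] assms(4) by auto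

lemma free_alg_simps:
  "carrier (free_alg X) = carrier (free_mod (lists X))" "\<zero>\<^bsub>free_alg X\<^esub> = \<zero>\<^bsub>free_mod (lists X)\<^esub>"
  "add (free_alg X) = add (free_mod (lists X))" "smult (free_alg X) = smult (free_mod (lists X))"
  "\<one>\<^bsub>free_alg X\<^esub> = delta []"
  "p \<otimes>\<^bsub>free_alg X\<^esub> q = (\<lambda>w. \<Sum>i\<le>length w. p (take i w) * q (drop i w))"
  by (simp_all add: free_alg_def)

lemma free_alg_minus: "p \<ominus>\<^bsub>free_alg X\<^esub> q = p \<ominus>\<^bsub>free_mod (lists X)\<^esub> q"
  by (simp add: a_minus_def a_inv_def free_alg_simps)

lemma free_alg_cvs: "cvs (free_alg X)"
  by (rule cvsI) (simp_all add: free_alg_simps(1-4) F.a_ac F.s_ladd F.s_radd F.s_mult)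

lemma lin_free_alg: "lin (free_alg X) W f \<longleftrightarrow> lin (free_mod (lists X)) W f"
  "lin V (free_alg X) g \<longleftrightarrow> lin V (free_mod (lists X)) g"
  by (simp_all add: LinearCombinations.module_hom_def free_alg_simps(1-4))

lemma subsp_free_alg: "subsp (free_alg X) N \<longleftrightarrow> subsp (free_mod (lists X)) N"
proof
  assume "subsp (free_alg X) N"
  from subspD[OF this] show "subsp (free_mod (lists X)) N"
    by (intro F.subsp_I) (auto simp: free_alg_simps(1-4))
next
  assume "subsp (free_mod (lists X)) N"
  from subspD[OF this] show "subsp (free_alg X) N"
    by (intro cvs.subsp_I[OF free_alg_cvs]) (auto simp: free_alg_simps(1-4))
qed

text \<open>Among all cuts of a word only the one at \<open>length u\<close> can produce the pair
  \<open>u\<close>, \<open>v\<close>.\<close>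

lemma delta_mult: "delta u \<otimes>\<^bsub>free_alg X\<^esub> delta v = delta (u @ v)"
proof
  fix w
  have "delta u (take i w) * delta v (drop i w) = (if i = length u then delta (u @ v) w else 0)"
    if "i \<le> length w" for i
  proof -
    have "take i w = u \<and> drop i w = v \<longleftrightarrow> i = length u \<and> w = u @ v"
      using that by (auto simp: min_absorb2)
    moreover have "delta u (take i w) * delta v (drop i w) =
        (if take i w = u \<and> drop i w = v then 1 else 0)"
      by (simp add: delta_def)
    ultimately show ?thesis by (simp add: delta_def)
  qed
  then have "(\<delta> \<otimes>\<^bsub>free_alg X\<^esub> delta v) w = (\<Sum>i\<le>length w. if i = length u then delta (u @ v) w else 0)"
    if "\<delta> = delta u" for \<delta>
    using that by (simp add: free_alg_simps)
  then show "(delta u \<otimes>\<^bsub>free_alg X\<^esub> delta v) w = delta (u @ v) w"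
    by (auto simp: sum.delta delta_def)
qed

text \<open>The support of a product lies in the finite set of concatenations of words from the two
  supports.\<close>

lemma free_alg_mult_closed:
  assumes p: "p \<in> carrier (free_alg X)" and q: "q \<in> carrier (free_alg X)"
  shows "p \<otimes>\<^bsub>free_alg X\<^esub> q \<in> carrier (free_alg X)"
proof -
  let ?P = "{w. p w \<noteq> 0}" and ?Q = "{w. q w \<noteq> 0}"
  have fin: "finite ?P" "finite ?Q" "?P \<subseteq> lists X" "?Q \<subseteq> lists X"
    using p q by (auto simp: free_alg_simps free_mod_carrier)
  have sub: "{w. (p \<otimes>\<^bsub>free_alg X\<^esub> q) w \<noteq> 0} \<subseteq> (\<lambda>(u, v). u @ v) ` (?P \<times> ?Q)"
  proof
    fix w assume "w \<in> {w. (p \<otimes>\<^bsub>free_alg X\<^esub> q) w \<noteq> 0}"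
    then obtain i where "p (take i w) * q (drop i w) \<noteq> 0"
      by (auto simp: free_alg_simps elim!: sum.not_neutral_contains_not_neutral)
    then show "w \<in> (\<lambda>(u, v). u @ v) ` (?P \<times> ?Q)"
      by (intro image_eqI[of _ _ "(take i w, drop i w)"]) auto
  qed
  have "(\<lambda>(u, v). u @ v) ` (?P \<times> ?Q) \<subseteq> lists X"
  proof
    fix w assume "w \<in> (\<lambda>(u, v). u @ v) ` (?P \<times> ?Q)"
    then obtain u v where w: "w = u @ v" and uv: "u \<in> ?P" "v \<in> ?Q" by auto
    show "w \<in> lists X"
      unfolding w using subsetD[OF fin(3) uv(1)] subsetD[OF fin(4) uv(2)] by simp
  qed
  with sub finite_subset[OF sub] fin(1,2) show ?thesis
    unfolding free_alg_simps(1) free_mod_carrier by blast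
qed

lemma free_alg_lin_l:
  assumes "q \<in> carrier (free_alg X)"
  shows "lin (free_alg X) (free_alg X) (\<lambda>p. p \<otimes>\<^bsub>free_alg X\<^esub> q)"
proof (rule linI)
  show "p \<otimes>\<^bsub>free_alg X\<^esub> q \<in> carrier (free_alg X)" if "p \<in> carrier (free_alg X)" for p
    using that assms by (rule free_alg_mult_closed)
qed (simp_all add: free_alg_simps free_mod_simps distrib_right sum.distrib sum_distrib_left mult.assoc)

lemma free_alg_lin_r:
  assumes "p \<in> carrier (free_alg X)"
  shows "lin (free_alg X) (free_alg X) (\<lambda>q. p \<otimes>\<^bsub>free_alg X\<^esub> q)"
proof (rule linI)
  show "p \<otimes>\<^bsub>free_alg X\<^esub> q \<in> carrier (free_alg X)" if "q \<in> carrier (free_alg X)" for q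
    using assms that by (rule free_alg_mult_closed)
qed (simp_all add: free_alg_simps free_mod_simps distrib_left sum.distrib sum_distrib_left mult.left_commute)

lemma free_alg_eqI:
  assumes "lin (free_alg X) W f" "lin (free_alg X) W g" "cvs W"
    and "\<And>w. w \<in> lists X \<Longrightarrow> f (delta w) = g (delta w)" and "p \<in> carrier (free_alg X)"
  shows "f p = g p"
  by (rule lin_eq_free[OF assms(1,2)[unfolded lin_free_alg] assms(3,4) assms(5)[unfolded free_alg_simps(1)]])

text \<open>Both sides are linear in each factor, so \<open>r\<close>, \<open>q\<close> and
  \<open>p\<close> are replaced by words in turn; for words it is associativity of
  concatenation.\<close>

lemma free_alg_assoc:
  assumes "p \<in> carrier (free_alg X)" "q \<in> carrier (free_alg X)" "r \<in> carrier (free_alg X)"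
  shows "(p \<otimes>\<^bsub>free_alg X\<^esub> q) \<otimes>\<^bsub>free_alg X\<^esub> r = p \<otimes>\<^bsub>free_alg X\<^esub> (q \<otimes>\<^bsub>free_alg X\<^esub> r)"
proof -
  have d: "delta w \<in> carrier (free_alg X)" if "w \<in> lists X" for w
    using that by (simp add: free_alg_simps)
  have 1: "(delta u \<otimes>\<^bsub>free_alg X\<^esub> delta v) \<otimes>\<^bsub>free_alg X\<^esub> r = delta u \<otimes>\<^bsub>free_alg X\<^esub> (delta v \<otimes>\<^bsub>free_alg X\<^esub> r)"
    if u: "u \<in> lists X" and v: "v \<in> lists X" for u v
    by (rule free_alg_eqI[OF free_alg_lin_r[OF free_alg_mult_closed[OF d[OF u] d[OF v]]]
          lin_comp[OF free_alg_lin_r[OF d[OF v]] free_alg_lin_r[OF d[OF u]]] free_alg_cvs _ assms(3)])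
      (simp add: delta_mult)
  have 2: "(delta u \<otimes>\<^bsub>free_alg X\<^esub> q) \<otimes>\<^bsub>free_alg X\<^esub> r = delta u \<otimes>\<^bsub>free_alg X\<^esub> (q \<otimes>\<^bsub>free_alg X\<^esub> r)"
    if u: "u \<in> lists X" for u
    by (rule free_alg_eqI[OF lin_comp[OF free_alg_lin_r[OF d[OF u]] free_alg_lin_l[OF assms(3)]]
          lin_comp[OF free_alg_lin_l[OF assms(3)] free_alg_lin_r[OF d[OF u]]] free_alg_cvs 1[OF u] assms(2)])
  show ?thesis
    by (rule free_alg_eqI[OF lin_comp[OF free_alg_lin_l[OF assms(2)] free_alg_lin_l[OF assms(3)]]
          free_alg_lin_l[OF free_alg_mult_closed[OF assms(2,3)]] free_alg_cvs 2 assms(1)])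
qed

lemma free_alg_one:
  assumes "p \<in> carrier (free_alg X)"
  shows "delta [] \<otimes>\<^bsub>free_alg X\<^esub> p = p" "p \<otimes>\<^bsub>free_alg X\<^esub> delta [] = p"
proof -
  have id: "lin (free_alg X) (free_alg X) (\<lambda>p. p)" by (rule linI) auto
  have d: "delta [] \<in> carrier (free_alg X)" by (simp add: free_alg_simps)
  show "delta [] \<otimes>\<^bsub>free_alg X\<^esub> p = p"
    using free_alg_eqI[OF free_alg_lin_r[OF d] id free_alg_cvs _ assms] by (simp add: delta_mult)
  show "p \<otimes>\<^bsub>free_alg X\<^esub> delta [] = p"
    using free_alg_eqI[OF free_alg_lin_l[OF d] id free_alg_cvs _ assms] by (simp add: delta_mult)
qed

lemma free_alg_ring: "ring (free_alg X)"
proof (rule ringI)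
  show "abelian_group (free_alg X)" by (rule cvs.abelian[OF free_alg_cvs])
  show "Group.monoid (free_alg X)"
    by (rule monoidI, simp_all only: free_alg_mult_closed free_alg_assoc free_alg_one free_alg_simps(5))
      (simp add: free_alg_simps(1))
qed (auto simp: linD(2)[OF free_alg_lin_l] linD(2)[OF free_alg_lin_r])

section \<open>Representations of a Lie algebra and the action of words\<close>

locale lie_rep = cvs V for L :: "'x lie_alg" and V :: "('x, 'v) lie_mod" (structure) +
  assumes act_closed [simp]: "x \<in> carrier L \<Longrightarrow> v \<in> carrier V \<Longrightarrow> act V x v \<in> carrier V"
    and act_add_r: "x \<in> carrier L \<Longrightarrow> v \<in> carrier V \<Longrightarrow> w \<in> carrier V \<Longrightarrow>
      act V x (v \<oplus> w) = act V x v \<oplus> act V x w"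
    and act_smult_r: "x \<in> carrier L \<Longrightarrow> v \<in> carrier V \<Longrightarrow> act V x (c \<odot>\<^bsub>V\<^esub> v) = c \<odot>\<^bsub>V\<^esub> act V x v"
    and act_add_l: "x \<in> carrier L \<Longrightarrow> y \<in> carrier L \<Longrightarrow> v \<in> carrier V \<Longrightarrow>
      act V (x \<oplus>\<^bsub>L\<^esub> y) v = act V x v \<oplus> act V y v"
    and act_smult_l: "x \<in> carrier L \<Longrightarrow> v \<in> carrier V \<Longrightarrow> act V (c \<odot>\<^bsub>L\<^esub> x) v = c \<odot>\<^bsub>V\<^esub> act V x v"
    and act_bracket: "x \<in> carrier L \<Longrightarrow> y \<in> carrier L \<Longrightarrow> v \<in> carrier V \<Longrightarrow>
      act V x (act V y v) = act V (bracket L x y) v \<oplus> act V y (act V x v)"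
begin

lemma act_lin: "x \<in> carrier L \<Longrightarrow> lin V V (act V x)"
  by (rule linI) (auto simp: act_add_r act_smult_r)

lemma act_lin_l: "v \<in> carrier V \<Longrightarrow> lin L V (\<lambda>x. act V x v)"
  by (rule linI) (auto simp: act_add_l act_smult_l)

lemma foldr_closed: "w \<in> lists (carrier L) \<Longrightarrow> v \<in> carrier V \<Longrightarrow> foldr (act V) w v \<in> carrier V"
  by (induction w) auto

lemma foldr_lin: "w \<in> lists (carrier L) \<Longrightarrow> lin V V (foldr (act V) w)"
  by (rule linI) (induction w; auto simp: act_add_r act_smult_r foldr_closed)+

definition word_act :: "('x list \<Rightarrow> complex) \<Rightarrow> 'v \<Rightarrow> 'v" where
  "word_act p v = free_ext V (\<lambda>w. foldr (act V) w v) p"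

lemma word_act_lin: "v \<in> carrier V \<Longrightarrow> lin (free_alg (carrier L)) V (\<lambda>p. word_act p v)"
  unfolding lin_free_alg word_act_def by (rule free_ext_lin) (auto intro: foldr_closed)

lemma word_act_delta: "w \<in> lists (carrier L) \<Longrightarrow> v \<in> carrier V \<Longrightarrow> word_act (delta w) v = foldr (act V) w v"
  unfolding word_act_def by (rule free_ext_delta) (rule foldr_closed)

text \<open>For words this is \<open>foldr\<close> over a concatenation. Linearity extends it first
  in \<open>q\<close>, then in \<open>p\<close>.\<close>

lemma word_act_mult:
  assumes p: "p \<in> carrier (free_alg (carrier L))" and q: "q \<in> carrier (free_alg (carrier L))"
    and v: "v \<in> carrier V"
  shows "word_act (p \<otimes>\<^bsub>free_alg (carrier L)\<^esub> q) v = word_act p (word_act q v)"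
proof -
  have d: "delta w \<in> carrier (free_alg (carrier L))" if "w \<in> lists (carrier L)" for w
    using that by (simp add: free_alg_simps)
  have 1: "word_act (delta u \<otimes>\<^bsub>free_alg (carrier L)\<^esub> q) v = word_act (delta u) (word_act q v)"
    if u: "u \<in> lists (carrier L)" for u
  proof -
    have "word_act (delta u \<otimes>\<^bsub>free_alg (carrier L)\<^esub> q) v = foldr (act V) u (word_act q v)"
    proof (rule free_alg_eqI[OF lin_comp[OF free_alg_lin_r[OF d[OF u]] word_act_lin[OF v]]
          lin_comp[OF word_act_lin[OF v] foldr_lin[OF u]] cvs_axioms _ q])
      fix w assume "w \<in> lists (carrier L)"
      then show "word_act (delta u \<otimes>\<^bsub>free_alg (carrier L)\<^esub> delta w) v = foldr (act V) u (word_act (delta w) v)"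
        using u v by (simp add: delta_mult word_act_delta)
    qed
    then show ?thesis
      using u linD(1)[OF word_act_lin[OF v] q] by (simp add: word_act_delta)
  qed
  show ?thesis
    by (rule free_alg_eqI[OF lin_comp[OF free_alg_lin_l[OF q] word_act_lin[OF v]]
          word_act_lin[OF linD(1)[OF word_act_lin[OF v] q]] cvs_axioms 1 p])
qed

end

section \<open>The enveloping algebra and its universal property\<close>

locale bracket_space = cvs L for L :: "'x lie_alg" (structure) +
  assumes br_closed: "x \<in> carrier L \<Longrightarrow> y \<in> carrier L \<Longrightarrow> bracket L x y \<in> carrier L"
begin

abbreviation "FA \<equiv> free_alg (carrier L)"
abbreviation "U \<equiv> uea L"

definition uea_rels :: "('x list \<Rightarrow> complex) set" where
  "uea_rels = {delta [x \<oplus> y] \<ominus>\<^bsub>FA\<^esub> (delta [x] \<oplus>\<^bsub>FA\<^esub> delta [y]) | x y. x \<in> carrier L \<and> y \<in> carrier L} \<union>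
      {delta [c \<odot>\<^bsub>L\<^esub> x] \<ominus>\<^bsub>FA\<^esub> c \<odot>\<^bsub>FA\<^esub> delta [x] | c x. x \<in> carrier L} \<union>
      {delta [x, y] \<ominus>\<^bsub>FA\<^esub> (delta [y, x] \<oplus>\<^bsub>FA\<^esub> delta [bracket L x y]) | x y. x \<in> carrier L \<and> y \<in> carrier L}"

lemma uea_ideal_eq: "uea_ideal L = genideal FA uea_rels"
proof -
  note d = delta_relations[where S = "lists (carrier L)", folded free_alg_minus[where X = "carrier L"],
      folded free_alg_simps(3,4)[where X = "carrier L"]]
  have "{\<lambda>w. delta [x \<oplus> y] w - delta [x] w - delta [y] w | x y. x \<in> carrier L \<and> y \<in> carrier L} =
    {delta [x \<oplus> y] \<ominus>\<^bsub>FA\<^esub> (delta [x] \<oplus>\<^bsub>FA\<^esub> delta [y]) | x y. x \<in> carrier L \<and> y \<in> carrier L}"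
    by (intro Collect_cong ex_cong1) (auto simp: d)
  moreover have "{\<lambda>w. delta [c \<odot>\<^bsub>L\<^esub> x] w - c * delta [x] w | c x. x \<in> carrier L} =
    {delta [c \<odot>\<^bsub>L\<^esub> x] \<ominus>\<^bsub>FA\<^esub> c \<odot>\<^bsub>FA\<^esub> delta [x] | c x. x \<in> carrier L}"
    by (intro Collect_cong ex_cong1) (auto simp: d)
  moreover have "{\<lambda>w. delta [x, y] w - delta [y, x] w - delta [bracket L x y] w | x y.
         x \<in> carrier L \<and> y \<in> carrier L} =
    {delta [x, y] \<ominus>\<^bsub>FA\<^esub> (delta [y, x] \<oplus>\<^bsub>FA\<^esub> delta [bracket L x y]) | x y. x \<in> carrier L \<and> y \<in> carrier L}"
    by (intro Collect_cong ex_cong1) (auto simp: d br_closed)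
  ultimately show ?thesis
    unfolding uea_ideal_def uea_rels_def by simp
qed

lemma FA_delta [simp]: "w \<in> lists (carrier L) \<Longrightarrow> delta w \<in> carrier FA"
  by (simp add: free_alg_simps)

sublocale FA: cvs FA by (rule free_alg_cvs)

lemma uea_rels_carrier: "uea_rels \<subseteq> carrier FA"
  unfolding uea_rels_def by (auto simp: br_closed)

lemma uea_ideal: "ideal (uea_ideal L) FA"
  unfolding uea_ideal_eq by (rule ring.genideal_ideal[OF free_alg_ring uea_rels_carrier])

text \<open>A ring ideal is stable under scalars because \<open>c\<close> times \<open>p\<close> is
  the ring product of \<open>c\<close> times the unit with \<open>p\<close>.\<close>

lemma FA_ideal_subsp:
  assumes "ideal N FA" shows "subsp FA N"
proof (rule FA.subsp_I)
  interpret ideal N FA by fact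
  show "N \<subseteq> carrier FA" "\<zero>\<^bsub>FA\<^esub> \<in> N" "\<And>x y. x \<in> N \<Longrightarrow> y \<in> N \<Longrightarrow> x \<oplus>\<^bsub>FA\<^esub> y \<in> N"
    using a_subset by auto
  fix c p assume p: "p \<in> N"
  have d: "delta [] \<in> carrier FA" by simp
  have "(c \<odot>\<^bsub>FA\<^esub> delta []) \<otimes>\<^bsub>FA\<^esub> p = c \<odot>\<^bsub>FA\<^esub> p"
    using linD(3)[OF free_alg_lin_l d, of p c] a_subset p free_alg_one(1)[of p "carrier L"] by auto
  then show "c \<odot>\<^bsub>FA\<^esub> p \<in> N"
    using I_l_closed[OF p, of "c \<odot>\<^bsub>FA\<^esub> delta []"] d by simp
qed

lemma UQ: "quot_space FA (uea_ideal L)"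
  unfolding quot_space_def quot_space_axioms_def
  using FA_ideal_subsp[OF uea_ideal] free_alg_cvs by blast

sublocale UQ: quot_space FA "uea_ideal L" by (rule UQ)

abbreviation "cls p \<equiv> uea_ideal L +>\<^bsub>FA\<^esub> p"

lemma U_cvs: "cvs U"
  unfolding uea_def by (rule UQ.quot_cvs)

sublocale U: cvs U by (rule U_cvs)

lemma cls_closed [simp]: "p \<in> carrier FA \<Longrightarrow> cls p \<in> carrier U"
  unfolding uea_def by (rule UQ.quot_I)

lemma cls_lin: "lin FA U cls"
  unfolding uea_def by (rule UQ.quot_lin)

lemma U_cases:
  assumes "u \<in> carrier U" obtains p where "p \<in> carrier FA" "u = cls p"
  using assms unfolding uea_def UQ.quot_carrier by blast

lemma cls_mult: "p \<in> carrier FA \<Longrightarrow> q \<in> carrier FA \<Longrightarrow> cls p \<otimes>\<^bsub>U\<^esub> cls q = cls (p \<otimes>\<^bsub>FA\<^esub> q)"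
  unfolding uea_def quot_mod_def using ideal.rcoset_mult_add[OF uea_ideal, of p q]
  by (simp add: ring.defs module.defs FactRing_def)

lemma U_one: "\<one>\<^bsub>U\<^esub> = cls (delta [])"
  unfolding uea_def quot_mod_def by (simp add: ring.defs module.defs FactRing_def free_alg_simps(5))

lemma U_one_closed [simp]: "\<one>\<^bsub>U\<^esub> \<in> carrier U"
  by (simp add: U_one)

lemma U_mult_closed [simp]: "u \<in> carrier U \<Longrightarrow> w \<in> carrier U \<Longrightarrow> u \<otimes>\<^bsub>U\<^esub> w \<in> carrier U"
  by (elim U_cases) (simp add: cls_mult free_alg_mult_closed)

lemma U_assoc: "u \<in> carrier U \<Longrightarrow> w \<in> carrier U \<Longrightarrow> z \<in> carrier U \<Longrightarrow>
    (u \<otimes>\<^bsub>U\<^esub> w) \<otimes>\<^bsub>U\<^esub> z = u \<otimes>\<^bsub>U\<^esub> (w \<otimes>\<^bsub>U\<^esub> z)"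
  by (elim U_cases) (simp add: cls_mult free_alg_mult_closed free_alg_assoc)

lemma U_l_one: "u \<in> carrier U \<Longrightarrow> \<one>\<^bsub>U\<^esub> \<otimes>\<^bsub>U\<^esub> u = u"
  and U_r_one: "u \<in> carrier U \<Longrightarrow> u \<otimes>\<^bsub>U\<^esub> \<one>\<^bsub>U\<^esub> = u"
  by (elim U_cases; simp add: cls_mult free_alg_one U_one)+

lemma U_lin_l: "w \<in> carrier U \<Longrightarrow> lin U U (\<lambda>u. u \<otimes>\<^bsub>U\<^esub> w)"
proof (rule linI)
  fix u u' assume w: "w \<in> carrier U" and "u \<in> carrier U" "u' \<in> carrier U"
  then obtain p q r where *: "p \<in> carrier FA" "q \<in> carrier FA" "r \<in> carrier FA"
    "u = cls p" "u' = cls q" "w = cls r" by (metis U_cases)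
  then show "(u \<oplus>\<^bsub>U\<^esub> u') \<otimes>\<^bsub>U\<^esub> w = u \<otimes>\<^bsub>U\<^esub> w \<oplus>\<^bsub>U\<^esub> u' \<otimes>\<^bsub>U\<^esub> w"
    by (simp add: cls_mult free_alg_mult_closed linD(2)[OF cls_lin, symmetric] linD(2)[OF free_alg_lin_l])
next
  fix c u assume w: "w \<in> carrier U" and "u \<in> carrier U"
  then obtain p r where "p \<in> carrier FA" "r \<in> carrier FA" "u = cls p" "w = cls r" by (metis U_cases)
  then show "(c \<odot>\<^bsub>U\<^esub> u) \<otimes>\<^bsub>U\<^esub> w = c \<odot>\<^bsub>U\<^esub> (u \<otimes>\<^bsub>U\<^esub> w)"
    by (simp add: cls_mult free_alg_mult_closed linD(3)[OF cls_lin, symmetric] linD(3)[OF free_alg_lin_l])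
qed auto

lemma U_lin_r: "w \<in> carrier U \<Longrightarrow> lin U U (\<lambda>u. w \<otimes>\<^bsub>U\<^esub> u)"
proof (rule linI)
  fix u u' assume w: "w \<in> carrier U" and "u \<in> carrier U" "u' \<in> carrier U"
  then obtain p q r where *: "p \<in> carrier FA" "q \<in> carrier FA" "r \<in> carrier FA"
    "u = cls p" "u' = cls q" "w = cls r" by (metis U_cases)
  then show "w \<otimes>\<^bsub>U\<^esub> (u \<oplus>\<^bsub>U\<^esub> u') = w \<otimes>\<^bsub>U\<^esub> u \<oplus>\<^bsub>U\<^esub> w \<otimes>\<^bsub>U\<^esub> u'"
    by (simp add: cls_mult free_alg_mult_closed linD(2)[OF cls_lin, symmetric] linD(2)[OF free_alg_lin_r])
next
  fix c u assume w: "w \<in> carrier U" and "u \<in> carrier U"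
  then obtain p r where "p \<in> carrier FA" "r \<in> carrier FA" "u = cls p" "w = cls r" by (metis U_cases)
  then show "w \<otimes>\<^bsub>U\<^esub> (c \<odot>\<^bsub>U\<^esub> u) = c \<odot>\<^bsub>U\<^esub> (w \<otimes>\<^bsub>U\<^esub> u)"
    by (simp add: cls_mult free_alg_mult_closed linD(3)[OF cls_lin, symmetric] linD(3)[OF free_alg_lin_r])
qed auto

lemma inj_eq: "uea_inj L x = cls (delta [x])"
  by (simp add: uea_inj_def)

lemma inj_closed [simp]: "x \<in> carrier L \<Longrightarrow> uea_inj L x \<in> carrier U"
  by (simp add: inj_eq)

lemma cls_rel:
  assumes "p \<ominus>\<^bsub>FA\<^esub> q \<in> uea_rels" "p \<in> carrier FA" "q \<in> carrier FA"
  shows "cls p = cls q"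
proof -
  have "p \<ominus>\<^bsub>FA\<^esub> q \<in> uea_ideal L"
    using ring.genideal_self[OF free_alg_ring uea_rels_carrier] assms(1) uea_ideal_eq by blast
  then show ?thesis using assms UQ.quot_eq_iff by blast
qed

lemma inj_lin: "lin L U (uea_inj L)"
proof (rule linI)
  fix x y assume xy: "x \<in> carrier L" "y \<in> carrier L"
  have "cls (delta [x \<oplus> y]) = cls (delta [x] \<oplus>\<^bsub>FA\<^esub> delta [y])"
    by (rule cls_rel) (use xy in \<open>auto simp: uea_rels_def\<close>)
  then show "uea_inj L (x \<oplus> y) = uea_inj L x \<oplus>\<^bsub>U\<^esub> uea_inj L y"
    using xy by (simp add: inj_eq linD(2)[OF cls_lin])
next
  fix c x assume x: "x \<in> carrier L"
  have "cls (delta [c \<odot>\<^bsub>L\<^esub> x]) = cls (c \<odot>\<^bsub>FA\<^esub> delta [x])"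
    by (rule cls_rel) (use x in \<open>auto simp: uea_rels_def\<close>)
  then show "uea_inj L (c \<odot>\<^bsub>L\<^esub> x) = c \<odot>\<^bsub>U\<^esub> uea_inj L x"
    using x by (simp add: inj_eq linD(3)[OF cls_lin])
qed simp

lemma inj_bracket:
  assumes x: "x \<in> carrier L" and y: "y \<in> carrier L"
  shows "uea_inj L x \<otimes>\<^bsub>U\<^esub> uea_inj L y = uea_inj L (bracket L x y) \<oplus>\<^bsub>U\<^esub> uea_inj L y \<otimes>\<^bsub>U\<^esub> uea_inj L x"
proof -
  have "cls (delta [x, y]) = cls (delta [y, x] \<oplus>\<^bsub>FA\<^esub> delta [bracket L x y])"
  proof (rule cls_rel)
    show "delta [x, y] \<ominus>\<^bsub>FA\<^esub> (delta [y, x] \<oplus>\<^bsub>FA\<^esub> delta [bracket L x y]) \<in> uea_rels"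
      unfolding uea_rels_def by (rule UnI2, rule CollectI, rule exI[of _ x], rule exI[of _ y]) (simp add: x y)
  qed (use x y in \<open>simp_all add: br_closed\<close>)
  then show ?thesis
    using x y by (simp add: inj_eq cls_mult delta_mult linD(2)[OF cls_lin] br_closed U.a_comm)
qed

text \<open>Words span, and each is built from the unit by left multiplication with elements of
  \<open>L\<close>. Applied to the Verma module, this gives its generation by the highest weight
  vector.\<close>

lemma U_induct:
  assumes N: "subsp U N" and one: "\<one>\<^bsub>U\<^esub> \<in> N"
    and step: "\<And>x u. x \<in> carrier L \<Longrightarrow> u \<in> N \<Longrightarrow> uea_inj L x \<otimes>\<^bsub>U\<^esub> u \<in> N"
    and u: "u \<in> carrier U"
  shows "u \<in> N"
proof -
  obtain p where p: "p \<in> carrier FA" "u = cls p" using u by (rule U_cases)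
  have S: "subsp FA {p \<in> carrier FA. cls p \<in> N}"
    by (rule lin_vimage_subsp[OF cls_lin free_alg_cvs U_cvs N])
  have w: "cls (delta w) \<in> N" if "w \<in> lists (carrier L)" for w
    using that
  proof (induction w)
    case Nil
    then show ?case using one by (simp add: U_one)
  next
    case (Cons x w)
    then have "cls (delta (x # w)) = uea_inj L x \<otimes>\<^bsub>U\<^esub> cls (delta w)"
      by (simp add: inj_eq cls_mult delta_mult)
    with Cons step show ?case by simp
  qed
  have "p \<in> {p \<in> carrier FA. cls p \<in> N}"
    by (rule free_mod_induct[OF S[unfolded subsp_free_alg] _ p(1)[unfolded free_alg_simps(1)]])
      (use w in auto)
  then show ?thesis by (simp add: p)
qed

text \<open>The extension of a representation to the enveloping algebra is stated as an evaluation
  \<open>ev u z\<close>, which avoids forming the algebra of endomorphisms of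
  \<open>Z\<close>.\<close>

lemma uea_universal:
  assumes "lie_rep L Z"
  obtains ev where "\<And>z. z \<in> carrier Z \<Longrightarrow> lin U Z (\<lambda>u. ev u z)"
    "\<And>z. z \<in> carrier Z \<Longrightarrow> ev \<one>\<^bsub>U\<^esub> z = z"
    "\<And>u w z. u \<in> carrier U \<Longrightarrow> w \<in> carrier U \<Longrightarrow> z \<in> carrier Z \<Longrightarrow> ev (u \<otimes>\<^bsub>U\<^esub> w) z = ev u (ev w z)"
    "\<And>x z. x \<in> carrier L \<Longrightarrow> z \<in> carrier Z \<Longrightarrow> ev (uea_inj L x) z = act Z x z"
    "\<And>u c z. u \<in> carrier U \<Longrightarrow> z \<in> carrier Z \<Longrightarrow> ev u (c \<odot>\<^bsub>Z\<^esub> z) = c \<odot>\<^bsub>Z\<^esub> ev u z"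
proof -
  interpret Z: lie_rep L Z by fact
  note wl = Z.word_act_lin
  \<comment> \<open>The annihilator of \<open>Z\<close> in the free algebra. It is a two-sided
    ideal, so it contains \<open>uea_ideal L\<close> as soon as it contains the relations.\<close>
  define N where "N = {p \<in> carrier FA. \<forall>z\<in>carrier Z. Z.word_act p z = \<zero>\<^bsub>Z\<^esub>}"
  \<comment> \<open>For \<open>p\<close> in the annihilator, the product with \<open>q\<close> on
    the left acts as \<open>q\<close> on zero; hence this is what left absorption needs.\<close>
  have w0: "Z.word_act p \<zero>\<^bsub>Z\<^esub> = \<zero>\<^bsub>Z\<^esub>" if "p \<in> carrier FA" for p
  proof (rule free_alg_eqI[OF wl _ Z.cvs_axioms _ that])
    show "lin FA Z (\<lambda>p. \<zero>\<^bsub>Z\<^esub>)" by (rule linI) auto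
    show "Z.word_act (delta w) \<zero>\<^bsub>Z\<^esub> = \<zero>\<^bsub>Z\<^esub>" if "w \<in> lists (carrier L)" for w
      using that lin_zero[OF Z.foldr_lin[OF that] Z.cvs_axioms Z.cvs_axioms] by (simp add: Z.word_act_delta)
  qed simp
  have "ideal N FA"
  proof (rule idealI[OF free_alg_ring])
    have neg: "Z.word_act (\<ominus>\<^bsub>FA\<^esub> p) z = \<zero>\<^bsub>Z\<^esub>" if "p \<in> N" "z \<in> carrier Z" for p z
      using that linD(3)[OF wl, of z p "- 1"] by (simp add: N_def FA.s_uminus[symmetric])
    show "subgroup N (add_monoid FA)"
      using neg linD(2)[OF wl] lin_zero[OF wl free_alg_cvs Z.cvs_axioms]
      by (intro subgroup.intro) (auto simp: N_def a_inv_def[symmetric])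
    show "q \<otimes>\<^bsub>FA\<^esub> p \<in> N" "p \<otimes>\<^bsub>FA\<^esub> q \<in> N" if "p \<in> N" "q \<in> carrier FA" for p q
      using that linD(1)[OF wl] by (auto simp: N_def Z.word_act_mult free_alg_mult_closed w0)
  qed
  moreover have "uea_rels \<subseteq> N"
  proof -
    have m: "Z.word_act (p \<ominus>\<^bsub>FA\<^esub> q) z = Z.word_act p z \<ominus>\<^bsub>Z\<^esub> Z.word_act q z"
      if "p \<in> carrier FA" "q \<in> carrier FA" "z \<in> carrier Z" for p q z
      using lin_minus[OF wl free_alg_cvs Z.cvs_axioms] that by blast
    have br: "act Z x (act Z y z) = act Z y (act Z x z) \<oplus>\<^bsub>Z\<^esub> act Z (bracket L x y) z"
      if "x \<in> carrier L" "y \<in> carrier L" "z \<in> carrier Z" for x y z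
      using that by (subst Z.act_bracket) (simp_all add: Z.a_comm br_closed)
    have "Z.word_act (delta [x, y] \<ominus>\<^bsub>FA\<^esub> (delta [y, x] \<oplus>\<^bsub>FA\<^esub> delta [bracket L x y])) z = \<zero>\<^bsub>Z\<^esub>"
      if "x \<in> carrier L" "y \<in> carrier L" "z \<in> carrier Z" for x y z
      using that br[OF that] by (subst m) (simp_all add: linD(2)[OF wl] Z.word_act_delta br_closed)
    then show ?thesis
      unfolding uea_rels_def N_def
      by (auto simp: m linD(2,3)[OF wl] Z.word_act_delta Z.act_add_l Z.act_smult_l br_closed)
  qed
  ultimately have sub: "uea_ideal L \<subseteq> N"
    unfolding uea_ideal_eq using ring.genideal_minimal[OF free_alg_ring] by blast
  have "\<exists>g. lin U Z g \<and> (\<forall>p\<in>carrier FA. g (cls p) = Z.word_act p z)" if "z \<in> carrier Z" for z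
    unfolding uea_def by (rule UQ.quot_lin_out[OF wl[OF that] Z.cvs_axioms]) (use sub that N_def in auto)
  then obtain ev where ev: "\<And>z. z \<in> carrier Z \<Longrightarrow> lin U Z (ev z)"
    "\<And>z p. z \<in> carrier Z \<Longrightarrow> p \<in> carrier FA \<Longrightarrow> ev z (cls p) = Z.word_act p z"
    by metis
  show ?thesis
  proof (rule that[of "\<lambda>u z. ev z u"])
    show "lin U Z (ev z)" if "z \<in> carrier Z" for z using ev(1)[OF that] .
    show "ev z \<one>\<^bsub>U\<^esub> = z" if "z \<in> carrier Z" for z
      using that by (simp add: U_one ev Z.word_act_delta)
    show "ev z (u \<otimes>\<^bsub>U\<^esub> w) = ev (ev z w) u" if "u \<in> carrier U" "w \<in> carrier U" "z \<in> carrier Z" for u w z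
      using that linD(1)[OF wl]
      by (elim U_cases) (simp add: cls_mult ev free_alg_mult_closed Z.word_act_mult)
    show "ev z (uea_inj L x) = act Z x z" if "x \<in> carrier L" "z \<in> carrier Z" for x z
      using that by (simp add: inj_eq ev Z.word_act_delta)
    show "ev (c \<odot>\<^bsub>Z\<^esub> z) u = c \<odot>\<^bsub>Z\<^esub> ev z u" if u: "u \<in> carrier U" and z: "z \<in> carrier Z" for u c z
    proof -
      obtain p where p: "p \<in> carrier FA" "u = cls p" using u by (rule U_cases)
      have s: "lin Z Z (\<lambda>z. c \<odot>\<^bsub>Z\<^esub> z)"
        by (rule linI) (auto simp: Z.s_radd Z.s_mult[symmetric] mult.commute)
      have "Z.word_act p (c \<odot>\<^bsub>Z\<^esub> z) = c \<odot>\<^bsub>Z\<^esub> Z.word_act p z"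
      proof (rule free_alg_eqI[OF wl lin_comp[OF wl s] Z.cvs_axioms _ p(1)])
        show "Z.word_act (delta w) (c \<odot>\<^bsub>Z\<^esub> z) = c \<odot>\<^bsub>Z\<^esub> Z.word_act (delta w) z" if "w \<in> lists (carrier L)" for w
          using that z linD(3)[OF Z.foldr_lin[OF that] z] by (simp add: Z.word_act_delta)
      qed (use z in auto)
      then show ?thesis using p z by (simp add: ev)
    qed
  qed
qed

end

section \<open>Modules over Lie algebras\<close>

lemma cvs_cong:
  assumes "cvs V" "carrier W = carrier V" "add W = add V" "zero W = zero V" "smult W = smult V"
  shows "cvs W"
proof -
  interpret V: cvs V by fact
  show ?thesis
    by (rule cvsI) (simp_all add: assms(2-) V.a_ac V.s_ladd V.s_radd V.s_mult)
qed

lemma lin_add: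
  assumes "lin V W f" "lin V W g" "cvs W" shows "lin V W (\<lambda>x. f x \<oplus>\<^bsub>W\<^esub> g x)"
proof -
  interpret W: cvs W by fact
  show ?thesis
    by (rule linI) (simp_all add: linD[OF assms(1)] linD[OF assms(2)] W.a_ac W.s_radd)
qed

lemma (in cvs) lin_smult: "lin V V (\<lambda>x. c \<odot> x)"
  by (rule linI) (simp_all add: s_radd s_mult[symmetric] mult.commute)

lemma lie_submoduleI:
  assumes "subsp V N" "\<And>x v. x \<in> carrier L \<Longrightarrow> v \<in> N \<Longrightarrow> act V x v \<in> N"
  shows "lie_submodule L V N"
  using assms by (simp add: lie_submodule_def)

lemma lie_submoduleD:
  assumes "lie_submodule L V N"
  shows "subsp V N" "x \<in> carrier L \<Longrightarrow> v \<in> N \<Longrightarrow> act V x v \<in> N"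
  using assms by (auto simp: lie_submodule_def)

text \<open>With \<open>N\<close> zero this yields kernels of homomorphisms; with \<open>N\<close>
  arbitrary it carries generation from a Verma module to its quotients.\<close>

lemma lie_hom_vimage:
  assumes "lie_rep L V" "lie_rep L W" "lin V W f"
    "\<And>x v. x \<in> carrier L \<Longrightarrow> v \<in> carrier V \<Longrightarrow> f (act V x v) = act W x (f v)"
    and N: "lie_submodule L W N"
  shows "lie_submodule L V {v \<in> carrier V. f v \<in> N}"
proof (rule lie_submoduleI)
  interpret V: lie_rep L V by fact
  interpret W: lie_rep L W by fact
  show "subsp V {v \<in> carrier V. f v \<in> N}"
    by (rule lin_vimage_subsp[OF assms(3) V.cvs_axioms W.cvs_axioms lie_submoduleD(1)[OF N]])
  show "act V x v \<in> {v \<in> carrier V. f v \<in> N}"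
    if "x \<in> carrier L" "v \<in> {v \<in> carrier V. f v \<in> N}" for x v
    using that assms(4) lie_submoduleD(2)[OF N] by simp
qed

context lie_rep begin

lemma act_zero [simp]: "x \<in> carrier L \<Longrightarrow> act V x \<zero> = \<zero>"
  using lin_zero[OF act_lin cvs_axioms cvs_axioms] .

lemma submodule_carrier: "lie_submodule L V (carrier V)"
  by (rule lie_submoduleI[OF subsp_carrier]) simp

lemma submodule_zero: "lie_submodule L V {\<zero>}"
  by (rule lie_submoduleI[OF subsp_zero]) simp

text \<open>The hypothesis on \<open>S\<close> makes \<open>carrier V\<close> one of the intersected
  submodules; the empty intersection is thereby excluded.\<close>

lemma submodule_gen:
  assumes S: "S \<subseteq> carrier V"
  shows "lie_submodule L V (lie_submodule_gen L V S)" "S \<subseteq> lie_submodule_gen L V S"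
    "lie_submodule L V N \<Longrightarrow> S \<subseteq> N \<Longrightarrow> lie_submodule_gen L V S \<subseteq> N"
proof -
  show "S \<subseteq> lie_submodule_gen L V S"
    and min: "lie_submodule L V N \<Longrightarrow> S \<subseteq> N \<Longrightarrow> lie_submodule_gen L V S \<subseteq> N" for N
    unfolding lie_submodule_gen_def by blast+
  have "lie_submodule_gen L V S \<subseteq> carrier V"
    by (rule min[OF submodule_carrier S])
  then have "subsp V (lie_submodule_gen L V S)"
    by (rule subsp_I) (auto simp: lie_submodule_gen_def lie_submodule_def dest: subspD(2-4))
  then show "lie_submodule L V (lie_submodule_gen L V S)"
    by (rule lie_submoduleI) (auto simp: lie_submodule_gen_def lie_submodule_def)
qed

end

locale lie_quotient = lie_rep L V for L :: "'x lie_alg" and V :: "('x, 'v) lie_mod" (structure) +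
  fixes N assumes N: "lie_submodule L V N"
begin

lemma quot: "quot_space V N"
  unfolding quot_space_def quot_space_axioms_def using cvs_axioms lie_submoduleD(1)[OF N] by blast

sublocale Q: quot_space V N by (rule quot)

lemma lie_quot_simps:
  "carrier (lie_quot V N) = carrier (quot_mod V N)" "add (lie_quot V N) = add (quot_mod V N)"
  "zero (lie_quot V N) = zero (quot_mod V N)" "smult (lie_quot V N) = smult (quot_mod V N)"
  by (simp_all add: lie_quot_def module.defs lie_mod.defs)

lemma lie_quot_lin: "lin V (lie_quot V N) ((+>) N)"
  using Q.quot_lin by (simp add: LinearCombinations.module_hom_def lie_quot_simps)

lemma lie_quot_act:
  assumes "x \<in> carrier L" "v \<in> carrier V"
  shows "act (lie_quot V N) x (N +> v) = N +> act V x v"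
proof -
  have "(\<Union>v\<in>N +> v. N +> act V x v) = N +> act V x v"
  proof (rule Q.UN_rep[OF assms(2)])
    fix w assume w: "w \<in> carrier V" "w \<ominus> v \<in> N"
    have "act V x w \<ominus> act V x v = act V x (w \<ominus> v)"
      using assms w lin_minus[OF act_lin cvs_axioms cvs_axioms] by simp
    with lie_submoduleD(2)[OF N assms(1) w(2)] show "N +> act V x w = N +> act V x v"
      using assms w Q.quot_eq_iff[of "act V x w" "act V x v"] by simp
  qed
  then show ?thesis by (simp add: lie_quot_def module.defs lie_mod.defs)
qed

lemma lie_quot_cases:
  assumes "X \<in> carrier (lie_quot V N)" obtains v where "v \<in> carrier V" "X = N +> v"
  using assms by (auto simp: lie_quot_simps Q.quot_carrier)

lemma lie_quot_rep:
  assumes L: "bracket_space L"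
  shows "lie_rep L (lie_quot V N)"
proof -
  interpret L: bracket_space L by fact
  note l = linD[OF lie_quot_lin]
  have "cvs (lie_quot V N)"
    by (rule cvs_cong[OF Q.quot_cvs lie_quot_simps])
  then show ?thesis
    unfolding lie_rep_def lie_rep_axioms_def
    apply (intro conjI allI impI)
    subgoal by simp
    subgoal by (elim lie_quot_cases) (simp add: lie_quot_act l)
    subgoal by (elim lie_quot_cases) (simp add: lie_quot_act l(2)[symmetric] act_add_r)
    subgoal by (elim lie_quot_cases) (simp add: lie_quot_act l(3)[symmetric] act_smult_r)
    subgoal by (elim lie_quot_cases) (simp add: lie_quot_act l(2)[symmetric] act_add_l)
    subgoal by (elim lie_quot_cases) (simp add: lie_quot_act l(3)[symmetric] act_smult_l)
    subgoal for x y by (elim lie_quot_cases)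
        (simp add: lie_quot_act l(2)[symmetric] L.br_closed act_bracket[of x y])
    done
qed

end

subsection \<open>Tensor products of modules\<close>

locale lie_tensor_space = A: lie_rep L V + B: lie_rep L W + L: bracket_space L
  for L :: "'x lie_alg" and V :: "('x, 'v) lie_mod" and W :: "('x, 'w) lie_mod"
begin

sublocale tensor_space V W "{} :: unit set" "\<lambda>v _. v" "\<lambda>_ w. w"
  unfolding tensor_space_def tensor_space_axioms_def
  using A.cvs_axioms B.cvs_axioms by simp

lemma lie_tensor_simps:
  "carrier (lie_tensor V W) = carrier T" "add (lie_tensor V W) = add T"
  "zero (lie_tensor V W) = zero T" "smult (lie_tensor V W) = smult T"
  by (simp_all add: lie_tensor_def module.defs lie_mod.defs)

lemma lie_tensor_cvs: "cvs (lie_tensor V W)"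
  by (rule cvs_cong[OF T_cvs lie_tensor_simps])

lemma lin_lie_tensor: "lin (lie_tensor V W) U f \<longleftrightarrow> lin T U f"
  by (simp add: LinearCombinations.module_hom_def lie_tensor_simps)

lemma subsp_lie_tensor: "subsp (lie_tensor V W) N \<longleftrightarrow> subsp T N"
proof
  assume "subsp (lie_tensor V W) N"
  from subspD[OF this] show "subsp T N"
    by (intro T.subsp_I) (auto simp: lie_tensor_simps)
next
  assume "subsp T N"
  from subspD[OF this] show "subsp (lie_tensor V W) N"
    by (intro cvs.subsp_I[OF lie_tensor_cvs]) (auto simp: lie_tensor_simps)
qed

lemma lie_tensor_act:
  assumes x: "x \<in> carrier L"
  shows "lin T T (act (lie_tensor V W) x)"
    and "v \<in> carrier V \<Longrightarrow> w \<in> carrier W \<Longrightarrow>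
      act (lie_tensor V W) x (pt v w) = pt (act V x v) w \<oplus>\<^bsub>T\<^esub> pt v (act W x w)"
proof -
  have eq: "act (lie_tensor V W) x = tensor_lift T (\<lambda>(v, w). pt (act V x v) w \<oplus>\<^bsub>T\<^esub> pt v (act W x w))"
    by (simp add: lie_tensor_def module.defs lie_mod.defs)
  let ?\<phi> = "\<lambda>(v, w). pt (act V x v) w \<oplus>\<^bsub>T\<^esub> pt v (act W x w)"
  have *: "?\<phi> (v \<oplus>\<^bsub>V\<^esub> v', w) = ?\<phi> (v, w) \<oplus>\<^bsub>T\<^esub> ?\<phi> (v', w)"
    "?\<phi> (c \<odot>\<^bsub>V\<^esub> v, w) = c \<odot>\<^bsub>T\<^esub> ?\<phi> (v, w)"
    if "v \<in> carrier V" "v' \<in> carrier V" "w \<in> carrier W" for c v v' w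
    using that x by (simp_all add: A.act_add_r A.act_smult_r pt_add_l pt_smult_l T.s_radd T.a_ac)
  have **: "?\<phi> (v, w \<oplus>\<^bsub>W\<^esub> w') = ?\<phi> (v, w) \<oplus>\<^bsub>T\<^esub> ?\<phi> (v, w')"
    "?\<phi> (v, c \<odot>\<^bsub>W\<^esub> w) = c \<odot>\<^bsub>T\<^esub> ?\<phi> (v, w)"
    if "v \<in> carrier V" "w \<in> carrier W" "w' \<in> carrier W" for c v w w'
    using that x by (simp_all add: B.act_add_r B.act_smult_r pt_add_r pt_smult_r T.s_radd T.a_ac)
  have cl: "?\<phi> (v, w) \<in> carrier T" if "v \<in> carrier V" "w \<in> carrier W" for v w
    using that x by simp
  note lift = tensor_lift[OF T_cvs cl *(1) **(1) *(2) **(2)]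
  show "lin T T (act (lie_tensor V W) x)"
    unfolding eq by (rule lift(1)) auto
  show "act (lie_tensor V W) x (pt v w) = pt (act V x v) w \<oplus>\<^bsub>T\<^esub> pt v (act W x w)"
    if "v \<in> carrier V" "w \<in> carrier W"
    unfolding eq by (subst lift(2)) (use that in auto)
qed

lemma lie_tensor_rep: "lie_rep L (lie_tensor V W)"
proof -
  note l = lie_tensor_act
  note ld = linD[OF l(1)]
  let ?a = "act (lie_tensor V W)"
  have add: "?a (x \<oplus>\<^bsub>L\<^esub> y) P = ?a x P \<oplus>\<^bsub>T\<^esub> ?a y P"
    if x: "x \<in> carrier L" and y: "y \<in> carrier L" and P: "P \<in> carrier T" for x y P
  proof (rule tensor_eqI[OF l(1) lin_add[OF l(1) l(1) T_cvs] T_cvs _ P])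
    show "?a (x \<oplus>\<^bsub>L\<^esub> y) (pt v w) = ?a x (pt v w) \<oplus>\<^bsub>T\<^esub> ?a y (pt v w)"
      if "v \<in> carrier V" "w \<in> carrier W" for v w
      using that x y by (simp add: l(2) A.act_add_l B.act_add_l pt_add_l pt_add_r T.a_ac)
  qed (use x y in auto)
  have smult: "?a (c \<odot>\<^bsub>L\<^esub> x) P = c \<odot>\<^bsub>T\<^esub> ?a x P"
    if x: "x \<in> carrier L" and P: "P \<in> carrier T" for c x P
  proof (rule tensor_eqI[OF l(1) lin_comp[OF l(1) T.lin_smult] T_cvs _ P])
    show "?a (c \<odot>\<^bsub>L\<^esub> x) (pt v w) = c \<odot>\<^bsub>T\<^esub> ?a x (pt v w)"
      if "v \<in> carrier V" "w \<in> carrier W" for v w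
      using that x by (simp add: l(2) A.act_smult_l B.act_smult_l pt_smult_l pt_smult_r T.s_radd)
  qed (use x in auto)
  have br: "?a x (?a y P) = ?a (bracket L x y) P \<oplus>\<^bsub>T\<^esub> ?a y (?a x P)"
    if x: "x \<in> carrier L" and y: "y \<in> carrier L" and P: "P \<in> carrier T" for x y P
  proof (rule tensor_eqI[OF lin_comp[OF l(1) l(1)] lin_add[OF l(1) lin_comp[OF l(1) l(1)] T_cvs] T_cvs _ P])
    fix v w assume v: "v \<in> carrier V" and w: "w \<in> carrier W"
    \<comment> \<open>The two mixed terms are exchanged when \<open>x\<close> and \<open>y\<close>
      are, so that only the outer terms have to be rewritten with
      \<open>act_bracket\<close>.\<close>
    have "?a x (?a y (pt v w)) = (pt (act V x (act V y v)) w \<oplus>\<^bsub>T\<^esub> pt (act V y v) (act W x w)) \<oplus>\<^bsub>T\<^esub>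
        (pt (act V x v) (act W y w) \<oplus>\<^bsub>T\<^esub> pt v (act W x (act W y w)))"
      using v w x y by (simp add: l(2) ld(2))
    also have "act V x (act V y v) = act V (bracket L x y) v \<oplus>\<^bsub>V\<^esub> act V y (act V x v)"
      by (rule A.act_bracket[OF x y v])
    also have "act W x (act W y w) = act W (bracket L x y) w \<oplus>\<^bsub>W\<^esub> act W y (act W x w)"
      by (rule B.act_bracket[OF x y w])
    finally show "?a x (?a y (pt v w)) = ?a (bracket L x y) (pt v w) \<oplus>\<^bsub>T\<^esub> ?a y (?a x (pt v w))"
      using v w x y by (simp add: l(2) ld(2) L.br_closed pt_add_l pt_add_r T.a_ac)
  qed (use x y L.br_closed in auto)
  show ?thesis
    unfolding lie_rep_def lie_rep_axioms_def lie_tensor_simps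
    by (intro conjI allI impI lie_tensor_cvs add smult br ld)
qed

end

lemma CC_mod_cvs: "cvs CC_mod"
  by (rule cvsI) (auto simp: CC_mod_def algebra_simps)

subsection \<open>Verma modules and their quotients\<close>

locale current_space = bracket_space "current D A H2"
  for D :: "'g km_datum" and A :: "(complex, 'a) module" and H2 :: "'g set" +
  assumes N_sub: "cur_N_plus D A H2 \<subseteq> carrier (current D A H2)"
    and H_sub: "cur_h D A H2 \<subseteq> carrier (current D A H2)"
    and F_sub: "m \<in> pos_roots D \<Longrightarrow> x \<in> root_space D (\<lambda>h. - root_of D m h) \<Longrightarrow> a \<in> carrier A \<Longrightarrow>
      cur_elem D A x a \<in> carrier (current D A H2)"
begin

abbreviation "Cur \<equiv> current D A H2"
abbreviation "NH \<equiv> cur_N_plus D A H2 \<times> cur_h D A H2"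
abbreviation "Ver \<psi> \<equiv> verma D A H2 \<psi>"
abbreviation "VT \<psi> \<equiv> verma_space D A H2 \<psi>"
abbreviation "vel \<psi> \<equiv> verma_elem D A H2 \<psi>"
abbreviation "ij \<equiv> uea_inj Cur"

lemma NH_closed: "n \<in> cur_N_plus D A H2 \<Longrightarrow> t \<in> cur_h D A H2 \<Longrightarrow> n \<oplus>\<^bsub>Cur\<^esub> t \<in> carrier Cur"
  using N_sub H_sub by (intro a_closed) auto

lemma verma_tensor: "tensor_space U CC_mod NH (verma_right D A H2) (verma_left \<psi>)"
  unfolding tensor_space_def tensor_space_axioms_def
  using U_cvs CC_mod_cvs NH_closed by (auto simp: verma_right_def CC_mod_def)

end

locale verma_module = current_space D A H2
  for D :: "'g km_datum" and A :: "(complex, 'a) module" and H2 :: "'g set" +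
  fixes \<psi> :: "('g, 'a) cur \<Rightarrow> complex"
begin

sublocale VT: tensor_space U CC_mod NH "verma_right D A H2" "verma_left \<psi>"
  by (rule verma_tensor)

lemma VT_fold: "VT.T = VT \<psi>" "VT.pt = vel \<psi>"
  by (simp_all add: verma_space_def verma_elem_def)

lemmas VT_cvs = VT.T_cvs[unfolded VT_fold]
lemmas vel_closed [simp] = VT.pt_closed[unfolded VT_fold]
lemmas vel_lin_l = VT.pt_lin_l[unfolded VT_fold]
lemmas vel_lin_r = VT.pt_lin_r[unfolded VT_fold]
lemmas vel_bal = VT.pt_bal[unfolded VT_fold]
lemmas VT_induct = VT.T_induct[unfolded VT_fold]
lemmas VT_lift = VT.tensor_lift[unfolded VT_fold]

sublocale V: cvs "VT \<psi>" by (rule VT_cvs)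

lemma CC_simps [simp]: "c \<in> carrier CC_mod" "c \<oplus>\<^bsub>CC_mod\<^esub> d = c + d" "c \<odot>\<^bsub>CC_mod\<^esub> d = c * d"
  by (simp_all add: CC_mod_def)

lemma vel_smult: "u \<in> carrier U \<Longrightarrow> vel \<psi> u c = c \<odot>\<^bsub>VT \<psi>\<^esub> vel \<psi> u 1"
  using linD(3)[OF vel_lin_r[of u], of 1 c] by simp

lemma verma_eqI:
  assumes "lin (VT \<psi>) W f" "lin (VT \<psi>) W g" "cvs W"
    and "\<And>u c. u \<in> carrier U \<Longrightarrow> f (vel \<psi> u c) = g (vel \<psi> u c)"
    and "P \<in> carrier (VT \<psi>)"
  shows "f P = g P"
  using VT_induct[OF lin_eq_subsp[OF assms(1,2) VT_cvs assms(3)] _ assms(5)] assms(4) by auto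

lemma verma_simps:
  "carrier (Ver \<psi>) = carrier (VT \<psi>)" "add (Ver \<psi>) = add (VT \<psi>)"
  "zero (Ver \<psi>) = zero (VT \<psi>)" "smult (Ver \<psi>) = smult (VT \<psi>)"
  by (simp_all add: verma_def module.defs lie_mod.defs)

lemma verma_cvs: "cvs (Ver \<psi>)"
  by (rule cvs_cong[OF VT_cvs verma_simps])

lemma right_eq: "s \<in> NH \<Longrightarrow> verma_right D A H2 u s = u \<otimes>\<^bsub>U\<^esub> ij (fst s \<oplus>\<^bsub>Cur\<^esub> snd s)"
  "verma_left \<psi> s c = \<psi> (snd s) * c"
  by (cases s; simp add: verma_right_def verma_left_def)+

text \<open>The balancing multiplies on the right and the action multiplies on the left.
  Associativity makes them compatible, which is fact \<open>5\<close>.\<close>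

lemma verma_act:
  assumes x: "x \<in> carrier Cur"
  shows "lin (VT \<psi>) (VT \<psi>) (act (Ver \<psi>) x)"
    and "u \<in> carrier U \<Longrightarrow> act (Ver \<psi>) x (vel \<psi> u c) = vel \<psi> (ij x \<otimes>\<^bsub>U\<^esub> u) c"
proof -
  let ?\<phi> = "\<lambda>(u, c). vel \<psi> (ij x \<otimes>\<^bsub>U\<^esub> u) c"
  have eq: "act (Ver \<psi>) x = tensor_lift (VT \<psi>) ?\<phi>"
    by (simp add: verma_def module.defs lie_mod.defs)
  note ix = inj_closed[OF x]
  have cl: "?\<phi> (u, c) \<in> carrier (VT \<psi>)" if "u \<in> carrier U" "c \<in> carrier CC_mod" for u c
    using that ix by simp
  have 1: "?\<phi> (u \<oplus>\<^bsub>U\<^esub> u', c) = ?\<phi> (u, c) \<oplus>\<^bsub>VT \<psi>\<^esub> ?\<phi> (u', c)"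
    if "u \<in> carrier U" "u' \<in> carrier U" "c \<in> carrier CC_mod" for u u' c
    using that ix by (simp add: linD(2)[OF U_lin_r] linD(2)[OF vel_lin_l])
  have 2: "?\<phi> (u, c \<oplus>\<^bsub>CC_mod\<^esub> c') = ?\<phi> (u, c) \<oplus>\<^bsub>VT \<psi>\<^esub> ?\<phi> (u, c')"
    if "u \<in> carrier U" "c \<in> carrier CC_mod" "c' \<in> carrier CC_mod" for u c c'
    using that ix linD(2)[OF vel_lin_r[of "ij x \<otimes>\<^bsub>U\<^esub> u"], of c c'] by simp
  have 3: "?\<phi> (d \<odot>\<^bsub>U\<^esub> u, c) = d \<odot>\<^bsub>VT \<psi>\<^esub> ?\<phi> (u, c)"
    if "u \<in> carrier U" "c \<in> carrier CC_mod" for d u c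
    using that ix by (simp add: linD(3)[OF U_lin_r] linD(3)[OF vel_lin_l])
  have 4: "?\<phi> (u, d \<odot>\<^bsub>CC_mod\<^esub> c) = d \<odot>\<^bsub>VT \<psi>\<^esub> ?\<phi> (u, c)"
    if "u \<in> carrier U" "c \<in> carrier CC_mod" for d u c
    using that ix linD(3)[OF vel_lin_r[of "ij x \<otimes>\<^bsub>U\<^esub> u"], of c d] by simp
  have 5: "?\<phi> (verma_right D A H2 u s, c) = ?\<phi> (u, verma_left \<psi> s c)"
    if u: "u \<in> carrier U" and "c \<in> carrier CC_mod" and s: "s \<in> NH" for u s c
  proof -
    have st: "fst s \<oplus>\<^bsub>Cur\<^esub> snd s \<in> carrier Cur" using s NH_closed by auto
    have "ij x \<otimes>\<^bsub>U\<^esub> verma_right D A H2 u s = verma_right D A H2 (ij x \<otimes>\<^bsub>U\<^esub> u) s"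
      unfolding right_eq(1)[OF s] using u ix st by (simp add: U_assoc)
    then show ?thesis
      using vel_bal[of "ij x \<otimes>\<^bsub>U\<^esub> u" c s] u ix s by simp
  qed
  note lift = VT_lift[OF VT_cvs cl 1 2 3 4 5]
  show "lin (VT \<psi>) (VT \<psi>) (act (Ver \<psi>) x)"
    unfolding eq by (rule lift(1)) auto
  show "act (Ver \<psi>) x (vel \<psi> u c) = vel \<psi> (ij x \<otimes>\<^bsub>U\<^esub> u) c" if "u \<in> carrier U"
    unfolding eq by (subst lift(2)) (use that in auto)
qed

lemma verma_rep: "lie_rep Cur (Ver \<psi>)"
proof -
  note l = verma_act
  note ld = linD[OF l(1)]
  let ?a = "act (Ver \<psi>)"
  have add: "?a (x \<oplus>\<^bsub>Cur\<^esub> y) P = ?a x P \<oplus>\<^bsub>VT \<psi>\<^esub> ?a y P"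
    if x: "x \<in> carrier Cur" and y: "y \<in> carrier Cur" and P: "P \<in> carrier (VT \<psi>)" for x y P
  proof (rule verma_eqI[OF l(1) lin_add[OF l(1) l(1) VT_cvs] VT_cvs _ P])
    show "?a (x \<oplus>\<^bsub>Cur\<^esub> y) (vel \<psi> u c) = ?a x (vel \<psi> u c) \<oplus>\<^bsub>VT \<psi>\<^esub> ?a y (vel \<psi> u c)"
      if "u \<in> carrier U" for u c
      using that x y by (simp add: l(2) linD(2)[OF inj_lin] linD(2)[OF U_lin_l] linD(2)[OF vel_lin_l])
  qed (use x y in auto)
  have smult: "?a (d \<odot>\<^bsub>Cur\<^esub> x) P = d \<odot>\<^bsub>VT \<psi>\<^esub> ?a x P"
    if x: "x \<in> carrier Cur" and P: "P \<in> carrier (VT \<psi>)" for d x P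
  proof (rule verma_eqI[OF l(1) lin_comp[OF l(1) V.lin_smult] VT_cvs _ P])
    show "?a (d \<odot>\<^bsub>Cur\<^esub> x) (vel \<psi> u c) = d \<odot>\<^bsub>VT \<psi>\<^esub> ?a x (vel \<psi> u c)"
      if "u \<in> carrier U" for u c
      using that x by (simp add: l(2) linD(3)[OF inj_lin] linD(3)[OF U_lin_l] linD(3)[OF vel_lin_l])
  qed (use x in auto)
  have br: "?a x (?a y P) = ?a (bracket Cur x y) P \<oplus>\<^bsub>VT \<psi>\<^esub> ?a y (?a x P)"
    if x: "x \<in> carrier Cur" and y: "y \<in> carrier Cur" and P: "P \<in> carrier (VT \<psi>)" for x y P
  proof (rule verma_eqI[OF lin_comp[OF l(1) l(1)] lin_add[OF l(1) lin_comp[OF l(1) l(1)] VT_cvs] VT_cvs _ P])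
    fix u c assume u: "u \<in> carrier U"
    have "ij x \<otimes>\<^bsub>U\<^esub> (ij y \<otimes>\<^bsub>U\<^esub> u) = (ij (bracket Cur x y) \<oplus>\<^bsub>U\<^esub> ij y \<otimes>\<^bsub>U\<^esub> ij x) \<otimes>\<^bsub>U\<^esub> u"
      using x y u by (simp add: U_assoc flip: inj_bracket)
    also have "\<dots> = ij (bracket Cur x y) \<otimes>\<^bsub>U\<^esub> u \<oplus>\<^bsub>U\<^esub> ij y \<otimes>\<^bsub>U\<^esub> (ij x \<otimes>\<^bsub>U\<^esub> u)"
      using x y u by (simp add: U_assoc linD(2)[OF U_lin_l] br_closed)
    finally show "?a x (?a y (vel \<psi> u c)) = ?a (bracket Cur x y) (vel \<psi> u c) \<oplus>\<^bsub>VT \<psi>\<^esub> ?a y (?a x (vel \<psi> u c))"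
      using x y u by (simp add: l(2) br_closed linD(2)[OF vel_lin_l])
  qed (use x y br_closed in auto)
  show ?thesis
    unfolding lie_rep_def lie_rep_axioms_def verma_simps
    by (intro conjI allI impI verma_cvs add smult br ld)
qed

abbreviation "vv \<equiv> verma_vec D A H2 \<psi>"

lemma vv_eq: "vv = vel \<psi> \<one>\<^bsub>U\<^esub> 1"
  by (simp add: verma_vec_def)

lemma vv_closed [simp]: "vv \<in> carrier (VT \<psi>)"
  by (simp add: vv_eq)

lemma verma_hw:
  assumes "n \<in> cur_N_plus D A H2" "t \<in> cur_h D A H2"
  shows "act (Ver \<psi>) (n \<oplus>\<^bsub>Cur\<^esub> t) vv = \<psi> t \<odot>\<^bsub>VT \<psi>\<^esub> vv"
proof -
  have st: "n \<oplus>\<^bsub>Cur\<^esub> t \<in> carrier Cur" using assms NH_closed by blast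
  have "act (Ver \<psi>) (n \<oplus>\<^bsub>Cur\<^esub> t) vv = vel \<psi> (verma_right D A H2 \<one>\<^bsub>U\<^esub> (n, t)) 1"
    using st assms by (simp add: vv_eq verma_act(2) right_eq U_l_one U_r_one)
  also have "\<dots> = vel \<psi> \<one>\<^bsub>U\<^esub> (verma_left \<psi> (n, t) 1)"
    by (rule vel_bal) (use assms in auto)
  also have "\<dots> = \<psi> t \<odot>\<^bsub>VT \<psi>\<^esub> vv"
    using vel_smult[of "\<one>\<^bsub>U\<^esub>" "\<psi> t"] by (simp add: right_eq vv_eq)
  finally show ?thesis .
qed

lemma verma_generated:
  assumes N: "lie_submodule Cur (Ver \<psi>) N" and v: "vv \<in> N"
  shows "N = carrier (Ver \<psi>)"
proof
  note sN = lie_submoduleD(1)[OF N]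
  show "N \<subseteq> carrier (Ver \<psi>)" using subspD(1)[OF sN] .
  have sV: "subsp (VT \<psi>) N"
    using subspD[OF sN] by (intro V.subsp_I) (auto simp: verma_simps)
  have u: "vel \<psi> u 1 \<in> N" if "u \<in> carrier U" for u
  proof -
    have "subsp U {u \<in> carrier U. vel \<psi> u 1 \<in> N}"
      by (rule lin_vimage_subsp[OF vel_lin_l U_cvs VT_cvs sV]) simp
    then have "u \<in> {u \<in> carrier U. vel \<psi> u 1 \<in> N}"
    proof (rule U_induct)
      show "\<one>\<^bsub>U\<^esub> \<in> {u \<in> carrier U. vel \<psi> u 1 \<in> N}"
        using v by (simp add: vv_eq)
      show "ij x \<otimes>\<^bsub>U\<^esub> u \<in> {u \<in> carrier U. vel \<psi> u 1 \<in> N}"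
        if "x \<in> carrier Cur" "u \<in> {u \<in> carrier U. vel \<psi> u 1 \<in> N}" for x u
        using that lie_submoduleD(2)[OF N that(1), of "vel \<psi> u 1"] by (simp add: verma_act(2))
    qed (rule that)
    then show ?thesis by simp
  qed
  show "carrier (Ver \<psi>) \<subseteq> N"
  proof
    fix P assume P: "P \<in> carrier (Ver \<psi>)"
    have "vel \<psi> w c \<in> N" if "w \<in> carrier U" for w c
      using vel_smult[OF that, of c] subspD(4)[OF sV u[OF that], of c] by simp
    then show "P \<in> N"
      using VT_induct[OF sV _ P[unfolded verma_simps]] by blast
  qed
qed

text \<open>The map sends \<open>u \<otimes> c\<close> to \<open>c\<close> times \<open>u z\<close>.
  That it is balanced over the subalgebra is exactly the highest weight condition
  \<open>hw\<close>.\<close>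

lemma verma_universal:
  assumes Z: "lie_rep Cur Z" and z: "z \<in> carrier Z"
    and hw: "\<And>n t. n \<in> cur_N_plus D A H2 \<Longrightarrow> t \<in> cur_h D A H2 \<Longrightarrow>
      act Z (n \<oplus>\<^bsub>Cur\<^esub> t) z = \<psi> t \<odot>\<^bsub>Z\<^esub> z"
  obtains f where "lin (VT \<psi>) Z f" "f vv = z"
    "\<And>x P. x \<in> carrier Cur \<Longrightarrow> P \<in> carrier (VT \<psi>) \<Longrightarrow> f (act (Ver \<psi>) x P) = act Z x (f P)"
proof -
  interpret Z: lie_rep Cur Z by fact
  show ?thesis
  proof (rule uea_universal[OF Z])
  fix ev assume ev:
    "\<And>z. z \<in> carrier Z \<Longrightarrow> lin U Z (\<lambda>u. ev u z)"
    "\<And>z. z \<in> carrier Z \<Longrightarrow> ev \<one>\<^bsub>U\<^esub> z = z"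
    "\<And>u w z. u \<in> carrier U \<Longrightarrow> w \<in> carrier U \<Longrightarrow> z \<in> carrier Z \<Longrightarrow> ev (u \<otimes>\<^bsub>U\<^esub> w) z = ev u (ev w z)"
    "\<And>x z. x \<in> carrier Cur \<Longrightarrow> z \<in> carrier Z \<Longrightarrow> ev (ij x) z = act Z x z"
    "\<And>u c z. u \<in> carrier U \<Longrightarrow> z \<in> carrier Z \<Longrightarrow> ev u (c \<odot>\<^bsub>Z\<^esub> z) = c \<odot>\<^bsub>Z\<^esub> ev u z"
  note evl = linD[OF ev(1)[OF z]]
  let ?\<phi> = "\<lambda>(u, c). c \<odot>\<^bsub>Z\<^esub> ev u z"
  have 0: "?\<phi> (u, c) \<in> carrier Z" if "u \<in> carrier U" "c \<in> carrier CC_mod" for u c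
    using that evl(1) by simp
  have 1: "?\<phi> (u \<oplus>\<^bsub>U\<^esub> u', c) = ?\<phi> (u, c) \<oplus>\<^bsub>Z\<^esub> ?\<phi> (u', c)"
    if "u \<in> carrier U" "u' \<in> carrier U" "c \<in> carrier CC_mod" for u u' c
    using that by (simp add: evl Z.s_radd)
  have 2: "?\<phi> (u, c \<oplus>\<^bsub>CC_mod\<^esub> c') = ?\<phi> (u, c) \<oplus>\<^bsub>Z\<^esub> ?\<phi> (u, c')"
    if "u \<in> carrier U" "c \<in> carrier CC_mod" "c' \<in> carrier CC_mod" for u c c'
    using that by (simp add: evl Z.s_ladd)
  have 3: "?\<phi> (d \<odot>\<^bsub>U\<^esub> u, c) = d \<odot>\<^bsub>Z\<^esub> ?\<phi> (u, c)"
    if "u \<in> carrier U" "c \<in> carrier CC_mod" for d u c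
    using that by (simp add: evl Z.s_mult[symmetric] mult.commute)
  have 4: "?\<phi> (u, d \<odot>\<^bsub>CC_mod\<^esub> c) = d \<odot>\<^bsub>Z\<^esub> ?\<phi> (u, c)"
    if "u \<in> carrier U" "c \<in> carrier CC_mod" for d u c
    using that by (simp add: evl Z.s_mult)
  have 5: "?\<phi> (verma_right D A H2 u s, c) = ?\<phi> (u, verma_left \<psi> s c)"
    if u: "u \<in> carrier U" and "c \<in> carrier CC_mod" and s: "s \<in> NH" for u s c
  proof -
    have st: "fst s \<oplus>\<^bsub>Cur\<^esub> snd s \<in> carrier Cur" using s NH_closed by auto
    have "ev (verma_right D A H2 u s) z = ev u (act Z (fst s \<oplus>\<^bsub>Cur\<^esub> snd s) z)"
      using u st z s by (simp add: right_eq ev)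
    also have "act Z (fst s \<oplus>\<^bsub>Cur\<^esub> snd s) z = \<psi> (snd s) \<odot>\<^bsub>Z\<^esub> z"
      by (rule hw) (use s in auto)
    finally show ?thesis
      using u z by (simp add: right_eq ev evl Z.s_mult[symmetric] mult.commute)
  qed
  note lift = VT_lift[OF Z.cvs_axioms 0 1 2 3 4 5]
  let ?f = "tensor_lift Z ?\<phi>"
  have f: "lin (VT \<psi>) Z ?f" by (rule lift(1)) auto
  have fv: "?f (vel \<psi> u c) = c \<odot>\<^bsub>Z\<^esub> ev u z" if "u \<in> carrier U" for u c
    by (subst lift(2)) (use that in auto)
  show thesis
  proof (rule that[OF f])
    show "?f vv = z" using z by (simp add: vv_eq fv ev)
    show "?f (act (Ver \<psi>) x P) = act Z x (?f P)" if x: "x \<in> carrier Cur" and P: "P \<in> carrier (VT \<psi>)" for x P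
    proof (rule verma_eqI[OF lin_comp[OF verma_act(1)[OF x] f] lin_comp[OF f Z.act_lin[OF x]] Z.cvs_axioms _ P])
      show "?f (act (Ver \<psi>) x (vel \<psi> u c)) = act Z x (?f (vel \<psi> u c))" if "u \<in> carrier U" for u c
        using that x z by (simp add: verma_act(2) fv ev evl Z.act_smult_r)
    qed
  qed
  qed
qed

end

section \<open>Quotients of Verma modules by families of ideals\<close>

locale family_module = verma_module D A H2 \<psi>
  for D :: "'g km_datum" and A :: "(complex, 'a) module" and H2 :: "'g set" and \<psi> +
  fixes F :: "(nat \<Rightarrow> nat) \<Rightarrow> 'a set"
  assumes F: "m \<in> pos_roots D \<Longrightarrow> F m \<subseteq> carrier A"
begin

definition gens where "gens = {act (Ver \<psi>) (cur_elem D A x a) vv | m x a.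
           m \<in> pos_roots D \<and> x \<in> root_space D (\<lambda>h. - root_of D m h) \<and> a \<in> F m}"

abbreviation "Sub \<equiv> lie_submodule_gen Cur (Ver \<psi>) gens"
abbreviation "M \<equiv> M_family D A H2 \<psi> F"
abbreviation "mv \<equiv> Sub +>\<^bsub>Ver \<psi>\<^esub> vv"

sublocale VR: lie_rep Cur "Ver \<psi>" by (rule verma_rep)

lemma gens_sub: "gens \<subseteq> carrier (Ver \<psi>)"
  unfolding gens_def using F F_sub by (fastforce simp: verma_simps(1)[symmetric] vv_closed[unfolded verma_simps(1)[symmetric]])

lemma quotient: "lie_quotient Cur (Ver \<psi>) Sub"
  unfolding lie_quotient_def lie_quotient_axioms_def
  using verma_rep VR.submodule_gen(1)[OF gens_sub] by blast

sublocale LQ: lie_quotient Cur "Ver \<psi>" Sub by (rule quotient)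

lemma M_eq: "M = lie_quot (Ver \<psi>) Sub"
  by (simp add: M_family_def gens_def)

lemma M_rep: "lie_rep Cur M"
  unfolding M_eq by (rule LQ.lie_quot_rep) (rule bracket_space_axioms)

lemma vv_Ver: "vv \<in> carrier (Ver \<psi>)"
  by (simp add: verma_simps)

lemma mv_closed: "mv \<in> carrier M"
  unfolding M_eq by (rule linD(1)[OF LQ.lie_quot_lin vv_Ver])

lemma M_hw:
  assumes "n \<in> cur_N_plus D A H2" "t \<in> cur_h D A H2"
  shows "act M (n \<oplus>\<^bsub>Cur\<^esub> t) mv = \<psi> t \<odot>\<^bsub>M\<^esub> mv"
  unfolding M_eq LQ.lie_quot_act[OF NH_closed[OF assms] vv_Ver] verma_hw[OF assms]
  using linD(3)[OF LQ.lie_quot_lin vv_Ver, of "\<psi> t"] by (simp add: verma_simps)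

lemma M_rel:
  assumes "m \<in> pos_roots D" "x \<in> root_space D (\<lambda>h. - root_of D m h)" "a \<in> F m"
  shows "act M (cur_elem D A x a) mv = \<zero>\<^bsub>M\<^esub>"
proof -
  have c: "cur_elem D A x a \<in> carrier Cur"
    using F_sub[OF assms(1,2)] F[OF assms(1)] assms(3) by blast
  have "act (Ver \<psi>) (cur_elem D A x a) vv \<in> Sub"
    using VR.submodule_gen(2)[OF gens_sub] assms unfolding gens_def by blast
  then show ?thesis
    unfolding M_eq LQ.lie_quot_act[OF c vv_Ver] LQ.lie_quot_simps LQ.Q.quot_zero
    using c vv_Ver by (subst LQ.Q.quot_eq_iff) (simp_all add: VR.minus_eq_iff a_minus_def VR.s_uminus[symmetric])
qed

text \<open>The preimage of \<open>N\<close> in the Verma module is a submodule containing the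
  highest weight vector, hence everything.\<close>

lemma M_generated:
  assumes N: "lie_submodule Cur M N" and "mv \<in> N"
  shows "N = carrier M"
proof -
  have "lie_submodule Cur (Ver \<psi>) {v \<in> carrier (Ver \<psi>). Sub +>\<^bsub>Ver \<psi>\<^esub> v \<in> N}"
    using LQ.lie_quot_act N unfolding M_eq
    by (intro lie_hom_vimage[OF verma_rep LQ.lie_quot_rep[OF bracket_space_axioms] LQ.lie_quot_lin]) auto
  from verma_generated[OF this] assms(2) vv_Ver
  have "carrier M \<subseteq> N"
    unfolding M_eq by (auto elim!: LQ.lie_quot_cases)
  then show ?thesis using subspD(1)[OF lie_submoduleD(1)[OF N]] by blast
qed

text \<open>The map out of the Verma module kills \<open>gens\<close> by \<open>rel\<close>. Its
  kernel is a submodule, so it kills \<open>Sub\<close> and factors through the quotient.\<close>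

lemma M_universal:
  assumes Z: "lie_rep Cur Z" and z: "z \<in> carrier Z"
    and hw: "\<And>n t. n \<in> cur_N_plus D A H2 \<Longrightarrow> t \<in> cur_h D A H2 \<Longrightarrow>
      act Z (n \<oplus>\<^bsub>Cur\<^esub> t) z = \<psi> t \<odot>\<^bsub>Z\<^esub> z"
    and rel: "\<And>m x a. m \<in> pos_roots D \<Longrightarrow> x \<in> root_space D (\<lambda>h. - root_of D m h) \<Longrightarrow> a \<in> F m \<Longrightarrow>
      act Z (cur_elem D A x a) z = \<zero>\<^bsub>Z\<^esub>"
  obtains f where "lin M Z f" "f mv = z"
    "\<And>x P. x \<in> carrier Cur \<Longrightarrow> P \<in> carrier M \<Longrightarrow> f (act M x P) = act Z x (f P)"
proof -
  interpret Z: lie_rep Cur Z by fact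
  obtain f where f: "lin (VT \<psi>) Z f" "f vv = z"
    "\<And>x P. x \<in> carrier Cur \<Longrightarrow> P \<in> carrier (VT \<psi>) \<Longrightarrow> f (act (Ver \<psi>) x P) = act Z x (f P)"
    using verma_universal[OF Z z hw] by metis
  have fl: "lin (Ver \<psi>) Z f"
    using f(1) by (simp add: LinearCombinations.module_hom_def verma_simps)
  have "lie_submodule Cur (Ver \<psi>) {v \<in> carrier (Ver \<psi>). f v \<in> {\<zero>\<^bsub>Z\<^esub>}}"
    by (rule lie_hom_vimage[OF verma_rep Z fl _ Z.submodule_zero]) (simp add: f(3) verma_simps)
  moreover have "gens \<subseteq> {v \<in> carrier (Ver \<psi>). f v \<in> {\<zero>\<^bsub>Z\<^esub>}}"
  proof
    fix v assume v: "v \<in> gens"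
    then obtain m x a where *: "m \<in> pos_roots D" "x \<in> root_space D (\<lambda>h. - root_of D m h)" "a \<in> F m"
      "v = act (Ver \<psi>) (cur_elem D A x a) vv" unfolding gens_def by blast
    have c: "cur_elem D A x a \<in> carrier Cur"
      using F_sub[OF *(1,2)] F[OF *(1)] *(3) by blast
    then have "f v = \<zero>\<^bsub>Z\<^esub>"
      using rel[OF *(1-3)] f(2,3) *(4) by simp
    with v gens_sub show "v \<in> {v \<in> carrier (Ver \<psi>). f v \<in> {\<zero>\<^bsub>Z\<^esub>}}" by blast
  qed
  ultimately have "Sub \<subseteq> {v \<in> carrier (Ver \<psi>). f v \<in> {\<zero>\<^bsub>Z\<^esub>}}"
    by (rule VR.submodule_gen(3)[OF gens_sub])
  then have "\<And>v. v \<in> Sub \<Longrightarrow> f v = \<zero>\<^bsub>Z\<^esub>" by blast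
  from LQ.Q.quot_lin_out[OF fl Z.cvs_axioms this]
  obtain g where g: "lin (quot_mod (Ver \<psi>) Sub) Z g" "\<forall>v\<in>carrier (Ver \<psi>). g (Sub +>\<^bsub>Ver \<psi>\<^esub> v) = f v"
    by blast
  show ?thesis
  proof (rule that[of g])
    show "lin M Z g"
      using g(1) by (simp add: LinearCombinations.module_hom_def M_eq LQ.lie_quot_simps)
    show "g mv = z" using g(2) vv_Ver f(2) by simp
    show "g (act M x P) = act Z x (g P)" if "x \<in> carrier Cur" "P \<in> carrier M" for x P
      using that(2) unfolding M_eq
      by (rule LQ.lie_quot_cases) (use that(1) g(2) f(3) in \<open>simp add: LQ.lie_quot_act verma_simps(1)[symmetric]\<close>)
  qed
qed

end

section \<open>Root vectors\<close>

locale liealg = cvs L for L :: "'g lie_alg" (structure) +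
  assumes lie: "lie_algebra L"
begin

abbreviation br where "br x y \<equiv> bracket L x y"

lemma br_closed [simp]: "x \<in> carrier L \<Longrightarrow> y \<in> carrier L \<Longrightarrow> br x y \<in> carrier L"
  and br_add_l: "x \<in> carrier L \<Longrightarrow> x' \<in> carrier L \<Longrightarrow> y \<in> carrier L \<Longrightarrow> br (x \<oplus> x') y = br x y \<oplus> br x' y"
  and br_add_r: "x \<in> carrier L \<Longrightarrow> y \<in> carrier L \<Longrightarrow> y' \<in> carrier L \<Longrightarrow> br x (y \<oplus> y') = br x y \<oplus> br x y'"
  and br_smult_l: "x \<in> carrier L \<Longrightarrow> y \<in> carrier L \<Longrightarrow> br (c \<odot>\<^bsub>L\<^esub> x) y = c \<odot>\<^bsub>L\<^esub> br x y"
  and br_smult_r: "x \<in> carrier L \<Longrightarrow> y \<in> carrier L \<Longrightarrow> br x (c \<odot>\<^bsub>L\<^esub> y) = c \<odot>\<^bsub>L\<^esub> br x y"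
  and br_self: "x \<in> carrier L \<Longrightarrow> br x x = \<zero>"
  by (fact lie_algebra.bracket_closed[OF lie] lie_algebra.bracket_add_l[OF lie]
    lie_algebra.bracket_add_r[OF lie] lie_algebra.bracket_smult_l[OF lie]
    lie_algebra.bracket_smult_r[OF lie] lie_algebra.bracket_self[OF lie])+

lemma br_lin_r: "x \<in> carrier L \<Longrightarrow> lin L L (br x)"
  by (rule linI) (simp_all add: br_add_r br_smult_r)

lemma br_lin_l: "y \<in> carrier L \<Longrightarrow> lin L L (\<lambda>x. br x y)"
  by (rule linI) (simp_all add: br_add_l br_smult_l)

lemma br_zero [simp]: "x \<in> carrier L \<Longrightarrow> br x \<zero> = \<zero>" "x \<in> carrier L \<Longrightarrow> br \<zero> x = \<zero>"
  using lin_zero[OF br_lin_r cvs_axioms cvs_axioms] lin_zero[OF br_lin_l cvs_axioms cvs_axioms] by auto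

lemma br_anti: "x \<in> carrier L \<Longrightarrow> y \<in> carrier L \<Longrightarrow> br x y = (- 1) \<odot>\<^bsub>L\<^esub> br y x"
proof -
  assume x: "x \<in> carrier L" and y: "y \<in> carrier L"
  have "br (x \<oplus> y) (x \<oplus> y) = br x y \<oplus> br y x"
    using x y br_self[OF x] br_self[OF y] by (simp add: br_add_l br_add_r a_comm)
  then have "br x y \<oplus> br y x = \<zero>"
    using br_self[of "x \<oplus> y"] x y by simp
  then show "br x y = (- 1) \<odot>\<^bsub>L\<^esub> br y x"
    using x y minus_cancel[of "br x y" "br y x"] by (simp add: s_uminus a_minus_def)
qed

lemma br_leibniz:
  assumes x: "x \<in> carrier L" and y: "y \<in> carrier L" and z: "z \<in> carrier L"
  shows "br x (br y z) = br (br x y) z \<oplus> br y (br x z)"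
proof -
  have j: "br x (br y z) \<oplus> (br y (br z x) \<oplus> br z (br x y)) = \<zero>"
    using lie_algebra.jacobi[OF lie x y z] x y z by (simp add: a_assoc)
  have "br y (br z x) = (- 1) \<odot>\<^bsub>L\<^esub> br y (br x z)"
    using x y z by (subst br_anti[of z x]) (simp_all add: br_smult_r)
  moreover have "br z (br x y) = (- 1) \<odot>\<^bsub>L\<^esub> br (br x y) z"
    using x y z by (subst br_anti) simp_all
  ultimately have "br x (br y z) \<oplus> (- 1) \<odot>\<^bsub>L\<^esub> (br (br x y) z \<oplus> br y (br x z)) = \<zero>"
    using j x y z by (simp add: s_radd a_comm)
  then show ?thesis
    using x y z minus_eq_zero_iff[of "br x (br y z)" "br (br x y) z \<oplus> br y (br x z)"]
    by (simp add: s_uminus a_minus_def)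
qed

end

lemma liealgI: "lie_algebra L \<Longrightarrow> liealg L"
  by (simp add: liealg_def liealg_axioms_def cvs_def lie_algebra_def)

text \<open>Right-normed brackets in \<open>s\<^sub>0, \<dots>, s\<^sub>n\<^sub>-\<^sub>1\<close>, paired with their multidegree.\<close>

inductive_set ad_words :: "'g lie_alg \<Rightarrow> nat \<Rightarrow> (nat \<Rightarrow> 'g) \<Rightarrow> ('g \<times> (nat \<Rightarrow> nat)) set"
  for L n s where
    base: "i < n \<Longrightarrow> (s i, (\<lambda>_. 0)(i := 1)) \<in> ad_words L n s"
  | step: "i < n \<Longrightarrow> (x, m) \<in> ad_words L n s \<Longrightarrow> (bracket L (s i) x, m(i := Suc (m i))) \<in> ad_words L n s"

text \<open>Interpreted twice in a Kac-Moody algebra, with the \<open>e_i\<close> and the simple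
  roots and with the \<open>f_i\<close> and their negatives, so that each argument about words is
  made once for both halves.\<close>

locale half_generators = liealg L for L :: "'g lie_alg" (structure) +
  fixes H :: "'g set" and n :: nat and s :: "nat \<Rightarrow> 'g" and \<beta> :: "nat \<Rightarrow> 'g \<Rightarrow> complex"
  assumes H: "subsp L H"
    and s_carrier: "i < n \<Longrightarrow> s i \<in> carrier L"
    and H_s: "h \<in> H \<Longrightarrow> i < n \<Longrightarrow> br h (s i) = \<beta> i h \<odot>\<^bsub>L\<^esub> s i"
begin

abbreviation "W \<equiv> ad_words L n s"

lemma H_carrier: "h \<in> H \<Longrightarrow> h \<in> carrier L"
  using subspD(1)[OF H] by blast

lemma word_carrier: "(x, m) \<in> W \<Longrightarrow> x \<in> carrier L"
  by (induction rule: ad_words.induct) (auto simp: s_carrier)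

lemma words_carrier: "fst ` W \<subseteq> carrier L"
  using word_carrier by auto

lemma word_degree: "(x, m) \<in> W \<Longrightarrow> (\<forall>i\<ge>n. m i = 0) \<and> (\<exists>i<n. m i \<noteq> 0)"
  by (induction rule: ad_words.induct) auto

lemma word_weight: "(x, m) \<in> W \<Longrightarrow> h \<in> H \<Longrightarrow> br h x = (\<Sum>i<n. of_nat (m i) * \<beta> i h) \<odot>\<^bsub>L\<^esub> x"
proof (induction rule: ad_words.induct)
  case (base i)
  have "(\<Sum>j<n. of_nat (((\<lambda>_. 0)(i := 1)) j) * \<beta> j h) = (\<Sum>j<n. if j = i then \<beta> j h else 0)"
    by (intro sum.cong) auto
  also have "\<dots> = \<beta> i h" using base by (simp add: sum.delta)
  finally show ?case using base H_s by simp
next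
  case (step i x m)
  note c = s_carrier[OF step(1)] word_carrier[OF step(2)] H_carrier[OF step(4)]
  have "(\<Sum>j<n. of_nat ((m(i := Suc (m i))) j) * \<beta> j h) =
      (\<Sum>j<n. of_nat (m j) * \<beta> j h + (if j = i then \<beta> j h else 0))"
    by (intro sum.cong) (auto simp: algebra_simps)
  also have "\<dots> = (\<Sum>j<n. of_nat (m j) * \<beta> j h) + \<beta> i h"
    using step(1) by (simp add: sum.distrib sum.delta)
  finally have e: "(\<Sum>j<n. of_nat ((m(i := Suc (m i))) j) * \<beta> j h) = (\<Sum>j<n. of_nat (m j) * \<beta> j h) + \<beta> i h" .
  have "br h (br (s i) x) = br (br h (s i)) x \<oplus> br (s i) (br h x)"
    using c by (intro br_leibniz)
  also have "\<dots> = \<beta> i h \<odot>\<^bsub>L\<^esub> br (s i) x \<oplus> (\<Sum>j<n. of_nat (m j) * \<beta> j h) \<odot>\<^bsub>L\<^esub> br (s i) x"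
    using c H_s[OF step(4,1)] step.IH[OF step(4)] by (simp add: br_smult_l br_smult_r)
  finally show ?case using c by (simp only: e s_ladd br_closed a_comm s_closed)
qed

lemma span_HW: "subsp L (cspan L (H \<union> fst ` W))"
  "h \<in> H \<Longrightarrow> h \<in> cspan L (H \<union> fst ` W)" "(x, m) \<in> W \<Longrightarrow> x \<in> cspan L (H \<union> fst ` W)"
proof -
  have sub: "H \<union> fst ` W \<subseteq> carrier L" using H_carrier words_carrier by auto
  show "subsp L (cspan L (H \<union> fst ` W))" by (rule span_subsp[OF sub])
  show "h \<in> H \<Longrightarrow> h \<in> cspan L (H \<union> fst ` W)" by (rule span_base[OF sub]) simp
  show "(x, m) \<in> W \<Longrightarrow> x \<in> cspan L (H \<union> fst ` W)" by (rule span_base[OF sub]) force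
qed

lemma ad_s_span:
  assumes i: "i < n" and y: "y \<in> cspan L (H \<union> fst ` W)"
  shows "br (s i) y \<in> cspan L (H \<union> fst ` W)"
proof -
  let ?S = "cspan L (H \<union> fst ` W)"
  have "?S \<subseteq> {y \<in> carrier L. br (s i) y \<in> ?S}"
  proof (rule span_least)
    show "subsp L {y \<in> carrier L. br (s i) y \<in> ?S}"
      by (rule lin_vimage_subsp[OF br_lin_r[OF s_carrier[OF i]] cvs_axioms cvs_axioms span_HW(1)])
    show "H \<union> fst ` W \<subseteq> {y \<in> carrier L. br (s i) y \<in> ?S}"
    proof (intro Un_least subsetI CollectI conjI)
      fix h assume h: "h \<in> H"
      show "h \<in> carrier L" by (rule H_carrier[OF h])
      have "br (s i) h = (- 1) \<odot>\<^bsub>L\<^esub> (\<beta> i h \<odot>\<^bsub>L\<^esub> s i)"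
        using br_anti[OF s_carrier[OF i] H_carrier[OF h]] H_s[OF h i] by simp
      then show "br (s i) h \<in> ?S"
        using subspD(4)[OF span_HW(1)] span_HW(3)[OF ad_words.base[OF i]] by simp
    next
      fix x assume "x \<in> fst ` W"
      then obtain m where xm: "(x, m) \<in> W" by auto
      show "x \<in> carrier L" by (rule word_carrier[OF xm])
      show "br (s i) x \<in> ?S" by (rule span_HW(3)[OF ad_words.step[OF i xm]])
    qed
  qed
  then show ?thesis using y by blast
qed

lemma ad_H_word: "(x, m) \<in> W \<Longrightarrow> h \<in> H \<Longrightarrow> br h x \<in> cspan L (H \<union> fst ` W)"
  using word_weight subspD(4)[OF span_HW(1)] span_HW(3) by simp

text \<open>Meant for \<open>y\<close> among the generators of the other half. By the Leibniz rule,
  \<open>y\<close> passes one letter of the word at a time; meeting that letter leaves an element of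
  \<open>H\<close>, which acts on the rest by a scalar. A word of length one ends in
  \<open>H\<close> itself, whence \<open>H\<close> in the span.\<close>

lemma ad_opposite_word:
  assumes y: "y \<in> carrier L" and H_y: "\<And>j. j < n \<Longrightarrow> br y (s j) \<in> H"
    and xm: "(x, m) \<in> W"
  shows "br y x \<in> cspan L (H \<union> fst ` W)"
  using xm
proof (induction rule: ad_words.induct)
  case (base i)
  then show ?case using H_y span_HW(2) by blast
next
  case (step i x m)
  note c = s_carrier[OF step(1)] word_carrier[OF step(2)]
  have "br y (br (s i) x) = br (br y (s i)) x \<oplus> br (s i) (br y x)"
    using c y by (intro br_leibniz)
  then show ?case
    using subspD(3)[OF span_HW(1)] ad_H_word[OF step(2) H_y[OF step(1)]] ad_s_span[OF step(1) step.IH] by simp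
qed

end

section \<open>Spanning sets of a Kac-Moody algebra and of its derived algebra\<close>

context kac_moody begin

abbreviation "\<gg> \<equiv> km_alg D"
abbreviation "\<hh> \<equiv> km_csa D"
abbreviation "E \<equiv> fst ` ad_words \<gg> (km_rank D) (km_e D)"
abbreviation "F \<equiv> fst ` ad_words \<gg> (km_rank D) (km_f D)"

sublocale liealg \<gg> by (rule liealgI[OF lie])

sublocale e: half_generators \<gg> \<hh> "km_rank D" "km_e D" "km_root D"
  using csa_subspace e_carrier rel_he
  by (simp add: half_generators_def half_generators_axioms_def liealg_axioms)

sublocale f: half_generators \<gg> \<hh> "km_rank D" "km_f D" "\<lambda>i h. - km_root D i h"
  using csa_subspace f_carrier rel_hf
  by (simp add: half_generators_def half_generators_axioms_def liealg_axioms)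

lemma ef_csa: "i < km_rank D \<Longrightarrow> j < km_rank D \<Longrightarrow> br (km_e D i) (km_f D j) \<in> \<hh>"
  using rel_ef coroot_csa subspD(2)[OF csa_subspace] by simp

lemma fe_csa: "i < km_rank D \<Longrightarrow> j < km_rank D \<Longrightarrow> br (km_f D i) (km_e D j) \<in> \<hh>"
  using ef_csa[of j i] subspD(4)[OF csa_subspace] by (subst br_anti) (auto simp: e_carrier f_carrier)

abbreviation "HEF \<equiv> \<hh> \<union> E \<union> F"

lemma HEF_carrier: "HEF \<subseteq> carrier \<gg>"
  using e.words_carrier f.words_carrier subspD(1)[OF csa_subspace] by blast

text \<open>A generator lengthens the words of its own half; a word of the other half is handled by
  \<open>ad_opposite_word\<close>, because brackets of an \<open>e_i\<close> with an
  \<open>f_j\<close> lie in \<hh>.\<close>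

lemma ad_generator_HEF:
  assumes t: "t \<in> \<hh> \<union> km_e D ` {..<km_rank D} \<union> km_f D ` {..<km_rank D}" and x: "x \<in> HEF"
  shows "br t x \<in> cspan \<gg> HEF"
proof -
  have mono: "cspan \<gg> (\<hh> \<union> E) \<subseteq> cspan \<gg> HEF" "cspan \<gg> (\<hh> \<union> F) \<subseteq> cspan \<gg> HEF"
    by (rule module.span_is_monotone[OF module]; blast)+
  have "br t x \<in> cspan \<gg> (\<hh> \<union> E) \<union> cspan \<gg> (\<hh> \<union> F)"
    using t
  proof (elim UnE imageE)
    assume t: "t \<in> \<hh>"
    from x show ?thesis
    proof (elim UnE)
      assume "x \<in> \<hh>"
      then show ?thesis using rel_hh[OF t] subspD(2)[OF e.span_HW(1)] by simp
    qed (use t e.ad_H_word f.ad_H_word in auto)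
  next
    fix i assume i: "i \<in> {..<km_rank D}" and t: "t = km_e D i"
    from x show ?thesis
    proof (elim UnE)
      assume "x \<in> \<hh>"
      then show ?thesis using e.ad_s_span e.span_HW(2) i t by blast
    next
      assume "x \<in> E"
      then show ?thesis using e.ad_s_span e.span_HW(3) i t by auto
    next
      assume "x \<in> F"
      then obtain m where "(x, m) \<in> ad_words \<gg> (km_rank D) (km_f D)" by auto
      then show ?thesis using f.ad_opposite_word[of t x m] ef_csa e_carrier i t by simp
    qed
  next
    fix i assume i: "i \<in> {..<km_rank D}" and t: "t = km_f D i"
    from x show ?thesis
    proof (elim UnE)
      assume "x \<in> \<hh>"
      then show ?thesis using f.ad_s_span f.span_HW(2) i t by blast
    next
      assume "x \<in> F"
      then show ?thesis using f.ad_s_span f.span_HW(3) i t by auto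
    next
      assume "x \<in> E"
      then obtain m where "(x, m) \<in> ad_words \<gg> (km_rank D) (km_e D)" by auto
      then show ?thesis using e.ad_opposite_word[of t x m] fe_csa f_carrier i t by simp
    qed
  qed
  with mono show ?thesis by blast
qed

text \<open>The normalizer of the span of \<open>\<hh>\<close> and the words contains the generators, hence is everything;
  so that span is itself a subalgebra.\<close>

lemma span_HEF: "cspan \<gg> HEF = carrier \<gg>"
proof -
  let ?S = "cspan \<gg> HEF"
  let ?G = "\<hh> \<union> km_e D ` {..<km_rank D} \<union> km_f D ` {..<km_rank D}"
  let ?N = "{t \<in> carrier \<gg>. \<forall>x\<in>?S. br t x \<in> ?S}"
  have S: "subsp \<gg> ?S" by (rule span_subsp[OF HEF_carrier])
  have SC: "x \<in> carrier \<gg>" if "x \<in> ?S" for x using subspD(1)[OF S] that by blast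
  have G: "?G \<subseteq> carrier \<gg>"
    using subspD(1)[OF csa_subspace] e_carrier f_carrier by auto
  have "?G \<subseteq> ?N"
  proof
    fix t assume t: "t \<in> ?G"
    then have tc: "t \<in> carrier \<gg>" using G by blast
    have "?S \<subseteq> {x \<in> carrier \<gg>. br t x \<in> ?S}"
    proof (rule span_least)
      show "subsp \<gg> {x \<in> carrier \<gg>. br t x \<in> ?S}"
        by (rule lin_vimage_subsp[OF br_lin_r[OF tc] cvs_axioms cvs_axioms S])
      show "HEF \<subseteq> {x \<in> carrier \<gg>. br t x \<in> ?S}"
        using ad_generator_HEF[OF t] HEF_carrier by blast
    qed
    with tc show "t \<in> ?N" by blast
  qed
  moreover have "lie_subalgebra \<gg> ?N"
    unfolding lie_subalgebra_def
  proof (intro conjI ballI)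
    show "subsp \<gg> ?N"
      by (rule subsp_I) (use SC subspD[OF S] in \<open>auto simp: br_add_l br_smult_l\<close>)
    fix t u assume t: "t \<in> ?N" and u: "u \<in> ?N"
    have "br (br t u) x \<in> ?S" if x: "x \<in> ?S" for x
    proof -
      have "br (br t u) x = br t (br u x) \<ominus>\<^bsub>\<gg>\<^esub> br u (br t x)"
        using t u SC[OF x] br_leibniz[of t u x] by simp
      then show ?thesis
        using t u x subspD_minus[OF S] by simp
    qed
    with t u show "br t u \<in> ?N" by simp
  qed
  ultimately have N: "?N = carrier \<gg>" by (intro generated)
  have "lie_subalgebra \<gg> ?S"
    unfolding lie_subalgebra_def using S SC N by blast
  moreover have "?G \<subseteq> ?S"
  proof -
    have "km_e D i \<in> E" "km_f D i \<in> F" if "i < km_rank D" for i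
      using ad_words.base[where L = \<gg> and s = "km_e D", OF that] ad_words.base[where L = \<gg> and s = "km_f D", OF that]
      by (metis fst_conv imageI)+
    then have "?G \<subseteq> HEF" by blast
    then show ?thesis using span_base[OF HEF_carrier] by blast
  qed
  ultimately show ?thesis by (rule generated)
qed

lemma derived_subsp: "subsp \<gg> (derived D)"
  unfolding derived_def by (rule span_subsp) auto

lemma derived_carrier: "x \<in> derived D \<Longrightarrow> x \<in> carrier \<gg>"
  using subspD(1)[OF derived_subsp] by blast

lemma br_derived: "x \<in> carrier \<gg> \<Longrightarrow> y \<in> carrier \<gg> \<Longrightarrow> br x y \<in> derived D"
  unfolding derived_def by (rule span_base) auto

text \<open>Division by the eigenvalue exhibits \<open>x\<close> as a multiple of the bracket
  \<open>br h x\<close>.\<close>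

lemma eigenvector_derived:
  assumes "h \<in> carrier \<gg>" "x \<in> carrier \<gg>" "br h x = c \<odot>\<^bsub>\<gg>\<^esub> x" "c \<noteq> 0"
  shows "x \<in> derived D"
proof -
  have "inverse c \<odot>\<^bsub>\<gg>\<^esub> br h x = x"
    using assms by (simp add: s_mult[symmetric])
  then show ?thesis
    using subspD(4)[OF derived_subsp br_derived[OF assms(1,2)], of "inverse c"] by simp
qed

text \<open>Independence of the simple roots keeps a positive root from vanishing on all of \<hh>.
  Its root vectors, and those of its negative, are then eigenvectors with nonzero eigenvalue for
  some \<open>h\<close>, hence lie in \<gg>'.\<close>

lemma pos_root_nonzero:
  assumes "m \<in> pos_roots D" obtains h where "h \<in> \<hh>" "root_of D m h \<noteq> 0"
proof -
  obtain i where i: "i < km_rank D" "m i \<noteq> 0" using assms by (auto simp: pos_roots_def)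
  have "\<exists>h\<in>\<hh>. root_of D m h \<noteq> 0"
  proof (rule ccontr)
    assume "\<not> ?thesis"
    then have "of_nat (m i) = (0::complex)"
      using root_indep[of "\<lambda>i. of_nat (m i)" i] i(1) by (auto simp: root_of_def)
    with i show False by simp
  qed
  with that show ?thesis by blast
qed

lemma root_space_derived:
  assumes m: "m \<in> pos_roots D"
  shows "root_space D (root_of D m) \<subseteq> derived D" "root_space D (\<lambda>h. - root_of D m h) \<subseteq> derived D"
proof -
  obtain h where h: "h \<in> \<hh>" "root_of D m h \<noteq> 0" using m by (rule pos_root_nonzero)
  show "root_space D (root_of D m) \<subseteq> derived D" "root_space D (\<lambda>h. - root_of D m h) \<subseteq> derived D"
    using eigenvector_derived[OF e.H_carrier[OF h(1)]] h by (auto simp: root_space_def)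
qed

lemma N_plus_derived: "N_plus D \<subseteq> derived D"
  unfolding N_plus_def
  by (rule span_least[OF _ derived_subsp]) (use root_space_derived in blast)

text \<open>A nonzero word in the \<open>e_i\<close> is itself the witness that its multidegree is a
  positive root. This ties words, which span, to \<open>pos_roots\<close>, in terms of which
  \<open>N_plus\<close> is defined.\<close>

lemma word_root_space:
  assumes "(x, m) \<in> ad_words \<gg> (km_rank D) (km_e D)"
  shows "x \<in> root_space D (root_of D m)" and "x \<noteq> \<zero>\<^bsub>\<gg>\<^esub> \<Longrightarrow> m \<in> pos_roots D"
proof -
  show x: "x \<in> root_space D (root_of D m)"
    using e.word_carrier[OF assms] e.word_weight[OF assms] by (simp add: root_space_def root_of_def)
  show "m \<in> pos_roots D" if "x \<noteq> \<zero>\<^bsub>\<gg>\<^esub>"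
    using x that e.word_degree[OF assms] by (auto simp: pos_roots_def)
qed

lemma coroot_root: "i < km_rank D \<Longrightarrow> km_root D i (km_coroot D i) = 2"
  using cartan by (simp add: generalized_cartan_matrix_def cartan_matrix_def)

lemma ef_derived:
  assumes i: "i < km_rank D" shows "km_e D i \<in> derived D" "km_f D i \<in> derived D"
  using eigenvector_derived[OF e.H_carrier[OF coroot_csa[OF i]] e_carrier[OF i], of 2]
    eigenvector_derived[OF e.H_carrier[OF coroot_csa[OF i]] f_carrier[OF i], of "- 2"]
    rel_he[OF coroot_csa[OF i] i] rel_hf[OF coroot_csa[OF i] i] coroot_root[OF i] by simp_all

text \<open>If \<open>e_i\<close> were zero, so would be the coroot, which is its bracket with
  \<open>f_i\<close>; but the root \<open>\<alpha>_i\<close> takes the value 2 there.\<close>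

lemma simple_root:
  assumes i: "i < km_rank D"
  shows "(\<lambda>_. 0)(i := 1) \<in> pos_roots D"
    and "km_f D i \<in> root_space D (\<lambda>h. - root_of D ((\<lambda>_. 0)(i := 1)) h)"
proof -
  have "km_e D i \<noteq> \<zero>\<^bsub>\<gg>\<^esub>"
  proof
    assume "km_e D i = \<zero>\<^bsub>\<gg>\<^esub>"
    then have "km_coroot D i = \<zero>\<^bsub>\<gg>\<^esub>"
      using rel_ef[OF i i] f_carrier[OF i] by simp
    then have "0 \<odot>\<^bsub>\<gg>\<^esub> km_coroot D i = km_coroot D i" by simp
    then have "km_root D i (km_coroot D i) = 0 * km_root D i (km_coroot D i)"
      using linD(3)[OF root_linear[OF i, unfolded functionals_def], of "km_coroot D i" 0] coroot_csa[OF i]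
      by (simp add: CC_mod_def)
    then show False using coroot_root[OF i] by simp
  qed
  with word_root_space(2)[OF ad_words.base[OF i]]
  show "(\<lambda>_. 0)(i := 1) \<in> pos_roots D" by blast
  have "root_of D ((\<lambda>_. 0)(i := 1)) h = km_root D i h" for h
  proof -
    have "root_of D ((\<lambda>_. 0)(i := 1)) h = (\<Sum>j<km_rank D. if j = i then km_root D j h else 0)"
      unfolding root_of_def by (intro sum.cong) auto
    then show ?thesis using i by (simp add: sum.delta)
  qed
  then show "km_f D i \<in> root_space D (\<lambda>h. - root_of D ((\<lambda>_. 0)(i := 1)) h)"
    using i f_carrier rel_hf by (simp add: root_space_def)
qed

text \<open>Shaped for a highest weight vector, which treats the two halves differently: whole
  positive root spaces are available at once, while the negative half is reached from the
  \<open>f_i\<close> by repeated brackets.\<close>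

lemma derived_subset:
  assumes N: "subsp \<gg> N" and H: "csa_derived D \<subseteq> N"
    and pos: "\<And>m. m \<in> pos_roots D \<Longrightarrow> root_space D (root_of D m) \<subseteq> N"
    and f: "\<And>i. i < km_rank D \<Longrightarrow> km_f D i \<in> N"
    and ad_f: "\<And>i x. i < km_rank D \<Longrightarrow> x \<in> N \<Longrightarrow> x \<in> derived D \<Longrightarrow> br (km_f D i) x \<in> N"
  shows "derived D \<subseteq> N"
proof
  fix x assume x: "x \<in> derived D"
  \<comment> \<open>The known spanning set involves all of \<hh>, whereas \<open>N\<close> is only
    assumed to contain \<hh>'. The Cartan part is therefore kept apart from the part in
    \<open>N\<close>.\<close>
  let ?R = "{h \<oplus>\<^bsub>\<gg>\<^esub> y | h y. h \<in> \<hh> \<and> y \<in> N \<inter> derived D}"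
  have hc: "h \<in> carrier \<gg>" if "h \<in> \<hh>" for h using that e.H_carrier by blast
  have R: "subsp \<gg> ?R"
  proof (rule subsp_I)
    show "?R \<subseteq> carrier \<gg>" using hc derived_carrier by auto
    show "\<zero>\<^bsub>\<gg>\<^esub> \<in> ?R"
      by (rule CollectI, intro exI[of _ "\<zero>\<^bsub>\<gg>\<^esub>"])
        (simp add: subspD(2)[OF N] subspD(2)[OF derived_subsp] subspD(2)[OF csa_subspace])
    fix c u assume "u \<in> ?R"
    then obtain h y where u: "u = h \<oplus>\<^bsub>\<gg>\<^esub> y" "h \<in> \<hh>" "y \<in> N" "y \<in> derived D" by blast
    then have "c \<odot>\<^bsub>\<gg>\<^esub> u = c \<odot>\<^bsub>\<gg>\<^esub> h \<oplus>\<^bsub>\<gg>\<^esub> c \<odot>\<^bsub>\<gg>\<^esub> y"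
      using hc derived_carrier by (simp add: s_radd)
    then show "c \<odot>\<^bsub>\<gg>\<^esub> u \<in> ?R"
      using u subspD(4)[OF N] subspD(4)[OF derived_subsp] subspD(4)[OF csa_subspace] by blast
    fix u' assume "u' \<in> ?R"
    then obtain h' y' where u': "u' = h' \<oplus>\<^bsub>\<gg>\<^esub> y'" "h' \<in> \<hh>" "y' \<in> N" "y' \<in> derived D" by blast
    then have "u \<oplus>\<^bsub>\<gg>\<^esub> u' = (h \<oplus>\<^bsub>\<gg>\<^esub> h') \<oplus>\<^bsub>\<gg>\<^esub> (y \<oplus>\<^bsub>\<gg>\<^esub> y')"
      using u hc derived_carrier by (simp add: a_ac)
    then show "u \<oplus>\<^bsub>\<gg>\<^esub> u' \<in> ?R"
      using u u' subspD(3)[OF N] subspD(3)[OF derived_subsp] subspD(3)[OF csa_subspace] by blast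
  qed
  have word: "y \<in> ?R" if "y = \<zero>\<^bsub>\<gg>\<^esub> \<or> y \<in> N \<inter> derived D" for y
  proof -
    have "y \<in> N \<inter> derived D" using that subspD(2)[OF N] subspD(2)[OF derived_subsp] by auto
    moreover then have "y = \<zero>\<^bsub>\<gg>\<^esub> \<oplus>\<^bsub>\<gg>\<^esub> y" using derived_carrier by simp
    ultimately show ?thesis using subspD(2)[OF csa_subspace] by blast
  qed
  have "HEF \<subseteq> ?R"
  proof (intro Un_least subsetI)
    fix h assume h: "h \<in> \<hh>"
    then have "h = h \<oplus>\<^bsub>\<gg>\<^esub> \<zero>\<^bsub>\<gg>\<^esub>" using hc by simp
    then show "h \<in> ?R" using h subspD(2)[OF N] subspD(2)[OF derived_subsp] by blast
  next
    fix y assume "y \<in> E"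
    then obtain m where "(y, m) \<in> ad_words \<gg> (km_rank D) (km_e D)" by auto
    from word_root_space[OF this] pos[of m] root_space_derived(1)[of m] show "y \<in> ?R"
      by (intro word) blast
  next
    fix y assume "y \<in> F"
    then obtain m where "(y, m) \<in> ad_words \<gg> (km_rank D) (km_f D)" by auto
    then have "y \<in> N \<inter> derived D"
      by (induction rule: ad_words.induct)
        (use f ad_f ef_derived br_derived f_carrier derived_carrier in auto)
    then show "y \<in> ?R" by (intro word) blast
  qed
  then have "carrier \<gg> \<subseteq> ?R" unfolding span_HEF[symmetric] by (rule span_least[OF _ R])
  then obtain h y where hy: "x = h \<oplus>\<^bsub>\<gg>\<^esub> y" "h \<in> \<hh>" "y \<in> N" "y \<in> derived D"
    using x derived_carrier by blast
  \<comment> \<open>Only here does the Cartan part return to \<hh>': it is a difference of two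
    elements of \<gg>'.\<close>
  then have h_eq: "h = x \<ominus>\<^bsub>\<gg>\<^esub> y" using hc derived_carrier by simp
  have "h \<in> derived D"
    by (subst h_eq) (rule subspD_minus[OF derived_subsp x hy(4)])
  then have "h \<in> csa_derived D"
    unfolding csa_derived_def using hy by simp
  then show "x \<in> N" using H hy subspD(3)[OF N] by blast
qed

end

section \<open>Powers of coprime ideals\<close>

context cring begin

abbreviation ideal_pow :: "'a set \<Rightarrow> nat \<Rightarrow> 'a set"
  where "ideal_pow I n \<equiv> I [^]\<^bsub>ideals_set R\<^esub> n"

lemma ideals_monoid: "Group.monoid (ideals_set R)"
  using ideals_set_is_comm_monoid by (rule comm_monoid.axioms(1))

lemma ideal_pow_ideal: "ideal I R \<Longrightarrow> ideal (ideal_pow I n) R"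
  using monoid.nat_pow_closed[OF ideals_monoid, of I n] by (simp add: ideals_set_def)

lemma ideal_pow_add: "ideal I R \<Longrightarrow> ideal_pow I (m + n) = ideal_prod R (ideal_pow I m) (ideal_pow I n)"
  using monoid.nat_pow_mult[OF ideals_monoid, of I m n] by (simp add: ideals_set_def)

lemma ideal_pow_mono: "ideal I R \<Longrightarrow> m \<le> n \<Longrightarrow> ideal_pow I n \<subseteq> ideal_pow I m"
  using ideal_pow_add[of I m "n - m"] ideal_prod_inter[OF ideal_pow_ideal ideal_pow_ideal, of I I m "n - m"]
  by auto

lemma ideal_pow_one: "ideal I R \<Longrightarrow> ideal_pow I 1 = I"
  using monoid.nat_pow_eone[OF ideals_monoid, of I] by (simp add: ideals_set_def)

lemma ideal_pow_prod: "ideal I R \<Longrightarrow> ideal J R \<Longrightarrow>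
    ideal_pow (ideal_prod R I J) n = ideal_prod R (ideal_pow I n) (ideal_pow J n)"
  using monoid.pow_mult_distrib[OF ideals_monoid, of I J n] ideal_prod_commute[of I J]
  by (simp add: ideals_set_def)

text \<open>By induction, multiplying a decomposition of the unit for the exponent \<open>n\<close>
  with one for the exponent 1.\<close>

lemma coprime_ideal_pow:
  assumes I: "ideal I R" and J: "ideal J R" and IJ: "I <+>\<^bsub>R\<^esub> J = carrier R"
  shows "I <+>\<^bsub>R\<^esub> ideal_pow J n = carrier R"
proof (induction n)
  case 0
  have "ideal_pow J 0 = carrier R" by (simp add: ideals_set_def nat_pow_def)
  then have "\<one> \<in> I <+>\<^bsub>R\<^esub> ideal_pow J 0"
    using additive_subgroup.zero_closed[OF ideal.axioms(1)[OF I]] l_zero[OF one_closed]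
    unfolding set_add_def' by fastforce
  then show ?case
    using ideal.one_imp_carrier[OF add_ideals[OF I ideal_pow_ideal[OF J]]] by blast
next
  case (Suc n)
  note Jn = ideal_pow_ideal[OF J, of n]
  obtain i j where ij: "i \<in> I" "j \<in> J" "\<one> = i \<oplus> j"
    using IJ one_closed unfolding set_add_def' by blast
  obtain i' j' where ij': "i' \<in> I" "j' \<in> ideal_pow J n" "\<one> = i' \<oplus> j'"
    using Suc one_closed unfolding set_add_def' by blast
  note c = ideal.Icarr[OF I ij(1)] ideal.Icarr[OF J ij(2)] ideal.Icarr[OF I ij'(1)] ideal.Icarr[OF Jn ij'(2)]
  \<comment> \<open>Of the four products only \<open>j' \<otimes> j\<close> need not lie in
    \<open>I\<close>, and that one lies in the next power of \<open>J\<close>.\<close>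
  have "\<one> = (i' \<oplus> j') \<otimes> (i \<oplus> j)" using ij(3)[symmetric] ij'(3)[symmetric] by simp
  also have "\<dots> = (i' \<oplus> j' \<otimes> i) \<oplus> j' \<otimes> j"
  proof -
    have "(i' \<oplus> j') \<otimes> (i \<oplus> j) = i' \<otimes> (i \<oplus> j) \<oplus> j' \<otimes> (i \<oplus> j)"
      using c by (intro l_distr) auto
    also have "\<dots> = i' \<oplus> (j' \<otimes> i \<oplus> j' \<otimes> j)"
      using c r_distr[of i j j'] by (simp flip: ij(3))
    finally show ?thesis using c by (simp add: a_assoc)
  qed
  finally have one: "\<one> = (i' \<oplus> j' \<otimes> i) \<oplus> j' \<otimes> j" .
  have "i' \<oplus> j' \<otimes> i \<in> I"
    using ij(1) ij'(1) c I by (meson additive_subgroup.a_closed ideal.I_l_closed ideal.axioms(1))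
  moreover have "j' \<otimes> j \<in> ideal_pow J (Suc n)"
    using ideal_prod.prod[OF ij'(2) ij(2), of R] by (simp add: ideals_set_def nat_pow_def)
  ultimately have "\<one> \<in> I <+>\<^bsub>R\<^esub> ideal_pow J (Suc n)"
    unfolding set_add_def' using one by blast
  then show ?case
    using ideal.one_imp_carrier[OF add_ideals[OF I ideal_pow_ideal[OF J]]] by blast
qed

text \<open>One ideal is raised at a time: first \<open>I\<close> against \<open>J\<close>, then
  \<open>J\<close> against the ideal \<open>ideal_pow I n\<close>.\<close>

lemma coprime_ideal_pows:
  assumes I: "ideal I R" and J: "ideal J R" and IJ: "I <+>\<^bsub>R\<^esub> J = carrier R"
  shows "ideal_pow I n <+>\<^bsub>R\<^esub> ideal_pow J n = carrier R"
proof -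
  note In = ideal_pow_ideal[OF I, of n]
  have ideal_sub: "N \<subseteq> carrier R" if "ideal N R" for N
    using ideal.Icarr[OF that] by blast
  have "ideal_pow I n <+>\<^bsub>R\<^esub> J = carrier R"
    using coprime_ideal_pow[OF J I, of n] IJ set_add_comm[OF ideal_sub[OF I] ideal_sub[OF J]]
      set_add_comm[OF ideal_sub[OF In] ideal_sub[OF J]] by simp
  from coprime_ideal_pow[OF In J this] show ?thesis .
qed

end

section \<open>The current algebra\<close>

locale loop_data = kac_moody D for D :: "'g km_datum" +
  fixes A :: "(complex, 'a) module" and H2 :: "'g set"
  assumes algebra: "Module.algebra CC A" and complement: "csa_complement D H2"
begin

lemma A_cring: "cring A"
  using algebra by (simp add: Module.algebra_def)

sublocale A: cvs A
  using algebra class_field by (simp add: cvs_def vectorspace_def Module.algebra_def)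

lemma A_mult_closed [simp]: "a \<in> carrier A \<Longrightarrow> b \<in> carrier A \<Longrightarrow> a \<otimes>\<^bsub>A\<^esub> b \<in> carrier A"
  and A_one_closed [simp]: "\<one>\<^bsub>A\<^esub> \<in> carrier A"
  and A_one [simp]: "a \<in> carrier A \<Longrightarrow> \<one>\<^bsub>A\<^esub> \<otimes>\<^bsub>A\<^esub> a = a" "a \<in> carrier A \<Longrightarrow> a \<otimes>\<^bsub>A\<^esub> \<one>\<^bsub>A\<^esub> = a"
  and A_assoc: "a \<in> carrier A \<Longrightarrow> b \<in> carrier A \<Longrightarrow> c \<in> carrier A \<Longrightarrow>
    (a \<otimes>\<^bsub>A\<^esub> b) \<otimes>\<^bsub>A\<^esub> c = a \<otimes>\<^bsub>A\<^esub> (b \<otimes>\<^bsub>A\<^esub> c)"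
  and A_comm: "a \<in> carrier A \<Longrightarrow> b \<in> carrier A \<Longrightarrow> a \<otimes>\<^bsub>A\<^esub> b = b \<otimes>\<^bsub>A\<^esub> a"
  and A_l_distr: "a \<in> carrier A \<Longrightarrow> b \<in> carrier A \<Longrightarrow> c \<in> carrier A \<Longrightarrow>
    (a \<oplus>\<^bsub>A\<^esub> b) \<otimes>\<^bsub>A\<^esub> c = a \<otimes>\<^bsub>A\<^esub> c \<oplus>\<^bsub>A\<^esub> b \<otimes>\<^bsub>A\<^esub> c"
  and A_r_distr: "a \<in> carrier A \<Longrightarrow> b \<in> carrier A \<Longrightarrow> c \<in> carrier A \<Longrightarrow>
    c \<otimes>\<^bsub>A\<^esub> (a \<oplus>\<^bsub>A\<^esub> b) = c \<otimes>\<^bsub>A\<^esub> a \<oplus>\<^bsub>A\<^esub> c \<otimes>\<^bsub>A\<^esub> b"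
proof -
  interpret R: cring A by (rule A_cring)
  show "a \<in> carrier A \<Longrightarrow> b \<in> carrier A \<Longrightarrow> a \<otimes>\<^bsub>A\<^esub> b \<in> carrier A" "\<one>\<^bsub>A\<^esub> \<in> carrier A"
    "a \<in> carrier A \<Longrightarrow> \<one>\<^bsub>A\<^esub> \<otimes>\<^bsub>A\<^esub> a = a" "a \<in> carrier A \<Longrightarrow> a \<otimes>\<^bsub>A\<^esub> \<one>\<^bsub>A\<^esub> = a"
    by simp_all
  show "a \<in> carrier A \<Longrightarrow> b \<in> carrier A \<Longrightarrow> c \<in> carrier A \<Longrightarrow> (a \<otimes>\<^bsub>A\<^esub> b) \<otimes>\<^bsub>A\<^esub> c = a \<otimes>\<^bsub>A\<^esub> (b \<otimes>\<^bsub>A\<^esub> c)"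
    by (rule R.m_assoc)
  show "a \<in> carrier A \<Longrightarrow> b \<in> carrier A \<Longrightarrow> a \<otimes>\<^bsub>A\<^esub> b = b \<otimes>\<^bsub>A\<^esub> a"
    by (rule R.m_comm)
  show "a \<in> carrier A \<Longrightarrow> b \<in> carrier A \<Longrightarrow> c \<in> carrier A \<Longrightarrow>
    (a \<oplus>\<^bsub>A\<^esub> b) \<otimes>\<^bsub>A\<^esub> c = a \<otimes>\<^bsub>A\<^esub> c \<oplus>\<^bsub>A\<^esub> b \<otimes>\<^bsub>A\<^esub> c"
    by (rule R.l_distr)
  show "a \<in> carrier A \<Longrightarrow> b \<in> carrier A \<Longrightarrow> c \<in> carrier A \<Longrightarrow>
    c \<otimes>\<^bsub>A\<^esub> (a \<oplus>\<^bsub>A\<^esub> b) = c \<otimes>\<^bsub>A\<^esub> a \<oplus>\<^bsub>A\<^esub> c \<otimes>\<^bsub>A\<^esub> b"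
    by (rule R.r_distr)
qed

lemma A_lin_l: "b \<in> carrier A \<Longrightarrow> lin A A (\<lambda>a. a \<otimes>\<^bsub>A\<^esub> b)"
  using algebra by (intro linI) (auto simp: A_l_distr Module.algebra_def algebra_axioms_def class_ring_simps)

lemma A_lin_r: "a \<in> carrier A \<Longrightarrow> lin A A (\<lambda>b. a \<otimes>\<^bsub>A\<^esub> b)"
proof (rule linI)
  show "a \<otimes>\<^bsub>A\<^esub> (c \<odot>\<^bsub>A\<^esub> b) = c \<odot>\<^bsub>A\<^esub> (a \<otimes>\<^bsub>A\<^esub> b)" if "a \<in> carrier A" "b \<in> carrier A" for c b
    using that linD(3)[OF A_lin_l[OF that(1)] that(2), of c] by (simp add: A_comm[of a])
qed (auto simp: A_r_distr)

abbreviation "\<gg>' \<equiv> \<gg>\<lparr>carrier := derived D\<rparr>"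
abbreviation "G \<equiv> loop_space D A"
abbreviation "tm x a \<equiv> loop_elem D A x a"

lemma g'_cvs: "cvs \<gg>'"
  by (rule subsp_cvs[OF derived_subsp])

sublocale LT: tensor_space \<gg>' A "{} :: unit set" "\<lambda>v _. v" "\<lambda>_ w. w"
  unfolding tensor_space_def tensor_space_axioms_def using g'_cvs A.cvs_axioms by simp

lemma LT_fold: "LT.T = G" "LT.pt = loop_elem D A"
  by (simp_all add: loop_space_def loop_elem_def fun_eq_iff)

lemmas G_cvs = LT.T_cvs[unfolded LT_fold]

sublocale G: cvs G by (rule G_cvs)

lemma le_closed [simp]: "x \<in> derived D \<Longrightarrow> a \<in> carrier A \<Longrightarrow> tm x a \<in> carrier G"
  using LT.pt_closed[unfolded LT_fold, of x a] by simp

lemmas le_lin_l = LT.pt_lin_l[unfolded LT_fold]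

lemma le_lin_r: "x \<in> derived D \<Longrightarrow> lin A G (\<lambda>a. tm x a)"
  using LT.pt_lin_r[unfolded LT_fold, of x] by simp

lemma G_eqI:
  assumes "lin G U f" "lin G U g" "cvs U"
    and "\<And>x a. x \<in> derived D \<Longrightarrow> a \<in> carrier A \<Longrightarrow> f (tm x a) = g (tm x a)"
    and "P \<in> carrier G"
  shows "f P = g P"
  using LT.tensor_eqI[unfolded LT_fold, OF assms(1-3) _ assms(5)] assms(4) by simp

lemma G_induct:
  assumes "subsp G N" "\<And>x a. x \<in> derived D \<Longrightarrow> a \<in> carrier A \<Longrightarrow> tm x a \<in> N" "P \<in> carrier G"
  shows "P \<in> N"
  using LT.T_induct[unfolded LT_fold, OF assms(1) _ assms(3)] assms(2) by simp

lemma G_lift: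
  assumes U: "cvs U" and l: "\<And>a. a \<in> carrier A \<Longrightarrow> lin \<gg>' U (\<lambda>x. \<phi> (x, a))"
    and r: "\<And>x. x \<in> derived D \<Longrightarrow> lin A U (\<lambda>a. \<phi> (x, a))"
  shows "lin G U (tensor_lift U \<phi>)"
    and "x \<in> derived D \<Longrightarrow> a \<in> carrier A \<Longrightarrow> tensor_lift U \<phi> (tm x a) = \<phi> (x, a)"
proof -
  have 0: "\<phi> (x, a) \<in> carrier U" if "x \<in> carrier \<gg>'" "a \<in> carrier A" for x a
    using linD(1)[OF l] that by simp
  have 1: "\<phi> (x \<oplus>\<^bsub>\<gg>'\<^esub> x', a) = \<phi> (x, a) \<oplus>\<^bsub>U\<^esub> \<phi> (x', a)"
    if "x \<in> carrier \<gg>'" "x' \<in> carrier \<gg>'" "a \<in> carrier A" for x x' a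
    using linD(2)[OF l[OF that(3)] that(1,2)] .
  have 2: "\<phi> (x, a \<oplus>\<^bsub>A\<^esub> a') = \<phi> (x, a) \<oplus>\<^bsub>U\<^esub> \<phi> (x, a')"
    if "x \<in> carrier \<gg>'" "a \<in> carrier A" "a' \<in> carrier A" for x a a'
    using linD(2)[OF r[of x] that(2,3)] that(1) by simp
  have 3: "\<phi> (c \<odot>\<^bsub>\<gg>'\<^esub> x, a) = c \<odot>\<^bsub>U\<^esub> \<phi> (x, a)" if "x \<in> carrier \<gg>'" "a \<in> carrier A" for c x a
    using linD(3)[OF l[OF that(2)] that(1)] .
  have 4: "\<phi> (x, c \<odot>\<^bsub>A\<^esub> a) = c \<odot>\<^bsub>U\<^esub> \<phi> (x, a)" if "x \<in> carrier \<gg>'" "a \<in> carrier A" for c x a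
    using linD(3)[OF r[of x] that(2)] that(1) by simp
  note lift = LT.tensor_lift[unfolded LT_fold, OF U 0 1 2 3 4]
  show "lin G U (tensor_lift U \<phi>)" by (rule lift(1)) auto
  show "x \<in> derived D \<Longrightarrow> a \<in> carrier A \<Longrightarrow> tensor_lift U \<phi> (tm x a) = \<phi> (x, a)"
    by (subst lift(2)) auto
qed

lemma br_lin_derived:
  "x \<in> carrier \<gg> \<Longrightarrow> lin \<gg>' \<gg>' (br x)" "y \<in> carrier \<gg> \<Longrightarrow> lin \<gg>' \<gg>' (\<lambda>x. br x y)"
  by (rule linI; simp add: br_derived derived_carrier br_add_r br_smult_r br_add_l br_smult_l)+

text \<open>The \<open>A\<close>-module structure of \<gg>' \<otimes> A. It lets a coefficient such
  as \<open>e_n\<close> be applied to an arbitrary element instead of a pure tensor only.\<close>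

definition loop_mul :: "'a \<Rightarrow> ('g \<times> 'a \<Rightarrow> complex) set \<Rightarrow> ('g \<times> 'a \<Rightarrow> complex) set" where
  "loop_mul a = tensor_lift G (\<lambda>(y, b). tm y (a \<otimes>\<^bsub>A\<^esub> b))"

lemma loop_mul:
  assumes a: "a \<in> carrier A"
  shows "lin G G (loop_mul a)"
    and "y \<in> derived D \<Longrightarrow> b \<in> carrier A \<Longrightarrow> loop_mul a (tm y b) = tm y (a \<otimes>\<^bsub>A\<^esub> b)"
proof -
  have l: "lin \<gg>' G (\<lambda>y. tm y (a \<otimes>\<^bsub>A\<^esub> b))" if "b \<in> carrier A" for b
    using a that by (intro le_lin_l) simp
  have r: "lin A G (\<lambda>b. tm y (a \<otimes>\<^bsub>A\<^esub> b))" if "y \<in> derived D" for y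
    by (rule lin_comp[OF A_lin_r[OF a] le_lin_r[OF that]])
  show "lin G G (loop_mul a)"
    unfolding loop_mul_def by (rule G_lift(1)[OF G_cvs]) (use l r in auto)
  show "y \<in> derived D \<Longrightarrow> b \<in> carrier A \<Longrightarrow> loop_mul a (tm y b) = tm y (a \<otimes>\<^bsub>A\<^esub> b)"
    unfolding loop_mul_def by (subst G_lift(2)[OF G_cvs]) (use l r in auto)
qed

abbreviation "LB \<equiv> loop_bracket D A"
abbreviation "LD \<equiv> loop_deriv D A"

lemma loop_deriv:
  assumes h: "h \<in> carrier \<gg>"
  shows "lin G G (LD h)"
    and "y \<in> derived D \<Longrightarrow> b \<in> carrier A \<Longrightarrow> LD h (tm y b) = tm (br h y) b"
proof -
  have l: "lin \<gg>' G (\<lambda>y. tm (br h y) b)" if "b \<in> carrier A" for b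
    by (rule lin_comp[OF br_lin_derived(1)[OF h] le_lin_l[OF that]])
  have r: "lin A G (\<lambda>b. tm (br h y) b)" if "y \<in> derived D" for y
    by (rule le_lin_r) (use h that br_derived derived_carrier in auto)
  show "lin G G (LD h)"
    unfolding loop_deriv_def by (rule G_lift(1)[OF G_cvs]) (use l r in auto)
  show "y \<in> derived D \<Longrightarrow> b \<in> carrier A \<Longrightarrow> LD h (tm y b) = tm (br h y) b"
    unfolding loop_deriv_def by (subst G_lift(2)[OF G_cvs]) (use l r in auto)
qed

text \<open>The bracket is one lift nested in another. The outer one is legitimate once the inner
  value is linear in \<open>x\<close> and in \<open>a\<close> for each \<open>Q\<close>, and this is
  checked on pure tensors \<open>Q\<close>.\<close>

lemma loop_bracket:
  shows "Q \<in> carrier G \<Longrightarrow> lin G G (\<lambda>P. LB P Q)" and "P \<in> carrier G \<Longrightarrow> lin G G (\<lambda>Q. LB P Q)"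
    and "x \<in> derived D \<Longrightarrow> a \<in> carrier A \<Longrightarrow> y \<in> derived D \<Longrightarrow> b \<in> carrier A \<Longrightarrow>
      LB (tm x a) (tm y b) = tm (br x y) (a \<otimes>\<^bsub>A\<^esub> b)"
proof -
  define inner where "inner x a = tensor_lift G (\<lambda>(y, b). tm (br x y) (a \<otimes>\<^bsub>A\<^esub> b))" for x a
  have LB: "LB P Q = tensor_lift G (\<lambda>(x, a). inner x a Q) P" for P Q
    by (simp add: loop_bracket_def inner_def)
  have inner: "lin G G (inner x a)"
    "y \<in> derived D \<Longrightarrow> b \<in> carrier A \<Longrightarrow> inner x a (tm y b) = tm (br x y) (a \<otimes>\<^bsub>A\<^esub> b)"
    if x: "x \<in> derived D" and a: "a \<in> carrier A" for x a y b
  proof -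
    have l: "lin \<gg>' G (\<lambda>y. tm (br x y) (a \<otimes>\<^bsub>A\<^esub> b))" if "b \<in> carrier A" for b
      using a that by (intro lin_comp[OF br_lin_derived(1)[OF derived_carrier[OF x]] le_lin_l]) simp
    have r: "lin A G (\<lambda>b. tm (br x y) (a \<otimes>\<^bsub>A\<^esub> b))" if "y \<in> derived D" for y
      by (rule lin_comp[OF A_lin_r[OF a] le_lin_r]) (use x that br_derived derived_carrier in auto)
    show "lin G G (inner x a)"
      unfolding inner_def by (rule G_lift(1)[OF G_cvs]) (use l r in auto)
    show "y \<in> derived D \<Longrightarrow> b \<in> carrier A \<Longrightarrow> inner x a (tm y b) = tm (br x y) (a \<otimes>\<^bsub>A\<^esub> b)"
      unfolding inner_def by (subst G_lift(2)[OF G_cvs]) (use l r in auto)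
  qed
  have l: "lin \<gg>' G (\<lambda>x. inner x a Q)" if a: "a \<in> carrier A" and Q: "Q \<in> carrier G" for a Q
  proof (rule linI)
    fix x assume x: "x \<in> carrier \<gg>'"
    show "inner x a Q \<in> carrier G" using linD(1)[OF inner(1) Q] x a by simp
    fix c
    show "inner (c \<odot>\<^bsub>\<gg>'\<^esub> x) a Q = c \<odot>\<^bsub>G\<^esub> inner x a Q"
    proof (rule G_eqI[OF inner(1) lin_comp[OF inner(1) G.lin_smult] G_cvs _ Q])
      show "inner (c \<odot>\<^bsub>\<gg>'\<^esub> x) a (tm y b) = c \<odot>\<^bsub>G\<^esub> inner x a (tm y b)"
        if "y \<in> derived D" "b \<in> carrier A" for y b
        using x a that subspD(4)[OF derived_subsp]
          linD(3)[OF lin_comp[OF br_lin_derived(2)[of y] le_lin_l[of "a \<otimes>\<^bsub>A\<^esub> b"]], of x c] derived_carrier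
        by (simp add: inner(2))
    qed (use x a subspD(4)[OF derived_subsp] in auto)
  next
    fix x x' assume x: "x \<in> carrier \<gg>'" "x' \<in> carrier \<gg>'"
    show "inner (x \<oplus>\<^bsub>\<gg>'\<^esub> x') a Q = inner x a Q \<oplus>\<^bsub>G\<^esub> inner x' a Q"
    proof (rule G_eqI[OF inner(1) lin_add[OF inner(1) inner(1) G_cvs] G_cvs _ Q])
      show "inner (x \<oplus>\<^bsub>\<gg>'\<^esub> x') a (tm y b) = inner x a (tm y b) \<oplus>\<^bsub>G\<^esub> inner x' a (tm y b)"
        if "y \<in> derived D" "b \<in> carrier A" for y b
        using x a that subspD(3)[OF derived_subsp]
          linD(2)[OF lin_comp[OF br_lin_derived(2)[of y] le_lin_l[of "a \<otimes>\<^bsub>A\<^esub> b"]], of x x'] derived_carrier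
        by (simp add: inner(2))
    qed (use x a subspD(3)[OF derived_subsp] in auto)
  qed
  have r: "lin A G (\<lambda>a. inner x a Q)" if x: "x \<in> derived D" and Q: "Q \<in> carrier G" for x Q
  proof (rule linI)
    fix a assume a: "a \<in> carrier A"
    show "inner x a Q \<in> carrier G" using linD(1)[OF inner(1) Q] x a by simp
    fix c
    show "inner x (c \<odot>\<^bsub>A\<^esub> a) Q = c \<odot>\<^bsub>G\<^esub> inner x a Q"
    proof (rule G_eqI[OF inner(1) lin_comp[OF inner(1) G.lin_smult] G_cvs _ Q])
      show "inner x (c \<odot>\<^bsub>A\<^esub> a) (tm y b) = c \<odot>\<^bsub>G\<^esub> inner x a (tm y b)"
        if "y \<in> derived D" "b \<in> carrier A" for y b
        using x a that br_derived derived_carrier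
          linD(3)[OF lin_comp[OF A_lin_l[of b] le_lin_r[of "br x y"]], of a c]
        by (simp add: inner(2))
    qed (use x a in auto)
  next
    fix a a' assume a: "a \<in> carrier A" "a' \<in> carrier A"
    show "inner x (a \<oplus>\<^bsub>A\<^esub> a') Q = inner x a Q \<oplus>\<^bsub>G\<^esub> inner x a' Q"
    proof (rule G_eqI[OF inner(1) lin_add[OF inner(1) inner(1) G_cvs] G_cvs _ Q])
      show "inner x (a \<oplus>\<^bsub>A\<^esub> a') (tm y b) = inner x a (tm y b) \<oplus>\<^bsub>G\<^esub> inner x a' (tm y b)"
        if "y \<in> derived D" "b \<in> carrier A" for y b
        using x a that br_derived derived_carrier
          linD(2)[OF lin_comp[OF A_lin_l[of b] le_lin_r[of "br x y"]], of a a']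
        by (simp add: inner(2))
    qed (use x a in auto)
  qed
  show L: "lin G G (\<lambda>P. LB P Q)" if "Q \<in> carrier G" for Q
    unfolding LB by (rule G_lift(1)[OF G_cvs]) (use l r that in auto)
  have v: "LB (tm x a) Q = inner x a Q" if "x \<in> derived D" "a \<in> carrier A" "Q \<in> carrier G" for x a Q
    unfolding LB by (subst G_lift(2)[OF G_cvs]) (use l r that in auto)
  show "lin G G (\<lambda>Q. LB P Q)" if P: "P \<in> carrier G" for P
  proof (rule linI)
    show "LB P Q \<in> carrier G" if "Q \<in> carrier G" for Q
      using linD(1)[OF L[OF that] P] .
    show "LB P (Q \<oplus>\<^bsub>G\<^esub> Q') = LB P Q \<oplus>\<^bsub>G\<^esub> LB P Q'" if Q: "Q \<in> carrier G" "Q' \<in> carrier G" for Q Q'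
      by (rule G_eqI[OF L lin_add[OF L L G_cvs] G_cvs _ P])
        (use Q in \<open>auto simp: v linD(2)[OF inner(1)]\<close>)
    show "LB P (c \<odot>\<^bsub>G\<^esub> Q) = c \<odot>\<^bsub>G\<^esub> LB P Q" if Q: "Q \<in> carrier G" for c Q
      by (rule G_eqI[OF L lin_comp[OF L G.lin_smult] G_cvs _ P])
        (use Q in \<open>auto simp: v linD(3)[OF inner(1)]\<close>)
  qed
  show "x \<in> derived D \<Longrightarrow> a \<in> carrier A \<Longrightarrow> y \<in> derived D \<Longrightarrow> b \<in> carrier A \<Longrightarrow>
      LB (tm x a) (tm y b) = tm (br x y) (a \<otimes>\<^bsub>A\<^esub> b)"
    by (simp add: v inner(2))
qed

lemma loop_mul_lin_l:
  assumes P: "P \<in> carrier G" shows "lin A G (\<lambda>a. loop_mul a P)"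
proof (rule linI)
  show "loop_mul a P \<in> carrier G" if "a \<in> carrier A" for a
    using linD(1)[OF loop_mul(1)[OF that] P] .
  show "loop_mul (a \<oplus>\<^bsub>A\<^esub> a') P = loop_mul a P \<oplus>\<^bsub>G\<^esub> loop_mul a' P"
    if a: "a \<in> carrier A" "a' \<in> carrier A" for a a'
    by (rule G_eqI[OF loop_mul(1) lin_add[OF loop_mul(1) loop_mul(1) G_cvs] G_cvs _ P])
      (use a in \<open>auto simp: loop_mul(2) A_l_distr linD(2)[OF le_lin_r]\<close>)
  show "loop_mul (c \<odot>\<^bsub>A\<^esub> a) P = c \<odot>\<^bsub>G\<^esub> loop_mul a P" if a: "a \<in> carrier A" for c a
    by (rule G_eqI[OF loop_mul(1) lin_comp[OF loop_mul(1) G.lin_smult] G_cvs _ P])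
      (use a in \<open>auto simp: loop_mul(2) linD(3)[OF A_lin_l] linD(3)[OF le_lin_r]\<close>)
qed

lemma id_lin: "lin V V (\<lambda>x. x)"
  by (rule linI) auto

lemma loop_mul_one: "P \<in> carrier G \<Longrightarrow> loop_mul \<one>\<^bsub>A\<^esub> P = P"
  by (rule G_eqI[OF loop_mul(1) id_lin G_cvs]) (auto simp: loop_mul(2))

lemma loop_mul_mul:
  assumes a: "a \<in> carrier A" "b \<in> carrier A" and P: "P \<in> carrier G"
  shows "loop_mul a (loop_mul b P) = loop_mul (a \<otimes>\<^bsub>A\<^esub> b) P"
  by (rule G_eqI[OF lin_comp[OF loop_mul(1) loop_mul(1)] loop_mul(1) G_cvs _ P])
    (use a in \<open>auto simp: loop_mul(2) A_assoc\<close>)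

lemma loop_mul_closed [simp]: "a \<in> carrier A \<Longrightarrow> P \<in> carrier G \<Longrightarrow> loop_mul a P \<in> carrier G"
  using linD(1)[OF loop_mul(1)] .

lemma LB_closed [simp]: "P \<in> carrier G \<Longrightarrow> Q \<in> carrier G \<Longrightarrow> LB P Q \<in> carrier G"
  using linD(1)[OF loop_bracket(1)] .

lemma LD_closed [simp]: "h \<in> carrier \<gg> \<Longrightarrow> Q \<in> carrier G \<Longrightarrow> LD h Q \<in> carrier G"
  using linD(1)[OF loop_deriv(1)] .

text \<open>Together with \<open>LB_mul_r\<close> and \<open>LD_mul\<close> this is linearity over
  \<open>A\<close> of the brackets. Multiplying the entries by coefficients multiplies the result by
  their product, on which both smoothness and the splitting of the action rest.\<close>

lemma LB_mul_l:
  assumes a: "a \<in> carrier A" and P: "P \<in> carrier G" and Q: "Q \<in> carrier G"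
  shows "LB (loop_mul a P) Q = loop_mul a (LB P Q)"
proof (rule G_eqI[OF lin_comp[OF loop_mul(1)[OF a] loop_bracket(1)[OF Q]]
      lin_comp[OF loop_bracket(1)[OF Q] loop_mul(1)[OF a]] G_cvs _ P])
  fix x b assume x: "x \<in> derived D" "b \<in> carrier A"
  show "LB (loop_mul a (tm x b)) Q = loop_mul a (LB (tm x b) Q)"
    by (rule G_eqI[OF loop_bracket(2) lin_comp[OF loop_bracket(2) loop_mul(1)[OF a]] G_cvs _ Q])
      (use a x br_derived derived_carrier in \<open>auto simp: loop_mul(2) loop_bracket(3) A_assoc\<close>)
qed

lemma LB_mul_r:
  assumes a: "a \<in> carrier A" and P: "P \<in> carrier G" and Q: "Q \<in> carrier G"
  shows "LB P (loop_mul a Q) = loop_mul a (LB P Q)"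
proof (rule G_eqI[OF loop_bracket(1) lin_comp[OF loop_bracket(1)[OF Q] loop_mul(1)[OF a]] G_cvs _ P])
  show "loop_mul a Q \<in> carrier G" using a Q by simp
  fix x b assume x: "x \<in> derived D" "b \<in> carrier A"
  have ab: "b \<otimes>\<^bsub>A\<^esub> (a \<otimes>\<^bsub>A\<^esub> c) = a \<otimes>\<^bsub>A\<^esub> (b \<otimes>\<^bsub>A\<^esub> c)" if "c \<in> carrier A" for c
    using a x that by (simp add: A_assoc[symmetric] A_comm[of b a])
  show "LB (tm x b) (loop_mul a Q) = loop_mul a (LB (tm x b) Q)"
    by (rule G_eqI[OF lin_comp[OF loop_mul(1)[OF a] loop_bracket(2)]
          lin_comp[OF loop_bracket(2) loop_mul(1)[OF a]] G_cvs _ Q])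
      (use a x br_derived derived_carrier in \<open>auto simp: loop_mul(2) loop_bracket(3) ab\<close>)
qed

lemma LD_mul:
  assumes a: "a \<in> carrier A" and h: "h \<in> carrier \<gg>" and Q: "Q \<in> carrier G"
  shows "LD h (loop_mul a Q) = loop_mul a (LD h Q)"
  by (rule G_eqI[OF lin_comp[OF loop_mul(1)[OF a] loop_deriv(1)[OF h]]
        lin_comp[OF loop_deriv(1)[OF h] loop_mul(1)[OF a]] G_cvs _ Q])
    (use a h br_derived derived_carrier in \<open>auto simp: loop_mul(2) loop_deriv(2)\<close>)

lemma LD_lin_l:
  assumes Q: "Q \<in> carrier G" shows "lin \<gg> G (\<lambda>h. LD h Q)"
proof (rule linI)
  show "LD h Q \<in> carrier G" if "h \<in> carrier \<gg>" for h using that Q by simp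
  show "LD (h \<oplus>\<^bsub>\<gg>\<^esub> k) Q = LD h Q \<oplus>\<^bsub>G\<^esub> LD k Q" if h: "h \<in> carrier \<gg>" "k \<in> carrier \<gg>" for h k
    by (rule G_eqI[OF loop_deriv(1) lin_add[OF loop_deriv(1) loop_deriv(1) G_cvs] G_cvs _ Q])
      (use h derived_carrier br_derived linD(2)[OF le_lin_l] in \<open>auto simp: loop_deriv(2) br_add_l\<close>)
  show "LD (c \<odot>\<^bsub>\<gg>\<^esub> h) Q = c \<odot>\<^bsub>G\<^esub> LD h Q" if h: "h \<in> carrier \<gg>" for c h
    by (rule G_eqI[OF loop_deriv(1) lin_comp[OF loop_deriv(1) G.lin_smult] G_cvs _ Q])
      (use h derived_carrier br_derived linD(3)[OF le_lin_l] in \<open>auto simp: loop_deriv(2) br_smult_l\<close>)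
qed

abbreviation "Cur \<equiv> current D A H2"

lemma H2_subsp: "subsp \<gg> H2"
  using complement by (simp add: csa_complement_def)

lemma H2_carrier: "h \<in> H2 \<Longrightarrow> h \<in> carrier \<gg>"
  using subspD(1)[OF H2_subsp] by blast

lemma Cur_simps:
  "carrier Cur = carrier G \<times> H2" "\<zero>\<^bsub>Cur\<^esub> = (\<zero>\<^bsub>G\<^esub>, \<zero>\<^bsub>\<gg>\<^esub>)"
  "X \<oplus>\<^bsub>Cur\<^esub> Y = (fst X \<oplus>\<^bsub>G\<^esub> fst Y, snd X \<oplus>\<^bsub>\<gg>\<^esub> snd Y)"
  "c \<odot>\<^bsub>Cur\<^esub> X = (c \<odot>\<^bsub>G\<^esub> fst X, c \<odot>\<^bsub>\<gg>\<^esub> snd X)"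
  "bracket Cur (P, h) (Q, k) = ((LB P Q \<oplus>\<^bsub>G\<^esub> LD h Q) \<ominus>\<^bsub>G\<^esub> LD k P, \<zero>\<^bsub>\<gg>\<^esub>)"
  by (simp_all add: current_def module.defs lie_alg.defs direct_sum_def)

lemma Cur_bracket: "bracket_space Cur"
proof (unfold bracket_space_def bracket_space_axioms_def, intro conjI allI impI)
  note H = subspD(2-4)[OF H2_subsp]
  show "cvs Cur"
    by (rule cvsI)
      (auto simp: Cur_simps H H2_carrier G.a_ac a_ac G.s_ladd G.s_radd G.s_mult s_ladd s_radd s_mult)
  show "bracket Cur X Y \<in> carrier Cur" if "X \<in> carrier Cur" "Y \<in> carrier Cur" for X Y
    using that H by (cases X; cases Y) (simp add: Cur_simps(1,5) H2_carrier)
qed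

lemma cur_elem_closed: "x \<in> derived D \<Longrightarrow> a \<in> carrier A \<Longrightarrow> cur_elem D A x a \<in> carrier Cur"
  using subspD(2)[OF H2_subsp] by (simp add: cur_elem_def Cur_simps)

lemma Cur_space: "current_space D A H2"
  unfolding current_space_def current_space_axioms_def
proof (intro conjI allI impI Cur_bracket)
  interpret C: bracket_space Cur by (rule Cur_bracket)
  show "cur_N_plus D A H2 \<subseteq> carrier Cur"
    unfolding cur_N_plus_def
    by (rule C.span_least[OF _ C.subsp_carrier]) (use N_plus_derived cur_elem_closed in auto)
  show "cur_h D A H2 \<subseteq> carrier Cur"
  proof -
    have "cspan G {tm x a | x a. x \<in> csa_derived D \<and> a \<in> carrier A} \<subseteq> carrier G"
      by (rule G.span_least[OF _ G.subsp_carrier]) (auto simp: csa_derived_def)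
    then show ?thesis by (auto simp: cur_h_def Cur_simps)
  qed
  show "cur_elem D A x a \<in> carrier Cur"
    if "m \<in> pos_roots D" "x \<in> root_space D (\<lambda>h. - root_of D m h)" "a \<in> carrier A" for m x a
    using that root_space_derived(2) cur_elem_closed by blast
qed

end

subsection \<open>Representations of the current algebra\<close>

locale cur_rep = loop_data D A H2 + Z: lie_rep "current D A H2" Z
  for D :: "'g km_datum" and A :: "(complex, 'a) module" and H2 :: "'g set"
    and Z :: "(('g, 'a) cur, 'z) lie_mod"
begin

text \<open>The two summands of the current algebra are kept apart because coefficients can be
  inserted in the first one only; \<open>act_split\<close> puts them together again.\<close>

definition gact where "gact P z = act Z (P, \<zero>\<^bsub>\<gg>\<^esub>) z"
definition hact where "hact h z = act Z (\<zero>\<^bsub>G\<^esub>, h) z"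

lemma H2_zero [simp]: "\<zero>\<^bsub>\<gg>\<^esub> \<in> H2"
  by (rule subspD(2)[OF H2_subsp])

lemma emb_closed: "P \<in> carrier G \<Longrightarrow> (P, \<zero>\<^bsub>\<gg>\<^esub>) \<in> carrier Cur" "h \<in> H2 \<Longrightarrow> (\<zero>\<^bsub>G\<^esub>, h) \<in> carrier Cur"
  by (simp_all add: Cur_simps)

lemma gact_lin_r: "P \<in> carrier G \<Longrightarrow> lin Z Z (gact P)"
  unfolding gact_def by (rule Z.act_lin) (rule emb_closed)

lemma hact_lin_r: "h \<in> H2 \<Longrightarrow> lin Z Z (hact h)"
  unfolding hact_def by (rule Z.act_lin) (rule emb_closed)

lemma gact_lin_l: "z \<in> carrier Z \<Longrightarrow> lin G Z (\<lambda>P. gact P z)"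
proof (rule linI)
  assume z: "z \<in> carrier Z"
  show "gact P z \<in> carrier Z" if "P \<in> carrier G" for P
    using linD(1)[OF gact_lin_r[OF that] z] .
  show "gact (P \<oplus>\<^bsub>G\<^esub> Q) z = gact P z \<oplus>\<^bsub>Z\<^esub> gact Q z" if "P \<in> carrier G" "Q \<in> carrier G" for P Q
    using Z.act_add_l[OF emb_closed(1)[OF that(1)] emb_closed(1)[OF that(2)] z]
    by (simp add: gact_def Cur_simps)
  show "gact (c \<odot>\<^bsub>G\<^esub> P) z = c \<odot>\<^bsub>Z\<^esub> gact P z" if "P \<in> carrier G" for c P
    using Z.act_smult_l[OF emb_closed(1)[OF that] z, of c] by (simp add: gact_def Cur_simps)
qed

lemma hact_lin_l: "z \<in> carrier Z \<Longrightarrow> lin (\<gg>\<lparr>carrier := H2\<rparr>) Z (\<lambda>h. hact h z)"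
proof (rule linI)
  assume z: "z \<in> carrier Z"
  show "hact h z \<in> carrier Z" if "h \<in> carrier (\<gg>\<lparr>carrier := H2\<rparr>)" for h
    using linD(1)[OF hact_lin_r z] that by simp
  show "hact (h \<oplus>\<^bsub>\<gg>\<lparr>carrier := H2\<rparr>\<^esub> k) z = hact h z \<oplus>\<^bsub>Z\<^esub> hact k z"
    if "h \<in> carrier (\<gg>\<lparr>carrier := H2\<rparr>)" "k \<in> carrier (\<gg>\<lparr>carrier := H2\<rparr>)" for h k
    using Z.act_add_l[OF emb_closed(2) emb_closed(2) z, of h k] that by (simp add: hact_def Cur_simps)
  show "hact (c \<odot>\<^bsub>\<gg>\<lparr>carrier := H2\<rparr>\<^esub> h) z = c \<odot>\<^bsub>Z\<^esub> hact h z" if "h \<in> carrier (\<gg>\<lparr>carrier := H2\<rparr>)" for c h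
    using Z.act_smult_l[OF emb_closed(2) z, of h c] that by (simp add: hact_def Cur_simps)
qed

lemma gact_closed [simp]: "P \<in> carrier G \<Longrightarrow> z \<in> carrier Z \<Longrightarrow> gact P z \<in> carrier Z"
  using linD(1)[OF gact_lin_r] .

lemma hact_closed [simp]: "h \<in> H2 \<Longrightarrow> z \<in> carrier Z \<Longrightarrow> hact h z \<in> carrier Z"
  using linD(1)[OF hact_lin_r] .

lemma act_split: "P \<in> carrier G \<Longrightarrow> h \<in> H2 \<Longrightarrow> z \<in> carrier Z \<Longrightarrow> act Z (P, h) z = gact P z \<oplus>\<^bsub>Z\<^esub> hact h z"
  using Z.act_add_l[OF emb_closed, of P h z] by (simp add: gact_def hact_def Cur_simps H2_carrier)

lemma gact_zero [simp]: "z \<in> carrier Z \<Longrightarrow> gact \<zero>\<^bsub>G\<^esub> z = \<zero>\<^bsub>Z\<^esub>" "P \<in> carrier G \<Longrightarrow> gact P \<zero>\<^bsub>Z\<^esub> = \<zero>\<^bsub>Z\<^esub>"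
  using lin_zero[OF gact_lin_l G_cvs Z.cvs_axioms] lin_zero[OF gact_lin_r Z.cvs_axioms Z.cvs_axioms] by auto

lemma LB_zero [simp]: "Q \<in> carrier G \<Longrightarrow> LB \<zero>\<^bsub>G\<^esub> Q = \<zero>\<^bsub>G\<^esub>"
  using lin_zero[OF loop_bracket(1) G_cvs G_cvs] by auto

lemma LD_zero [simp]: "h \<in> carrier \<gg> \<Longrightarrow> LD h \<zero>\<^bsub>G\<^esub> = \<zero>\<^bsub>G\<^esub>" "Q \<in> carrier G \<Longrightarrow> LD \<zero>\<^bsub>\<gg>\<^esub> Q = \<zero>\<^bsub>G\<^esub>"
  using lin_zero[OF loop_deriv(1) G_cvs G_cvs] lin_zero[OF LD_lin_l cvs_axioms G_cvs] by auto

lemma G_minus_zero [simp]: "P \<in> carrier G \<Longrightarrow> P \<ominus>\<^bsub>G\<^esub> \<zero>\<^bsub>G\<^esub> = P"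
  by (simp add: G.minus_eq_iff)

lemma gact_gact: "P \<in> carrier G \<Longrightarrow> Q \<in> carrier G \<Longrightarrow> z \<in> carrier Z \<Longrightarrow>
    gact P (gact Q z) = gact (LB P Q) z \<oplus>\<^bsub>Z\<^esub> gact Q (gact P z)"
  using Z.act_bracket[OF emb_closed(1) emb_closed(1), of P Q z]
  by (simp add: gact_def Cur_simps(5))

lemma hact_gact: "h \<in> H2 \<Longrightarrow> Q \<in> carrier G \<Longrightarrow> z \<in> carrier Z \<Longrightarrow>
    hact h (gact Q z) = gact (LD h Q) z \<oplus>\<^bsub>Z\<^esub> gact Q (hact h z)"
  using Z.act_bracket[OF emb_closed(2) emb_closed(1), of h Q z]
  by (simp add: gact_def hact_def Cur_simps(5) H2_carrier)

lemma hact_hact: "h \<in> H2 \<Longrightarrow> k \<in> H2 \<Longrightarrow> z \<in> carrier Z \<Longrightarrow> hact h (hact k z) = hact k (hact h z)"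
proof -
  assume a: "h \<in> H2" "k \<in> H2" "z \<in> carrier Z"
  have "hact h (hact k z) = act Z (\<zero>\<^bsub>G\<^esub>, \<zero>\<^bsub>\<gg>\<^esub>) z \<oplus>\<^bsub>Z\<^esub> hact k (hact h z)"
    using Z.act_bracket[OF emb_closed(2) emb_closed(2) a(3), OF a(1,2)] a
    by (simp add: hact_def Cur_simps(5) H2_carrier)
  also have "act Z (\<zero>\<^bsub>G\<^esub>, \<zero>\<^bsub>\<gg>\<^esub>) z = \<zero>\<^bsub>Z\<^esub>"
    using gact_zero(1)[OF a(3)] by (simp add: gact_def)
  finally show ?thesis using a by simp
qed

lemma submoduleI:
  assumes N: "subsp Z N" and g: "\<And>P z. P \<in> carrier G \<Longrightarrow> z \<in> N \<Longrightarrow> gact P z \<in> N"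
    and h: "\<And>h z. h \<in> H2 \<Longrightarrow> z \<in> N \<Longrightarrow> hact h z \<in> N"
  shows "lie_submodule Cur Z N"
proof (rule lie_submoduleI[OF N])
  fix X z assume X: "X \<in> carrier Cur" and z: "z \<in> N"
  then obtain P k where "X = (P, k)" "P \<in> carrier G" "k \<in> H2" by (auto simp: Cur_simps)
  then show "act Z X z \<in> N"
    using z g h subspD(1,3)[OF N] act_split[of P k z] by auto
qed

end

text \<open>Assembles a module from separate actions of \<gg>' \<otimes> A and of \<hh>''. Both
  auxiliary modules, \<open>ZE\<close> and \<open>HF\<close>, arise in this way, each with a
  modified action of \<hh>''.\<close>

lemma (in loop_data) cur_rep_I:
  fixes Z :: "(('g, 'a) cur, 'z) lie_mod"
  assumes Z: "cvs Z"
    and g_r: "\<And>P. P \<in> carrier G \<Longrightarrow> lin Z Z (g P)"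
    and g_l: "\<And>z. z \<in> carrier Z \<Longrightarrow> lin G Z (\<lambda>P. g P z)"
    and k_r: "\<And>h. h \<in> H2 \<Longrightarrow> lin Z Z (k h)"
    and k_l: "\<And>z. z \<in> carrier Z \<Longrightarrow> lin (\<gg>\<lparr>carrier := H2\<rparr>) Z (\<lambda>h. k h z)"
    and gg: "\<And>P Q z. P \<in> carrier G \<Longrightarrow> Q \<in> carrier G \<Longrightarrow> z \<in> carrier Z \<Longrightarrow>
      g P (g Q z) = g (LB P Q) z \<oplus>\<^bsub>Z\<^esub> g Q (g P z)"
    and kg: "\<And>h Q z. h \<in> H2 \<Longrightarrow> Q \<in> carrier G \<Longrightarrow> z \<in> carrier Z \<Longrightarrow>
      k h (g Q z) = g (LD h Q) z \<oplus>\<^bsub>Z\<^esub> g Q (k h z)"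
    and kk: "\<And>h h' z. h \<in> H2 \<Longrightarrow> h' \<in> H2 \<Longrightarrow> z \<in> carrier Z \<Longrightarrow> k h (k h' z) = k h' (k h z)"
  shows "lie_rep Cur (Z\<lparr>act := \<lambda>X z. g (fst X) z \<oplus>\<^bsub>Z\<^esub> k (snd X) z\<rparr>)"
proof -
  interpret Z: cvs Z by fact
  note gr = linD[OF g_r] and gl = linD[OF g_l] and kr = linD[OF k_r]
  have kl: "k (h \<oplus>\<^bsub>\<gg>\<^esub> h') z = k h z \<oplus>\<^bsub>Z\<^esub> k h' z" "k (c \<odot>\<^bsub>\<gg>\<^esub> h) z = c \<odot>\<^bsub>Z\<^esub> k h z"
    if "h \<in> H2" "h' \<in> H2" "z \<in> carrier Z" for h h' c z
    using linD(2,3)[OF k_l[OF that(3)]] that by simp_all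
  have k0: "k \<zero>\<^bsub>\<gg>\<^esub> z = \<zero>\<^bsub>Z\<^esub>" if "z \<in> carrier Z" for z
    using lin_zero[OF k_l[OF that] subsp_cvs[OF H2_subsp] Z] by simp
  have br: "g P (g Q z \<oplus>\<^bsub>Z\<^esub> k h' z) \<oplus>\<^bsub>Z\<^esub> k h (g Q z \<oplus>\<^bsub>Z\<^esub> k h' z) =
      (g ((LB P Q \<oplus>\<^bsub>G\<^esub> LD h Q) \<ominus>\<^bsub>G\<^esub> LD h' P) z \<oplus>\<^bsub>Z\<^esub> k \<zero>\<^bsub>\<gg>\<^esub> z) \<oplus>\<^bsub>Z\<^esub>
      (g Q (g P z \<oplus>\<^bsub>Z\<^esub> k h z) \<oplus>\<^bsub>Z\<^esub> k h' (g P z \<oplus>\<^bsub>Z\<^esub> k h z))"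
    if P: "P \<in> carrier G" and Q: "Q \<in> carrier G" and h: "h \<in> H2" and h': "h' \<in> H2" and z: "z \<in> carrier Z"
    for P Q h h' z
  proof -
    let ?d = "g ((LB P Q \<oplus>\<^bsub>G\<^esub> LD h Q) \<ominus>\<^bsub>G\<^esub> LD h' P) z" and ?u = "g (LD h' P) z"
    note c = H2_carrier[OF h] H2_carrier[OF h'] P Q h h' z
    have cl: "g (LB P Q) z \<in> carrier Z" "g (LD h Q) z \<in> carrier Z" "?u \<in> carrier Z" "?d \<in> carrier Z"
      "g Q (g P z) \<in> carrier Z" "g P (k h' z) \<in> carrier Z" "g Q (k h z) \<in> carrier Z" "k h' (k h z) \<in> carrier Z"
      using c by (auto simp: gr kr)
    \<comment> \<open>The negative term of the bracket is brought to the other side, so that the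
      remaining calculation only rearranges sums.\<close>
    have w: "g (LB P Q) z \<oplus>\<^bsub>Z\<^esub> g (LD h Q) z = ?d \<oplus>\<^bsub>Z\<^esub> ?u"
      using c cl lin_minus[OF g_l[OF z] G_cvs Z, of "LB P Q \<oplus>\<^bsub>G\<^esub> LD h Q" "LD h' P"] by (simp add: gl)
    have "g P (g Q z \<oplus>\<^bsub>Z\<^esub> k h' z) \<oplus>\<^bsub>Z\<^esub> k h (g Q z \<oplus>\<^bsub>Z\<^esub> k h' z) =
        (g P (g Q z) \<oplus>\<^bsub>Z\<^esub> g P (k h' z)) \<oplus>\<^bsub>Z\<^esub> (k h (g Q z) \<oplus>\<^bsub>Z\<^esub> k h (k h' z))"
      using c by (simp add: gr kr)
    also have "\<dots> = (g (LB P Q) z \<oplus>\<^bsub>Z\<^esub> g (LD h Q) z) \<oplus>\<^bsub>Z\<^esub>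
        (g Q (g P z) \<oplus>\<^bsub>Z\<^esub> (g P (k h' z) \<oplus>\<^bsub>Z\<^esub> (g Q (k h z) \<oplus>\<^bsub>Z\<^esub> k h' (k h z))))"
      unfolding gg[OF P Q z] kg[OF h Q z] kk[OF h h' z] using cl by (simp add: Z.a_ac)
    also have "\<dots> = ?d \<oplus>\<^bsub>Z\<^esub> (g Q (g P z) \<oplus>\<^bsub>Z\<^esub> g Q (k h z) \<oplus>\<^bsub>Z\<^esub> (k h' (g P z) \<oplus>\<^bsub>Z\<^esub> k h' (k h z)))"
      unfolding w kg[OF h' P z] using cl by (simp add: Z.a_ac)
    also have "\<dots> = (?d \<oplus>\<^bsub>Z\<^esub> k \<zero>\<^bsub>\<gg>\<^esub> z) \<oplus>\<^bsub>Z\<^esub>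
        (g Q (g P z \<oplus>\<^bsub>Z\<^esub> k h z) \<oplus>\<^bsub>Z\<^esub> k h' (g P z \<oplus>\<^bsub>Z\<^esub> k h z))"
      using c cl by (simp add: gr kr k0)
    finally show ?thesis .
  qed
  let ?Z = "Z\<lparr>act := \<lambda>X z. g (fst X) z \<oplus>\<^bsub>Z\<^esub> k (snd X) z\<rparr>"
  have "cvs ?Z" by (rule cvs_cong[OF Z]) simp_all
  then show ?thesis
    unfolding lie_rep_def lie_rep_axioms_def
  proof (intro conjI allI impI)
    fix X Y z w c
    assume X: "X \<in> carrier Cur" and z: "z \<in> carrier ?Z"
    then obtain P h where [simp]: "X = (P, h)" and X': "P \<in> carrier G" "h \<in> H2" by (auto simp: Cur_simps)
    have z': "z \<in> carrier Z" using z by simp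
    show "act ?Z X z \<in> carrier ?Z" using X' z' by (simp add: gr kr)
    show "act ?Z X (c \<odot>\<^bsub>?Z\<^esub> z) = c \<odot>\<^bsub>?Z\<^esub> act ?Z X z"
      using X' z' by (simp add: gr kr Z.s_radd)
    show "act ?Z (c \<odot>\<^bsub>Cur\<^esub> X) z = c \<odot>\<^bsub>?Z\<^esub> act ?Z X z"
      using X' z' by (simp add: Cur_simps gr kr gl kl Z.s_radd)
    { assume w: "w \<in> carrier ?Z"
      show "act ?Z X (z \<oplus>\<^bsub>?Z\<^esub> w) = act ?Z X z \<oplus>\<^bsub>?Z\<^esub> act ?Z X w"
        using X' z' w by (simp add: gr kr Z.a_ac) }
    assume Y: "Y \<in> carrier Cur"
    then obtain Q h' where [simp]: "Y = (Q, h')" and Y': "Q \<in> carrier G" "h' \<in> H2" by (auto simp: Cur_simps)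
    show "act ?Z (X \<oplus>\<^bsub>Cur\<^esub> Y) z = act ?Z X z \<oplus>\<^bsub>?Z\<^esub> act ?Z Y z"
      using X' Y' z' by (simp add: Cur_simps gr kr gl kl Z.a_ac)
    show "act ?Z X (act ?Z Y z) = act ?Z (bracket Cur X Y) z \<oplus>\<^bsub>?Z\<^esub> act ?Z Y (act ?Z X z)"
      using br[OF X'(1) Y'(1) X'(2) Y'(2) z'] by (simp add: Cur_simps(5))
  qed
qed

subsection \<open>Smooth vectors\<close>

locale smooth_data = cur_rep D A H2 Z
  for D :: "'g km_datum" and A :: "(complex, 'a) module" and H2 :: "'g set"
    and Z :: "(('g, 'a) cur, 'z) lie_mod" +
  fixes Q :: "'a set"
  assumes Q: "ideal Q A"
begin

abbreviation "C n \<equiv> Q [^]\<^bsub>ideals_set A\<^esub> (n::nat)"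

lemma C_ideal: "ideal (C n) A"
  by (rule cring.ideal_pow_ideal[OF A_cring Q])

lemma C_carrier: "a \<in> C n \<Longrightarrow> a \<in> carrier A"
  using ideal.Icarr[OF C_ideal] .

lemma C_mono: "m \<le> n \<Longrightarrow> a \<in> C n \<Longrightarrow> a \<in> C m"
  using cring.ideal_pow_mono[OF A_cring Q] by blast

lemma C_mult: "a \<in> C n \<Longrightarrow> b \<in> carrier A \<Longrightarrow> a \<otimes>\<^bsub>A\<^esub> b \<in> C n"
  by (rule ideal.I_r_closed[OF C_ideal])

text \<open>Continuity of the action on \<open>z\<close> in the \<open>Q\<close>-adic sense, one
  \<open>P\<close> at a time: the exponent may vary with \<open>P\<close>.\<close>

definition smooth :: "'z set" where
  "smooth = {z \<in> carrier Z. \<forall>P\<in>carrier G. \<exists>n. \<forall>a\<in>C n. gact (loop_mul a P) z = \<zero>\<^bsub>Z\<^esub>}"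

text \<open>Moving \<open>a R\<close> past \<open>P\<close> produces \<open>a\<close> times the
  bracket of \<open>R\<close> and \<open>P\<close>. Hence \<open>a R\<close> kills
  \<open>P z\<close> once both \<open>a R\<close> and that bracket multiplied by \<open>a\<close>
  kill \<open>z\<close>; the larger exponent serves both. The case of \<hh>'' is the same with
  \<open>LD\<close>.\<close>

lemma smooth_submodule: "lie_submodule Cur Z smooth"
proof (rule submoduleI)
  have two: "\<exists>n. \<forall>a\<in>C n. f a = \<zero>\<^bsub>Z\<^esub> \<and> g a = \<zero>\<^bsub>Z\<^esub>"
    if fg: "\<exists>n. \<forall>a\<in>C n. f a = \<zero>\<^bsub>Z\<^esub>" "\<exists>n. \<forall>a\<in>C n. g a = \<zero>\<^bsub>Z\<^esub>" for f g :: "'a \<Rightarrow> 'z"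
  proof -
    obtain k n where "\<forall>a\<in>C k. f a = \<zero>\<^bsub>Z\<^esub>" "\<forall>a\<in>C n. g a = \<zero>\<^bsub>Z\<^esub>" using fg by blast
    then have "\<forall>a\<in>C (max k n). f a = \<zero>\<^bsub>Z\<^esub> \<and> g a = \<zero>\<^bsub>Z\<^esub>"
      using C_mono[of k "max k n"] C_mono[of n "max k n"] by simp
    then show ?thesis by blast
  qed
  note s = smooth_def
  show "subsp Z smooth"
  proof (rule Z.subsp_I)
    show "smooth \<subseteq> carrier Z" by (auto simp: s)
    show "\<zero>\<^bsub>Z\<^esub> \<in> smooth" using C_carrier by (auto simp: s)
    show "x \<oplus>\<^bsub>Z\<^esub> y \<in> smooth" if x: "x \<in> smooth" and y: "y \<in> smooth" for x y
      unfolding s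
    proof (intro CollectI conjI ballI)
      fix P assume P: "P \<in> carrier G"
      have xy: "x \<in> carrier Z" "y \<in> carrier Z" using x y by (auto simp: s)
      have "\<exists>n. \<forall>a\<in>C n. gact (loop_mul a P) x = \<zero>\<^bsub>Z\<^esub> \<and> gact (loop_mul a P) y = \<zero>\<^bsub>Z\<^esub>"
        by (rule two) (use x y P in \<open>auto simp: s\<close>)
      then obtain n where n: "\<forall>a\<in>C n. gact (loop_mul a P) x = \<zero>\<^bsub>Z\<^esub> \<and> gact (loop_mul a P) y = \<zero>\<^bsub>Z\<^esub>" by blast
      have "gact (loop_mul a P) (x \<oplus>\<^bsub>Z\<^esub> y) = \<zero>\<^bsub>Z\<^esub>" if "a \<in> C n" for a
        using n that xy linD(2)[OF gact_lin_r xy, of "loop_mul a P"] C_carrier[OF that] P by simp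
      then show "\<exists>n. \<forall>a\<in>C n. gact (loop_mul a P) (x \<oplus>\<^bsub>Z\<^esub> y) = \<zero>\<^bsub>Z\<^esub>" by blast
    qed (use x y in \<open>auto simp: s\<close>)
    show "c \<odot>\<^bsub>Z\<^esub> x \<in> smooth" if x: "x \<in> smooth" for c x
      unfolding s
    proof (intro CollectI conjI ballI)
      fix P assume P: "P \<in> carrier G"
      then obtain n where n: "\<forall>a\<in>C n. gact (loop_mul a P) x = \<zero>\<^bsub>Z\<^esub>" using x by (auto simp: s)
      have xc: "x \<in> carrier Z" using x by (simp add: s)
      have "gact (loop_mul a P) (c \<odot>\<^bsub>Z\<^esub> x) = \<zero>\<^bsub>Z\<^esub>" if "a \<in> C n" for a
        using n that linD(3)[OF gact_lin_r xc, of "loop_mul a P" c] C_carrier[OF that] P by simp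
      then show "\<exists>n. \<forall>a\<in>C n. gact (loop_mul a P) (c \<odot>\<^bsub>Z\<^esub> x) = \<zero>\<^bsub>Z\<^esub>" by blast
    qed (use x in \<open>auto simp: s\<close>)
  qed
  show "gact P z \<in> smooth" if P: "P \<in> carrier G" and z: "z \<in> smooth" for P z
    unfolding s
  proof (intro CollectI conjI ballI)
    have zc: "z \<in> carrier Z" using z by (simp add: s)
    then show "gact P z \<in> carrier Z" using P by simp
    fix R assume R: "R \<in> carrier G"
    have "\<exists>n. \<forall>a\<in>C n. gact (loop_mul a R) z = \<zero>\<^bsub>Z\<^esub> \<and> gact (loop_mul a (LB R P)) z = \<zero>\<^bsub>Z\<^esub>"
      by (rule two) (use z P R in \<open>auto simp: s\<close>)
    then obtain n where n: "\<forall>a\<in>C n. gact (loop_mul a R) z = \<zero>\<^bsub>Z\<^esub> \<and> gact (loop_mul a (LB R P)) z = \<zero>\<^bsub>Z\<^esub>" by blast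
    have "gact (loop_mul a R) (gact P z) = \<zero>\<^bsub>Z\<^esub>" if "a \<in> C n" for a
      using n that zc P R C_carrier[OF that] gact_gact[of "loop_mul a R" P z] by (simp add: LB_mul_l)
    then show "\<exists>n. \<forall>a\<in>C n. gact (loop_mul a R) (gact P z) = \<zero>\<^bsub>Z\<^esub>" by blast
  qed
  show "hact h z \<in> smooth" if h: "h \<in> H2" and z: "z \<in> smooth" for h z
    unfolding s
  proof (intro CollectI conjI ballI)
    have zc: "z \<in> carrier Z" using z by (simp add: s)
    then show "hact h z \<in> carrier Z" using h by simp
    fix R assume R: "R \<in> carrier G"
    have "\<exists>n. \<forall>a\<in>C n. gact (loop_mul a R) z = \<zero>\<^bsub>Z\<^esub> \<and> gact (loop_mul a (LD h R)) z = \<zero>\<^bsub>Z\<^esub>"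
      by (rule two) (use z h R H2_carrier in \<open>auto simp: s\<close>)
    then obtain n where n: "\<forall>a\<in>C n. gact (loop_mul a R) z = \<zero>\<^bsub>Z\<^esub> \<and> gact (loop_mul a (LD h R)) z = \<zero>\<^bsub>Z\<^esub>" by blast
    have "gact (loop_mul a R) (hact h z) = \<zero>\<^bsub>Z\<^esub>" if "a \<in> C n" for a
      using n that zc h R C_carrier[OF that] hact_gact[of h "loop_mul a R" z]
        lin_zero[OF hact_lin_r[OF h] Z.cvs_axioms Z.cvs_axioms] by (simp add: LD_mul H2_carrier)
    then show "\<exists>n. \<forall>a\<in>C n. gact (loop_mul a R) (hact h z) = \<zero>\<^bsub>Z\<^esub>" by blast
  qed
qed

text \<open>The elements of \<gg>' whose tensors with some power of \<open>Q\<close> kill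
  \<open>z\<close> form a subspace to which \<open>derived_subset\<close> applies. The exponent is 1
  on \<hh>' and 0 on positive root spaces; it is given on the \<open>f_i\<close>, and a bracket
  receives the sum of two exponents.\<close>

lemma smoothI:
  assumes z: "z \<in> carrier Z"
    and h: "\<And>x a. x \<in> csa_derived D \<Longrightarrow> a \<in> Q \<Longrightarrow> gact (tm x a) z = \<zero>\<^bsub>Z\<^esub>"
    and pos: "\<And>x a. x \<in> N_plus D \<Longrightarrow> a \<in> carrier A \<Longrightarrow> gact (tm x a) z = \<zero>\<^bsub>Z\<^esub>"
    and f: "\<And>i. i < km_rank D \<Longrightarrow> \<exists>n. \<forall>a\<in>C n. gact (tm (km_f D i) a) z = \<zero>\<^bsub>Z\<^esub>"
  shows "z \<in> smooth"
proof -
  let ?N = "{x \<in> derived D. \<exists>n. \<forall>a\<in>C n. gact (tm x a) z = \<zero>\<^bsub>Z\<^esub>}"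
  have le: "lin \<gg>' Z (\<lambda>x. gact (tm x a) z)" if "a \<in> carrier A" for a
    by (rule lin_comp[OF le_lin_l[OF that] gact_lin_l[OF z]])
  have "subsp \<gg> ?N"
  proof (rule subsp_I)
    show "?N \<subseteq> carrier \<gg>" using derived_carrier by auto
    show "\<zero>\<^bsub>\<gg>\<^esub> \<in> ?N"
      using lin_zero[OF le g'_cvs Z.cvs_axioms] subspD(2)[OF derived_subsp] C_carrier by auto
    show "x \<oplus>\<^bsub>\<gg>\<^esub> y \<in> ?N" if x: "x \<in> ?N" and y: "y \<in> ?N" for x y
    proof -
      obtain k n where kn: "\<forall>a\<in>C k. gact (tm x a) z = \<zero>\<^bsub>Z\<^esub>" "\<forall>a\<in>C n. gact (tm y a) z = \<zero>\<^bsub>Z\<^esub>"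
        using x y by blast
      have "gact (tm (x \<oplus>\<^bsub>\<gg>\<^esub> y) a) z = \<zero>\<^bsub>Z\<^esub>" if a: "a \<in> C (max k n)" for a
        using linD(2)[OF le[OF C_carrier[OF a]], of x y] x y kn C_mono[OF _ a, of k] C_mono[OF _ a, of n] by simp
      then show ?thesis using x y subspD(3)[OF derived_subsp] by blast
    qed
    show "c \<odot>\<^bsub>\<gg>\<^esub> x \<in> ?N" if x: "x \<in> ?N" for c x
    proof -
      obtain n where n: "\<forall>a\<in>C n. gact (tm x a) z = \<zero>\<^bsub>Z\<^esub>" using x by blast
      have "gact (tm (c \<odot>\<^bsub>\<gg>\<^esub> x) a) z = \<zero>\<^bsub>Z\<^esub>" if a: "a \<in> C n" for a
        using linD(3)[OF le[OF C_carrier[OF a]], of x c] x n a by simp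
      then show ?thesis using x subspD(4)[OF derived_subsp] by blast
    qed
  qed
  then have "derived D \<subseteq> ?N"
  proof (rule derived_subset)
    show "csa_derived D \<subseteq> ?N"
    proof
      fix x assume x: "x \<in> csa_derived D"
      then have "\<forall>a\<in>C 1. gact (tm x a) z = \<zero>\<^bsub>Z\<^esub>"
        using h cring.ideal_pow_one[OF A_cring Q] by simp
      with x show "x \<in> ?N" unfolding csa_derived_def by blast
    qed
    show "root_space D (root_of D m) \<subseteq> ?N" if m: "m \<in> pos_roots D" for m
    proof
      fix x assume x: "x \<in> root_space D (root_of D m)"
      have "x \<in> N_plus D"
        unfolding N_plus_def by (rule span_base) (use x m in \<open>auto simp: root_space_def\<close>)
      then have "\<forall>a\<in>C 0. gact (tm x a) z = \<zero>\<^bsub>Z\<^esub>" using pos C_carrier by blast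
      then show "x \<in> ?N" using x root_space_derived(1)[OF m] by blast
    qed
    show "km_f D i \<in> ?N" if "i < km_rank D" for i
      using f[OF that] ef_derived(2)[OF that] by blast
    show "br (km_f D i) x \<in> ?N" if i: "i < km_rank D" and x: "x \<in> ?N" for i x
    proof -
      obtain k n where kn: "\<forall>a\<in>C k. gact (tm (km_f D i) a) z = \<zero>\<^bsub>Z\<^esub>" "\<forall>a\<in>C n. gact (tm x a) z = \<zero>\<^bsub>Z\<^esub>"
        using f[OF i] x by blast
      note d = ef_derived(2)[OF i]
      have xd: "x \<in> derived D" using x by blast
      have bd: "br (km_f D i) x \<in> derived D"
        using br_derived[OF derived_carrier[OF d] derived_carrier[OF xd]] .
      \<comment> \<open>The sum of exponents is read as a product of ideals, whose elements are sums
        of products \<open>a b\<close>; and \<open>[f_i, x] \<otimes> a b\<close> is the bracket of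
        \<open>f_i \<otimes> a\<close> with \<open>x \<otimes> b\<close>, both of which kill
        \<open>z\<close>.\<close>
      have "a \<in> carrier A \<and> gact (tm (br (km_f D i) x) a) z = \<zero>\<^bsub>Z\<^esub>"
        if "a \<in> ideal_prod A (C (max k n)) (C (max k n))" for a
        using that
      proof (induction rule: ideal_prod.induct)
        case (prod a b)
        note ab = C_carrier[OF prod(1)] C_carrier[OF prod(2)]
        have "gact (tm (km_f D i) a) z = \<zero>\<^bsub>Z\<^esub>" "gact (tm x b) z = \<zero>\<^bsub>Z\<^esub>"
          using kn C_mono[OF _ prod(1), of k] C_mono[OF _ prod(2), of n] by auto
        then show ?case
          using gact_gact[of "tm (km_f D i) a" "tm x b" z] ab d xd z bd by (simp add: loop_bracket(3))
      next
        case (sum a b)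
        then show ?case
          using linD(2)[OF le_lin_r[OF bd], of a b] linD(2)[OF gact_lin_l[OF z], of "tm (br (km_f D i) x) a" "tm (br (km_f D i) x) b"] bd
          by simp
      qed
      then have "\<forall>a\<in>C (max k n + max k n). gact (tm (br (km_f D i) x) a) z = \<zero>\<^bsub>Z\<^esub>"
        unfolding cring.ideal_pow_add[OF A_cring Q] by blast
      with bd show ?thesis by blast
    qed
  qed
  then have D: "\<exists>n. \<forall>a\<in>C n. gact (tm x a) z = \<zero>\<^bsub>Z\<^esub>" if "x \<in> derived D" for x
    using that by blast
  \<comment> \<open>From \<gg>' to all of \<gg>' \<otimes> A: a further coefficient \<open>b\<close>
    does not matter, as the powers of \<open>Q\<close> are ideals.\<close>
  let ?P = "{P \<in> carrier G. \<exists>n. \<forall>a\<in>C n. gact (loop_mul a P) z = \<zero>\<^bsub>Z\<^esub>}"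
  have lm: "lin G Z (\<lambda>P. gact (loop_mul a P) z)" if "a \<in> carrier A" for a
    by (rule lin_comp[OF loop_mul(1)[OF that] gact_lin_l[OF z]])
  have "subsp G ?P"
  proof (rule G.subsp_I)
    show "?P \<subseteq> carrier G" by auto
    show "\<zero>\<^bsub>G\<^esub> \<in> ?P" using lin_zero[OF lm G_cvs Z.cvs_axioms] C_carrier by auto
    show "x \<oplus>\<^bsub>G\<^esub> y \<in> ?P" if x: "x \<in> ?P" and y: "y \<in> ?P" for x y
    proof -
      obtain k n where kn: "\<forall>a\<in>C k. gact (loop_mul a x) z = \<zero>\<^bsub>Z\<^esub>" "\<forall>a\<in>C n. gact (loop_mul a y) z = \<zero>\<^bsub>Z\<^esub>"
        using x y by blast
      have "gact (loop_mul a (x \<oplus>\<^bsub>G\<^esub> y)) z = \<zero>\<^bsub>Z\<^esub>" if a: "a \<in> C (max k n)" for a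
        using linD(2)[OF lm[OF C_carrier[OF a]], of x y] x y kn C_mono[OF _ a, of k] C_mono[OF _ a, of n] by simp
      then show ?thesis using x y G.a_closed[of x y] by blast
    qed
    show "c \<odot>\<^bsub>G\<^esub> x \<in> ?P" if x: "x \<in> ?P" for c x
    proof -
      obtain n where n: "\<forall>a\<in>C n. gact (loop_mul a x) z = \<zero>\<^bsub>Z\<^esub>" using x by blast
      have "gact (loop_mul a (c \<odot>\<^bsub>G\<^esub> x)) z = \<zero>\<^bsub>Z\<^esub>" if a: "a \<in> C n" for a
        using linD(3)[OF lm[OF C_carrier[OF a]], of x c] x n a by simp
      then show ?thesis using x G.s_closed[of x c] by blast
    qed
  qed
  moreover have "tm x b \<in> ?P" if x: "x \<in> derived D" and b: "b \<in> carrier A" for x b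
  proof -
    obtain n where "\<forall>a\<in>C n. gact (tm x a) z = \<zero>\<^bsub>Z\<^esub>" using D[OF x] by blast
    then have "\<forall>a\<in>C n. gact (loop_mul a (tm x b)) z = \<zero>\<^bsub>Z\<^esub>"
      using C_mult C_carrier b x by (simp add: loop_mul(2))
    then show ?thesis using x b by auto
  qed
  ultimately have "P \<in> ?P" if "P \<in> carrier G" for P
    using that by (rule G_induct)
  then show ?thesis using z by (auto simp: smooth_def)
qed

end

locale smooth_rep = smooth_data D A H2 Z Q
  for D :: "'g km_datum" and A :: "(complex, 'a) module" and H2 :: "'g set"
    and Z :: "(('g, 'a) cur, 'z) lie_mod" and Q +
  assumes all_smooth: "carrier Z \<subseteq> smooth"
begin

lemma null_sequence:
  assumes c: "\<And>m. c m \<in> C m" and P: "P \<in> carrier G" and z: "z \<in> carrier Z"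
  shows "\<forall>\<^sub>F m in sequentially. gact (loop_mul (c m) P) z = \<zero>\<^bsub>Z\<^esub>"
proof -
  obtain n where n: "\<forall>a\<in>C n. gact (loop_mul a P) z = \<zero>\<^bsub>Z\<^esub>"
    using all_smooth z P unfolding smooth_def by blast
  show ?thesis
    using n C_mono c by (intro eventually_sequentiallyI[of n]) blast
qed

text \<open>Such sequences stand for elements of the \<open>Q\<close>-adic completion of
  \<open>A\<close>, and \<open>lim_act\<close> for the action of the completed coefficients on a
  smooth module.\<close>

definition coherent :: "(nat \<Rightarrow> 'a) \<Rightarrow> bool" where
  "coherent e \<longleftrightarrow> (\<forall>m. e m \<in> carrier A) \<and> (\<forall>n m. n \<le> m \<longrightarrow> e n \<ominus>\<^bsub>A\<^esub> e m \<in> C n)"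

definition lim_act :: "(nat \<Rightarrow> 'a) \<Rightarrow> ('g \<times> 'a \<Rightarrow> complex) set \<Rightarrow> 'z \<Rightarrow> 'z" where
  "lim_act e P z = (THE u. \<forall>\<^sub>F m in sequentially. gact (loop_mul (e m) P) z = u)"

lemma lim_act_unique:
  assumes "\<forall>\<^sub>F m in sequentially. gact (loop_mul (e m) P) z = u"
  shows "lim_act e P z = u"
  unfolding lim_act_def
proof (rule the_equality[where P = "\<lambda>u. \<forall>\<^sub>F m in sequentially. gact (loop_mul (e m) P) z = u", OF assms])
  fix u' assume "\<forall>\<^sub>F m in sequentially. gact (loop_mul (e m) P) z = u'"
  with assms have "\<forall>\<^sub>F m in sequentially. u' = u" by eventually_elim simp
  then show "u' = u" by simp
qed

lemma gact_mul_minus: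
  assumes "a \<in> carrier A" "b \<in> carrier A" "P \<in> carrier G" "z \<in> carrier Z"
  shows "gact (loop_mul (a \<ominus>\<^bsub>A\<^esub> b) P) z = gact (loop_mul a P) z \<ominus>\<^bsub>Z\<^esub> gact (loop_mul b P) z"
  using lin_minus[OF lin_comp[OF loop_mul_lin_l[OF assms(3)] gact_lin_l[OF assms(4)]] A.cvs_axioms Z.cvs_axioms assms(1,2)] .

text \<open>If the power \<open>C n\<close> annihilates, then \<open>e n\<close> and
  \<open>e m\<close> act alike for all \<open>m\<close> beyond \<open>n\<close>; the sequence of
  values is eventually constant, and the limit is purely algebraic.\<close>

lemma lim_act:
  assumes e: "coherent e" and P: "P \<in> carrier G" and z: "z \<in> carrier Z"
  shows "\<forall>\<^sub>F m in sequentially. gact (loop_mul (e m) P) z = lim_act e P z"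
proof -
  have ec: "e m \<in> carrier A" for m using e by (simp add: coherent_def)
  obtain n where n: "\<forall>a\<in>C n. gact (loop_mul a P) z = \<zero>\<^bsub>Z\<^esub>"
    using all_smooth z P unfolding smooth_def by blast
  have "gact (loop_mul (e m) P) z = gact (loop_mul (e n) P) z" if "n \<le> m" for m
  proof -
    have "gact (loop_mul (e n \<ominus>\<^bsub>A\<^esub> e m) P) z = \<zero>\<^bsub>Z\<^esub>"
      using n e that by (simp add: coherent_def)
    then show ?thesis
      using ec P z by (simp add: gact_mul_minus Z.minus_eq_zero_iff)
  qed
  then have ev: "\<forall>\<^sub>F m in sequentially. gact (loop_mul (e m) P) z = gact (loop_mul (e n) P) z"
    by (intro eventually_sequentiallyI[of n])
  show ?thesis using lim_act_unique[OF ev] ev by simp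
qed

lemma lim_act_closed [simp]:
  assumes e: "coherent e" and P: "P \<in> carrier G" and z: "z \<in> carrier Z"
  shows "lim_act e P z \<in> carrier Z"
proof -
  have "\<forall>\<^sub>F m in sequentially. lim_act e P z \<in> carrier Z"
    using lim_act[OF assms]
  proof eventually_elim
    case (elim m)
    have "e m \<in> carrier A" using e by (simp add: coherent_def)
    then show ?case using P z elim[symmetric] by simp
  qed
  then show ?thesis by simp
qed

lemma lim_act_lin_r:
  assumes e: "coherent e" and P: "P \<in> carrier G"
  shows "lin Z Z (lim_act e P)"
proof (rule linI)
  have eP: "loop_mul (e m) P \<in> carrier G" for m using e P by (simp add: coherent_def)
  show "lim_act e P z \<in> carrier Z" if "z \<in> carrier Z" for z using assms that by simp
  show "lim_act e P (z \<oplus>\<^bsub>Z\<^esub> w) = lim_act e P z \<oplus>\<^bsub>Z\<^esub> lim_act e P w" if z: "z \<in> carrier Z" "w \<in> carrier Z" for z w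
    by (rule lim_act_unique, use lim_act[OF e P z(1)] lim_act[OF e P z(2)] in eventually_elim)
      (simp add: linD(2)[OF gact_lin_r[OF eP] z])
  show "lim_act e P (c \<odot>\<^bsub>Z\<^esub> z) = c \<odot>\<^bsub>Z\<^esub> lim_act e P z" if z: "z \<in> carrier Z" for c z
    by (rule lim_act_unique, use lim_act[OF e P z] in eventually_elim)
      (simp add: linD(3)[OF gact_lin_r[OF eP] z])
qed

lemma lim_act_lin_l:
  assumes e: "coherent e" and z: "z \<in> carrier Z"
  shows "lin G Z (\<lambda>P. lim_act e P z)"
proof (rule linI)
  have ec: "e m \<in> carrier A" for m using e by (simp add: coherent_def)
  note l = lin_comp[OF loop_mul(1)[OF ec] gact_lin_l[OF z]]
  show "lim_act e P z \<in> carrier Z" if "P \<in> carrier G" for P using assms that by simp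
  show "lim_act e (P \<oplus>\<^bsub>G\<^esub> R) z = lim_act e P z \<oplus>\<^bsub>Z\<^esub> lim_act e R z" if P: "P \<in> carrier G" "R \<in> carrier G" for P R
    by (rule lim_act_unique, use lim_act[OF e P(1) z] lim_act[OF e P(2) z] in eventually_elim)
      (simp add: linD(2)[OF l P])
  show "lim_act e (c \<odot>\<^bsub>G\<^esub> P) z = c \<odot>\<^bsub>Z\<^esub> lim_act e P z" if P: "P \<in> carrier G" for c P
    by (rule lim_act_unique, use lim_act[OF e P z] in eventually_elim)
      (simp add: linD(3)[OF l P])
qed

text \<open>For coherent \<open>e\<close>, \<open>f\<close> the product \<open>e f\<close> is the limit of any coherent \<open>g\<close> congruent to it; the
  two cases of interest are \<open>e = f = g\<close> idempotent and \<open>e\<close>, \<open>f\<close> orthogonal with \<open>g = 0\<close>.\<close>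

lemma lim_act_lim_act:
  assumes e: "coherent e" and f: "coherent f" and g: "coherent g"
    and ef: "\<And>m. e m \<otimes>\<^bsub>A\<^esub> f m \<ominus>\<^bsub>A\<^esub> g m \<in> C m"
    and P: "P \<in> carrier G" and R: "R \<in> carrier G" and z: "z \<in> carrier Z"
  shows "lim_act e P (lim_act f R z) = lim_act g (LB P R) z \<oplus>\<^bsub>Z\<^esub> lim_act f R (lim_act e P z)"
proof -
  have c: "e m \<in> carrier A" "f m \<in> carrier A" "g m \<in> carrier A" for m
    using e f g by (simp_all add: coherent_def)
  have "\<forall>\<^sub>F m in sequentially. lim_act e P (lim_act f R z) =
      lim_act g (LB P R) z \<oplus>\<^bsub>Z\<^esub> lim_act f R (lim_act e P z)"
    using lim_act[OF e P lim_act_closed[OF f R z]] lim_act[OF f R z] lim_act[OF e P z]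
      lim_act[OF f R lim_act_closed[OF e P z]] lim_act[OF g LB_closed[OF P R] z]
      null_sequence[OF ef LB_closed[OF P R] z]
  proof eventually_elim
    case (elim m)
    have "gact (loop_mul (e m \<otimes>\<^bsub>A\<^esub> f m) (LB P R)) z = lim_act g (LB P R) z"
      using elim(5,6) c P R z lim_act_closed[OF g LB_closed[OF P R] z]
      by (simp add: gact_mul_minus Z.minus_eq_zero_iff)
    moreover have "LB (loop_mul (e m) P) (loop_mul (f m) R) = loop_mul (e m \<otimes>\<^bsub>A\<^esub> f m) (LB P R)"
      using c P R A_comm[of "f m" "e m"] by (simp add: LB_mul_l LB_mul_r loop_mul_mul)
    ultimately show ?case
      using gact_gact[of "loop_mul (e m) P" "loop_mul (f m) R" z] c P R z elim(1-4) by simp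
  qed
  then show ?thesis by simp
qed

lemma hact_lim_act:
  assumes e: "coherent e" and h: "h \<in> H2" and P: "P \<in> carrier G" and z: "z \<in> carrier Z"
  shows "hact h (lim_act e P z) = lim_act e (LD h P) z \<oplus>\<^bsub>Z\<^esub> lim_act e P (hact h z)"
proof -
  have c: "e m \<in> carrier A" for m using e by (simp add: coherent_def)
  note hc = H2_carrier[OF h]
  have "\<forall>\<^sub>F m in sequentially. hact h (lim_act e P z) = lim_act e (LD h P) z \<oplus>\<^bsub>Z\<^esub> lim_act e P (hact h z)"
    using lim_act[OF e P z] lim_act[OF e LD_closed[OF hc P] z] lim_act[OF e P hact_closed[OF h z]]
  proof eventually_elim
    case (elim m)
    then show ?case
      using hact_gact[OF h, of "loop_mul (e m) P" z] c[of m] P z by (simp add: LD_mul hc)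
  qed
  then show ?thesis by simp
qed

lemma lim_act_complement:
  assumes e: "coherent e" and f: "coherent f" and ef: "\<And>m. e m \<oplus>\<^bsub>A\<^esub> f m = \<one>\<^bsub>A\<^esub>"
    and P: "P \<in> carrier G" and z: "z \<in> carrier Z"
  shows "lim_act e P z \<oplus>\<^bsub>Z\<^esub> lim_act f P z = gact P z"
proof -
  have c: "e m \<in> carrier A" "f m \<in> carrier A" for m using e f by (simp_all add: coherent_def)
  have "\<forall>\<^sub>F m in sequentially. lim_act e P z \<oplus>\<^bsub>Z\<^esub> lim_act f P z = gact P z"
    using lim_act[OF e P z] lim_act[OF f P z]
  proof eventually_elim
    case (elim m)
    have "gact (loop_mul (e m \<oplus>\<^bsub>A\<^esub> f m) P) z = gact (loop_mul (e m) P) z \<oplus>\<^bsub>Z\<^esub> gact (loop_mul (f m) P) z"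
      using linD(2)[OF lin_comp[OF loop_mul_lin_l[OF P] gact_lin_l[OF z]] c] .
    then show ?case using elim P by (simp add: ef loop_mul_one)
  qed
  then show ?thesis by simp
qed

lemma lim_act_tm:
  assumes e: "coherent e" and x: "x \<in> derived D" and a: "a \<in> carrier A" and z: "z \<in> carrier Z"
    and ev: "\<forall>\<^sub>F m in sequentially. gact (tm x (e m \<otimes>\<^bsub>A\<^esub> a)) z = u"
  shows "lim_act e (tm x a) z = u"
proof (rule lim_act_unique)
  have c: "e m \<in> carrier A" for m using e by (simp add: coherent_def)
  show "\<forall>\<^sub>F m in sequentially. gact (loop_mul (e m) (tm x a)) z = u"
    using ev by eventually_elim (simp add: loop_mul(2) c x a)
qed

end

subsection \<open>Highest weight vectors\<close>

context loop_data begin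

lemma cur_h_subsp: "subsp Cur (cur_h D A H2)"
proof -
  interpret B: bracket_space Cur by (rule Cur_bracket)
  let ?S = "cspan G {tm x a | x a. x \<in> csa_derived D \<and> a \<in> carrier A}"
  have S: "subsp G ?S" by (rule G.span_subsp) (auto simp: csa_derived_def)
  show ?thesis
    unfolding cur_h_def
    by (rule B.subsp_I)
      (use subspD[OF S] subspD[OF H2_subsp] in \<open>auto simp: Cur_simps\<close>)
qed

lemma cur_N_subsp: "subsp Cur (cur_N_plus D A H2)"
proof -
  interpret B: bracket_space Cur by (rule Cur_bracket)
  show ?thesis
    unfolding cur_N_plus_def using N_plus_derived cur_elem_closed by (intro B.span_subsp) auto
qed

lemma cur_h_elem: "x \<in> csa_derived D \<Longrightarrow> a \<in> carrier A \<Longrightarrow> cur_elem D A x a \<in> cur_h D A H2"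
  unfolding cur_h_def cur_elem_def using subspD(2)[OF H2_subsp]
  by (auto intro!: G.span_base simp: csa_derived_def)

lemma cur_h_H2: "h \<in> H2 \<Longrightarrow> (\<zero>\<^bsub>G\<^esub>, h) \<in> cur_h D A H2"
proof -
  have "subsp G (cspan G {tm x a | x a. x \<in> csa_derived D \<and> a \<in> carrier A})"
    by (rule G.span_subsp) (auto simp: csa_derived_def)
  then show "h \<in> H2 \<Longrightarrow> (\<zero>\<^bsub>G\<^esub>, h) \<in> cur_h D A H2"
    unfolding cur_h_def by (simp add: subspD(2))
qed

end

locale weight = loop_data D A H2 for D :: "'g km_datum" and A :: "(complex, 'a) module" and H2 :: "'g set" +
  fixes \<psi> :: "('g, 'a) cur \<Rightarrow> complex"
  assumes \<psi>: "\<psi> \<in> functionals ((current D A H2)\<lparr>carrier := cur_h D A H2\<rparr>)"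
begin

lemma \<psi>_add: "t \<in> cur_h D A H2 \<Longrightarrow> s \<in> cur_h D A H2 \<Longrightarrow> \<psi> (t \<oplus>\<^bsub>Cur\<^esub> s) = \<psi> t + \<psi> s"
  using linD(2)[OF \<psi>[unfolded functionals_def], of t s] by (simp add: CC_mod_def)

lemma \<psi>_smult: "t \<in> cur_h D A H2 \<Longrightarrow> \<psi> (c \<odot>\<^bsub>Cur\<^esub> t) = c * \<psi> t"
  using linD(3)[OF \<psi>[unfolded functionals_def], of t c] by (simp add: CC_mod_def)

lemma \<psi>_zero: "\<psi> \<zero>\<^bsub>Cur\<^esub> = 0"
proof -
  interpret B: bracket_space Cur by (rule Cur_bracket)
  show ?thesis using \<psi>_smult[OF subspD(2)[OF cur_h_subsp], of 0] by simp
qed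

lemma \<psi>_elem_add: "x \<in> csa_derived D \<Longrightarrow> a \<in> carrier A \<Longrightarrow> b \<in> carrier A \<Longrightarrow>
    \<psi> (cur_elem D A x (a \<oplus>\<^bsub>A\<^esub> b)) = \<psi> (cur_elem D A x a) + \<psi> (cur_elem D A x b)"
proof -
  assume x: "x \<in> csa_derived D" and a: "a \<in> carrier A" "b \<in> carrier A"
  have "cur_elem D A x (a \<oplus>\<^bsub>A\<^esub> b) = cur_elem D A x a \<oplus>\<^bsub>Cur\<^esub> cur_elem D A x b"
    using linD(2)[OF le_lin_r a] x by (simp add: cur_elem_def Cur_simps csa_derived_def)
  then show ?thesis using \<psi>_add[OF cur_h_elem[OF x a(1)] cur_h_elem[OF x a(2)]] by simp
qed

end

locale weight_rep = weight D A H2 \<psi> + cur_rep D A H2 Z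
  for D :: "'g km_datum" and A :: "(complex, 'a) module" and H2 :: "'g set" and \<psi>
    and Z :: "(('g, 'a) cur, 'z) lie_mod"
begin

text \<open>The condition of the Verma module concerns arbitrary sums \<open>n + t\<close>. Taking
  one summand to be zero separates it, and linearity reduces each half to pure tensors and \<hh>'',
  where it can be checked by hand.\<close>

lemma highest_weight_iff:
  assumes z: "z \<in> carrier Z"
  shows "(\<forall>n\<in>cur_N_plus D A H2. \<forall>t\<in>cur_h D A H2. act Z (n \<oplus>\<^bsub>Cur\<^esub> t) z = \<psi> t \<odot>\<^bsub>Z\<^esub> z) \<longleftrightarrow>
    (\<forall>x\<in>N_plus D. \<forall>a\<in>carrier A. gact (tm x a) z = \<zero>\<^bsub>Z\<^esub>) \<and>
    (\<forall>x\<in>csa_derived D. \<forall>a\<in>carrier A. gact (tm x a) z = \<psi> (cur_elem D A x a) \<odot>\<^bsub>Z\<^esub> z) \<and>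
    (\<forall>h\<in>H2. hact h z = \<psi> (\<zero>\<^bsub>G\<^esub>, h) \<odot>\<^bsub>Z\<^esub> z)" (is "?L \<longleftrightarrow> ?N \<and> ?C \<and> ?H")
proof
  interpret B: bracket_space Cur by (rule Cur_bracket)
  have Nc: "n \<in> carrier Cur" if "n \<in> cur_N_plus D A H2" for n
    using subspD(1)[OF cur_N_subsp] that by blast
  have hc: "t \<in> carrier Cur" if "t \<in> cur_h D A H2" for t
    using subspD(1)[OF cur_h_subsp] that by blast
  { assume L: ?L
    have n: "act Z n z = \<zero>\<^bsub>Z\<^esub>" if "n \<in> cur_N_plus D A H2" for n
      using L[rule_format, OF that subspD(2)[OF cur_h_subsp]] Nc[OF that] z by (simp add: \<psi>_zero)
    have t: "act Z t z = \<psi> t \<odot>\<^bsub>Z\<^esub> z" if "t \<in> cur_h D A H2" for t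
      using L[rule_format, OF subspD(2)[OF cur_N_subsp] that] hc[OF that] by simp
    have "cur_elem D A x a \<in> cur_N_plus D A H2" if "x \<in> N_plus D" "a \<in> carrier A" for x a
      unfolding cur_N_plus_def using that N_plus_derived cur_elem_closed by (intro B.span_base) auto
    then have ?N using n by (simp add: gact_def cur_elem_def)
    moreover have ?C using t[OF cur_h_elem] by (simp add: gact_def cur_elem_def)
    moreover have ?H using t[OF cur_h_H2] by (simp add: hact_def)
    ultimately show "?N \<and> ?C \<and> ?H" by blast }
  assume NCH: "?N \<and> ?C \<and> ?H"
  have "cur_N_plus D A H2 \<subseteq> {X \<in> carrier Cur. act Z X z \<in> {\<zero>\<^bsub>Z\<^esub>}}"
    unfolding cur_N_plus_def
  proof (rule B.span_least)
    show "subsp Cur {X \<in> carrier Cur. act Z X z \<in> {\<zero>\<^bsub>Z\<^esub>}}"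
      by (rule lin_vimage_subsp[OF Z.act_lin_l[OF z] B.cvs_axioms Z.cvs_axioms Z.subsp_zero])
    show "{cur_elem D A x a |x a. x \<in> N_plus D \<and> a \<in> carrier A} \<subseteq> {X \<in> carrier Cur. act Z X z \<in> {\<zero>\<^bsub>Z\<^esub>}}"
      using NCH N_plus_derived cur_elem_closed by (auto simp: gact_def cur_elem_def)
  qed
  then have n: "act Z n z = \<zero>\<^bsub>Z\<^esub>" if "n \<in> cur_N_plus D A H2" for n using that by blast
  let ?S = "{tm x a | x a. x \<in> csa_derived D \<and> a \<in> carrier A}"
  \<comment> \<open>Membership in \<open>cur_h\<close> is carried along because
    \<open>\<psi>\<close> is known to be linear there only.\<close>
  let ?E = "{P \<in> carrier G. (P, \<zero>\<^bsub>\<gg>\<^esub>) \<in> cur_h D A H2 \<and> gact P z = \<psi> (P, \<zero>\<^bsub>\<gg>\<^esub>) \<odot>\<^bsub>Z\<^esub> z}"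
  note gl = linD[OF gact_lin_l[OF z]]
  have "cspan G ?S \<subseteq> ?E"
  proof (rule G.span_least)
    show "subsp G ?E"
    proof (rule G.subsp_I)
      show "?E \<subseteq> carrier G" by blast
      show "\<zero>\<^bsub>G\<^esub> \<in> ?E"
        using subspD(2)[OF cur_h_subsp] \<psi>_zero z by (simp add: Cur_simps)
      show "P \<oplus>\<^bsub>G\<^esub> R \<in> ?E" if P: "P \<in> ?E" and R: "R \<in> ?E" for P R
        using P R subspD(3)[OF cur_h_subsp, of "(P, \<zero>\<^bsub>\<gg>\<^esub>)" "(R, \<zero>\<^bsub>\<gg>\<^esub>)"] \<psi>_add[of "(P, \<zero>\<^bsub>\<gg>\<^esub>)" "(R, \<zero>\<^bsub>\<gg>\<^esub>)"] z
        by (simp add: Cur_simps gl Z.s_ladd)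
      show "c \<odot>\<^bsub>G\<^esub> P \<in> ?E" if P: "P \<in> ?E" for c P
        using P subspD(4)[OF cur_h_subsp, of "(P, \<zero>\<^bsub>\<gg>\<^esub>)" c] \<psi>_smult[of "(P, \<zero>\<^bsub>\<gg>\<^esub>)" c] z
        by (simp add: Cur_simps gl Z.s_mult)
    qed
    show "?S \<subseteq> ?E"
      using NCH cur_h_elem by (auto simp: cur_elem_def csa_derived_def)
  qed
  then have t: "act Z t z = \<psi> t \<odot>\<^bsub>Z\<^esub> z" if t: "t \<in> cur_h D A H2" for t
  proof -
    obtain P h where Ph: "t = (P, h)" "P \<in> ?E" "h \<in> H2"
      using t \<open>cspan G ?S \<subseteq> ?E\<close> unfolding cur_h_def by blast
    have "t = (P, \<zero>\<^bsub>\<gg>\<^esub>) \<oplus>\<^bsub>Cur\<^esub> (\<zero>\<^bsub>G\<^esub>, h)"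
      using Ph by (simp add: Cur_simps H2_carrier)
    then have "\<psi> t = \<psi> (P, \<zero>\<^bsub>\<gg>\<^esub>) + \<psi> (\<zero>\<^bsub>G\<^esub>, h)"
      using \<psi>_add[of "(P, \<zero>\<^bsub>\<gg>\<^esub>)" "(\<zero>\<^bsub>G\<^esub>, h)"] cur_h_H2[OF Ph(3)] Ph(2) by simp
    then show ?thesis
      using Ph act_split[of P h z] NCH z by (simp add: Z.s_ladd)
  qed
  show ?L
    using n t Nc hc z by (simp add: Z.act_add_l)
qed

end

text \<open>A vector that is an eigenvector of \<hh>'' generates the module by loop elements alone,
  since \<hh>'' normalizes \<gg>' \<otimes> A. The later inductions rely on this: their properties
  are compatible with the loop action, but not with that of \<hh>''.\<close>

lemma (in cur_rep) generated_by_loop: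
  assumes gen: "\<And>N. lie_submodule Cur Z N \<Longrightarrow> v \<in> N \<Longrightarrow> N = carrier Z"
    and v: "v \<in> carrier Z" and eig: "\<And>h. h \<in> H2 \<Longrightarrow> \<exists>c. hact h v = c \<odot>\<^bsub>Z\<^esub> v"
    and N: "subsp Z N" "v \<in> N" "\<And>P z. P \<in> carrier G \<Longrightarrow> z \<in> N \<Longrightarrow> gact P z \<in> N"
  shows "N = carrier Z"
proof -
  define S where "S = {N. subsp Z N \<and> v \<in> N \<and> (\<forall>P\<in>carrier G. \<forall>z\<in>N. gact P z \<in> N)}"
  have SI: "N \<in> S" if "subsp Z N" "v \<in> N" "\<And>P z. P \<in> carrier G \<Longrightarrow> z \<in> N \<Longrightarrow> gact P z \<in> N" for N
    using that by (simp add: S_def)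
  \<comment> \<open>The given \<open>N\<close> need not be visibly stable under \<hh>''; stability
    is proved for the least subspace of this kind.\<close>
  let ?M = "\<Inter>S"
  have NS: "N \<in> S" using N by (simp add: S_def)
  have Mc: "?M \<subseteq> carrier Z" using NS subspD(1)[OF N(1)] by blast
  have M: "subsp Z ?M"
    by (rule Z.subsp_I[OF Mc]) (auto simp: S_def dest: subspD(2-4))
  have MS: "?M \<in> S" using M by (auto simp: S_def)
  have "lie_submodule Cur Z ?M"
  proof (rule submoduleI[OF M])
    show "gact P z \<in> ?M" if "P \<in> carrier G" "z \<in> ?M" for P z
      using that MS unfolding S_def by blast
    show "hact h z \<in> ?M" if h: "h \<in> H2" and z: "z \<in> ?M" for h z
    proof -
      \<comment> \<open>By \<open>hact_gact\<close> this set is again stable under loop elements,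
        and it contains \<open>v\<close> by \<open>eig\<close>. Minimality then forces it to be all
        of \<open>?M\<close>.\<close>
      let ?K = "{u \<in> ?M. hact h u \<in> ?M}"
      have hl: "lin Z Z (hact h)" by (rule hact_lin_r[OF h])
      have "?K \<in> S"
      proof (rule SI)
        show "subsp Z ?K"
        proof (rule Z.subsp_I)
          show "?K \<subseteq> carrier Z" using Mc by blast
          show "\<zero>\<^bsub>Z\<^esub> \<in> ?K" using subspD(2)[OF M] lin_zero[OF hl Z.cvs_axioms Z.cvs_axioms] by simp
          show "x \<oplus>\<^bsub>Z\<^esub> y \<in> ?K" if "x \<in> ?K" "y \<in> ?K" for x y
          proof -
            have "x \<in> carrier Z" "y \<in> carrier Z" using that Mc by blast+
            then show ?thesis
              using that subspD(3)[OF M] linD(2)[OF hl, of x y] by (simp del: Inter_iff)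
          qed
          show "c \<odot>\<^bsub>Z\<^esub> x \<in> ?K" if "x \<in> ?K" for c x
          proof -
            have "x \<in> carrier Z" using that Mc by blast
            then show ?thesis
              using that subspD(4)[OF M] linD(3)[OF hl, of x c] by (simp del: Inter_iff)
          qed
        qed
        obtain c where "hact h v = c \<odot>\<^bsub>Z\<^esub> v" using eig[OF h] by blast
        then have "hact h v \<in> ?M"
          using MS subspD(4)[OF M, of v c] unfolding S_def by simp
        then show "v \<in> ?K" using MS unfolding S_def by blast
        fix P u assume P: "P \<in> carrier G" and u: "u \<in> ?K"
        have st: "gact R w \<in> ?M" if "R \<in> carrier G" "w \<in> ?M" for R w
          using MS that unfolding S_def by blast
        have uc: "u \<in> carrier Z" using u Mc by blast
        have "hact h (gact P u) \<in> ?M"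
          unfolding hact_gact[OF h P uc]
          by (rule subspD(3)[OF M]) (use st u P H2_carrier[OF h] in auto)
        then show "gact P u \<in> ?K" using st[OF P] u by blast
      qed
      then show ?thesis using z by blast
    qed
  qed
  moreover have "v \<in> ?M" using MS unfolding S_def by blast
  ultimately have "?M = carrier Z" by (rule gen)
  then show ?thesis using NS subspD(1)[OF N(1)] by blast
qed

subsection \<open>Linear maps between two modules\<close>

text \<open>Maps are required to vanish outside \<open>carrier V\<close>, so that equal linear maps
  are equal functions. The field \<open>act\<close> is a placeholder, replaced when
  \<open>HF\<close> is formed.\<close>

definition hom_space :: "('x, 'v) lie_mod \<Rightarrow> ('x, 'z) lie_mod \<Rightarrow> ('x, 'v \<Rightarrow> 'z) lie_mod" where
  "hom_space V Z = \<lparr>carrier = {\<phi>. lin V Z \<phi> \<and> (\<forall>v. v \<notin> carrier V \<longrightarrow> \<phi> v = \<zero>\<^bsub>Z\<^esub>)},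
     mult = (\<lambda>_ _ _. \<zero>\<^bsub>Z\<^esub>), one = (\<lambda>_. \<zero>\<^bsub>Z\<^esub>), zero = (\<lambda>_. \<zero>\<^bsub>Z\<^esub>),
     add = (\<lambda>\<phi> \<chi> v. \<phi> v \<oplus>\<^bsub>Z\<^esub> \<chi> v), smult = (\<lambda>c \<phi> v. c \<odot>\<^bsub>Z\<^esub> \<phi> v), act = (\<lambda>_ \<phi>. \<phi>)\<rparr>"

lemma hom_space_simps:
  "\<phi> \<in> carrier (hom_space V Z) \<longleftrightarrow> lin V Z \<phi> \<and> (\<forall>v. v \<notin> carrier V \<longrightarrow> \<phi> v = \<zero>\<^bsub>Z\<^esub>)"
  "\<zero>\<^bsub>hom_space V Z\<^esub> = (\<lambda>_. \<zero>\<^bsub>Z\<^esub>)" "\<phi> \<oplus>\<^bsub>hom_space V Z\<^esub> \<chi> = (\<lambda>v. \<phi> v \<oplus>\<^bsub>Z\<^esub> \<chi> v)"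
  "c \<odot>\<^bsub>hom_space V Z\<^esub> \<phi> = (\<lambda>v. c \<odot>\<^bsub>Z\<^esub> \<phi> v)"
  by (simp_all add: hom_space_def)

lemma hom_space_cvs:
  assumes Z: "cvs Z" shows "cvs (hom_space V Z)"
proof -
  interpret Z: cvs Z by fact
  have val: "\<phi> v \<in> carrier Z" if "\<phi> \<in> carrier (hom_space V Z)" for \<phi> v
    using that linD(1)[where V = V and W = Z and f = \<phi> and x = v] by (cases "v \<in> carrier V") (auto simp: hom_space_simps)
  have "lin V Z (\<lambda>_. \<zero>\<^bsub>Z\<^esub>)" by (rule linI) auto
  then show ?thesis
    by (intro cvsI)
      (simp_all add: hom_space_simps(2-) val Z.a_ac Z.s_ladd Z.s_radd Z.s_mult,
       simp_all add: hom_space_simps lin_add[OF _ _ Z] lin_comp[OF _ Z.lin_smult])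
qed

lemma lin_restrict:
  assumes "lin V W f" "cvs V"
  shows "lin V W (\<lambda>v. if v \<in> carrier V then f v else z)"
proof -
  interpret V: cvs V by fact
  show ?thesis by (rule linI) (simp_all add: linD[OF assms(1)])
qed

text \<open>A form of \<open>highest_weight_iff\<close> with the module as a premise, applicable to
  the modules \<open>ZE\<close> and \<open>HF\<close> that are built later.\<close>

lemma (in loop_data) highest_weight_I:
  assumes "weight D A H2 \<psi>" "lie_rep Cur Z" "z \<in> carrier Z"
    and "\<And>x a. x \<in> N_plus D \<Longrightarrow> a \<in> carrier A \<Longrightarrow> act Z (tm x a, \<zero>\<^bsub>\<gg>\<^esub>) z = \<zero>\<^bsub>Z\<^esub>"
    and "\<And>x a. x \<in> csa_derived D \<Longrightarrow> a \<in> carrier A \<Longrightarrow> act Z (tm x a, \<zero>\<^bsub>\<gg>\<^esub>) z = \<psi> (cur_elem D A x a) \<odot>\<^bsub>Z\<^esub> z"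
    and "\<And>h. h \<in> H2 \<Longrightarrow> act Z (\<zero>\<^bsub>G\<^esub>, h) z = \<psi> (\<zero>\<^bsub>G\<^esub>, h) \<odot>\<^bsub>Z\<^esub> z"
    and "n \<in> cur_N_plus D A H2" "t \<in> cur_h D A H2"
  shows "act Z (n \<oplus>\<^bsub>Cur\<^esub> t) z = \<psi> t \<odot>\<^bsub>Z\<^esub> z"
proof -
  have "cur_rep D A H2 Z" using assms(2) by (simp add: cur_rep_def loop_data_axioms)
  then interpret weight_rep D A H2 \<psi> Z using assms(1) by (simp add: weight_rep_def)
  show ?thesis
    using highest_weight_iff[OF assms(3)] assms(4-) by (simp add: gact_def hact_def)
qed

lemma (in loop_data) highest_weight_D:
  assumes "weight D A H2 \<psi>" "lie_rep Cur Z" "z \<in> carrier Z"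
    and "\<And>n t. n \<in> cur_N_plus D A H2 \<Longrightarrow> t \<in> cur_h D A H2 \<Longrightarrow> act Z (n \<oplus>\<^bsub>Cur\<^esub> t) z = \<psi> t \<odot>\<^bsub>Z\<^esub> z"
  shows "x \<in> N_plus D \<Longrightarrow> a \<in> carrier A \<Longrightarrow> act Z (tm x a, \<zero>\<^bsub>\<gg>\<^esub>) z = \<zero>\<^bsub>Z\<^esub>"
    and "y \<in> csa_derived D \<Longrightarrow> a \<in> carrier A \<Longrightarrow> act Z (tm y a, \<zero>\<^bsub>\<gg>\<^esub>) z = \<psi> (cur_elem D A y a) \<odot>\<^bsub>Z\<^esub> z"
    and "h \<in> H2 \<Longrightarrow> act Z (\<zero>\<^bsub>G\<^esub>, h) z = \<psi> (\<zero>\<^bsub>G\<^esub>, h) \<odot>\<^bsub>Z\<^esub> z"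
proof -
  have "cur_rep D A H2 Z" using assms(2) by (simp add: cur_rep_def loop_data_axioms)
  then interpret weight_rep D A H2 \<psi> Z using assms(1) by (simp add: weight_rep_def)
  have *: "(\<forall>x\<in>N_plus D. \<forall>a\<in>carrier A. gact (tm x a) z = \<zero>\<^bsub>Z\<^esub>) \<and>
    (\<forall>x\<in>csa_derived D. \<forall>a\<in>carrier A. gact (tm x a) z = \<psi> (cur_elem D A x a) \<odot>\<^bsub>Z\<^esub> z) \<and>
    (\<forall>h\<in>H2. hact h z = \<psi> (\<zero>\<^bsub>G\<^esub>, h) \<odot>\<^bsub>Z\<^esub> z)"
    using highest_weight_iff[OF assms(3)] assms(4) by blast
  show "x \<in> N_plus D \<Longrightarrow> a \<in> carrier A \<Longrightarrow> act Z (tm x a, \<zero>\<^bsub>\<gg>\<^esub>) z = \<zero>\<^bsub>Z\<^esub>"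
    and "y \<in> csa_derived D \<Longrightarrow> a \<in> carrier A \<Longrightarrow> act Z (tm y a, \<zero>\<^bsub>\<gg>\<^esub>) z = \<psi> (cur_elem D A y a) \<odot>\<^bsub>Z\<^esub> z"
    and "h \<in> H2 \<Longrightarrow> act Z (\<zero>\<^bsub>G\<^esub>, h) z = \<psi> (\<zero>\<^bsub>G\<^esub>, h) \<odot>\<^bsub>Z\<^esub> z"
    using * by (simp_all add: gact_def hact_def)
qed

subsection \<open>Orthogonal sequences for coprime ideals\<close>

text \<open>Coprimality of I^n and J^n writes the unit as \<open>e n \<oplus> f n\<close>. The
  choices for different \<open>n\<close> are unrelated, yet any choice is coherent and idempotent up
  to powers of \<open>Q\<close>.\<close>

lemma (in cring) coprime_sequences:
  assumes I: "ideal I R" and J: "ideal J R" and IJ: "I <+>\<^bsub>R\<^esub> J = carrier R"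
  defines "Q \<equiv> ideal_prod R I J"
  obtains e f where "\<And>n. e n \<in> ideal_pow J n" "\<And>n. f n \<in> ideal_pow I n" "\<And>n. e n \<oplus> f n = \<one>"
    "\<And>n m. n \<le> m \<Longrightarrow> e n \<ominus> e m \<in> ideal_pow Q n" "\<And>n m. n \<le> m \<Longrightarrow> f n \<ominus> f m \<in> ideal_pow Q n"
    "\<And>n. e n \<otimes> e n \<ominus> e n \<in> ideal_pow Q n" "\<And>n. f n \<otimes> f n \<ominus> f n \<in> ideal_pow Q n"
    "\<And>n. e n \<otimes> f n \<in> ideal_pow Q n"
proof -
  note In = ideal_pow_ideal[OF I] and Jn = ideal_pow_ideal[OF J]
  \<comment> \<open>Coprime ideals have equal product and intersection, so membership in a power of
    \<open>Q\<close> is tested in the two ideals separately.\<close>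
  have Qn: "ideal_pow Q n = ideal_pow I n \<inter> ideal_pow J n" for n
    unfolding Q_def ideal_pow_prod[OF I J]
    by (rule ideal_prod_eq_inter[OF In Jn coprime_ideal_pows[OF I J IJ]])
  have "\<exists>e f. e \<in> ideal_pow J n \<and> f \<in> ideal_pow I n \<and> e \<oplus> f = \<one>" for n
  proof -
    have "\<one> \<in> ideal_pow I n <+>\<^bsub>R\<^esub> ideal_pow J n"
      by (simp add: coprime_ideal_pows[OF I J IJ])
    then obtain a b where "a \<in> ideal_pow I n" "b \<in> ideal_pow J n" "\<one> = a \<oplus> b"
      unfolding set_add_def' by blast
    then show ?thesis using ideal.Icarr[OF In] ideal.Icarr[OF Jn] a_comm[of a b] by metis
  qed
  then obtain e f where ef: "\<And>n. e n \<in> ideal_pow J n" "\<And>n. f n \<in> ideal_pow I n" "\<And>n. e n \<oplus> f n = \<one>"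
    by metis
  have c: "e n \<in> carrier R" "f n \<in> carrier R" for n
    using ef ideal.Icarr[OF In] ideal.Icarr[OF Jn] by blast+
  have minus: "a \<ominus> b \<in> N" if "ideal N R" "a \<in> N" "b \<in> N" for a b N
    using that unfolding a_minus_def
    by (meson additive_subgroup.a_closed additive_subgroup.a_inv_closed ideal.axioms(1))
  have ei: "e n = \<one> \<ominus> f n" and fi: "f n = \<one> \<ominus> e n" for n
    using ef(3)[of n, symmetric] c[of n] by (simp, algebra)+
  \<comment> \<open>A difference of two \<open>e\<close> lies in the power of \<open>J\<close> by
    choice and, being a difference of two \<open>f\<close>, in the power of \<open>I\<close> as
    well.\<close>
  have d: "e n \<ominus> e m = f m \<ominus> f n" "f n \<ominus> f m = e m \<ominus> e n" for n m
    unfolding ei[of n] ei[of m] using c(2)[of n] c(2)[of m] by algebra+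
  have J: "e n \<ominus> e m \<in> ideal_pow J n" "e m \<ominus> e n \<in> ideal_pow J n" if "n \<le> m" for n m
    using minus[OF Jn, of _ n] ef(1) ideal_pow_mono[OF J that] by blast+
  have I: "f n \<ominus> f m \<in> ideal_pow I n" "f m \<ominus> f n \<in> ideal_pow I n" if "n \<le> m" for n m
    using minus[OF In, of _ n] ef(2) ideal_pow_mono[OF I that] by blast+
  have ef_Q: "e n \<otimes> f n \<in> ideal_pow Q n" for n
    unfolding Qn using ideal.I_l_closed[OF In ef(2) c(1)] ideal.I_r_closed[OF Jn ef(1) c(2)] by blast
  have ee: "e n \<otimes> e n \<ominus> e n = \<ominus> (e n \<otimes> f n)" "f n \<otimes> f n \<ominus> f n = \<ominus> (e n \<otimes> f n)" for n
    unfolding ei[of n] using c(2)[of n] by algebra+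
  have neg: "\<ominus> (e n \<otimes> f n) \<in> ideal_pow Q n" for n
    unfolding Qn using ef_Q[of n, unfolded Qn]
    by (meson Int_iff In Jn additive_subgroup.a_inv_closed ideal.axioms(1))
  show thesis
  proof (rule that[OF ef])
    show "e n \<ominus> e m \<in> ideal_pow Q n" if "n \<le> m" for n m
      unfolding Qn using J(1)[OF that] I(2)[OF that] d(1) by simp
    show "f n \<ominus> f m \<in> ideal_pow Q n" if "n \<le> m" for n m
      unfolding Qn using J(2)[OF that] I(1)[OF that] d(2) by simp
  qed (simp_all add: ee neg ef_Q)
qed

section \<open>The isomorphism\<close>

text \<open>The image of the highest weight vector, named outside any locale so that three modules
  with different weights can be used side by side.\<close>

definition M_vec :: "'g km_datum \<Rightarrow> (complex, 'a) module \<Rightarrow> 'g set \<Rightarrow> (('g, 'a) cur \<Rightarrow> complex) \<Rightarrow>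
    ((nat \<Rightarrow> nat) \<Rightarrow> 'a set) \<Rightarrow> ('g, 'a) verma_elem set" where
  "M_vec D A H2 \<psi> F = lie_submodule_gen (current D A H2) (verma D A H2 \<psi>) (family_module.gens D A H2 \<psi> F)
     +>\<^bsub>verma D A H2 \<psi>\<^esub> verma_vec D A H2 \<psi>"

locale weight_family = weight D A H2 \<psi> for D :: "'g km_datum" and A :: "(complex, 'a) module" and H2 :: "'g set" and \<psi> +
  fixes F :: "(nat \<Rightarrow> nat) \<Rightarrow> 'a set"
  assumes F: "m \<in> pos_roots D \<Longrightarrow> F m \<subseteq> carrier A"
begin

lemma family: "family_module D A H2 F"
  by (intro family_module.intro verma_module.intro Cur_space family_module_axioms.intro F)

abbreviation "M \<equiv> M_family D A H2 \<psi> F"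
abbreviation "mv \<equiv> M_vec D A H2 \<psi> F"

lemmas M_rep = family_module.M_rep[OF family, of \<psi>]
lemmas mv_closed = family_module.mv_closed[OF family, of \<psi>, folded M_vec_def]
lemmas M_hw = family_module.M_hw[OF family, of _ _ \<psi>, folded M_vec_def]
lemmas M_generated = family_module.M_generated[OF family, of \<psi>, folded M_vec_def]
lemmas M_universal = family_module.M_universal[OF family, where \<psi> = \<psi>, folded M_vec_def]

lemma M_rel: "m \<in> pos_roots D \<Longrightarrow> x \<in> root_space D (\<lambda>h. - root_of D m h) \<Longrightarrow> a \<in> F m \<Longrightarrow>
    act M (tm x a, \<zero>\<^bsub>\<gg>\<^esub>) mv = \<zero>\<^bsub>M\<^esub>"
  using family_module.M_rel[OF family, of m x a \<psi>] by (simp add: M_vec_def cur_elem_def)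

lemma M_weight:
  "x \<in> N_plus D \<Longrightarrow> a \<in> carrier A \<Longrightarrow> act M (tm x a, \<zero>\<^bsub>\<gg>\<^esub>) mv = \<zero>\<^bsub>M\<^esub>"
  "y \<in> csa_derived D \<Longrightarrow> a \<in> carrier A \<Longrightarrow> act M (tm y a, \<zero>\<^bsub>\<gg>\<^esub>) mv = \<psi> (cur_elem D A y a) \<odot>\<^bsub>M\<^esub> mv"
  "h \<in> H2 \<Longrightarrow> act M (\<zero>\<^bsub>G\<^esub>, h) mv = \<psi> (\<zero>\<^bsub>G\<^esub>, h) \<odot>\<^bsub>M\<^esub> mv"
  by (rule highest_weight_D[OF weight_axioms M_rep mv_closed]; (rule M_hw; assumption | assumption))+

text \<open>The vector \<open>mv\<close> is smooth by \<open>smoothI\<close>: \<open>h\<close>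
  covers \<hh>', and the relation at a simple root covers the corresponding \<open>f_i\<close>.
  Smooth vectors form a submodule, and \<open>mv\<close> generates.\<close>

lemma M_smooth:
  assumes Q: "ideal Q A"
    and h: "\<And>x a. x \<in> csa_derived D \<Longrightarrow> a \<in> Q \<Longrightarrow> \<psi> (cur_elem D A x a) = 0"
    and f: "\<And>m. m \<in> pos_roots D \<Longrightarrow> \<exists>n. Q [^]\<^bsub>ideals_set A\<^esub> (n::nat) \<subseteq> F m"
  shows "smooth_rep D A H2 M Q"
proof -
  have "cur_rep D A H2 M" using M_rep by (simp add: cur_rep_def loop_data_axioms)
  then have "smooth_data D A H2 M Q" using Q by (simp add: smooth_data_def smooth_data_axioms_def)
  then interpret smooth_data D A H2 M Q .
  have "mv \<in> smooth"
  proof (rule smoothI[OF mv_closed])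
    show "gact (tm x a) mv = \<zero>\<^bsub>M\<^esub>" if "x \<in> csa_derived D" "a \<in> Q" for x a
      using M_weight(2)[OF that(1) ideal.Icarr[OF Q that(2)]] h[OF that] mv_closed by (simp add: gact_def)
    show "gact (tm x a) mv = \<zero>\<^bsub>M\<^esub>" if "x \<in> N_plus D" "a \<in> carrier A" for x a
      using M_weight(1)[OF that] by (simp add: gact_def)
    show "\<exists>n. \<forall>a\<in>C n. gact (tm (km_f D i) a) mv = \<zero>\<^bsub>M\<^esub>" if i: "i < km_rank D" for i
    proof -
      obtain n where "C n \<subseteq> F ((\<lambda>_. 0)(i := 1))" using f[OF simple_root(1)[OF i]] by blast
      then have "\<forall>a\<in>C n. gact (tm (km_f D i) a) mv = \<zero>\<^bsub>M\<^esub>"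
        using M_rel[OF simple_root[OF i]] by (auto simp: gact_def)
      then show ?thesis by blast
    qed
  qed
  from M_generated[OF smooth_submodule this] show ?thesis
    unfolding smooth_rep_def smooth_rep_axioms_def using \<open>smooth_data D A H2 M Q\<close> by simp
qed

end

text \<open>The exponents \<open>p\<close> and \<open>q\<close> stand for the two weight heights,
  with which \<open>theorem3p4\<close> instantiates them.\<close>

locale coprime_data = loop_data D A H2
  for D :: "'g km_datum" and A :: "(complex, 'a) module" and H2 :: "'g set" +
  fixes I J :: "'a set" and \<psi>1 \<psi>2 :: "('g, 'a) cur \<Rightarrow> complex"
    and p q :: "(nat \<Rightarrow> nat) \<Rightarrow> nat" and K :: "(nat \<Rightarrow> nat) \<Rightarrow> 'a set"
  assumes I: "ideal I A" and J: "ideal J A" and IJ: "I <+>\<^bsub>A\<^esub> J = carrier A"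
    and w1: "weight D A H2 \<psi>1" and w2: "weight D A H2 \<psi>2"
    and \<psi>1_I: "x \<in> csa_derived D \<Longrightarrow> a \<in> I \<Longrightarrow> \<psi>1 (cur_elem D A x a) = 0"
    and \<psi>2_J: "x \<in> csa_derived D \<Longrightarrow> a \<in> J \<Longrightarrow> \<psi>2 (cur_elem D A x a) = 0"
    and K: "m \<in> pos_roots D \<Longrightarrow> K m = I [^]\<^bsub>ideals_set A\<^esub> p m \<inter> J [^]\<^bsub>ideals_set A\<^esub> q m"
begin

abbreviation "ip N n \<equiv> N [^]\<^bsub>ideals_set A\<^esub> (n::nat)"
abbreviation "Q \<equiv> ideal_prod A I J"

lemma ip_carrier: "ideal N A \<Longrightarrow> ip N n \<subseteq> carrier A"
  using ideal.Icarr[OF cring.ideal_pow_ideal[OF A_cring]] by blast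

lemma Q_ideal: "ideal Q A"
  by (rule ring.ideal_prod_is_ideal[OF cring.axioms(1)[OF A_cring] I J])

lemma Q_sub: "ip Q n \<subseteq> ip I n" "ip Q n \<subseteq> ip J n" "Q \<subseteq> I" "Q \<subseteq> J"
proof -
  interpret cring A by (rule A_cring)
  show "ip Q n \<subseteq> ip I n" "ip Q n \<subseteq> ip J n"
    using ideal_prod_inter[OF ideal_pow_ideal[OF I] ideal_pow_ideal[OF J]] ideal_pow_prod[OF I J] by blast+
  show "Q \<subseteq> I" "Q \<subseteq> J" using ideal_prod_inter[OF I J] by blast+
qed

lemma ip_mono: "ideal N A \<Longrightarrow> m \<le> n \<Longrightarrow> a \<in> ip N n \<Longrightarrow> a \<in> ip N m"
  using cring.ideal_pow_mono[OF A_cring] by blast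

sublocale MV: weight_family D A H2 \<psi>1 "\<lambda>m. ip I (p m)"
  using w1 ip_carrier[OF I] by (simp add: weight_family_def weight_family_axioms_def)

sublocale MW: weight_family D A H2 \<psi>2 "\<lambda>m. ip J (q m)"
  using w2 ip_carrier[OF J] by (simp add: weight_family_def weight_family_axioms_def)

lemma w12: "weight D A H2 (\<lambda>x. \<psi>1 x + \<psi>2 x)"
  using weight.\<psi>_add[OF w1] weight.\<psi>_add[OF w2] weight.\<psi>_smult[OF w1] weight.\<psi>_smult[OF w2]
  by (auto simp: weight_def weight_axioms_def loop_data_axioms functionals_def CC_mod_def algebra_simps intro!: linI)

sublocale MZ: weight_family D A H2 "\<lambda>x. \<psi>1 x + \<psi>2 x" K
  using w12 ip_carrier[OF I] K by (auto simp: weight_family_def weight_family_axioms_def)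

abbreviation "V \<equiv> M_family D A H2 \<psi>1 (\<lambda>m. ip I (p m))"
abbreviation "W \<equiv> M_family D A H2 \<psi>2 (\<lambda>m. ip J (q m))"
abbreviation "Z \<equiv> M_family D A H2 (\<lambda>x. \<psi>1 x + \<psi>2 x) K"
abbreviation "v0 \<equiv> M_vec D A H2 \<psi>1 (\<lambda>m. ip I (p m))"
abbreviation "w0 \<equiv> M_vec D A H2 \<psi>2 (\<lambda>m. ip J (q m))"
abbreviation "z0 \<equiv> M_vec D A H2 (\<lambda>x. \<psi>1 x + \<psi>2 x) K"

lemma V_smooth: "smooth_rep D A H2 V I"
  by (rule MV.M_smooth[OF I]) (use \<psi>1_I in auto)

lemma W_smooth: "smooth_rep D A H2 W J"
  by (rule MW.M_smooth[OF J]) (use \<psi>2_J in auto)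

lemma Z_smooth: "smooth_rep D A H2 Z Q"
proof (rule MZ.M_smooth[OF Q_ideal])
  show "\<psi>1 (cur_elem D A x a) + \<psi>2 (cur_elem D A x a) = 0" if "x \<in> csa_derived D" "a \<in> Q" for x a
  proof -
    have "a \<in> I" "a \<in> J" using that(2) Q_sub(3,4) by blast+
    then show ?thesis using \<psi>1_I[OF that(1)] \<psi>2_J[OF that(1)] by simp
  qed
  show "\<exists>n. ip Q n \<subseteq> K m" if "m \<in> pos_roots D" for m
  proof -
    \<comment> \<open>A single power of \<open>Q\<close> must lie below both exponents, whence the
      maximum.\<close>
    have "ip Q (max (p m) (q m)) \<subseteq> ip I (p m) \<inter> ip J (q m)"
      using Q_sub(1,2)[of "max (p m) (q m)"] ip_mono[OF I, of "p m" "max (p m) (q m)"]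
        ip_mono[OF J, of "q m" "max (p m) (q m)"] by auto
    then show ?thesis using K[OF that] by blast
  qed
qed

sublocale RV: smooth_rep D A H2 V I by (rule V_smooth)
sublocale RW: smooth_rep D A H2 W J by (rule W_smooth)
sublocale RZ: smooth_rep D A H2 Z Q by (rule Z_smooth)

lemma V_induct:
  assumes "subsp V N" "v0 \<in> N" "\<And>P v. P \<in> carrier G \<Longrightarrow> v \<in> N \<Longrightarrow> RV.gact P v \<in> N"
  shows "N = carrier V"
proof (rule RV.generated_by_loop[OF MV.M_generated MV.mv_closed _ assms])
  show "\<exists>c. RV.hact h v0 = c \<odot>\<^bsub>V\<^esub> v0" if "h \<in> H2" for h
    using MV.M_weight(3)[OF that] by (auto simp: RV.hact_def)
qed

lemma W_induct:
  assumes "subsp W N" "w0 \<in> N" "\<And>P w. P \<in> carrier G \<Longrightarrow> w \<in> N \<Longrightarrow> RW.gact P w \<in> N"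
  shows "N = carrier W"
proof (rule RW.generated_by_loop[OF MW.M_generated MW.mv_closed _ assms])
  show "\<exists>c. RW.hact h w0 = c \<odot>\<^bsub>W\<^esub> w0" if "h \<in> H2" for h
    using MW.M_weight(3)[OF that] by (auto simp: RW.hact_def)
qed

end

section \<open>The two commuting loop actions on \<open>Z\<close>\<close>

locale coprime_splitting = coprime_data +
  fixes e f :: "nat \<Rightarrow> 'b"
  assumes e_J: "e n \<in> ip J n" and f_I: "f n \<in> ip I n" and ef_one: "e n \<oplus>\<^bsub>A\<^esub> f n = \<one>\<^bsub>A\<^esub>"
    and e_Q: "n \<le> m \<Longrightarrow> e n \<ominus>\<^bsub>A\<^esub> e m \<in> ip Q n" and f_Q: "n \<le> m \<Longrightarrow> f n \<ominus>\<^bsub>A\<^esub> f m \<in> ip Q n"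
    and ee: "e n \<otimes>\<^bsub>A\<^esub> e n \<ominus>\<^bsub>A\<^esub> e n \<in> ip Q n" and ff: "f n \<otimes>\<^bsub>A\<^esub> f n \<ominus>\<^bsub>A\<^esub> f n \<in> ip Q n"
    and ef: "e n \<otimes>\<^bsub>A\<^esub> f n \<in> ip Q n"
begin

lemma e_carrier [simp]: "e n \<in> carrier A" and f_carrier' [simp]: "f n \<in> carrier A"
  using e_J f_I ip_carrier[OF I] ip_carrier[OF J] by blast+

lemma coh_e: "RZ.coherent e" and coh_f: "RZ.coherent f"
  using e_Q f_Q by (simp_all add: RZ.coherent_def)

text \<open>The zero sequence is the limit assigned to the product of \<open>e\<close> and
  \<open>f\<close>.\<close>

lemma coh_0: "RZ.coherent (\<lambda>_. \<zero>\<^bsub>A\<^esub>)"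
  using additive_subgroup.zero_closed[OF ideal.axioms(1)[OF RZ.C_ideal]] by (simp add: RZ.coherent_def)

abbreviation "actE \<equiv> RZ.lim_act e"
abbreviation "actF \<equiv> RZ.lim_act f"

lemmas E_closed [simp] = RZ.lim_act_closed[OF coh_e]
lemmas F_closed [simp] = RZ.lim_act_closed[OF coh_f]
lemmas E_lin = RZ.lim_act_lin_r[OF coh_e] and F_lin = RZ.lim_act_lin_r[OF coh_f]
lemmas E_lin_l = RZ.lim_act_lin_l[OF coh_e] and F_lin_l = RZ.lim_act_lin_l[OF coh_f]
lemmas EE = RZ.lim_act_lim_act[OF coh_e coh_e coh_e ee]
lemmas FF = RZ.lim_act_lim_act[OF coh_f coh_f coh_f ff]
lemmas hE = RZ.hact_lim_act[OF coh_e] and hF = RZ.hact_lim_act[OF coh_f]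
lemmas E_plus_F = RZ.lim_act_complement[OF coh_e coh_f ef_one]

text \<open>The products \<open>e m \<otimes> f m\<close> tend to zero, so the bracket term of
  \<open>lim_act_lim_act\<close> disappears.\<close>

lemma EF:
  assumes P: "P \<in> carrier G" and R: "R \<in> carrier G" and z: "z \<in> carrier Z"
  shows "actE P (actF R z) = actF R (actE P z)"
proof -
  have "\<forall>\<^sub>F m in sequentially. RZ.gact (loop_mul \<zero>\<^bsub>A\<^esub> (LB P R)) z = \<zero>\<^bsub>Z\<^esub>"
    using lin_zero[OF lin_comp[OF loop_mul_lin_l[OF LB_closed[OF P R]] RZ.gact_lin_l[OF z]] A.cvs_axioms RZ.Z.cvs_axioms]
    by simp
  then have "RZ.lim_act (\<lambda>_. \<zero>\<^bsub>A\<^esub>) (LB P R) z = \<zero>\<^bsub>Z\<^esub>"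
    by (rule RZ.lim_act_unique)
  moreover have "e m \<otimes>\<^bsub>A\<^esub> f m \<ominus>\<^bsub>A\<^esub> \<zero>\<^bsub>A\<^esub> \<in> ip Q m" for m
    using ef[of m] A.minus_eq_iff[of "e m \<otimes>\<^bsub>A\<^esub> f m" "\<zero>\<^bsub>A\<^esub>" "e m \<otimes>\<^bsub>A\<^esub> f m"] by simp
  ultimately show ?thesis
    using RZ.lim_act_lim_act[OF coh_e coh_f coh_0 _ P R z] P R z by simp
qed

lemma z0_closed: "z0 \<in> carrier Z"
  by (rule MZ.mv_closed)

lemma E_N_plus: "x \<in> N_plus D \<Longrightarrow> a \<in> carrier A \<Longrightarrow> actE (tm x a) z0 = \<zero>\<^bsub>Z\<^esub>"
  and F_N_plus: "x \<in> N_plus D \<Longrightarrow> a \<in> carrier A \<Longrightarrow> actF (tm x a) z0 = \<zero>\<^bsub>Z\<^esub>"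
proof -
  assume x: "x \<in> N_plus D" and a: "a \<in> carrier A"
  have xd: "x \<in> derived D" using x N_plus_derived by blast
  show "actE (tm x a) z0 = \<zero>\<^bsub>Z\<^esub>"
    by (rule RZ.lim_act_tm[OF coh_e xd a z0_closed]) (simp add: RZ.gact_def MZ.M_weight(1)[OF x] a)
  show "actF (tm x a) z0 = \<zero>\<^bsub>Z\<^esub>"
    by (rule RZ.lim_act_tm[OF coh_f xd a z0_closed]) (simp add: RZ.gact_def MZ.M_weight(1)[OF x] a)
qed

text \<open>From \<open>m = 1\<close> on, \<open>e m\<close> lies in \<open>J\<close> and
  \<open>f m\<close> in \<open>I\<close>, where \<open>\<psi>2\<close> and \<open>\<psi>1\<close>
  vanish. The remaining two values follow from \<open>e m \<oplus> f m\<close> being the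
  unit.\<close>

lemma weight_split:
  assumes x: "x \<in> csa_derived D" and a: "a \<in> carrier A" and m: "1 \<le> m"
  shows "\<psi>1 (cur_elem D A x (e m \<otimes>\<^bsub>A\<^esub> a)) = \<psi>1 (cur_elem D A x a)"
    "\<psi>2 (cur_elem D A x (e m \<otimes>\<^bsub>A\<^esub> a)) = 0" "\<psi>1 (cur_elem D A x (f m \<otimes>\<^bsub>A\<^esub> a)) = 0"
    "\<psi>2 (cur_elem D A x (f m \<otimes>\<^bsub>A\<^esub> a)) = \<psi>2 (cur_elem D A x a)"
proof -
  have one: "ip I 1 = I" "ip J 1 = J" using cring.ideal_pow_one[OF A_cring] I J by auto
  have "e m \<otimes>\<^bsub>A\<^esub> a \<in> J" "f m \<otimes>\<^bsub>A\<^esub> a \<in> I"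
    using ideal.I_r_closed[OF J ip_mono[OF J m e_J, unfolded one] a]
      ideal.I_r_closed[OF I ip_mono[OF I m f_I, unfolded one] a] by auto
  then show 0: "\<psi>2 (cur_elem D A x (e m \<otimes>\<^bsub>A\<^esub> a)) = 0" "\<psi>1 (cur_elem D A x (f m \<otimes>\<^bsub>A\<^esub> a)) = 0"
    using \<psi>1_I[OF x] \<psi>2_J[OF x] by auto
  have "e m \<otimes>\<^bsub>A\<^esub> a \<oplus>\<^bsub>A\<^esub> f m \<otimes>\<^bsub>A\<^esub> a = a"
    using A_l_distr[of "e m" "f m" a] a by (simp add: ef_one)
  then show "\<psi>1 (cur_elem D A x (e m \<otimes>\<^bsub>A\<^esub> a)) = \<psi>1 (cur_elem D A x a)"
    "\<psi>2 (cur_elem D A x (f m \<otimes>\<^bsub>A\<^esub> a)) = \<psi>2 (cur_elem D A x a)"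
    using weight.\<psi>_elem_add[OF w1 x, of "e m \<otimes>\<^bsub>A\<^esub> a" "f m \<otimes>\<^bsub>A\<^esub> a"]
      weight.\<psi>_elem_add[OF w2 x, of "e m \<otimes>\<^bsub>A\<^esub> a" "f m \<otimes>\<^bsub>A\<^esub> a"] a 0 by simp_all
qed

lemma E_csa: "x \<in> csa_derived D \<Longrightarrow> a \<in> carrier A \<Longrightarrow> actE (tm x a) z0 = \<psi>1 (cur_elem D A x a) \<odot>\<^bsub>Z\<^esub> z0"
  and F_csa: "x \<in> csa_derived D \<Longrightarrow> a \<in> carrier A \<Longrightarrow> actF (tm x a) z0 = \<psi>2 (cur_elem D A x a) \<odot>\<^bsub>Z\<^esub> z0"
proof -
  assume x: "x \<in> csa_derived D" and a: "a \<in> carrier A"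
  have xd: "x \<in> derived D" using x by (simp add: csa_derived_def)
  show "actE (tm x a) z0 = \<psi>1 (cur_elem D A x a) \<odot>\<^bsub>Z\<^esub> z0"
    by (rule RZ.lim_act_tm[OF coh_e xd a z0_closed], rule eventually_sequentiallyI[of 1])
      (use MZ.M_weight(2)[OF x, of "e _ \<otimes>\<^bsub>A\<^esub> a"] weight_split[OF x a] a in \<open>simp add: RZ.gact_def\<close>)
  show "actF (tm x a) z0 = \<psi>2 (cur_elem D A x a) \<odot>\<^bsub>Z\<^esub> z0"
    by (rule RZ.lim_act_tm[OF coh_f xd a z0_closed], rule eventually_sequentiallyI[of 1])
      (use MZ.M_weight(2)[OF x, of "f _ \<otimes>\<^bsub>A\<^esub> a"] weight_split[OF x a] a in \<open>simp add: RZ.gact_def\<close>)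
qed

text \<open>This is where the shape of \<open>K\<close> enters: multiplication by \<open>e k\<close>
  with \<open>k\<close> at least \<open>q m\<close> adds the condition for \<open>J\<close> to the
  one for \<open>I\<close> already satisfied by \<open>a\<close>, so the product lies in
  \<open>K m\<close>.\<close>

lemma E_neg:
  assumes m: "m \<in> pos_roots D" and x: "x \<in> root_space D (\<lambda>h. - root_of D m h)" and a: "a \<in> ip I (p m)"
  shows "actE (tm x a) z0 = \<zero>\<^bsub>Z\<^esub>"
proof (rule RZ.lim_act_tm[OF coh_e _ _ z0_closed])
  show "x \<in> derived D" using root_space_derived(2)[OF m] x by blast
  show ac: "a \<in> carrier A" using a ip_carrier[OF I] by blast
  show "\<forall>\<^sub>F k in sequentially. RZ.gact (tm x (e k \<otimes>\<^bsub>A\<^esub> a)) z0 = \<zero>\<^bsub>Z\<^esub>"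
  proof (rule eventually_sequentiallyI[of "q m"])
    fix k assume k: "q m \<le> k"
    have "e k \<otimes>\<^bsub>A\<^esub> a \<in> ip I (p m)" "e k \<otimes>\<^bsub>A\<^esub> a \<in> ip J (q m)"
      using ideal.I_l_closed[OF cring.ideal_pow_ideal[OF A_cring I] a, of "e k"]
        ideal.I_r_closed[OF cring.ideal_pow_ideal[OF A_cring J] ip_mono[OF J k e_J] ac] by simp_all
    then show "RZ.gact (tm x (e k \<otimes>\<^bsub>A\<^esub> a)) z0 = \<zero>\<^bsub>Z\<^esub>"
      using MZ.M_rel[OF m x] K[OF m] by (simp add: RZ.gact_def)
  qed
qed

lemma F_neg:
  assumes m: "m \<in> pos_roots D" and x: "x \<in> root_space D (\<lambda>h. - root_of D m h)" and a: "a \<in> ip J (q m)"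
  shows "actF (tm x a) z0 = \<zero>\<^bsub>Z\<^esub>"
proof (rule RZ.lim_act_tm[OF coh_f _ _ z0_closed])
  show "x \<in> derived D" using root_space_derived(2)[OF m] x by blast
  show ac: "a \<in> carrier A" using a ip_carrier[OF J] by blast
  show "\<forall>\<^sub>F k in sequentially. RZ.gact (tm x (f k \<otimes>\<^bsub>A\<^esub> a)) z0 = \<zero>\<^bsub>Z\<^esub>"
  proof (rule eventually_sequentiallyI[of "p m"])
    fix k assume k: "p m \<le> k"
    have "f k \<otimes>\<^bsub>A\<^esub> a \<in> ip J (q m)" "f k \<otimes>\<^bsub>A\<^esub> a \<in> ip I (p m)"
      using ideal.I_l_closed[OF cring.ideal_pow_ideal[OF A_cring J] a, of "f k"]
        ideal.I_r_closed[OF cring.ideal_pow_ideal[OF A_cring I] ip_mono[OF I k f_I] ac] by simp_all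
    then show "RZ.gact (tm x (f k \<otimes>\<^bsub>A\<^esub> a)) z0 = \<zero>\<^bsub>Z\<^esub>"
      using MZ.M_rel[OF m x] K[OF m] by (simp add: RZ.gact_def)
  qed
qed

section \<open>The first action as a module, and the map \<open>theta\<close> from
  \<open>V\<close>\<close>

lemma \<psi>2_lin: "lin (\<gg>\<lparr>carrier := H2\<rparr>) CC_mod (\<lambda>h. \<psi>2 (\<zero>\<^bsub>G\<^esub>, h))"
proof (rule linI)
  show "\<psi>2 (\<zero>\<^bsub>G\<^esub>, h \<oplus>\<^bsub>\<gg>\<lparr>carrier := H2\<rparr>\<^esub> k) = \<psi>2 (\<zero>\<^bsub>G\<^esub>, h) \<oplus>\<^bsub>CC_mod\<^esub> \<psi>2 (\<zero>\<^bsub>G\<^esub>, k)"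
    if "h \<in> carrier (\<gg>\<lparr>carrier := H2\<rparr>)" "k \<in> carrier (\<gg>\<lparr>carrier := H2\<rparr>)" for h k
    using weight.\<psi>_add[OF w2 cur_h_H2 cur_h_H2, of h k] that by (simp add: Cur_simps CC_mod_def)
  show "\<psi>2 (\<zero>\<^bsub>G\<^esub>, c \<odot>\<^bsub>\<gg>\<lparr>carrier := H2\<rparr>\<^esub> h) = c \<odot>\<^bsub>CC_mod\<^esub> \<psi>2 (\<zero>\<^bsub>G\<^esub>, h)"
    if "h \<in> carrier (\<gg>\<lparr>carrier := H2\<rparr>)" for c h
    using weight.\<psi>_smult[OF w2 cur_h_H2, of h c] that by (simp add: Cur_simps CC_mod_def)
qed (simp add: CC_mod_def)

text \<open>On \<hh>'' the vector \<open>z0\<close> has weight \<open>\<psi>1 + \<psi>2\<close>, but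
  as the image of \<open>v0\<close> it must have weight \<open>\<psi>1\<close>. Subtracting the
  scalar \<open>\<psi>2\<close> achieves this and leaves the commutators with \<open>actE\<close>
  unchanged.\<close>

definition hE where "hE h z = RZ.hact h z \<oplus>\<^bsub>Z\<^esub> (- \<psi>2 (\<zero>\<^bsub>G\<^esub>, h)) \<odot>\<^bsub>Z\<^esub> z"

definition ZE where "ZE = Z\<lparr>act := \<lambda>X z. actE (fst X) z \<oplus>\<^bsub>Z\<^esub> hE (snd X) z\<rparr>"

lemma ZE_simps: "carrier ZE = carrier Z" "add ZE = add Z" "zero ZE = zero Z" "smult ZE = smult Z"
  by (simp_all add: ZE_def)

lemma hE_lin_l: "z \<in> carrier Z \<Longrightarrow> lin (\<gg>\<lparr>carrier := H2\<rparr>) Z (\<lambda>h. hE h z)"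
proof -
  assume z: "z \<in> carrier Z"
  have "lin (\<gg>\<lparr>carrier := H2\<rparr>) Z (\<lambda>h. (- \<psi>2 (\<zero>\<^bsub>G\<^esub>, h)) \<odot>\<^bsub>Z\<^esub> z)"
    using linD(2,3)[OF \<psi>2_lin] z
    by (intro linI) (simp_all add: CC_mod_def RZ.Z.s_ladd[symmetric] RZ.Z.s_mult[symmetric])
  from lin_add[OF RZ.hact_lin_l[OF z] this RZ.Z.cvs_axioms] show ?thesis by (simp add: hE_def)
qed

lemma hE_lin_r: "h \<in> H2 \<Longrightarrow> lin Z Z (hE h)"
  using lin_add[OF RZ.hact_lin_r RZ.Z.lin_smult RZ.Z.cvs_axioms] by (simp add: hE_def[abs_def])

lemma ZE_rep: "lie_rep Cur ZE"
  unfolding ZE_def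
proof (rule cur_rep_I[OF RZ.Z.cvs_axioms E_lin E_lin_l hE_lin_r hE_lin_l EE])
  show "hE h (actE P z) = actE (LD h P) z \<oplus>\<^bsub>Z\<^esub> actE P (hE h z)"
    if h: "h \<in> H2" and P: "P \<in> carrier G" and z: "z \<in> carrier Z" for h P z
    using h P z H2_carrier[OF h] linD(2,3)[OF E_lin[OF P]] hE[OF h P z]
    by (simp add: hE_def RZ.Z.a_assoc)
  show "hE h (hE k z) = hE k (hE h z)" if h: "h \<in> H2" and k: "k \<in> H2" and z: "z \<in> carrier Z" for h k z
    using h k z linD(2,3)[OF RZ.hact_lin_r[OF h]] linD(2,3)[OF RZ.hact_lin_r[OF k]] RZ.hact_hact[OF h k z]
    by (simp add: hE_def RZ.Z.s_radd RZ.Z.s_mult[symmetric] mult.commute RZ.Z.a_ac)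
qed

end

context coprime_splitting begin

lemma hE_zero: "z \<in> carrier Z \<Longrightarrow> hE \<zero>\<^bsub>\<gg>\<^esub> z = \<zero>\<^bsub>Z\<^esub>"
  using lin_zero[OF hE_lin_l subsp_cvs[OF H2_subsp] RZ.Z.cvs_axioms] by simp

lemma actE_zero: "z \<in> carrier Z \<Longrightarrow> actE \<zero>\<^bsub>G\<^esub> z = \<zero>\<^bsub>Z\<^esub>"
  using lin_zero[OF E_lin_l G_cvs RZ.Z.cvs_axioms] by simp

lemma actF_zero: "z \<in> carrier Z \<Longrightarrow> actF \<zero>\<^bsub>G\<^esub> z = \<zero>\<^bsub>Z\<^esub>"
  using lin_zero[OF F_lin_l G_cvs RZ.Z.cvs_axioms] by simp

lemma hE_closed [simp]: "h \<in> H2 \<Longrightarrow> z \<in> carrier Z \<Longrightarrow> hE h z \<in> carrier Z"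
  using linD(1)[OF hE_lin_r] .

lemma ZE_act:
  "P \<in> carrier G \<Longrightarrow> z \<in> carrier Z \<Longrightarrow> act ZE (P, \<zero>\<^bsub>\<gg>\<^esub>) z = actE P z"
  "h \<in> H2 \<Longrightarrow> z \<in> carrier Z \<Longrightarrow> act ZE (\<zero>\<^bsub>G\<^esub>, h) z = hE h z"
  by (simp_all add: ZE_def hE_zero actE_zero)

text \<open>In \<open>ZE\<close> the vector \<open>z0\<close> satisfies the defining relations of
  \<open>V\<close>: these are \<open>E_N_plus\<close>, \<open>E_csa\<close> and
  \<open>E_neg\<close>, together with the shift in \<open>hE\<close>.\<close>

lemma theta_exists:
  "\<exists>\<theta>. lin V Z \<theta> \<and> \<theta> v0 = z0 \<and> (\<forall>P\<in>carrier G. \<forall>v\<in>carrier V. \<theta> (RV.gact P v) = actE P (\<theta> v)) \<and>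
    (\<forall>h\<in>H2. \<forall>v\<in>carrier V. \<theta> (RV.hact h v) = hE h (\<theta> v))"
proof -
  have z: "z0 \<in> carrier ZE" using z0_closed by (simp add: ZE_simps)
  have hw: "act ZE (n \<oplus>\<^bsub>Cur\<^esub> t) z0 = \<psi>1 t \<odot>\<^bsub>ZE\<^esub> z0"
    if "n \<in> cur_N_plus D A H2" "t \<in> cur_h D A H2" for n t
  proof (rule highest_weight_I[OF w1 ZE_rep z _ _ _ that])
    show "act ZE (tm x a, \<zero>\<^bsub>\<gg>\<^esub>) z0 = \<zero>\<^bsub>ZE\<^esub>" if "x \<in> N_plus D" "a \<in> carrier A" for x a
    proof -
      have "x \<in> derived D" using that N_plus_derived by blast
      then show ?thesis using that E_N_plus by (simp add: ZE_act ZE_simps z0_closed)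
    qed
    show "act ZE (tm x a, \<zero>\<^bsub>\<gg>\<^esub>) z0 = \<psi>1 (cur_elem D A x a) \<odot>\<^bsub>ZE\<^esub> z0"
      if "x \<in> csa_derived D" "a \<in> carrier A" for x a
    proof -
      have "x \<in> derived D" using that by (simp add: csa_derived_def)
      then show ?thesis using that E_csa by (simp add: ZE_act ZE_simps z0_closed)
    qed
    show "act ZE (\<zero>\<^bsub>G\<^esub>, h) z0 = \<psi>1 (\<zero>\<^bsub>G\<^esub>, h) \<odot>\<^bsub>ZE\<^esub> z0" if h: "h \<in> H2" for h
    proof -
      have "RZ.hact h z0 = (\<psi>1 (\<zero>\<^bsub>G\<^esub>, h) + \<psi>2 (\<zero>\<^bsub>G\<^esub>, h)) \<odot>\<^bsub>Z\<^esub> z0"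
        using MZ.M_weight(3)[OF h] by (simp add: RZ.hact_def)
      then show ?thesis
        using h z0_closed by (simp add: ZE_act ZE_simps hE_def RZ.Z.s_ladd[symmetric])
    qed
  qed
  have rel: "act ZE (cur_elem D A x a) z0 = \<zero>\<^bsub>ZE\<^esub>"
    if "m \<in> pos_roots D" "x \<in> root_space D (\<lambda>h. - root_of D m h)" "a \<in> ip I (p m)" for m x a
  proof -
    have "x \<in> derived D" "a \<in> carrier A" using that root_space_derived(2) ip_carrier[OF I] by blast+
    then show ?thesis using E_neg[OF that] by (simp add: cur_elem_def ZE_act ZE_simps z0_closed)
  qed
  show ?thesis
  proof (rule MV.M_universal[OF ZE_rep z hw rel])
    fix \<theta> assume \<theta>: "lin V ZE \<theta>" "\<theta> v0 = z0"
    "\<And>x P. x \<in> carrier Cur \<Longrightarrow> P \<in> carrier V \<Longrightarrow> \<theta> (act V x P) = act ZE x (\<theta> P)"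
    have l: "lin V Z \<theta>"
      using \<theta>(1) by (simp add: LinearCombinations.module_hom_def ZE_simps)
    then show ?thesis
      using \<theta>(2,3) linD(1)[OF l]
      by (intro exI[of _ \<theta>]) (simp add: RV.gact_def RV.hact_def RV.emb_closed ZE_act)
  qed
qed

definition theta where "theta = (SOME \<theta>. lin V Z \<theta> \<and> \<theta> v0 = z0 \<and>
    (\<forall>P\<in>carrier G. \<forall>v\<in>carrier V. \<theta> (RV.gact P v) = actE P (\<theta> v)) \<and>
    (\<forall>h\<in>H2. \<forall>v\<in>carrier V. \<theta> (RV.hact h v) = hE h (\<theta> v)))"

lemma theta:
  "lin V Z theta" "theta v0 = z0"
  "P \<in> carrier G \<Longrightarrow> v \<in> carrier V \<Longrightarrow> theta (RV.gact P v) = actE P (theta v)"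
  "h \<in> H2 \<Longrightarrow> v \<in> carrier V \<Longrightarrow> theta (RV.hact h v) = hE h (theta v)"
  using someI_ex[OF theta_exists] unfolding theta_def[symmetric] by auto

lemmas theta_closed [simp] = linD(1)[OF theta(1)]

text \<open>Since \<open>actF\<close> commutes with \<open>actE\<close>, an eigenvalue equation at
  \<open>z0\<close> spreads over everything that loop elements reach through \<open>theta\<close>.
  The operators \<open>hE h\<close> do not commute with \<open>actF\<close> in general, so
  generation by loop elements alone is essential.\<close>

lemma F_theta:
  assumes X: "X \<in> carrier G" and c: "actF X z0 = c \<odot>\<^bsub>Z\<^esub> z0" and v: "v \<in> carrier V"
  shows "actF X (theta v) = c \<odot>\<^bsub>Z\<^esub> theta v"
proof -
  let ?N = "{v \<in> carrier V. actF X (theta v) = c \<odot>\<^bsub>Z\<^esub> theta v}"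
  have "?N = carrier V"
  proof (rule V_induct)
    show "subsp V ?N"
      by (rule lin_eq_subsp[OF lin_comp[OF theta(1) F_lin[OF X]] lin_comp[OF theta(1) RZ.Z.lin_smult]
            RV.Z.cvs_axioms RZ.Z.cvs_axioms])
    show "v0 \<in> ?N" using MV.mv_closed c by (simp add: theta(2))
    show "RV.gact P v \<in> ?N" if P: "P \<in> carrier G" and v: "v \<in> ?N" for P v
    proof -
      have vc: "v \<in> carrier V" "actF X (theta v) = c \<odot>\<^bsub>Z\<^esub> theta v" using v by auto
      have "actF X (actE P (theta v)) = actE P (c \<odot>\<^bsub>Z\<^esub> theta v)"
        using EF[OF P X theta_closed[OF vc(1)]] vc(2) by simp
      then show ?thesis
        using P vc(1) linD(3)[OF E_lin[OF P] theta_closed[OF vc(1)]] by (simp add: theta(3))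
    qed
  qed
  then show ?thesis using v by blast
qed

section \<open>The second action on linear maps from \<open>V\<close> to \<open>Z\<close>, and the
  map \<open>eta\<close> from \<open>W\<close>\<close>

abbreviation "HM \<equiv> hom_space V Z"

lemma HM_cvs: "cvs HM"
  by (rule hom_space_cvs[OF RZ.Z.cvs_axioms])

lemma HM_val [simp]: "\<phi> \<in> carrier HM \<Longrightarrow> \<phi> v \<in> carrier Z"
  using linD(1)[where V = V and W = Z and f = \<phi> and x = v] by (cases "v \<in> carrier V") (auto simp: hom_space_simps)

lemma HM_lin: "\<phi> \<in> carrier HM \<Longrightarrow> lin V Z \<phi>"
  by (simp add: hom_space_simps)

definition gF where "gF P \<phi> = (\<lambda>v. if v \<in> carrier V then actF P (\<phi> v) else \<zero>\<^bsub>Z\<^esub>)"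
text \<open>The usual commutator action on linear maps. Loop elements act in \<open>gF\<close> on
  the target alone, since \<open>actF\<close> accounts for the factor \<open>W\<close>, whereas
  \<hh>'' acts on \<open>V\<close> as well and that contribution must be removed.\<close>

definition hF where "hF h \<phi> = (\<lambda>v. if v \<in> carrier V
    then RZ.hact h (\<phi> v) \<oplus>\<^bsub>Z\<^esub> (- 1) \<odot>\<^bsub>Z\<^esub> \<phi> (RV.hact h v) else \<zero>\<^bsub>Z\<^esub>)"

lemma gF_closed: "P \<in> carrier G \<Longrightarrow> \<phi> \<in> carrier HM \<Longrightarrow> gF P \<phi> \<in> carrier HM"
  unfolding hom_space_simps(1) gF_def
  by (intro conjI lin_restrict lin_comp[OF _ F_lin] RV.Z.cvs_axioms) auto

lemma hF_closed: "h \<in> H2 \<Longrightarrow> \<phi> \<in> carrier HM \<Longrightarrow> hF h \<phi> \<in> carrier HM"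
  unfolding hom_space_simps(1) hF_def
  by (intro conjI lin_restrict lin_add lin_comp[OF _ RZ.hact_lin_r] lin_comp[OF lin_comp[OF RV.hact_lin_r] RZ.Z.lin_smult]
      RV.Z.cvs_axioms RZ.Z.cvs_axioms) auto

definition HF where "HF = HM\<lparr>act := \<lambda>X \<phi>. gF (fst X) \<phi> \<oplus>\<^bsub>HM\<^esub> hF (snd X) \<phi>\<rparr>"

lemma HF_simps: "carrier HF = carrier HM" "add HF = add HM" "zero HF = zero HM" "smult HF = smult HM"
  by (simp_all add: HF_def)

lemma HF_rep: "lie_rep Cur HF"
  unfolding HF_def
proof (rule cur_rep_I[OF HM_cvs])
  note [simp] = hom_space_simps(2-4)
  show "lin HM HM (gF P)" if P: "P \<in> carrier G" for P
    by (rule linI) (use P gF_closed in \<open>auto simp: gF_def fun_eq_iff linD(2,3)[OF F_lin]\<close>)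
  show "lin G HM (\<lambda>P. gF P \<phi>)" if \<phi>: "\<phi> \<in> carrier HM" for \<phi>
    by (rule linI) (use \<phi> gF_closed in \<open>auto simp: gF_def fun_eq_iff linD(2,3)[OF F_lin_l]\<close>)
  show "lin HM HM (hF h)" if h: "h \<in> H2" for h
    by (rule linI)
      (use h hF_closed in \<open>auto simp: hF_def fun_eq_iff linD(2,3)[OF RZ.hact_lin_r] RZ.Z.s_radd RZ.Z.a_ac
        RZ.Z.s_mult[symmetric] mult.commute\<close>)
  show "lin (\<gg>\<lparr>carrier := H2\<rparr>) HM (\<lambda>h. hF h \<phi>)" if \<phi>: "\<phi> \<in> carrier HM" for \<phi>
  proof (rule linI)
    show "hF h \<phi> \<in> carrier HM" if "h \<in> carrier (\<gg>\<lparr>carrier := H2\<rparr>)" for h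
      using that hF_closed \<phi> by simp
    note l = linD(2,3)[OF RZ.hact_lin_l, of "\<phi> _"] linD(2,3)[OF RV.hact_lin_l] linD(2,3)[OF HM_lin[OF \<phi>]]
    show "hF (h \<oplus>\<^bsub>\<gg>\<lparr>carrier := H2\<rparr>\<^esub> k) \<phi> = hF h \<phi> \<oplus>\<^bsub>HM\<^esub> hF k \<phi>"
      if "h \<in> carrier (\<gg>\<lparr>carrier := H2\<rparr>)" "k \<in> carrier (\<gg>\<lparr>carrier := H2\<rparr>)" for h k
      using that \<phi> l(1)[of _ h k] l(3)[of _ h k]
      by (auto simp: hF_def fun_eq_iff l(5) RZ.Z.s_radd RZ.Z.a_ac)
    show "hF (c \<odot>\<^bsub>\<gg>\<lparr>carrier := H2\<rparr>\<^esub> h) \<phi> = c \<odot>\<^bsub>HM\<^esub> hF h \<phi>"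
      if "h \<in> carrier (\<gg>\<lparr>carrier := H2\<rparr>)" for c h
      using that \<phi> l(2)[of _ h c] l(4)[of _ h c]
      by (auto simp: hF_def fun_eq_iff l(6) RZ.Z.s_radd RZ.Z.s_mult[symmetric] mult.commute)
  qed
  show "gF P (gF R \<phi>) = gF (LB P R) \<phi> \<oplus>\<^bsub>HM\<^esub> gF R (gF P \<phi>)"
    if "P \<in> carrier G" "R \<in> carrier G" "\<phi> \<in> carrier HM" for P R \<phi>
    using that FF[OF that(1,2)] by (auto simp: gF_def fun_eq_iff)
  \<comment> \<open>The part of \<open>hF\<close> that precomposes with \<open>h\<close> commutes
    with postcomposition by \<open>actF P\<close>; what is left is the commutator of
    \<open>h\<close> with \<open>actF P\<close> on \<open>Z\<close>.\<close>
  show "hF h (gF P \<phi>) = gF (LD h P) \<phi> \<oplus>\<^bsub>HM\<^esub> gF P (hF h \<phi>)"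
    if h: "h \<in> H2" and P: "P \<in> carrier G" and \<phi>: "\<phi> \<in> carrier HM" for h P \<phi>
    using h P \<phi> hF[OF h P] H2_carrier[OF h] linD(2,3)[OF F_lin[OF P]]
    by (auto simp: gF_def hF_def fun_eq_iff RZ.Z.a_assoc)
  show "hF h (hF k \<phi>) = hF k (hF h \<phi>)" if h: "h \<in> H2" and k: "k \<in> H2" and \<phi>: "\<phi> \<in> carrier HM" for h k \<phi>
  proof
    fix v
    show "hF h (hF k \<phi>) v = hF k (hF h \<phi>) v"
    proof (cases "v \<in> carrier V")
      case True
      then show ?thesis
        using h k \<phi> linD(2,3)[OF RZ.hact_lin_r[OF h]] linD(2,3)[OF RZ.hact_lin_r[OF k]]
          RZ.hact_hact[OF h k HM_val[OF \<phi>, of v]] RV.hact_hact[OF h k True]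
        by (simp add: hF_def RZ.Z.s_radd RZ.Z.s_mult[symmetric] RZ.Z.a_ac)
    qed (simp add: hF_def)
  qed
qed

lemma gF_zero: "\<phi> \<in> carrier HM \<Longrightarrow> gF \<zero>\<^bsub>G\<^esub> \<phi> = \<zero>\<^bsub>HM\<^esub>"
  by (simp add: gF_def fun_eq_iff hom_space_simps actF_zero[OF HM_val, unfolded hom_space_simps])

lemma hF_zero: "\<phi> \<in> carrier HM \<Longrightarrow> hF \<zero>\<^bsub>\<gg>\<^esub> \<phi> = \<zero>\<^bsub>HM\<^esub>"
proof -
  assume \<phi>: "\<phi> \<in> carrier HM"
  have "RZ.hact \<zero>\<^bsub>\<gg>\<^esub> z = \<zero>\<^bsub>Z\<^esub>" if "z \<in> carrier Z" for z
    using lin_zero[OF RZ.hact_lin_l[OF that] subsp_cvs[OF H2_subsp] RZ.Z.cvs_axioms] by simp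
  moreover have "RV.hact \<zero>\<^bsub>\<gg>\<^esub> v = \<zero>\<^bsub>V\<^esub>" if "v \<in> carrier V" for v
    using lin_zero[OF RV.hact_lin_l[OF that] subsp_cvs[OF H2_subsp] RV.Z.cvs_axioms] by simp
  moreover have "\<phi> \<zero>\<^bsub>V\<^esub> = \<zero>\<^bsub>Z\<^esub>"
    by (rule lin_zero[OF HM_lin[OF \<phi>] RV.Z.cvs_axioms RZ.Z.cvs_axioms])
  ultimately show ?thesis
    using HM_val[OF \<phi>] by (simp add: hF_def fun_eq_iff hom_space_simps(2))
qed

lemma HF_act:
  assumes \<phi>: "\<phi> \<in> carrier HM"
  shows "P \<in> carrier G \<Longrightarrow> act HF (P, \<zero>\<^bsub>\<gg>\<^esub>) \<phi> = gF P \<phi>" and "h \<in> H2 \<Longrightarrow> act HF (\<zero>\<^bsub>G\<^esub>, h) \<phi> = hF h \<phi>"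
proof -
  interpret HM: cvs HM by (rule HM_cvs)
  show "P \<in> carrier G \<Longrightarrow> act HF (P, \<zero>\<^bsub>\<gg>\<^esub>) \<phi> = gF P \<phi>"
    using HM.r_zero[OF gF_closed[OF _ \<phi>]] by (simp add: HF_def hF_zero[OF \<phi>])
  show "h \<in> H2 \<Longrightarrow> act HF (\<zero>\<^bsub>G\<^esub>, h) \<phi> = hF h \<phi>"
    using HM.l_zero[OF hF_closed[OF _ \<phi>]] by (simp add: HF_def gF_zero[OF \<phi>])
qed

text \<open>The map \<open>theta\<close> is arbitrary outside \<open>carrier V\<close>; membership
  in \<open>HM\<close> requires zero there.\<close>

definition theta0 where "theta0 = (\<lambda>v. if v \<in> carrier V then theta v else \<zero>\<^bsub>Z\<^esub>)"

lemma theta0_closed: "theta0 \<in> carrier HM"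
  unfolding hom_space_simps(1) theta0_def by (intro conjI lin_restrict theta(1) RV.Z.cvs_axioms) auto

lemma gF_theta0:
  assumes "X \<in> carrier G" "actF X z0 = c \<odot>\<^bsub>Z\<^esub> z0"
  shows "gF X theta0 = c \<odot>\<^bsub>HM\<^esub> theta0"
  using F_theta[OF assms] by (auto simp: gF_def theta0_def fun_eq_iff hom_space_simps)

text \<open>The commutator compares the action of \<open>h\<close> on \<open>Z\<close> with
  \<open>hE\<close>, which \<open>theta\<close> intertwines; the difference is the scalar
  \<open>\<psi>2\<close> that was subtracted in \<open>hE\<close>.\<close>

lemma hF_theta0:
  assumes h: "h \<in> H2" shows "hF h theta0 = \<psi>2 (\<zero>\<^bsub>G\<^esub>, h) \<odot>\<^bsub>HM\<^esub> theta0"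
proof
  fix v
  show "hF h theta0 v = (\<psi>2 (\<zero>\<^bsub>G\<^esub>, h) \<odot>\<^bsub>HM\<^esub> theta0) v"
  proof (cases "v \<in> carrier V")
    case True
    let ?x = "RZ.hact h (theta v)" and ?y = "\<psi>2 (\<zero>\<^bsub>G\<^esub>, h) \<odot>\<^bsub>Z\<^esub> theta v"
    have c: "?x \<in> carrier Z" "?y \<in> carrier Z" using h True by simp_all
    have "?x \<oplus>\<^bsub>Z\<^esub> (- 1) \<odot>\<^bsub>Z\<^esub> hE h (theta v) = (?x \<oplus>\<^bsub>Z\<^esub> (- 1) \<odot>\<^bsub>Z\<^esub> ?x) \<oplus>\<^bsub>Z\<^esub> ?y"
      using c True by (simp add: hE_def RZ.Z.s_radd RZ.Z.s_mult[symmetric] RZ.Z.a_assoc)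
    then show ?thesis
      using c True h by (simp add: hF_def theta0_def hom_space_simps theta(4) RZ.Z.s_uminus RZ.Z.r_neg)
  qed (simp add: hF_def theta0_def hom_space_simps)
qed

text \<open>Through \<open>gF_theta0\<close>, the equations for \<open>actF\<close> at
  \<open>z0\<close> become equations at \<open>theta0\<close> in \<open>HF\<close>. They are the
  defining relations of \<open>W\<close>, with \<open>hF_theta0\<close> supplying the weight on
  \<hh>''.\<close>

lemma eta_exists:
  "\<exists>\<eta>. lin W HM \<eta> \<and> \<eta> w0 = theta0 \<and> (\<forall>P\<in>carrier G. \<forall>w\<in>carrier W. \<eta> (RW.gact P w) = gF P (\<eta> w)) \<and>
    (\<forall>h\<in>H2. \<forall>w\<in>carrier W. \<eta> (RW.hact h w) = hF h (\<eta> w))"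
proof -
  have z: "theta0 \<in> carrier HF" using theta0_closed by (simp add: HF_simps)
  have zero: "0 \<odot>\<^bsub>HM\<^esub> theta0 = \<zero>\<^bsub>HM\<^esub>"
    by (rule cvs.s_zero[OF HM_cvs theta0_closed])
  have hw: "act HF (n \<oplus>\<^bsub>Cur\<^esub> t) theta0 = \<psi>2 t \<odot>\<^bsub>HF\<^esub> theta0"
    if "n \<in> cur_N_plus D A H2" "t \<in> cur_h D A H2" for n t
  proof (rule highest_weight_I[OF w2 HF_rep z _ _ _ that])
    show "act HF (tm x a, \<zero>\<^bsub>\<gg>\<^esub>) theta0 = \<zero>\<^bsub>HF\<^esub>" if "x \<in> N_plus D" "a \<in> carrier A" for x a
    proof -
      have "tm x a \<in> carrier G" by (rule le_closed) (use that N_plus_derived in auto)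
      moreover have "actF (tm x a) z0 = 0 \<odot>\<^bsub>Z\<^esub> z0" using F_N_plus[OF that] z0_closed by simp
      ultimately show ?thesis using gF_theta0 zero by (simp add: HF_act[OF theta0_closed] HF_simps)
    qed
    show "act HF (tm x a, \<zero>\<^bsub>\<gg>\<^esub>) theta0 = \<psi>2 (cur_elem D A x a) \<odot>\<^bsub>HF\<^esub> theta0"
      if "x \<in> csa_derived D" "a \<in> carrier A" for x a
    proof -
      have "tm x a \<in> carrier G" using that by (simp add: csa_derived_def)
      then show ?thesis using gF_theta0[OF _ F_csa[OF that]] by (simp add: HF_act[OF theta0_closed] HF_simps)
    qed
    show "act HF (\<zero>\<^bsub>G\<^esub>, h) theta0 = \<psi>2 (\<zero>\<^bsub>G\<^esub>, h) \<odot>\<^bsub>HF\<^esub> theta0" if "h \<in> H2" for h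
      using hF_theta0[OF that] that by (simp add: HF_act[OF theta0_closed] HF_simps)
  qed
  have rel: "act HF (cur_elem D A x a) theta0 = \<zero>\<^bsub>HF\<^esub>"
    if "m \<in> pos_roots D" "x \<in> root_space D (\<lambda>h. - root_of D m h)" "a \<in> ip J (q m)" for m x a
  proof -
    have "x \<in> derived D" "a \<in> carrier A" using that root_space_derived(2) ip_carrier[OF J] by blast+
    then have "tm x a \<in> carrier G" by simp
    moreover have "actF (tm x a) z0 = 0 \<odot>\<^bsub>Z\<^esub> z0" using F_neg[OF that] z0_closed by simp
    ultimately show ?thesis using gF_theta0 zero by (simp add: cur_elem_def HF_act[OF theta0_closed] HF_simps)
  qed
  show ?thesis
  proof (rule MW.M_universal[OF HF_rep z hw rel])
    fix \<eta> assume \<eta>: "lin W HF \<eta>" "\<eta> w0 = theta0"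
    "\<And>x P. x \<in> carrier Cur \<Longrightarrow> P \<in> carrier W \<Longrightarrow> \<eta> (act W x P) = act HF x (\<eta> P)"
    have l: "lin W HM \<eta>"
      using \<eta>(1) by (simp add: LinearCombinations.module_hom_def HF_simps)
    then show ?thesis
      using \<eta>(2,3) linD(1)[OF l]
      by (intro exI[of _ \<eta>]) (simp add: RW.gact_def RW.hact_def RW.emb_closed HF_act)
  qed
qed

definition eta where "eta = (SOME \<eta>. lin W HM \<eta> \<and> \<eta> w0 = theta0 \<and>
    (\<forall>P\<in>carrier G. \<forall>w\<in>carrier W. \<eta> (RW.gact P w) = gF P (\<eta> w)) \<and>
    (\<forall>h\<in>H2. \<forall>w\<in>carrier W. \<eta> (RW.hact h w) = hF h (\<eta> w)))"

lemma eta: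
  "lin W HM eta" "eta w0 = theta0"
  "P \<in> carrier G \<Longrightarrow> w \<in> carrier W \<Longrightarrow> eta (RW.gact P w) = gF P (eta w)"
  "h \<in> H2 \<Longrightarrow> w \<in> carrier W \<Longrightarrow> eta (RW.hact h w) = hF h (eta w)"
  using someI_ex[OF eta_exists] unfolding eta_def[symmetric] by auto

lemmas eta_closed = linD(1)[OF eta(1)]

lemma eta_val [simp]: "w \<in> carrier W \<Longrightarrow> eta w v \<in> carrier Z"
  using HM_val[OF eta_closed] .

lemma eta_lin: "w \<in> carrier W \<Longrightarrow> lin V Z (eta w)"
  by (rule HM_lin[OF eta_closed])

lemma eta_lin_r: "lin W Z (\<lambda>w. eta w v)"
  by (rule linI) (simp_all add: linD(2,3)[OF eta(1)] hom_space_simps)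

text \<open>The property holds for \<open>theta0\<close> by construction. It passes from
  \<open>w\<close> to its images under loop elements because these change \<open>eta w\<close> by
  \<open>actF\<close>, which commutes with \<open>actE\<close>.\<close>

lemma eta_gact:
  assumes w: "w \<in> carrier W" and P: "P \<in> carrier G" and v: "v \<in> carrier V"
  shows "eta w (RV.gact P v) = actE P (eta w v)"
proof -
  let ?N = "{w \<in> carrier W. \<forall>P\<in>carrier G. \<forall>v\<in>carrier V. eta w (RV.gact P v) = actE P (eta w v)}"
  have "?N = carrier W"
  proof (rule W_induct)
    show "subsp W ?N"
    proof (rule RW.Z.subsp_I)
      show "\<zero>\<^bsub>W\<^esub> \<in> ?N"
        using lin_zero[OF eta_lin_r RW.Z.cvs_axioms RZ.Z.cvs_axioms] lin_zero[OF E_lin RZ.Z.cvs_axioms RZ.Z.cvs_axioms]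
        by auto
    qed (use linD(2,3)[OF eta_lin_r] linD(2,3)[OF E_lin] in auto)
    show "w0 \<in> ?N" using MW.mv_closed by (auto simp: eta(2) theta0_def theta(3))
    show "RW.gact R w \<in> ?N" if R: "R \<in> carrier G" and w: "w \<in> ?N" for R w
    proof (intro CollectI conjI ballI)
      show "RW.gact R w \<in> carrier W" using R w by simp
      fix P v assume P: "P \<in> carrier G" and v: "v \<in> carrier V"
      have "eta w (RV.gact P v) = actE P (eta w v)" "w \<in> carrier W" using w P v by auto
      then show "eta (RW.gact R w) (RV.gact P v) = actE P (eta (RW.gact R w) v)"
        using R P v EF[OF P R, of "eta w v"] by (simp add: eta(3) gF_def)
    qed
  qed
  then show ?thesis using w P v by blast
qed

section \<open>The tensor product and the two mutually inverse homomorphisms\<close>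

sublocale TT: lie_tensor_space "current D A H2" V W
  using RV.Z.lie_rep_axioms RW.Z.lie_rep_axioms Cur_bracket by (simp add: lie_tensor_space_def)

abbreviation "TVW \<equiv> tensor V W"
abbreviation "LVW \<equiv> lie_tensor V W"
abbreviation "tv \<equiv> ptensor V W"

definition Psi where "Psi = tensor_lift Z (\<lambda>(v, w). eta w v)"

lemma Psi:
  "lin TVW Z Psi" "v \<in> carrier V \<Longrightarrow> w \<in> carrier W \<Longrightarrow> Psi (tv v w) = eta w v"
proof -
  have 0: "(\<lambda>(v, w). eta w v) (v, w) \<in> carrier Z" if "v \<in> carrier V" "w \<in> carrier W" for v w
    using that by simp
  have 1: "(\<lambda>(v, w). eta w v) (v \<oplus>\<^bsub>V\<^esub> v', w) = (\<lambda>(v, w). eta w v) (v, w) \<oplus>\<^bsub>Z\<^esub> (\<lambda>(v, w). eta w v) (v', w)"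
    if "v \<in> carrier V" "v' \<in> carrier V" "w \<in> carrier W" for v v' w
    using linD(2)[OF eta_lin] that by simp
  have 2: "(\<lambda>(v, w). eta w v) (v, w \<oplus>\<^bsub>W\<^esub> w') = (\<lambda>(v, w). eta w v) (v, w) \<oplus>\<^bsub>Z\<^esub> (\<lambda>(v, w). eta w v) (v, w')"
    if "v \<in> carrier V" "w \<in> carrier W" "w' \<in> carrier W" for v w w'
    using linD(2)[OF eta_lin_r] that by simp
  have 3: "(\<lambda>(v, w). eta w v) (c \<odot>\<^bsub>V\<^esub> v, w) = c \<odot>\<^bsub>Z\<^esub> (\<lambda>(v, w). eta w v) (v, w)"
    if "v \<in> carrier V" "w \<in> carrier W" for c v w
    using linD(3)[OF eta_lin] that by simp
  have 4: "(\<lambda>(v, w). eta w v) (v, c \<odot>\<^bsub>W\<^esub> w) = c \<odot>\<^bsub>Z\<^esub> (\<lambda>(v, w). eta w v) (v, w)"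
    if "v \<in> carrier V" "w \<in> carrier W" for c v w
    using linD(3)[OF eta_lin_r] that by simp
  note lift = TT.tensor_lift[OF RZ.Z.cvs_axioms 0 1 2 3 4]
  show "lin TVW Z Psi" unfolding Psi_def by (rule lift(1)) auto
  show "v \<in> carrier V \<Longrightarrow> w \<in> carrier W \<Longrightarrow> Psi (tv v w) = eta w v"
    unfolding Psi_def by (subst lift(2)) auto
qed

lemma LVW_gact: "P \<in> carrier G \<Longrightarrow> v \<in> carrier V \<Longrightarrow> w \<in> carrier W \<Longrightarrow>
    act LVW (P, \<zero>\<^bsub>\<gg>\<^esub>) (tv v w) = tv (RV.gact P v) w \<oplus>\<^bsub>TVW\<^esub> tv v (RW.gact P w)"
  using TT.lie_tensor_act(2)[OF RV.emb_closed(1)] by (simp add: RV.gact_def RW.gact_def)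

text \<open>On the loop part, \<open>actE\<close> from the left factor and \<open>actF\<close> from
  the right add up to the given action. On \<hh>'', the left factor contributes
  \<open>eta w (h v)\<close>, which cancels against the second term of \<open>hF\<close>.\<close>

lemma Psi_act:
  assumes X: "X \<in> carrier Cur" and t: "t \<in> carrier TVW"
  shows "Psi (act LVW X t) = act Z X (Psi t)"
proof (rule TT.tensor_eqI[OF lin_comp[OF TT.lie_tensor_act(1)[OF X] Psi(1)] lin_comp[OF Psi(1) RZ.Z.act_lin[OF X]]
      RZ.Z.cvs_axioms _ t])
  fix v w assume v: "v \<in> carrier V" and w: "w \<in> carrier W"
  obtain P h where [simp]: "X = (P, h)" and P: "P \<in> carrier G" and h: "h \<in> H2"
    using X by (auto simp: Cur_simps)
  let ?a = "RZ.hact h (eta w v)" and ?b = "eta w (RV.hact h v)"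
  have c: "?a \<in> carrier Z" "?b \<in> carrier Z" "actE P (eta w v) \<in> carrier Z" "actF P (eta w v) \<in> carrier Z"
    using v w P h by simp_all
  have "Psi (act LVW X (tv v w)) = eta w (act V X v) \<oplus>\<^bsub>Z\<^esub> eta (act W X w) v"
    using v w X RV.Z.act_closed[OF X v] RW.Z.act_closed[OF X w]
    by (simp add: TT.lie_tensor_act(2) linD(2)[OF Psi(1)] Psi(2))
  also have "eta w (act V X v) = actE P (eta w v) \<oplus>\<^bsub>Z\<^esub> ?b"
    using v w P h linD(2)[OF eta_lin[OF w]] by (simp add: RV.act_split eta_gact)
  also have "eta (act W X w) v = actF P (eta w v) \<oplus>\<^bsub>Z\<^esub> (?a \<oplus>\<^bsub>Z\<^esub> (- 1) \<odot>\<^bsub>Z\<^esub> ?b)"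
    using v w P h linD(2)[OF eta_lin_r] by (simp add: RW.act_split eta(3,4) gF_def hF_def)
  also have "(actE P (eta w v) \<oplus>\<^bsub>Z\<^esub> ?b) \<oplus>\<^bsub>Z\<^esub> (actF P (eta w v) \<oplus>\<^bsub>Z\<^esub> (?a \<oplus>\<^bsub>Z\<^esub> (- 1) \<odot>\<^bsub>Z\<^esub> ?b)) =
      ((actE P (eta w v) \<oplus>\<^bsub>Z\<^esub> actF P (eta w v)) \<oplus>\<^bsub>Z\<^esub> ?a) \<oplus>\<^bsub>Z\<^esub> (?b \<oplus>\<^bsub>Z\<^esub> (- 1) \<odot>\<^bsub>Z\<^esub> ?b)"
    using c by (simp add: RZ.Z.a_ac)
  also have "\<dots> = RZ.gact P (eta w v) \<oplus>\<^bsub>Z\<^esub> ?a"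
    using c w P by (simp add: E_plus_F RZ.Z.s_uminus RZ.Z.r_neg)
  also have "\<dots> = act Z X (Psi (tv v w))"
    using v w P h by (simp add: RZ.act_split Psi(2))
  finally show "Psi (act LVW X (tv v w)) = act Z X (Psi (tv v w))" .
qed

text \<open>The weights of \<open>v0\<close> and \<open>w0\<close> add up in the tensor product, and
  a coefficient in \<open>K m\<close> lies in both ideals, so the corresponding root vector kills
  each factor.\<close>

lemma Phi_exists:
  "\<exists>\<Phi>. lin Z LVW \<Phi> \<and> \<Phi> z0 = tv v0 w0 \<and>
    (\<forall>X\<in>carrier Cur. \<forall>z\<in>carrier Z. \<Phi> (act Z X z) = act LVW X (\<Phi> z))"
proof -
  note vw = MV.mv_closed MW.mv_closed
  have t: "tv v0 w0 \<in> carrier LVW" using vw by (simp add: TT.lie_tensor_simps)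
  have hw: "act LVW (n \<oplus>\<^bsub>Cur\<^esub> t) (tv v0 w0) = (\<psi>1 t + \<psi>2 t) \<odot>\<^bsub>LVW\<^esub> tv v0 w0"
    if "n \<in> cur_N_plus D A H2" "t \<in> cur_h D A H2" for n t
  proof -
    have c: "n \<oplus>\<^bsub>Cur\<^esub> t \<in> carrier Cur"
      using current_space.NH_closed[OF Cur_space that] .
    have "act V (n \<oplus>\<^bsub>Cur\<^esub> t) v0 = \<psi>1 t \<odot>\<^bsub>V\<^esub> v0" "act W (n \<oplus>\<^bsub>Cur\<^esub> t) w0 = \<psi>2 t \<odot>\<^bsub>W\<^esub> w0"
      using MV.M_hw[OF that] MW.M_hw[OF that] by auto
    then show ?thesis
      using vw by (simp add: TT.lie_tensor_act(2)[OF c] TT.lie_tensor_simps TT.pt_smult_l TT.pt_smult_r TT.T.s_ladd)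
  qed
  have rel: "act LVW (cur_elem D A x a) (tv v0 w0) = \<zero>\<^bsub>LVW\<^esub>"
    if "m \<in> pos_roots D" "x \<in> root_space D (\<lambda>h. - root_of D m h)" "a \<in> K m" for m x a
  proof -
    have "x \<in> derived D" "a \<in> ip I (p m)" "a \<in> ip J (q m)" "a \<in> carrier A"
      using that root_space_derived(2) K[OF that(1)] ip_carrier[OF I] by blast+
    moreover from this have "RV.gact (tm x a) v0 = \<zero>\<^bsub>V\<^esub>" "RW.gact (tm x a) w0 = \<zero>\<^bsub>W\<^esub>"
      using MV.M_rel[OF that(1,2)] MW.M_rel[OF that(1,2)] by (simp_all add: RV.gact_def RW.gact_def)
    moreover have "tv \<zero>\<^bsub>V\<^esub> w0 = \<zero>\<^bsub>TVW\<^esub>" "tv v0 \<zero>\<^bsub>W\<^esub> = \<zero>\<^bsub>TVW\<^esub>"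
      using lin_zero[OF TT.pt_lin_l[OF vw(2)] RV.Z.cvs_axioms TT.T_cvs]
        lin_zero[OF TT.pt_lin_r[OF vw(1)] RW.Z.cvs_axioms TT.T_cvs] by auto
    ultimately show ?thesis
      using vw by (simp add: cur_elem_def LVW_gact TT.lie_tensor_simps)
  qed
  show ?thesis
  proof (rule MZ.M_universal[OF TT.lie_tensor_rep t hw rel])
    fix \<Phi> assume "lin Z LVW \<Phi>" "\<Phi> z0 = tv v0 w0"
    "\<And>X z. X \<in> carrier Cur \<Longrightarrow> z \<in> carrier Z \<Longrightarrow> \<Phi> (act Z X z) = act LVW X (\<Phi> z)"
    then show ?thesis by blast
  qed
qed

text \<open>On \<open>V \<otimes> W\<close> the elements \<open>e\<^sub>n P\<close> act, for large \<open>n\<close>, as \<open>P \<otimes> 1\<close>; so submodules are stable under both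
  factors.\<close>

lemma submodule_factors:
  assumes N: "lie_submodule Cur LVW N" and P: "P \<in> carrier G"
    and v: "v \<in> carrier V" and w: "w \<in> carrier W" and vw: "tv v w \<in> N"
  shows "tv (RV.gact P v) w \<in> N" "tv v (RW.gact P w) \<in> N"
proof -
  have sN: "subsp TVW N" using lie_submoduleD(1)[OF N] by (simp add: TT.subsp_lie_tensor)
  have gN: "tv (RV.gact R v) w \<oplus>\<^bsub>TVW\<^esub> tv v (RW.gact R w) \<in> N" if "R \<in> carrier G" for R
    using lie_submoduleD(2)[OF N RV.emb_closed(1)[OF that] vw] LVW_gact[OF that v w] by simp
  have "\<forall>\<^sub>F m in sequentially. tv (RV.gact P v) w \<in> N"
    using RV.null_sequence[OF f_I P v] RW.null_sequence[OF e_J P w]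
  proof eventually_elim
    case (elim m)
    have "RV.gact (loop_mul (e m \<oplus>\<^bsub>A\<^esub> f m) P) v =
        RV.gact (loop_mul (e m) P) v \<oplus>\<^bsub>V\<^esub> RV.gact (loop_mul (f m) P) v"
      using linD(2)[OF lin_comp[OF loop_mul_lin_l[OF P] RV.gact_lin_l[OF v]] e_carrier f_carrier'] .
    then have "RV.gact (loop_mul (e m) P) v = RV.gact P v"
      using elim(1) P v by (simp add: ef_one loop_mul_one)
    moreover have "tv v \<zero>\<^bsub>W\<^esub> = \<zero>\<^bsub>TVW\<^esub>"
      using lin_zero[OF TT.pt_lin_r[OF v] RW.Z.cvs_axioms TT.T_cvs] .
    ultimately show ?case
      using gN[of "loop_mul (e m) P"] elim(2) P v w by simp
  qed
  then show 1: "tv (RV.gact P v) w \<in> N" by simp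
  have "(tv (RV.gact P v) w \<oplus>\<^bsub>TVW\<^esub> tv v (RW.gact P w)) \<ominus>\<^bsub>TVW\<^esub> tv (RV.gact P v) w \<in> N"
    by (rule TT.T.subspD_minus[OF sN gN[OF P] 1])
  then show "tv v (RW.gact P w) \<in> N"
    using P v w by (simp add: TT.T.a_comm)
qed

text \<open>The left factor is varied first, with \<open>w0\<close> fixed; then, for each
  \<open>v\<close> so reached, the right one.\<close>

lemma tensor_generated:
  assumes N: "lie_submodule Cur LVW N" and vw: "tv v0 w0 \<in> N"
  shows "carrier TVW \<subseteq> N"
proof -
  have sN: "subsp TVW N" using lie_submoduleD(1)[OF N] by (simp add: TT.subsp_lie_tensor)
  note c = MV.mv_closed MW.mv_closed
  have "{v \<in> carrier V. tv v w0 \<in> N} = carrier V"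
    by (rule V_induct[OF lin_vimage_subsp[OF TT.pt_lin_l[OF c(2)] RV.Z.cvs_axioms TT.T_cvs sN]])
      (use c vw submodule_factors(1)[OF N] in auto)
  then have v: "tv v w0 \<in> N" if "v \<in> carrier V" for v using that by blast
  have "{w \<in> carrier W. tv v w \<in> N} = carrier W" if "v \<in> carrier V" for v
    by (rule W_induct[OF lin_vimage_subsp[OF TT.pt_lin_r[OF that] RW.Z.cvs_axioms TT.T_cvs sN]])
      (use c v that submodule_factors(2)[OF N] in auto)
  then have "tv v w \<in> N" if "v \<in> carrier V" "w \<in> carrier W" for v w using that by blast
  then show ?thesis using TT.T_induct[OF sN] by blast
qed

text \<open>Each composite fixes the generating vector. The vectors fixed by a composite form a
  submodule, so both composites are identities.\<close>

theorem tensor_iso: "lie_mod_iso Cur Z LVW"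
proof -
  obtain \<Phi> where \<Phi>: "lin Z LVW \<Phi>" "\<Phi> z0 = tv v0 w0"
    "\<And>X z. X \<in> carrier Cur \<Longrightarrow> z \<in> carrier Z \<Longrightarrow> \<Phi> (act Z X z) = act LVW X (\<Phi> z)"
    using Phi_exists by blast
  note c = MV.mv_closed MW.mv_closed
  have PL: "lin LVW Z Psi" using Psi(1) by (simp add: TT.lin_lie_tensor)
  have Psi0: "Psi (tv v0 w0) = z0" using c by (simp add: Psi(2) eta(2) theta0_def theta(2))
  have Tc: "\<Phi> z \<in> carrier TVW" if "z \<in> carrier Z" for z
    using linD(1)[OF \<Phi>(1) that] by (simp add: TT.lie_tensor_simps)
  have "lie_submodule Cur Z {z \<in> carrier Z. Psi (\<Phi> z) = z}"
  proof (rule lie_submoduleI)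
    show "subsp Z {z \<in> carrier Z. Psi (\<Phi> z) = z}"
      by (rule lin_eq_subsp[OF lin_comp[OF \<Phi>(1) PL] id_lin RZ.Z.cvs_axioms RZ.Z.cvs_axioms])
    show "act Z X z \<in> {z \<in> carrier Z. Psi (\<Phi> z) = z}"
      if "X \<in> carrier Cur" "z \<in> {z \<in> carrier Z. Psi (\<Phi> z) = z}" for X z
      using that Psi_act[OF that(1) Tc] by (simp add: \<Phi>(3))
  qed
  from MZ.M_generated[OF this] have 1: "Psi (\<Phi> z) = z" if "z \<in> carrier Z" for z
    using that z0_closed \<Phi>(2) Psi0 by auto
  have "lie_submodule Cur LVW {t \<in> carrier LVW. \<Phi> (Psi t) = t}"
  proof (rule lie_submoduleI)
    show "subsp LVW {t \<in> carrier LVW. \<Phi> (Psi t) = t}"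
      by (rule lin_eq_subsp[OF lin_comp[OF PL \<Phi>(1)] id_lin TT.lie_tensor_cvs TT.lie_tensor_cvs])
    show "act LVW X t \<in> {t \<in> carrier LVW. \<Phi> (Psi t) = t}"
      if "X \<in> carrier Cur" "t \<in> {t \<in> carrier LVW. \<Phi> (Psi t) = t}" for X t
      using that Psi_act[OF that(1), of t] linD(1)[OF PL, of t] linD(1)[OF TT.lie_tensor_act(1)[OF that(1)], of t]
      by (simp add: \<Phi>(3) TT.lie_tensor_simps)
  qed
  from tensor_generated[OF this] have 2: "\<Phi> (Psi t) = t" if "t \<in> carrier LVW" for t
    using that c \<Phi>(2) Psi0 by (auto simp: TT.lie_tensor_simps)
  have "bij_betw \<Phi> (carrier Z) (carrier LVW)"
    by (rule bij_betw_byWitness[where f' = Psi]) (use 1 2 linD(1)[OF \<Phi>(1)] linD(1)[OF PL] in auto)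
  then show ?thesis
    unfolding lie_mod_iso_def using \<Phi>(1,3) by blast
qed

end

text \<open>\<open>M_ideal\<close> reads its exponents off \<open>\<psi>\<close> composed with
  \<open>csa_embed\<close>, while \<open>K\<close> uses \<open>\<Lambda>\<close> and
  \<open>\<mu>\<close>. They agree on \<hh>, in particular on the coroots, where alone a weight
  height evaluates them.\<close>

lemma weight_height_cong:
  assumes "\<And>i. i < km_rank D \<Longrightarrow> \<Lambda> (km_coroot D i) = \<Lambda>' (km_coroot D i)"
  shows "weight_height D \<Lambda> m = weight_height D \<Lambda>' m"
  using assms by (simp add: weight_height_def)

theorem theorem3p4:
  fixes D :: "'g km_datum"
    and A :: "(complex, 'a) module"
    and H2 :: "'g set"
    and I J :: "'a set"
    and \<psi>1 \<psi>2 :: "('g, 'a) cur \<Rightarrow> complex"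
    and \<Lambda> \<mu> :: "'g \<Rightarrow> complex"
    and K :: "(nat \<Rightarrow> nat) \<Rightarrow> 'a set"
  assumes "kac_moody D"
    and "fin_gen_algebra A"
    and "csa_complement D H2"
    and "cofinite_ideal A I"
    and "cofinite_ideal A J"
    and "I <+>\<^bsub>A\<^esub> J = carrier A"
    and "\<psi>1 \<in> functionals ((current D A H2)\<lparr>carrier := cur_h D A H2\<rparr>)"
    and "\<psi>2 \<in> functionals ((current D A H2)\<lparr>carrier := cur_h D A H2\<rparr>)"
    and "\<And>h a. h \<in> csa_derived D \<Longrightarrow> a \<in> I \<Longrightarrow> \<psi>1 (cur_elem D A h a) = 0"
    and "\<And>h a. h \<in> csa_derived D \<Longrightarrow> a \<in> J \<Longrightarrow> \<psi>2 (cur_elem D A h a) = 0"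
    and "\<And>h. h \<in> km_csa D \<Longrightarrow> \<psi>1 (csa_embed D A H2 h) = \<Lambda> h"
    and "\<And>h. h \<in> km_csa D \<Longrightarrow> \<psi>2 (csa_embed D A H2 h) = \<mu> h"
    and "dominant_integral D \<Lambda>"
    and "dominant_integral D \<mu>"
    and "\<And>m. m \<in> pos_roots D \<Longrightarrow>
           K m = I [^]\<^bsub>ideals_set A\<^esub> weight_height D \<Lambda> m \<inter> J [^]\<^bsub>ideals_set A\<^esub> weight_height D \<mu> m"
  shows "lie_mod_iso (current D A H2)
           (M_family D A H2 (\<lambda>x. \<psi>1 x + \<psi>2 x) K)
           (lie_tensor (M_ideal D A H2 \<psi>1 I) (M_ideal D A H2 \<psi>2 J))"
proof -
  let ?p = "weight_height D (\<lambda>h. \<psi>1 (csa_embed D A H2 h))"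
  let ?q = "weight_height D (\<lambda>h. \<psi>2 (csa_embed D A H2 h))"
  have A: "Module.algebra CC A" using assms(2) by (simp add: fin_gen_algebra_def)
  then have cA: "cring A" by (simp add: Module.algebra_def)
  have I: "ideal I A" and J: "ideal J A" using assms(4,5) by (simp_all add: cofinite_ideal_def)
  have ld: "loop_data D A H2"
    using assms(1,3) A by (simp add: loop_data_def loop_data_axioms_def)
  have "?p m = weight_height D \<Lambda> m" "?q m = weight_height D \<mu> m" for m
    using assms(11,12) kac_moody.coroot_csa[OF assms(1)] by (auto intro!: weight_height_cong)
  then have K: "K m = I [^]\<^bsub>ideals_set A\<^esub> ?p m \<inter> J [^]\<^bsub>ideals_set A\<^esub> ?q m" if "m \<in> pos_roots D" for m
    using assms(15)[OF that] by simp
  have data: "coprime_data D A H2 I J \<psi>1 \<psi>2 ?p ?q K"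
    using ld I J assms(6-10) K
    by (simp add: coprime_data_def coprime_data_axioms_def weight_def weight_axioms_def)
  show ?thesis
  proof (rule cring.coprime_sequences[OF cA I J assms(6)])
    fix e f :: "nat \<Rightarrow> 'a"
    assume "\<And>n. e n \<in> J [^]\<^bsub>ideals_set A\<^esub> n" "\<And>n. f n \<in> I [^]\<^bsub>ideals_set A\<^esub> n"
      "\<And>n. e n \<oplus>\<^bsub>A\<^esub> f n = \<one>\<^bsub>A\<^esub>"
      "\<And>n m. n \<le> m \<Longrightarrow> e n \<ominus>\<^bsub>A\<^esub> e m \<in> ideal_prod A I J [^]\<^bsub>ideals_set A\<^esub> n"
      "\<And>n m. n \<le> m \<Longrightarrow> f n \<ominus>\<^bsub>A\<^esub> f m \<in> ideal_prod A I J [^]\<^bsub>ideals_set A\<^esub> n"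
      "\<And>n. e n \<otimes>\<^bsub>A\<^esub> e n \<ominus>\<^bsub>A\<^esub> e n \<in> ideal_prod A I J [^]\<^bsub>ideals_set A\<^esub> n"
      "\<And>n. f n \<otimes>\<^bsub>A\<^esub> f n \<ominus>\<^bsub>A\<^esub> f n \<in> ideal_prod A I J [^]\<^bsub>ideals_set A\<^esub> n"
      "\<And>n. e n \<otimes>\<^bsub>A\<^esub> f n \<in> ideal_prod A I J [^]\<^bsub>ideals_set A\<^esub> n"
    then have "coprime_splitting D A H2 I J \<psi>1 \<psi>2 ?p ?q K e f"
      using data by (simp add: coprime_splitting_def coprime_splitting_axioms_def)
    from coprime_splitting.tensor_iso[OF this] show ?thesis
      by (simp add: M_ideal_def)
  qed
qed

end
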